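(* Let $n\ge0$, let $\mathcal C$ be an $n$-Frobenius category and let $f:M\to N$ be a morphism in $\mathcal C$. Then $f$ is quasi-invertible if and only if it acts as invertible on $\operatorname{Ext}^n/\mathcal P$. Here acting as invertible may be taken from either side: quasi-invertibility of $f$ is equivalent to the maps $\operatorname{Ext}^n(X,M)/\mathcal P\to\operatorname{Ext}^n(X,N)/\mathcal P$, $\bar\gamma\mapsto\overline{f\gamma}$, being isomorphisms for all $X\in\mathcal C$, and also to the maps $\operatorname{Ext}^n(N,X)/\mathcal P\to\operatorname{Ext}^n(M,X)/\mathcal P$, $\bar\gamma\mapsto\overline{\gamma f}$, being isomorphisms for all $X\in\mathcal C$.
   Context: Let $\mathcal A$ be an abelian category and $\mathcal C$ a full additive extension-closed subcategory with the inherited exact structure: conflations are short exact sequences of $\mathcal A$ with all terms in $\mathcal C$ (first map an inflation, second a deflation). $\operatorname{Ext}^t(A,B)=\operatorname{Ext}^t_{\mathcal C}(A,B)$ ($t\ge1$) is the abelian group (Baer sum) of equivalence classes of exact sequences $B\to X_{t-1}\to\cdots\to X_0\to A$ spliced from $t$ conflations; $\operatorname{Ext}^0=\operatorname{Hom}_{\mathcal C}$. $g\gamma$ and $\gamma h$ denote push-out along $g$ and pull-back along $h$ (compositions if $t=0$). $P\in\mathcal C$ is $n$-projective (resp. $n$-injective) if $\operatorname{Ext}^i(P,X)=0$ (resp. $\operatorname{Ext}^i(X,P)=0$) for all $i>n$ and $X\in\mathcal C$. $\mathcal C$ is $n$-Frobenius if every object has a deflation from an $n$-projective and an inflation into an $n$-injective,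 and the $n$-projectives coincide with the $n$-injectives. $\mathcal P(X,Y)\subseteq\operatorname{Ext}^n(X,Y)$ is the subgroup of all elements $\eta h$ with $h:X\to P$, $P$ $n$-projective, $\eta\in\operatorname{Ext}^n(P,Y)$; it is a subfunctor of $\operatorname{Ext}^n$, and bars denote classes modulo $\mathcal P$. A morphism $f:M\to N$ is quasi-invertible if it acts as invertible on $\operatorname{Ext}^{n+1}$, i.e. for every $X\in\mathcal C$ the map $\operatorname{Ext}^{n+1}(X,M)\to\operatorname{Ext}^{n+1}(X,N)$, $\gamma\mapsto f\gamma$, is an isomorphism (equivalently, $\operatorname{Ext}^{n+1}(N,X)\to\operatorname{Ext}^{n+1}(M,X)$, $\gamma\mapsto\gamma f$, is an isomorphism for every $X$). *)

theory Defs
  imports "HOL-Algebra.Coset"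
begin

section \<open>Abelian categories\<close>

text \<open>
  \<open>g \<cdot>\<^bsub>\<A>\<^esub> f\<close> is the composite "first \<open>f\<close>, then \<open>g\<close>". All operations are only meaningful on
  arguments for which they make sense; their values elsewhere are unconstrained.
\<close>

record ('o, 'a) addcat =
  obj  :: "'o set"
  arr  :: "'a set"
  src  :: "'a \<Rightarrow> 'o"
  tgt  :: "'a \<Rightarrow> 'o"
  ide  :: "'o \<Rightarrow> 'a"
  cmp  :: "'a \<Rightarrow> 'a \<Rightarrow> 'a" (infixl "\<cdot>\<index>" 70)
  hadd :: "'a \<Rightarrow> 'a \<Rightarrow> 'a"
  hzero :: "'o \<Rightarrow> 'o \<Rightarrow> 'a"

definition Hom :: "('o, 'a) addcat \<Rightarrow> 'o \<Rightarrow> 'o \<Rightarrow> 'a set" where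
  "Hom \<A> X Y = {f \<in> arr \<A>. src \<A> f = X \<and> tgt \<A> f = Y}"

definition Hom_group :: "('o, 'a) addcat \<Rightarrow> 'o \<Rightarrow> 'o \<Rightarrow> 'a monoid" where
  "Hom_group \<A> X Y = \<lparr>carrier = Hom \<A> X Y, mult = hadd \<A>, one = hzero \<A> X Y\<rparr>"

locale preadditive_category =
  fixes \<A> :: "('o, 'a) addcat" (structure)
  assumes src_obj: "f \<in> arr \<A> \<Longrightarrow> src \<A> f \<in> obj \<A>"
    and tgt_obj: "f \<in> arr \<A> \<Longrightarrow> tgt \<A> f \<in> obj \<A>"
    and ide_in_Hom: "X \<in> obj \<A> \<Longrightarrow> ide \<A> X \<in> Hom \<A> X X"
    and cmp_in_Hom: "\<lbrakk>f \<in> Hom \<A> X Y; g \<in> Hom \<A> Y Z\<rbrakk> \<Longrightarrow> g \<cdot> f \<in> Hom \<A> X Z"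
    and cmp_assoc: "\<lbrakk>f \<in> Hom \<A> W X; g \<in> Hom \<A> X Y; h \<in> Hom \<A> Y Z\<rbrakk> \<Longrightarrow> h \<cdot> g \<cdot> f = h \<cdot> (g \<cdot> f)"
    and cmp_ide_right: "f \<in> Hom \<A> X Y \<Longrightarrow> f \<cdot> ide \<A> X = f"
    and cmp_ide_left: "f \<in> Hom \<A> X Y \<Longrightarrow> ide \<A> Y \<cdot> f = f"
    and Hom_comm_group: "\<lbrakk>X \<in> obj \<A>; Y \<in> obj \<A>\<rbrakk> \<Longrightarrow> comm_group (Hom_group \<A> X Y)"
    and cmp_hadd_right: "\<lbrakk>f \<in> Hom \<A> X Y; f' \<in> Hom \<A> X Y; g \<in> Hom \<A> Y Z\<rbrakk>
          \<Longrightarrow> g \<cdot> hadd \<A> f f' = hadd \<A> (g \<cdot> f) (g \<cdot> f')"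
    and cmp_hadd_left: "\<lbrakk>f \<in> Hom \<A> X Y; g \<in> Hom \<A> Y Z; g' \<in> Hom \<A> Y Z\<rbrakk>
          \<Longrightarrow> hadd \<A> g g' \<cdot> f = hadd \<A> (g \<cdot> f) (g' \<cdot> f)"

definition is_zero_object :: "('o, 'a) addcat \<Rightarrow> 'o \<Rightarrow> bool" where
  "is_zero_object \<A> Z \<longleftrightarrow> Z \<in> obj \<A> \<and>
     (\<forall>X\<in>obj \<A>. (\<exists>!f. f \<in> Hom \<A> X Z) \<and> (\<exists>!f. f \<in> Hom \<A> Z X))"

definition is_biproduct ::
  "('o, 'a) addcat \<Rightarrow> 'o \<Rightarrow> 'o \<Rightarrow> 'o \<Rightarrow> 'a \<Rightarrow> 'a \<Rightarrow> 'a \<Rightarrow> 'a \<Rightarrow> bool" where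
  "is_biproduct \<A> X Y S i\<^sub>1 i\<^sub>2 p\<^sub>1 p\<^sub>2 \<longleftrightarrow>
     i\<^sub>1 \<in> Hom \<A> X S \<and> i\<^sub>2 \<in> Hom \<A> Y S \<and> p\<^sub>1 \<in> Hom \<A> S X \<and> p\<^sub>2 \<in> Hom \<A> S Y \<and>
     p\<^sub>1 \<cdot>\<^bsub>\<A>\<^esub> i\<^sub>1 = ide \<A> X \<and> p\<^sub>2 \<cdot>\<^bsub>\<A>\<^esub> i\<^sub>2 = ide \<A> Y \<and>
     p\<^sub>2 \<cdot>\<^bsub>\<A>\<^esub> i\<^sub>1 = hzero \<A> X Y \<and> p\<^sub>1 \<cdot>\<^bsub>\<A>\<^esub> i\<^sub>2 = hzero \<A> Y X \<and>
     hadd \<A> (i\<^sub>1 \<cdot>\<^bsub>\<A>\<^esub> p\<^sub>1) (i\<^sub>2 \<cdot>\<^bsub>\<A>\<^esub> p\<^sub>2) = ide \<A> S"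

definition is_kernel :: "('o, 'a) addcat \<Rightarrow> 'a \<Rightarrow> 'a \<Rightarrow> bool" where
  "is_kernel \<A> k f \<longleftrightarrow> k \<in> arr \<A> \<and> f \<in> arr \<A> \<and> tgt \<A> k = src \<A> f \<and>
     f \<cdot>\<^bsub>\<A>\<^esub> k = hzero \<A> (src \<A> k) (tgt \<A> f) \<and>
     (\<forall>g\<in>arr \<A>. tgt \<A> g = src \<A> f \<and> f \<cdot>\<^bsub>\<A>\<^esub> g = hzero \<A> (src \<A> g) (tgt \<A> f) \<longrightarrow>
        (\<exists>!u. u \<in> Hom \<A> (src \<A> g) (src \<A> k) \<and> k \<cdot>\<^bsub>\<A>\<^esub> u = g))"

definition is_cokernel :: "('o, 'a) addcat \<Rightarrow> 'a \<Rightarrow> 'a \<Rightarrow> bool" where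
  "is_cokernel \<A> q f \<longleftrightarrow> q \<in> arr \<A> \<and> f \<in> arr \<A> \<and> src \<A> q = tgt \<A> f \<and>
     q \<cdot>\<^bsub>\<A>\<^esub> f = hzero \<A> (src \<A> f) (tgt \<A> q) \<and>
     (\<forall>g\<in>arr \<A>. src \<A> g = tgt \<A> f \<and> g \<cdot>\<^bsub>\<A>\<^esub> f = hzero \<A> (src \<A> f) (tgt \<A> g) \<longrightarrow>
        (\<exists>!u. u \<in> Hom \<A> (tgt \<A> q) (tgt \<A> g) \<and> u \<cdot>\<^bsub>\<A>\<^esub> q = g))"

definition monic :: "('o, 'a) addcat \<Rightarrow> 'a \<Rightarrow> bool" where
  "monic \<A> m \<longleftrightarrow> m \<in> arr \<A> \<and>
     (\<forall>g\<in>arr \<A>. \<forall>h\<in>arr \<A>. src \<A> g = src \<A> h \<and> tgt \<A> g = src \<A> m \<and> tgt \<A> h = src \<A> m \<and>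
        m \<cdot>\<^bsub>\<A>\<^esub> g = m \<cdot>\<^bsub>\<A>\<^esub> h \<longrightarrow> g = h)"

definition epic :: "('o, 'a) addcat \<Rightarrow> 'a \<Rightarrow> bool" where
  "epic \<A> e \<longleftrightarrow> e \<in> arr \<A> \<and>
     (\<forall>g\<in>arr \<A>. \<forall>h\<in>arr \<A>. tgt \<A> g = tgt \<A> h \<and> src \<A> g = tgt \<A> e \<and> src \<A> h = tgt \<A> e \<and>
        g \<cdot>\<^bsub>\<A>\<^esub> e = h \<cdot>\<^bsub>\<A>\<^esub> e \<longrightarrow> g = h)"

locale abelian_category = preadditive_category +
  assumes zero_object_exists: "\<exists>Z. is_zero_object \<A> Z"
    and biproduct_exists: "\<lbrakk>X \<in> obj \<A>; Y \<in> obj \<A>\<rbrakk> \<Longrightarrow>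
          \<exists>S i\<^sub>1 i\<^sub>2 p\<^sub>1 p\<^sub>2. is_biproduct \<A> X Y S i\<^sub>1 i\<^sub>2 p\<^sub>1 p\<^sub>2"
    and kernel_exists: "f \<in> arr \<A> \<Longrightarrow> \<exists>k. is_kernel \<A> k f"
    and cokernel_exists: "f \<in> arr \<A> \<Longrightarrow> \<exists>q. is_cokernel \<A> q f"
    and monic_is_kernel: "monic \<A> m \<Longrightarrow> \<exists>f. is_kernel \<A> m f"
    and epic_is_cokernel: "epic \<A> e \<Longrightarrow> \<exists>f. is_cokernel \<A> e f"

definition pushout_square :: "('o, 'a) addcat \<Rightarrow> 'a \<Rightarrow> 'a \<Rightarrow> 'a \<Rightarrow> 'a \<Rightarrow> bool" where
  "pushout_square \<A> f g u v \<longleftrightarrow> f \<in> arr \<A> \<and> g \<in> arr \<A> \<and> u \<in> arr \<A> \<and> v \<in> arr \<A> \<and>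
     src \<A> f = src \<A> g \<and> src \<A> u = tgt \<A> f \<and> src \<A> v = tgt \<A> g \<and> tgt \<A> u = tgt \<A> v \<and>
     u \<cdot>\<^bsub>\<A>\<^esub> f = v \<cdot>\<^bsub>\<A>\<^esub> g \<and>
     (\<forall>a\<in>arr \<A>. \<forall>b\<in>arr \<A>. src \<A> a = tgt \<A> f \<and> src \<A> b = tgt \<A> g \<and> tgt \<A> a = tgt \<A> b \<and>
        a \<cdot>\<^bsub>\<A>\<^esub> f = b \<cdot>\<^bsub>\<A>\<^esub> g \<longrightarrow>
        (\<exists>!w. w \<in> Hom \<A> (tgt \<A> u) (tgt \<A> a) \<and> w \<cdot>\<^bsub>\<A>\<^esub> u = a \<and> w \<cdot>\<^bsub>\<A>\<^esub> v = b))"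

definition pullback_square :: "('o, 'a) addcat \<Rightarrow> 'a \<Rightarrow> 'a \<Rightarrow> 'a \<Rightarrow> 'a \<Rightarrow> bool" where
  "pullback_square \<A> f g u v \<longleftrightarrow> f \<in> arr \<A> \<and> g \<in> arr \<A> \<and> u \<in> arr \<A> \<and> v \<in> arr \<A> \<and>
     tgt \<A> f = tgt \<A> g \<and> tgt \<A> u = src \<A> f \<and> tgt \<A> v = src \<A> g \<and> src \<A> u = src \<A> v \<and>
     f \<cdot>\<^bsub>\<A>\<^esub> u = g \<cdot>\<^bsub>\<A>\<^esub> v \<and>
     (\<forall>a\<in>arr \<A>. \<forall>b\<in>arr \<A>. tgt \<A> a = src \<A> f \<and> tgt \<A> b = src \<A> g \<and> src \<A> a = src \<A> b \<and>
        f \<cdot>\<^bsub>\<A>\<^esub> a = g \<cdot>\<^bsub>\<A>\<^esub> b \<longrightarrow>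
        (\<exists>!w. w \<in> Hom \<A> (src \<A> a) (src \<A> u) \<and> u \<cdot>\<^bsub>\<A>\<^esub> w = a \<and> v \<cdot>\<^bsub>\<A>\<^esub> w = b))"

text \<open>Chosen zero object and biproducts, with the induced direct sum of morphisms.\<close>

definition zero_obj :: "('o, 'a) addcat \<Rightarrow> 'o" where
  "zero_obj \<A> = (SOME Z. is_zero_object \<A> Z)"

definition biprod :: "('o, 'a) addcat \<Rightarrow> 'o \<Rightarrow> 'o \<Rightarrow> 'o \<times> 'a \<times> 'a \<times> 'a \<times> 'a" where
  "biprod \<A> X Y = (SOME (S, i\<^sub>1, i\<^sub>2, p\<^sub>1, p\<^sub>2). is_biproduct \<A> X Y S i\<^sub>1 i\<^sub>2 p\<^sub>1 p\<^sub>2)"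

definition inj1 :: "('o, 'a) addcat \<Rightarrow> 'o \<Rightarrow> 'o \<Rightarrow> 'a" where
  "inj1 \<A> X Y = (case biprod \<A> X Y of (S, i\<^sub>1, i\<^sub>2, p\<^sub>1, p\<^sub>2) \<Rightarrow> i\<^sub>1)"

definition inj2 :: "('o, 'a) addcat \<Rightarrow> 'o \<Rightarrow> 'o \<Rightarrow> 'a" where
  "inj2 \<A> X Y = (case biprod \<A> X Y of (S, i\<^sub>1, i\<^sub>2, p\<^sub>1, p\<^sub>2) \<Rightarrow> i\<^sub>2)"

definition proj1 :: "('o, 'a) addcat \<Rightarrow> 'o \<Rightarrow> 'o \<Rightarrow> 'a" where
  "proj1 \<A> X Y = (case biprod \<A> X Y of (S, i\<^sub>1, i\<^sub>2, p\<^sub>1, p\<^sub>2) \<Rightarrow> p\<^sub>1)"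

definition proj2 :: "('o, 'a) addcat \<Rightarrow> 'o \<Rightarrow> 'o \<Rightarrow> 'a" where
  "proj2 \<A> X Y = (case biprod \<A> X Y of (S, i\<^sub>1, i\<^sub>2, p\<^sub>1, p\<^sub>2) \<Rightarrow> p\<^sub>2)"

definition dsum :: "('o, 'a) addcat \<Rightarrow> 'a \<Rightarrow> 'a \<Rightarrow> 'a" where
  "dsum \<A> f g =
     hadd \<A> (inj1 \<A> (tgt \<A> f) (tgt \<A> g) \<cdot>\<^bsub>\<A>\<^esub> f \<cdot>\<^bsub>\<A>\<^esub> proj1 \<A> (src \<A> f) (src \<A> g))
            (inj2 \<A> (tgt \<A> f) (tgt \<A> g) \<cdot>\<^bsub>\<A>\<^esub> g \<cdot>\<^bsub>\<A>\<^esub> proj2 \<A> (src \<A> f) (src \<A> g))"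

definition diag :: "('o, 'a) addcat \<Rightarrow> 'o \<Rightarrow> 'a" where
  "diag \<A> X = hadd \<A> (inj1 \<A> X X) (inj2 \<A> X X)"

definition codiag :: "('o, 'a) addcat \<Rightarrow> 'o \<Rightarrow> 'a" where
  "codiag \<A> X = hadd \<A> (proj1 \<A> X X) (proj2 \<A> X X)"

section \<open>Extension-closed subcategories and conflations\<close>

definition short_exact :: "('o, 'a) addcat \<Rightarrow> 'a \<Rightarrow> 'a \<Rightarrow> bool" where
  "short_exact \<A> i p \<longleftrightarrow> is_kernel \<A> i p \<and> is_cokernel \<A> p i"

text \<open>
  A full subcategory is given by its set \<open>\<C>\<close> of objects. The last condition, applied to
  \<open>X \<rightarrow> Y \<rightarrow> 0\<close>, makes \<open>\<C>\<close> closed under isomorphism, so that it contains every zero object and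
  every biproduct of two of its objects.
\<close>

definition additive_extension_closed :: "('o, 'a) addcat \<Rightarrow> 'o set \<Rightarrow> bool" where
  "additive_extension_closed \<A> \<C> \<longleftrightarrow> \<C> \<subseteq> obj \<A> \<and>
     (\<exists>Z\<in>\<C>. is_zero_object \<A> Z) \<and>
     (\<forall>X\<in>\<C>. \<forall>Y\<in>\<C>. \<exists>S\<in>\<C>. \<exists>i\<^sub>1 i\<^sub>2 p\<^sub>1 p\<^sub>2. is_biproduct \<A> X Y S i\<^sub>1 i\<^sub>2 p\<^sub>1 p\<^sub>2) \<and>
     (\<forall>i p. short_exact \<A> i p \<and> src \<A> i \<in> \<C> \<and> tgt \<A> p \<in> \<C> \<longrightarrow> tgt \<A> i \<in> \<C>)"

definition conflation :: "('o, 'a) addcat \<Rightarrow> 'o set \<Rightarrow> 'a \<Rightarrow> 'a \<Rightarrow> bool" where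
  "conflation \<A> \<C> i p \<longleftrightarrow> short_exact \<A> i p \<and> src \<A> i \<in> \<C> \<and> tgt \<A> i \<in> \<C> \<and> tgt \<A> p \<in> \<C>"

definition inflation :: "('o, 'a) addcat \<Rightarrow> 'o set \<Rightarrow> 'a \<Rightarrow> bool" where
  "inflation \<A> \<C> i \<longleftrightarrow> (\<exists>p. conflation \<A> \<C> i p)"

definition deflation :: "('o, 'a) addcat \<Rightarrow> 'o set \<Rightarrow> 'a \<Rightarrow> bool" where
  "deflation \<A> \<C> p \<longleftrightarrow> (\<exists>i. conflation \<A> \<C> i p)"

section \<open>Yoneda extension groups\<close>

text \<open>
  \<open>yext \<A> \<C> t X Y s\<close>: the list \<open>s\<close> of \<open>t + 1\<close> composable morphisms, read from left to right, is an
  exact sequence \<open>Y \<rightarrow> X\<^sub>t\<^sub>-\<^sub>1 \<rightarrow> \<dots> \<rightarrow> X\<^sub>0 \<rightarrow> X\<close> spliced from \<open>t \<ge> 1\<close> conflations.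
\<close>

inductive yext :: "('o, 'a) addcat \<Rightarrow> 'o set \<Rightarrow> nat \<Rightarrow> 'o \<Rightarrow> 'o \<Rightarrow> 'a list \<Rightarrow> bool"
  for \<A> \<C> where
  conflation: "conflation \<A> \<C> i p \<Longrightarrow> yext \<A> \<C> (Suc 0) (tgt \<A> p) (src \<A> i) [i, p]"
| splice: "\<lbrakk>conflation \<A> \<C> i p; yext \<A> \<C> t X (tgt \<A> p) (j # s)\<rbrakk> \<Longrightarrow>
     yext \<A> \<C> (Suc t) X (src \<A> i) (i # j \<cdot>\<^bsub>\<A>\<^esub> p # s)"

definition seq_morphism :: "('o, 'a) addcat \<Rightarrow> 'a list \<Rightarrow> 'a list \<Rightarrow> 'a list \<Rightarrow> bool" where
  "seq_morphism \<A> s s' \<phi> \<longleftrightarrow> length s' = length s \<and> length \<phi> = Suc (length s) \<and>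
     (\<forall>k<length s. \<phi> ! k \<in> Hom \<A> (src \<A> (s ! k)) (src \<A> (s' ! k)) \<and>
        \<phi> ! Suc k \<in> Hom \<A> (tgt \<A> (s ! k)) (tgt \<A> (s' ! k)) \<and>
        \<phi> ! Suc k \<cdot>\<^bsub>\<A>\<^esub> s ! k = s' ! k \<cdot>\<^bsub>\<A>\<^esub> \<phi> ! k)"

definition yrel :: "('o, 'a) addcat \<Rightarrow> 'o set \<Rightarrow> 'a list rel" where
  "yrel \<A> \<C> = {(s, s'). \<exists>t X Y \<phi>. yext \<A> \<C> t X Y s \<and> yext \<A> \<C> t X Y s' \<and>
     seq_morphism \<A> s s' \<phi> \<and> hd \<phi> = ide \<A> Y \<and> last \<phi> = ide \<A> X}"

definition yequiv :: "('o, 'a) addcat \<Rightarrow> 'o set \<Rightarrow> 'a list rel" where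
  "yequiv \<A> \<C> = (yrel \<A> \<C> \<union> (yrel \<A> \<C>)\<inverse>)\<^sup>*"

text \<open>
  An element of an Ext group is a morphism in degree \<open>0\<close> and an equivalence class of exact
  sequences in positive degree.
\<close>

datatype 'a ext = Mor 'a | Cls "'a list set"

definition Ext :: "('o, 'a) addcat \<Rightarrow> 'o set \<Rightarrow> nat \<Rightarrow> 'o \<Rightarrow> 'o \<Rightarrow> 'a ext set" where
  "Ext \<A> \<C> t X Y =
     (if t = 0 then Mor ` Hom \<A> X Y else Cls ` ({s. yext \<A> \<C> t X Y s} // yequiv \<A> \<C>))"

text \<open>
  \<open>pushout_seq \<A> \<C> g s s'\<close> is the diagram
    \<open>Y  \<rightarrow> X\<^sub>t\<^sub>-\<^sub>1  \<rightarrow> X\<^sub>t\<^sub>-\<^sub>2 \<rightarrow> \<dots>\<close>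
  over
    \<open>Y' \<rightarrow> X'\<^sub>t\<^sub>-\<^sub>1 \<rightarrow> X\<^sub>t\<^sub>-\<^sub>2 \<rightarrow> \<dots>\<close>
  with \<open>g : Y \<rightarrow> Y'\<close>, a push-out square on the left and identities further right;
  \<open>pullback_seq\<close> is dual.
\<close>

definition pushout_seq :: "('o, 'a) addcat \<Rightarrow> 'o set \<Rightarrow> 'a \<Rightarrow> 'a list \<Rightarrow> 'a list \<Rightarrow> bool" where
  "pushout_seq \<A> \<C> g s s' \<longleftrightarrow> (\<exists>i d r i' d' u. s = i # d # r \<and> s' = i' # d' # r \<and>
     pushout_square \<A> i g u i' \<and> d' \<in> Hom \<A> (tgt \<A> u) (tgt \<A> d) \<and>
     d' \<cdot>\<^bsub>\<A>\<^esub> u = d \<and> d' \<cdot>\<^bsub>\<A>\<^esub> i' = hzero \<A> (src \<A> i') (tgt \<A> d)) \<and>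
     (\<exists>t X Y. yext \<A> \<C> t X Y s')"

definition pullback_seq :: "('o, 'a) addcat \<Rightarrow> 'o set \<Rightarrow> 'a list \<Rightarrow> 'a \<Rightarrow> 'a list \<Rightarrow> bool" where
  "pullback_seq \<A> \<C> s h s' \<longleftrightarrow> (\<exists>r d p d' p' u. s = r @ [d, p] \<and> s' = r @ [d', p'] \<and>
     pullback_square \<A> p h u p' \<and> d' \<in> Hom \<A> (src \<A> d) (src \<A> u) \<and>
     u \<cdot>\<^bsub>\<A>\<^esub> d' = d \<and> p' \<cdot>\<^bsub>\<A>\<^esub> d' = hzero \<A> (src \<A> d) (tgt \<A> p')) \<and>
     (\<exists>t X Y. yext \<A> \<C> t X Y s')"

text \<open>\<open>push \<A> \<C> g \<gamma>\<close> is \<open>g\<gamma>\<close> and \<open>pull \<A> \<C> \<gamma> h\<close> is \<open>\<gamma>h\<close>.\<close>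

fun push :: "('o, 'a) addcat \<Rightarrow> 'o set \<Rightarrow> 'a \<Rightarrow> 'a ext \<Rightarrow> 'a ext" where
  "push \<A> \<C> g (Mor k) = Mor (g \<cdot>\<^bsub>\<A>\<^esub> k)"
| "push \<A> \<C> g (Cls S) =
     Cls {w. \<exists>s\<in>S. \<exists>s'. pushout_seq \<A> \<C> g s s' \<and> (s', w) \<in> yequiv \<A> \<C>}"

fun pull :: "('o, 'a) addcat \<Rightarrow> 'o set \<Rightarrow> 'a ext \<Rightarrow> 'a \<Rightarrow> 'a ext" where
  "pull \<A> \<C> (Mor k) h = Mor (k \<cdot>\<^bsub>\<A>\<^esub> h)"
| "pull \<A> \<C> (Cls S) h =
     Cls {w. \<exists>s\<in>S. \<exists>s'. pullback_seq \<A> \<C> s h s' \<and> (s', w) \<in> yequiv \<A> \<C>}"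

text \<open>In positive degree this is the Baer sum \<open>\<nabla>(\<gamma> \<oplus> \<gamma>')\<Delta>\<close> of two elements of \<open>Ext\<^sup>t(X, Y)\<close>.\<close>

fun ext_add :: "('o, 'a) addcat \<Rightarrow> 'o set \<Rightarrow> 'o \<Rightarrow> 'o \<Rightarrow> 'a ext \<Rightarrow> 'a ext \<Rightarrow> 'a ext" where
  "ext_add \<A> \<C> X Y (Mor f) (Mor g) = Mor (hadd \<A> f g)"
| "ext_add \<A> \<C> X Y (Cls S) (Cls T) =
     push \<A> \<C> (codiag \<A> Y)
       (pull \<A> \<C> (Cls {w. \<exists>s\<in>S. \<exists>s'\<in>T. (map2 (dsum \<A>) s s', w) \<in> yequiv \<A> \<C>}) (diag \<A> X))"
| "ext_add \<A> \<C> X Y _ _ = undefined"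

text \<open>
  The trivial extensions: \<open>Y \<rightarrow> Y \<oplus> X \<rightarrow> X\<close> in degree \<open>1\<close> and
  \<open>Y = Y \<rightarrow> 0 \<rightarrow> \<dots> \<rightarrow> 0 \<rightarrow> X = X\<close> in higher degrees (with no \<open>0\<close> left in degree \<open>2\<close>).
\<close>

fun trivial_seq :: "('o, 'a) addcat \<Rightarrow> nat \<Rightarrow> 'o \<Rightarrow> 'o \<Rightarrow> 'a list" where
  "trivial_seq \<A> 0 X Y = []"
| "trivial_seq \<A> (Suc 0) X Y = [inj1 \<A> Y X, proj2 \<A> Y X]"
| "trivial_seq \<A> (Suc (Suc 0)) X Y = [ide \<A> Y, hzero \<A> Y X, ide \<A> X]"
| "trivial_seq \<A> (Suc (Suc (Suc k))) X Y =
     [ide \<A> Y, hzero \<A> Y (zero_obj \<A>)] @ replicate k (hzero \<A> (zero_obj \<A>) (zero_obj \<A>)) @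
     [hzero \<A> (zero_obj \<A>) X, ide \<A> X]"

definition ext_zero :: "('o, 'a) addcat \<Rightarrow> 'o set \<Rightarrow> nat \<Rightarrow> 'o \<Rightarrow> 'o \<Rightarrow> 'a ext" where
  "ext_zero \<A> \<C> t X Y =
     (if t = 0 then Mor (hzero \<A> X Y) else Cls (yequiv \<A> \<C> `` {trivial_seq \<A> t X Y}))"

text \<open>The abelian group \<open>Ext\<^sup>t(X, Y)\<close>, written multiplicatively as in \<^theory>\<open>HOL-Algebra.Coset\<close>.\<close>

definition Ext_group :: "('o, 'a) addcat \<Rightarrow> 'o set \<Rightarrow> nat \<Rightarrow> 'o \<Rightarrow> 'o \<Rightarrow> 'a ext monoid" where
  "Ext_group \<A> \<C> t X Y =
     \<lparr>carrier = Ext \<A> \<C> t X Y, mult = ext_add \<A> \<C> X Y, one = ext_zero \<A> \<C> t X Y\<rparr>"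

section \<open>\<open>n\<close>-Frobenius categories\<close>

definition Ext_vanishes :: "('o, 'a) addcat \<Rightarrow> 'o set \<Rightarrow> nat \<Rightarrow> 'o \<Rightarrow> 'o \<Rightarrow> bool" where
  "Ext_vanishes \<A> \<C> t X Y \<longleftrightarrow> carrier (Ext_group \<A> \<C> t X Y) = {\<one>\<^bsub>Ext_group \<A> \<C> t X Y\<^esub>}"

definition n_projective :: "('o, 'a) addcat \<Rightarrow> 'o set \<Rightarrow> nat \<Rightarrow> 'o \<Rightarrow> bool" where
  "n_projective \<A> \<C> n P \<longleftrightarrow> P \<in> \<C> \<and> (\<forall>i>n. \<forall>X\<in>\<C>. Ext_vanishes \<A> \<C> i P X)"

definition n_injective :: "('o, 'a) addcat \<Rightarrow> 'o set \<Rightarrow> nat \<Rightarrow> 'o \<Rightarrow> bool" where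
  "n_injective \<A> \<C> n P \<longleftrightarrow> P \<in> \<C> \<and> (\<forall>i>n. \<forall>X\<in>\<C>. Ext_vanishes \<A> \<C> i X P)"

definition n_Frobenius :: "('o, 'a) addcat \<Rightarrow> 'o set \<Rightarrow> nat \<Rightarrow> bool" where
  "n_Frobenius \<A> \<C> n \<longleftrightarrow>
     (\<forall>X\<in>\<C>. \<exists>P p. n_projective \<A> \<C> n P \<and> p \<in> Hom \<A> P X \<and> deflation \<A> \<C> p) \<and>
     (\<forall>X\<in>\<C>. \<exists>I i. n_injective \<A> \<C> n I \<and> i \<in> Hom \<A> X I \<and> inflation \<A> \<C> i) \<and>
     (\<forall>P. n_projective \<A> \<C> n P \<longleftrightarrow> n_injective \<A> \<C> n P)"

definition proj_factoring :: "('o, 'a) addcat \<Rightarrow> 'o set \<Rightarrow> nat \<Rightarrow> 'o \<Rightarrow> 'o \<Rightarrow> 'a ext set" where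
  "proj_factoring \<A> \<C> n X Y = {pull \<A> \<C> \<eta> h | P \<eta> h.
     n_projective \<A> \<C> n P \<and> h \<in> Hom \<A> X P \<and> \<eta> \<in> Ext \<A> \<C> n P Y}"

definition Ext_mod :: "('o, 'a) addcat \<Rightarrow> 'o set \<Rightarrow> nat \<Rightarrow> 'o \<Rightarrow> 'o \<Rightarrow> 'a ext set monoid" where
  "Ext_mod \<A> \<C> n X Y = Ext_group \<A> \<C> n X Y Mod proj_factoring \<A> \<C> n X Y"

text \<open>
  The maps induced by \<open>\<gamma> \<mapsto> f\<gamma>\<close> and \<open>\<gamma> \<mapsto> \<gamma>f\<close> on cosets: \<open>S\<close> is sent to the union of the cosets
  of the images of its representatives, which all coincide.
\<close>

definition push_mod :: "('o, 'a) addcat \<Rightarrow> 'o set \<Rightarrow> nat \<Rightarrow> 'o \<Rightarrow> 'a \<Rightarrow> 'a ext set \<Rightarrow> 'a ext set" where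
  "push_mod \<A> \<C> n X f S =
     (\<Union>\<gamma>\<in>S. proj_factoring \<A> \<C> n X (tgt \<A> f) #>\<^bsub>Ext_group \<A> \<C> n X (tgt \<A> f)\<^esub> push \<A> \<C> f \<gamma>)"

definition pull_mod :: "('o, 'a) addcat \<Rightarrow> 'o set \<Rightarrow> nat \<Rightarrow> 'o \<Rightarrow> 'a \<Rightarrow> 'a ext set \<Rightarrow> 'a ext set" where
  "pull_mod \<A> \<C> n X f S =
     (\<Union>\<gamma>\<in>S. proj_factoring \<A> \<C> n (src \<A> f) X #>\<^bsub>Ext_group \<A> \<C> n (src \<A> f) X\<^esub> pull \<A> \<C> \<gamma> f)"

definition quasi_invertible :: "('o, 'a) addcat \<Rightarrow> 'o set \<Rightarrow> nat \<Rightarrow> 'a \<Rightarrow> bool" where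
  "quasi_invertible \<A> \<C> n f \<longleftrightarrow> (\<forall>X\<in>\<C>. push \<A> \<C> f \<in>
     iso (Ext_group \<A> \<C> (n + 1) X (src \<A> f)) (Ext_group \<A> \<C> (n + 1) X (tgt \<A> f)))"

end

(* Every element of Ext^(t+1)(X, Y) is a Yoneda product of a conflation Y -> E -> W with an element
   of Ext^t(X, W), and two such products agree iff they agree after enlarging E, up to elements
   coming from Ext^t(X, E). This left-satellite description yields the group structure and the long
   exact sequences by induction on t.

   If X' -> P -> X is a conflation with P n-projective, the connecting morphism therefore identifies
   Ext^n(X', Y) modulo P(X', Y) with Ext^(n+1)(X, Y), naturally in Y, and dually in the second
   variable. This reduces the claim to the equivalence of the two one-sided forms of
   quasi-invertibility. Adding to f a morphism into an n-injective makes f an inflation, and an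
   inflation is quasi-invertible on either side iff its cokernel is n-projective. *)
theory Submission imports Defs begin

section \<open>Additive and abelian categories\<close>

text \<open>The main obstacle is equality in Ext. Classes are generated by zigzags of chain maps,
  and n-projective objects provide no resolutions by projectives, so the exact sequences cannot be
  taken from derived functors. Instead \<open>splice_rel\<close> replaces a zigzag by one common
  enlargement of two conflations together with a correction term. The connecting morphism then links
  degree t with t+1, and morphisms, in degree 0, are the common base of the inductions, so that n =
  0 is covered uniformly.

  In the comparison of the two sides the difficulty is the degree. For an inflation, bijectivity in
  degree n+1 says nothing about the terms of degree n and n+2 next to it in the long exact
  sequences. These terms are avoided by moving a class along a conflation with n-projective middle
  term, which lowers its degree by one, and by using that this middle term is n-projective and
  n-injective at the same time.\<close>

context preadditive_category begin

abbreviation add_arr (infixl "\<oplus>" 65) where "f \<oplus> g \<equiv> hadd \<A> f g"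

lemma Hom_iff [simp]: "f \<in> Hom \<A> X Y \<longleftrightarrow> f \<in> arr \<A> \<and> src \<A> f = X \<and> tgt \<A> f = Y"
  by (simp add: Hom_def)

lemmas [simp] = src_obj tgt_obj

lemma ide_arr [simp]:
  assumes "X \<in> obj \<A>"
  shows "ide \<A> X \<in> arr \<A>" "src \<A> (ide \<A> X) = X" "tgt \<A> (ide \<A> X) = X"
  using ide_in_Hom[OF assms] by simp_all

lemma cmp_arr [simp]:
  assumes "f \<in> arr \<A>" "g \<in> arr \<A>" "tgt \<A> f = src \<A> g"
  shows "g \<cdot> f \<in> arr \<A>" "src \<A> (g \<cdot> f) = src \<A> f" "tgt \<A> (g \<cdot> f) = tgt \<A> g"
  using cmp_in_Hom[of f "src \<A> f" "tgt \<A> f" g "tgt \<A> g"] assms by simp_all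

lemma cmp_assoc' [simp]:
  assumes "f \<in> arr \<A>" "g \<in> arr \<A>" "h \<in> arr \<A>" "tgt \<A> f = src \<A> g" "tgt \<A> g = src \<A> h"
  shows "h \<cdot> g \<cdot> f = h \<cdot> (g \<cdot> f)"
  using cmp_assoc[of f "src \<A> f" "tgt \<A> f" g "tgt \<A> g" h "tgt \<A> h"] assms by simp

lemma cmp_ide [simp]:
  "\<lbrakk>f \<in> arr \<A>; src \<A> f = X\<rbrakk> \<Longrightarrow> f \<cdot> ide \<A> X = f"
  "\<lbrakk>f \<in> arr \<A>; tgt \<A> f = X\<rbrakk> \<Longrightarrow> ide \<A> X \<cdot> f = f"
  by (auto intro: cmp_ide_right cmp_ide_left)

text \<open>Composites are normalised to the right, so the left-hand side of an equation
  \<open>u \<cdot> v = w\<close> no longer occurs as a subterm of a longer composite. This form, and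
  \<open>cmp_reassoc2\<close> below, make such equations usable there.\<close>

lemma cmp_reassoc:
  assumes "u \<cdot> v = w" "v \<in> arr \<A>" "u \<in> arr \<A>" "tgt \<A> v = src \<A> u"
    and "x \<in> arr \<A>" "tgt \<A> x = src \<A> v"
  shows "u \<cdot> (v \<cdot> x) = w \<cdot> x"
  using assms by (metis cmp_assoc')

lemma cmp_reassoc2:
  assumes "x \<cdot> f = y \<cdot> g" "f \<in> arr \<A>" "g \<in> arr \<A>" "x \<in> arr \<A>" "y \<in> arr \<A>" "z \<in> arr \<A>"
    "tgt \<A> f = src \<A> x" "tgt \<A> g = src \<A> y" "tgt \<A> z = src \<A> f" "tgt \<A> z = src \<A> g"
  shows "x \<cdot> (f \<cdot> z) = y \<cdot> (g \<cdot> z)"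
  using assms by (metis cmp_assoc')

lemma hzero_arr [simp]:
  assumes "X \<in> obj \<A>" "Y \<in> obj \<A>"
  shows "hzero \<A> X Y \<in> arr \<A>" "src \<A> (hzero \<A> X Y) = X" "tgt \<A> (hzero \<A> X Y) = Y"
proof -
  interpret comm_group "Hom_group \<A> X Y" using assms by (rule Hom_comm_group)
  show "hzero \<A> X Y \<in> arr \<A>" "src \<A> (hzero \<A> X Y) = X" "tgt \<A> (hzero \<A> X Y) = Y"
    using one_closed by (simp_all add: Hom_group_def)
qed

lemma hadd_arr [simp]:
  assumes "f \<in> arr \<A>" "g \<in> arr \<A>" "src \<A> f = src \<A> g" "tgt \<A> f = tgt \<A> g"
  shows "f \<oplus> g \<in> arr \<A>" "src \<A> (f \<oplus> g) = src \<A> g" "tgt \<A> (f \<oplus> g) = tgt \<A> g"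
proof -
  interpret comm_group "Hom_group \<A> (src \<A> g) (tgt \<A> g)" using assms by (simp add: Hom_comm_group)
  show "f \<oplus> g \<in> arr \<A>" "src \<A> (f \<oplus> g) = src \<A> g" "tgt \<A> (f \<oplus> g) = tgt \<A> g"
    using m_closed[of f g] assms by (simp_all add: Hom_group_def)
qed

lemma hadd_assoc:
  assumes "f \<in> arr \<A>" "g \<in> arr \<A>" "h \<in> arr \<A>"
    "src \<A> f = src \<A> g" "tgt \<A> f = tgt \<A> g" "src \<A> g = src \<A> h" "tgt \<A> g = tgt \<A> h"
  shows "f \<oplus> g \<oplus> h = f \<oplus> (g \<oplus> h)"
proof -
  interpret comm_group "Hom_group \<A> (src \<A> h) (tgt \<A> h)" using assms by (simp add: Hom_comm_group)
  show ?thesis using m_assoc[of f g h] assms by (simp add: Hom_group_def)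
qed

lemma hadd_commute:
  assumes "f \<in> arr \<A>" "g \<in> arr \<A>" "src \<A> f = src \<A> g" "tgt \<A> f = tgt \<A> g"
  shows "f \<oplus> g = g \<oplus> f"
proof -
  interpret comm_group "Hom_group \<A> (src \<A> g) (tgt \<A> g)" using assms by (simp add: Hom_comm_group)
  show ?thesis using m_comm[of f g] assms by (simp add: Hom_group_def)
qed

lemma hadd_left_commute:
  assumes "f \<in> arr \<A>" "g \<in> arr \<A>" "h \<in> arr \<A>"
    "src \<A> f = src \<A> g" "tgt \<A> f = tgt \<A> g" "src \<A> g = src \<A> h" "tgt \<A> g = tgt \<A> h"
  shows "f \<oplus> (g \<oplus> h) = g \<oplus> (f \<oplus> h)"
  using assms hadd_assoc[of f g h] hadd_assoc[of g f h] hadd_commute[of f g] by simp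

lemmas hadd_ac = hadd_assoc hadd_commute hadd_left_commute

lemma hadd_hzero [simp]:
  assumes "f \<in> arr \<A>" "src \<A> f = X" "tgt \<A> f = Y"
  shows "hzero \<A> X Y \<oplus> f = f" "f \<oplus> hzero \<A> X Y = f"
proof -
  interpret comm_group "Hom_group \<A> X Y" using assms by (auto intro: Hom_comm_group)
  show "hzero \<A> X Y \<oplus> f = f" "f \<oplus> hzero \<A> X Y = f"
    using l_one[of f] r_one[of f] assms by (simp_all add: Hom_group_def)
qed

definition hneg :: "'a \<Rightarrow> 'a" where
  "hneg f = inv\<^bsub>Hom_group \<A> (src \<A> f) (tgt \<A> f)\<^esub> f"

lemma hneg_arr [simp]:
  assumes "f \<in> arr \<A>"
  shows "hneg f \<in> arr \<A>" "src \<A> (hneg f) = src \<A> f" "tgt \<A> (hneg f) = tgt \<A> f"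
    and hadd_hneg: "f \<oplus> hneg f = hzero \<A> (src \<A> f) (tgt \<A> f)"
      "hneg f \<oplus> f = hzero \<A> (src \<A> f) (tgt \<A> f)"
proof -
  interpret comm_group "Hom_group \<A> (src \<A> f) (tgt \<A> f)" using assms by (simp add: Hom_comm_group)
  show "hneg f \<in> arr \<A>" "src \<A> (hneg f) = src \<A> f" "tgt \<A> (hneg f) = tgt \<A> f"
    "f \<oplus> hneg f = hzero \<A> (src \<A> f) (tgt \<A> f)" "hneg f \<oplus> f = hzero \<A> (src \<A> f) (tgt \<A> f)"
    using inv_closed[of f] r_inv[of f] l_inv[of f] assms by (simp_all add: Hom_group_def hneg_def)
qed

lemma hadd_cancel:
  assumes "f \<in> arr \<A>" "g \<in> arr \<A>" "h \<in> arr \<A>" "f \<oplus> h = g \<oplus> h"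
    "src \<A> f = src \<A> g" "tgt \<A> f = tgt \<A> g" "src \<A> g = src \<A> h" "tgt \<A> g = tgt \<A> h"
  shows "f = g"
proof -
  interpret comm_group "Hom_group \<A> (src \<A> h) (tgt \<A> h)" using assms by (simp add: Hom_comm_group)
  show ?thesis using right_cancel[of h f g] assms by (simp add: Hom_group_def)
qed

lemma hneg_unique:
  assumes "f \<in> arr \<A>" "g \<in> arr \<A>" "f \<oplus> g = hzero \<A> (src \<A> f) (tgt \<A> f)"
    "src \<A> f = src \<A> g" "tgt \<A> f = tgt \<A> g"
  shows "f = hneg g"
  by (rule hadd_cancel[of _ _ g]) (use assms in \<open>simp_all\<close>)

lemma hneg_hzero [simp]:
  assumes "X \<in> obj \<A>" "Y \<in> obj \<A>"
  shows "hneg (hzero \<A> X Y) = hzero \<A> X Y"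
  using hneg_unique[of "hzero \<A> X Y" "hzero \<A> X Y"] assms by simp

lemma diff_eq_zero:
  assumes "f \<in> arr \<A>" "g \<in> arr \<A>" "f \<oplus> hneg g = hzero \<A> (src \<A> f) (tgt \<A> f)"
    "src \<A> f = src \<A> g" "tgt \<A> f = tgt \<A> g"
  shows "f = g"
  by (rule hadd_cancel[of _ _ "hneg g"]) (use assms in \<open>simp_all\<close>)

lemma cmp_hadd [simp]:
  "\<lbrakk>f \<in> arr \<A>; f' \<in> arr \<A>; g \<in> arr \<A>; src \<A> f = src \<A> f'; tgt \<A> f = tgt \<A> f'; tgt \<A> f = src \<A> g\<rbrakk>
     \<Longrightarrow> g \<cdot> (f \<oplus> f') = g \<cdot> f \<oplus> g \<cdot> f'"
  "\<lbrakk>f \<in> arr \<A>; g \<in> arr \<A>; g' \<in> arr \<A>; src \<A> g = src \<A> g'; tgt \<A> g = tgt \<A> g'; tgt \<A> f = src \<A> g\<rbrakk>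
     \<Longrightarrow> (g \<oplus> g') \<cdot> f = g \<cdot> f \<oplus> g' \<cdot> f"
  using cmp_hadd_right[of f "src \<A> f'" "tgt \<A> f'" f' g "tgt \<A> g"]
    cmp_hadd_left[of f "src \<A> f" "tgt \<A> f" g "tgt \<A> g'" g'] by simp_all

lemma cmp_hzero [simp]:
  assumes "f \<in> arr \<A>" "X \<in> obj \<A>"
  shows "tgt \<A> f = Y \<Longrightarrow> hzero \<A> Y X \<cdot> f = hzero \<A> (src \<A> f) X"
    "src \<A> f = Y \<Longrightarrow> f \<cdot> hzero \<A> X Y = hzero \<A> X (tgt \<A> f)"
proof -
  assume [simp]: "tgt \<A> f = Y"
  have "Y \<in> obj \<A>" using assms tgt_obj[of f] by simp
  then have "hzero \<A> Y X \<cdot> f \<oplus> hzero \<A> Y X \<cdot> f = hzero \<A> (src \<A> f) X \<oplus> hzero \<A> Y X \<cdot> f"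
    using assms by (simp add: cmp_hadd(2)[symmetric] del: cmp_hadd)
  then show "hzero \<A> Y X \<cdot> f = hzero \<A> (src \<A> f) X"
    by (rule hadd_cancel[rotated 3]) (use assms \<open>Y \<in> obj \<A>\<close> in simp_all)
next
  assume [simp]: "src \<A> f = Y"
  have "Y \<in> obj \<A>" using assms src_obj[of f] by simp
  then have "f \<cdot> hzero \<A> X Y \<oplus> f \<cdot> hzero \<A> X Y = hzero \<A> X (tgt \<A> f) \<oplus> f \<cdot> hzero \<A> X Y"
    using assms by (simp add: cmp_hadd(1)[symmetric] del: cmp_hadd)
  then show "f \<cdot> hzero \<A> X Y = hzero \<A> X (tgt \<A> f)"
    by (rule hadd_cancel[rotated 3]) (use assms \<open>Y \<in> obj \<A>\<close> in simp_all)
qed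

lemma cmp_hneg [simp]:
  assumes "f \<in> arr \<A>" "g \<in> arr \<A>" "tgt \<A> f = src \<A> g"
  shows "g \<cdot> hneg f = hneg (g \<cdot> f)" "hneg g \<cdot> f = hneg (g \<cdot> f)"
  by (rule hneg_unique;
      use assms in \<open>simp add: cmp_hadd[symmetric] del: cmp_hadd\<close>)+

section \<open>Monics, epics, kernels and cokernels\<close>

lemma monicI:
  assumes "m \<in> arr \<A>"
    and "\<And>g. \<lbrakk>g \<in> arr \<A>; tgt \<A> g = src \<A> m; m \<cdot> g = hzero \<A> (src \<A> g) (tgt \<A> m)\<rbrakk>
      \<Longrightarrow> g = hzero \<A> (src \<A> g) (src \<A> m)"
  shows "monic \<A> m"
  unfolding monic_def
proof (intro conjI ballI impI assms(1), elim conjE)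
  fix g h assume *: "g \<in> arr \<A>" "h \<in> arr \<A>" "src \<A> g = src \<A> h" "tgt \<A> g = src \<A> m"
    "tgt \<A> h = src \<A> m" "m \<cdot> g = m \<cdot> h"
  have "g \<oplus> hneg h = hzero \<A> (src \<A> (g \<oplus> hneg h)) (src \<A> m)"
    by (rule assms(2)) (use * assms(1) in simp_all)
  then have "g \<oplus> hneg h = hzero \<A> (src \<A> g) (tgt \<A> g)" using * assms(1) by simp
  then show "g = h" using * diff_eq_zero[of g h] by metis
qed

lemma epicI:
  assumes "e \<in> arr \<A>"
    and "\<And>g. \<lbrakk>g \<in> arr \<A>; src \<A> g = tgt \<A> e; g \<cdot> e = hzero \<A> (src \<A> e) (tgt \<A> g)\<rbrakk>
      \<Longrightarrow> g = hzero \<A> (tgt \<A> e) (tgt \<A> g)"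
  shows "epic \<A> e"
  unfolding epic_def
proof (intro conjI ballI impI assms(1), elim conjE)
  fix g h assume *: "g \<in> arr \<A>" "h \<in> arr \<A>" "tgt \<A> g = tgt \<A> h" "src \<A> g = tgt \<A> e"
    "src \<A> h = tgt \<A> e" "g \<cdot> e = h \<cdot> e"
  have "g \<oplus> hneg h = hzero \<A> (tgt \<A> e) (tgt \<A> (g \<oplus> hneg h))"
    by (rule assms(2)) (use * assms(1) in simp_all)
  then have "g \<oplus> hneg h = hzero \<A> (src \<A> g) (tgt \<A> g)" using * assms(1) by simp
  then show "g = h" using * diff_eq_zero[of g h] by metis
qed

lemma short_exact_arr:
  assumes "short_exact \<A> i p"
  shows "i \<in> arr \<A>" "p \<in> arr \<A>" "src \<A> p = tgt \<A> i" "p \<cdot> i = hzero \<A> (src \<A> i) (tgt \<A> p)"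
  using assms by (simp_all add: short_exact_def is_kernel_def)

lemma kernel_ex1:
  assumes "is_kernel \<A> i p" "g \<in> arr \<A>" "tgt \<A> g = tgt \<A> i"
    "p \<cdot> g = hzero \<A> (src \<A> g) (tgt \<A> p)"
  shows "\<exists>!u. u \<in> Hom \<A> (src \<A> g) (src \<A> i) \<and> i \<cdot> u = g"
proof -
  have "src \<A> p = tgt \<A> i" using assms(1) by (simp add: is_kernel_def)
  then show ?thesis using assms(1)[unfolded is_kernel_def] assms(2-4) by metis
qed

lemma cokernel_ex1:
  assumes "is_cokernel \<A> p i" "g \<in> arr \<A>" "src \<A> g = tgt \<A> i"
    "g \<cdot> i = hzero \<A> (src \<A> i) (tgt \<A> g)"
  shows "\<exists>!u. u \<in> Hom \<A> (tgt \<A> p) (tgt \<A> g) \<and> u \<cdot> p = g"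
  using assms(1)[unfolded is_cokernel_def] assms(2-4) by metis

lemma kernel_lift:
  assumes "is_kernel \<A> i p" "g \<in> arr \<A>" "tgt \<A> g = tgt \<A> i"
    "p \<cdot> g = hzero \<A> (src \<A> g) (tgt \<A> p)"
  obtains u where "u \<in> arr \<A>" "src \<A> u = src \<A> g" "tgt \<A> u = src \<A> i" "i \<cdot> u = g"
  using kernel_ex1[OF assms] by auto

lemma cokernel_desc:
  assumes "is_cokernel \<A> p i" "g \<in> arr \<A>" "src \<A> g = tgt \<A> i"
    "g \<cdot> i = hzero \<A> (src \<A> i) (tgt \<A> g)"
  obtains u where "u \<in> arr \<A>" "src \<A> u = tgt \<A> p" "tgt \<A> u = tgt \<A> g" "u \<cdot> p = g"
  using cokernel_ex1[OF assms] by auto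

lemma kernel_cancel:
  assumes "is_kernel \<A> i p" "x \<in> arr \<A>" "y \<in> arr \<A>" "src \<A> x = src \<A> y"
    "tgt \<A> x = src \<A> i" "tgt \<A> y = src \<A> i" "i \<cdot> x = i \<cdot> y"
  shows "x = y"
proof -
  have i: "i \<in> arr \<A>" "p \<in> arr \<A>" "src \<A> p = tgt \<A> i" "p \<cdot> i = hzero \<A> (src \<A> i) (tgt \<A> p)"
    using assms(1) by (simp_all add: is_kernel_def)
  have "p \<cdot> (i \<cdot> y) = hzero \<A> (src \<A> i) (tgt \<A> p) \<cdot> y"
    by (rule cmp_reassoc) (use i assms(2-7) in simp_all)
  then have "\<exists>!u. u \<in> Hom \<A> (src \<A> (i \<cdot> y)) (src \<A> i) \<and> i \<cdot> u = i \<cdot> y"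
    by (intro kernel_ex1[OF assms(1)]) (use i assms(2-6) in simp_all)
  moreover have "x \<in> Hom \<A> (src \<A> (i \<cdot> y)) (src \<A> i) \<and> i \<cdot> x = i \<cdot> y"
    "y \<in> Hom \<A> (src \<A> (i \<cdot> y)) (src \<A> i) \<and> i \<cdot> y = i \<cdot> y"
    using i assms(2-7) by simp_all
  ultimately show ?thesis by blast
qed

lemma cokernel_cancel:
  assumes "is_cokernel \<A> p i" "x \<in> arr \<A>" "y \<in> arr \<A>" "tgt \<A> x = tgt \<A> y"
    "src \<A> x = tgt \<A> p" "src \<A> y = tgt \<A> p" "x \<cdot> p = y \<cdot> p"
  shows "x = y"
proof -
  have i: "i \<in> arr \<A>" "p \<in> arr \<A>" "src \<A> p = tgt \<A> i" "p \<cdot> i = hzero \<A> (src \<A> i) (tgt \<A> p)"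
    using assms(1) by (simp_all add: is_cokernel_def)
  then have "y \<cdot> p \<cdot> i = hzero \<A> (src \<A> i) (tgt \<A> (y \<cdot> p))" using assms(2-6) by simp
  then have "\<exists>!u. u \<in> Hom \<A> (tgt \<A> p) (tgt \<A> (y \<cdot> p)) \<and> u \<cdot> p = y \<cdot> p"
    by (intro cokernel_ex1[OF assms(1)]) (use i assms(2-6) in simp_all)
  moreover have "x \<in> Hom \<A> (tgt \<A> p) (tgt \<A> (y \<cdot> p)) \<and> x \<cdot> p = y \<cdot> p"
    "y \<in> Hom \<A> (tgt \<A> p) (tgt \<A> (y \<cdot> p)) \<and> y \<cdot> p = y \<cdot> p"
    using i assms(2-7) by simp_all
  ultimately show ?thesis by blast
qed

end

context abelian_category begin

text \<open>\<open>i\<close> is the kernel of some \<open>f\<close>, and \<open>f\<close>, vanishing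
  on \<open>i\<close>, factors through the cokernel \<open>p\<close>. So whatever \<open>p\<close>
  kills is killed by \<open>f\<close> and lifts through \<open>i\<close>.\<close>

lemma short_exactI_monic:
  assumes "monic \<A> i" "is_cokernel \<A> p i"
  shows "short_exact \<A> i p"
proof -
  obtain f where f: "is_kernel \<A> i f" using monic_is_kernel assms by blast
  have a: "i \<in> arr \<A>" "p \<in> arr \<A>" "src \<A> p = tgt \<A> i" "p \<cdot> i = hzero \<A> (src \<A> i) (tgt \<A> p)"
    "f \<in> arr \<A>" "src \<A> f = tgt \<A> i" "f \<cdot> i = hzero \<A> (src \<A> i) (tgt \<A> f)"
    using assms(2) f by (simp_all add: is_cokernel_def is_kernel_def)
  obtain u where u: "u \<in> arr \<A>" "src \<A> u = tgt \<A> p" "tgt \<A> u = tgt \<A> f" "u \<cdot> p = f"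
    using cokernel_desc[OF assms(2), of f] a by auto
  have "is_kernel \<A> i p"
    unfolding is_kernel_def
  proof (intro conjI ballI impI a; (elim conjE)?)
    show "tgt \<A> i = src \<A> p" using a by simp
    fix g assume g: "g \<in> arr \<A>" "tgt \<A> g = src \<A> p" "p \<cdot> g = hzero \<A> (src \<A> g) (tgt \<A> p)"
    have "f \<cdot> g = u \<cdot> (p \<cdot> g)" using u(1-3) g a by (simp add: u(4)[symmetric])
    then have "f \<cdot> g = hzero \<A> (src \<A> g) (tgt \<A> f)" using u(1-3) g a by simp
    then show "\<exists>!u. u \<in> Hom \<A> (src \<A> g) (src \<A> i) \<and> i \<cdot> u = g"
      by (intro kernel_ex1[OF f]) (use a g in simp_all)
  qed
  then show ?thesis using assms by (simp add: short_exact_def)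
qed

text \<open>Dual argument: \<open>p\<close> is the cokernel of some \<open>f\<close>, which factors
  through the kernel \<open>i\<close>.\<close>

lemma short_exactI_epic:
  assumes "epic \<A> p" "is_kernel \<A> i p"
  shows "short_exact \<A> i p"
proof -
  obtain f where f: "is_cokernel \<A> p f" using epic_is_cokernel assms by blast
  have a: "i \<in> arr \<A>" "p \<in> arr \<A>" "src \<A> p = tgt \<A> i" "p \<cdot> i = hzero \<A> (src \<A> i) (tgt \<A> p)"
    "f \<in> arr \<A>" "tgt \<A> f = tgt \<A> i" "p \<cdot> f = hzero \<A> (src \<A> f) (tgt \<A> p)"
    using assms(2) f by (simp_all add: is_cokernel_def is_kernel_def)
  obtain u where u: "u \<in> arr \<A>" "tgt \<A> u = src \<A> i" "src \<A> u = src \<A> f" "i \<cdot> u = f"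
    using kernel_lift[OF assms(2), of f] a by auto
  have "is_cokernel \<A> p i"
    unfolding is_cokernel_def
  proof (intro conjI ballI impI a; (elim conjE)?)
    fix g assume g: "g \<in> arr \<A>" "src \<A> g = tgt \<A> i" "g \<cdot> i = hzero \<A> (src \<A> i) (tgt \<A> g)"
    have "g \<cdot> f = g \<cdot> i \<cdot> u" using u(1-3) g(1,2) a by (simp add: u(4)[symmetric])
    then have "g \<cdot> f = hzero \<A> (src \<A> f) (tgt \<A> g)" using u(1-3) g a by simp
    then show "\<exists>!u. u \<in> Hom \<A> (tgt \<A> p) (tgt \<A> g) \<and> u \<cdot> p = g"
      by (intro cokernel_ex1[OF f]) (use a g in simp_all)
  qed
  then show ?thesis using assms by (simp add: short_exact_def)
qed

end

section \<open>Chosen biproducts and the zero object\<close>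

context abelian_category begin

definition bsum :: "'a \<Rightarrow> 'a \<Rightarrow> 'a" where "bsum X Y = fst (biprod \<A> X Y)"

lemma biprod_is_biproduct:
  assumes "X \<in> obj \<A>" "Y \<in> obj \<A>"
  shows "is_biproduct \<A> X Y (bsum X Y) (inj1 \<A> X Y) (inj2 \<A> X Y) (proj1 \<A> X Y) (proj2 \<A> X Y)"
proof -
  have "\<exists>b. case b of (S, i\<^sub>1, i\<^sub>2, p\<^sub>1, p\<^sub>2) \<Rightarrow> is_biproduct \<A> X Y S i\<^sub>1 i\<^sub>2 p\<^sub>1 p\<^sub>2"
    using biproduct_exists[OF assms] by auto
  then have "case biprod \<A> X Y of (S, i\<^sub>1, i\<^sub>2, p\<^sub>1, p\<^sub>2) \<Rightarrow> is_biproduct \<A> X Y S i\<^sub>1 i\<^sub>2 p\<^sub>1 p\<^sub>2"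
    unfolding biprod_def by (rule someI_ex)
  then show ?thesis
    by (simp add: bsum_def inj1_def inj2_def proj1_def proj2_def split: prod.splits)
qed

lemma biprod_arr [simp]:
  assumes "X \<in> obj \<A>" "Y \<in> obj \<A>"
  shows "inj1 \<A> X Y \<in> arr \<A>" "src \<A> (inj1 \<A> X Y) = X" "tgt \<A> (inj1 \<A> X Y) = bsum X Y"
    "inj2 \<A> X Y \<in> arr \<A>" "src \<A> (inj2 \<A> X Y) = Y" "tgt \<A> (inj2 \<A> X Y) = bsum X Y"
    "proj1 \<A> X Y \<in> arr \<A>" "src \<A> (proj1 \<A> X Y) = bsum X Y" "tgt \<A> (proj1 \<A> X Y) = X"
    "proj2 \<A> X Y \<in> arr \<A>" "src \<A> (proj2 \<A> X Y) = bsum X Y" "tgt \<A> (proj2 \<A> X Y) = Y"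
    "proj1 \<A> X Y \<cdot> inj1 \<A> X Y = ide \<A> X" "proj2 \<A> X Y \<cdot> inj2 \<A> X Y = ide \<A> Y"
    "proj2 \<A> X Y \<cdot> inj1 \<A> X Y = hzero \<A> X Y" "proj1 \<A> X Y \<cdot> inj2 \<A> X Y = hzero \<A> Y X"
    "inj1 \<A> X Y \<cdot> proj1 \<A> X Y \<oplus> inj2 \<A> X Y \<cdot> proj2 \<A> X Y = ide \<A> (bsum X Y)"
  using biprod_is_biproduct[OF assms] by (simp_all add: is_biproduct_def)

lemma bsum_obj [simp]: "X \<in> obj \<A> \<Longrightarrow> Y \<in> obj \<A> \<Longrightarrow> bsum X Y \<in> obj \<A>"
  using tgt_obj[of "inj1 \<A> X Y"] by simp

lemma biprod_reassoc [simp]: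
  assumes "f \<in> arr \<A>" "X \<in> obj \<A>" "Y \<in> obj \<A>"
  shows "tgt \<A> f = X \<Longrightarrow> proj1 \<A> X Y \<cdot> (inj1 \<A> X Y \<cdot> f) = f"
    "tgt \<A> f = Y \<Longrightarrow> proj2 \<A> X Y \<cdot> (inj2 \<A> X Y \<cdot> f) = f"
    "tgt \<A> f = X \<Longrightarrow> proj2 \<A> X Y \<cdot> (inj1 \<A> X Y \<cdot> f) = hzero \<A> (src \<A> f) Y"
    "tgt \<A> f = Y \<Longrightarrow> proj1 \<A> X Y \<cdot> (inj2 \<A> X Y \<cdot> f) = hzero \<A> (src \<A> f) X"
  using assms by (simp_all add: cmp_assoc'[symmetric] del: cmp_assoc')

lemma biprod_eqI_in:
  assumes "f \<in> arr \<A>" "g \<in> arr \<A>" "src \<A> f = src \<A> g" "tgt \<A> f = bsum X Y" "tgt \<A> g = bsum X Y"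
    "X \<in> obj \<A>" "Y \<in> obj \<A>"
    "proj1 \<A> X Y \<cdot> f = proj1 \<A> X Y \<cdot> g" "proj2 \<A> X Y \<cdot> f = proj2 \<A> X Y \<cdot> g"
  shows "f = g"
proof -
  let ?e = "\<lambda>h. (inj1 \<A> X Y \<cdot> proj1 \<A> X Y \<oplus> inj2 \<A> X Y \<cdot> proj2 \<A> X Y) \<cdot> h"
  have "f = ?e f" using assms by simp
  also have "\<dots> = inj1 \<A> X Y \<cdot> (proj1 \<A> X Y \<cdot> f) \<oplus> inj2 \<A> X Y \<cdot> (proj2 \<A> X Y \<cdot> f)"
    using assms(1-7) by (simp del: biprod_arr(17))
  also have "\<dots> = ?e g" using assms by (simp del: biprod_arr(17))
  also have "\<dots> = g" using assms by simp
  finally show ?thesis .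
qed

lemma biprod_eqI_out:
  assumes "f \<in> arr \<A>" "g \<in> arr \<A>" "tgt \<A> f = tgt \<A> g" "src \<A> f = bsum X Y" "src \<A> g = bsum X Y"
    "X \<in> obj \<A>" "Y \<in> obj \<A>"
    "f \<cdot> inj1 \<A> X Y = g \<cdot> inj1 \<A> X Y" "f \<cdot> inj2 \<A> X Y = g \<cdot> inj2 \<A> X Y"
  shows "f = g"
proof -
  let ?e = "\<lambda>h. h \<cdot> (inj1 \<A> X Y \<cdot> proj1 \<A> X Y \<oplus> inj2 \<A> X Y \<cdot> proj2 \<A> X Y)"
  have "f = ?e f" using assms by simp
  also have "\<dots> = f \<cdot> inj1 \<A> X Y \<cdot> proj1 \<A> X Y \<oplus> f \<cdot> inj2 \<A> X Y \<cdot> proj2 \<A> X Y"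
    using assms(1-7) by (simp del: biprod_arr(17))
  also have "\<dots> = g \<cdot> inj1 \<A> X Y \<cdot> proj1 \<A> X Y \<oplus> g \<cdot> inj2 \<A> X Y \<cdot> proj2 \<A> X Y"
    using assms(8,9) by simp
  also have "\<dots> = ?e g" using assms(1-7) by (simp del: biprod_arr(17))
  also have "\<dots> = g" using assms by simp
  finally show ?thesis .
qed

lemma dsum_arr [simp]:
  assumes "f \<in> arr \<A>" "g \<in> arr \<A>"
  shows "dsum \<A> f g \<in> arr \<A>" "src \<A> (dsum \<A> f g) = bsum (src \<A> f) (src \<A> g)"
    "tgt \<A> (dsum \<A> f g) = bsum (tgt \<A> f) (tgt \<A> g)"
  using assms by (simp_all add: dsum_def)

lemma dsum_proj [simp]:
  assumes "f \<in> arr \<A>" "g \<in> arr \<A>" "tgt \<A> f = X" "tgt \<A> g = Y"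
  shows "proj1 \<A> X Y \<cdot> dsum \<A> f g = f \<cdot> proj1 \<A> (src \<A> f) (src \<A> g)"
    "proj2 \<A> X Y \<cdot> dsum \<A> f g = g \<cdot> proj2 \<A> (src \<A> f) (src \<A> g)"
  using assms(1,2) assms(3,4)[symmetric] by (simp_all add: dsum_def)

lemma dsum_inj [simp]:
  assumes "f \<in> arr \<A>" "g \<in> arr \<A>" "src \<A> f = X" "src \<A> g = Y"
  shows "dsum \<A> f g \<cdot> inj1 \<A> X Y = inj1 \<A> (tgt \<A> f) (tgt \<A> g) \<cdot> f"
    "dsum \<A> f g \<cdot> inj2 \<A> X Y = inj2 \<A> (tgt \<A> f) (tgt \<A> g) \<cdot> g"
  using assms(1,2) assms(3,4)[symmetric] by (simp_all add: dsum_def)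

lemma dsum_reassoc [simp]:
  assumes "f \<in> arr \<A>" "g \<in> arr \<A>" "x \<in> arr \<A>"
  shows "\<lbrakk>tgt \<A> f = X; tgt \<A> g = Y; tgt \<A> x = bsum (src \<A> f) (src \<A> g)\<rbrakk> \<Longrightarrow>
      proj1 \<A> X Y \<cdot> (dsum \<A> f g \<cdot> x) = f \<cdot> (proj1 \<A> (src \<A> f) (src \<A> g) \<cdot> x)"
    "\<lbrakk>tgt \<A> f = X; tgt \<A> g = Y; tgt \<A> x = bsum (src \<A> f) (src \<A> g)\<rbrakk> \<Longrightarrow>
      proj2 \<A> X Y \<cdot> (dsum \<A> f g \<cdot> x) = g \<cdot> (proj2 \<A> (src \<A> f) (src \<A> g) \<cdot> x)"
    "\<lbrakk>src \<A> f = X; src \<A> g = Y; tgt \<A> x = X\<rbrakk> \<Longrightarrow>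
      dsum \<A> f g \<cdot> (inj1 \<A> X Y \<cdot> x) = inj1 \<A> (tgt \<A> f) (tgt \<A> g) \<cdot> (f \<cdot> x)"
    "\<lbrakk>src \<A> f = X; src \<A> g = Y; tgt \<A> x = Y\<rbrakk> \<Longrightarrow>
      dsum \<A> f g \<cdot> (inj2 \<A> X Y \<cdot> x) = inj2 \<A> (tgt \<A> f) (tgt \<A> g) \<cdot> (g \<cdot> x)"
proof -
  show "\<lbrakk>tgt \<A> f = X; tgt \<A> g = Y; tgt \<A> x = bsum (src \<A> f) (src \<A> g)\<rbrakk> \<Longrightarrow>
      proj1 \<A> X Y \<cdot> (dsum \<A> f g \<cdot> x) = f \<cdot> (proj1 \<A> (src \<A> f) (src \<A> g) \<cdot> x)"
    "\<lbrakk>tgt \<A> f = X; tgt \<A> g = Y; tgt \<A> x = bsum (src \<A> f) (src \<A> g)\<rbrakk> \<Longrightarrow>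
      proj2 \<A> X Y \<cdot> (dsum \<A> f g \<cdot> x) = g \<cdot> (proj2 \<A> (src \<A> f) (src \<A> g) \<cdot> x)"
    using assms cmp_reassoc[OF dsum_proj(1)[of f g X Y], of x]
      cmp_reassoc[OF dsum_proj(2)[of f g X Y], of x] by (auto simp del: dsum_proj)
  show "\<lbrakk>src \<A> f = X; src \<A> g = Y; tgt \<A> x = X\<rbrakk> \<Longrightarrow>
      dsum \<A> f g \<cdot> (inj1 \<A> X Y \<cdot> x) = inj1 \<A> (tgt \<A> f) (tgt \<A> g) \<cdot> (f \<cdot> x)"
    "\<lbrakk>src \<A> f = X; src \<A> g = Y; tgt \<A> x = Y\<rbrakk> \<Longrightarrow>
      dsum \<A> f g \<cdot> (inj2 \<A> X Y \<cdot> x) = inj2 \<A> (tgt \<A> f) (tgt \<A> g) \<cdot> (g \<cdot> x)"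
    using assms cmp_reassoc[OF dsum_inj(1)[of f g X Y], of x]
      cmp_reassoc[OF dsum_inj(2)[of f g X Y], of x] by (auto simp del: dsum_inj)
qed

lemma dsum_cmp [simp]:
  assumes "f \<in> arr \<A>" "g \<in> arr \<A>" "f' \<in> arr \<A>" "g' \<in> arr \<A>" "tgt \<A> f = src \<A> f'" "tgt \<A> g = src \<A> g'"
  shows "dsum \<A> f' g' \<cdot> dsum \<A> f g = dsum \<A> (f' \<cdot> f) (g' \<cdot> g)"
  by (rule biprod_eqI_in[of _ _ "tgt \<A> f'" "tgt \<A> g'"]) (use assms in simp_all)

lemma dsum_ide [simp]:
  assumes "X \<in> obj \<A>" "Y \<in> obj \<A>"
  shows "dsum \<A> (ide \<A> X) (ide \<A> Y) = ide \<A> (bsum X Y)"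
  by (rule biprod_eqI_in[of _ _ X Y]) (use assms in simp_all)

lemma diag_arr [simp]:
  assumes "X \<in> obj \<A>"
  shows "diag \<A> X \<in> arr \<A>" "src \<A> (diag \<A> X) = X" "tgt \<A> (diag \<A> X) = bsum X X"
    "proj1 \<A> X X \<cdot> diag \<A> X = ide \<A> X" "proj2 \<A> X X \<cdot> diag \<A> X = ide \<A> X"
  using assms by (simp_all add: diag_def)

lemma codiag_arr [simp]:
  assumes "X \<in> obj \<A>"
  shows "codiag \<A> X \<in> arr \<A>" "src \<A> (codiag \<A> X) = bsum X X" "tgt \<A> (codiag \<A> X) = X"
    "codiag \<A> X \<cdot> inj1 \<A> X X = ide \<A> X" "codiag \<A> X \<cdot> inj2 \<A> X X = ide \<A> X"
  using assms by (simp_all add: codiag_def)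

lemma codiag_dsum_diag:
  assumes "f \<in> arr \<A>" "g \<in> arr \<A>" "src \<A> f = src \<A> g" "tgt \<A> f = tgt \<A> g"
  shows "codiag \<A> (tgt \<A> f) \<cdot> (dsum \<A> f g \<cdot> diag \<A> (src \<A> f)) = f \<oplus> g"
  using assms by (simp add: codiag_def)

lemma codiag_natural:
  assumes "f \<in> arr \<A>" "src \<A> f = X" "tgt \<A> f = Y"
  shows "codiag \<A> Y \<cdot> dsum \<A> f f = f \<cdot> codiag \<A> X"
  using assms(1) unfolding assms(2,3)[symmetric] by (simp add: codiag_def)

lemma is_zero_object_zero_obj: "is_zero_object \<A> (zero_obj \<A>)"
  unfolding zero_obj_def by (rule someI_ex[OF zero_object_exists])

lemma zero_obj_obj [simp]: "zero_obj \<A> \<in> obj \<A>"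
  using is_zero_object_zero_obj by (simp add: is_zero_object_def)

lemma zero_obj_unique:
  assumes "X \<in> obj \<A>"
  shows "\<exists>!f. f \<in> Hom \<A> X (zero_obj \<A>)" "\<exists>!f. f \<in> Hom \<A> (zero_obj \<A>) X"
proof -
  have *: "\<forall>X\<in>obj \<A>. (\<exists>!f. f \<in> Hom \<A> X (zero_obj \<A>)) \<and> (\<exists>!f. f \<in> Hom \<A> (zero_obj \<A>) X)"
    using is_zero_object_zero_obj unfolding is_zero_object_def by (rule conjunct2)
  show "\<exists>!f. f \<in> Hom \<A> X (zero_obj \<A>)" "\<exists>!f. f \<in> Hom \<A> (zero_obj \<A>) X"
    by (rule conjunct1[OF bspec[OF * assms]], rule conjunct2[OF bspec[OF * assms]])
qed

lemma to_zero_obj: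
  assumes "f \<in> arr \<A>" "tgt \<A> f = zero_obj \<A>"
  shows "f = hzero \<A> (src \<A> f) (zero_obj \<A>)"
proof -
  have "f \<in> Hom \<A> (src \<A> f) (zero_obj \<A>)"
    "hzero \<A> (src \<A> f) (zero_obj \<A>) \<in> Hom \<A> (src \<A> f) (zero_obj \<A>)" using assms by simp_all
  then show ?thesis using zero_obj_unique(1)[of "src \<A> f"] assms(1) src_obj by blast
qed

lemma from_zero_obj:
  assumes "f \<in> arr \<A>" "src \<A> f = zero_obj \<A>"
  shows "f = hzero \<A> (zero_obj \<A>) (tgt \<A> f)"
proof -
  have "f \<in> Hom \<A> (zero_obj \<A>) (tgt \<A> f)"
    "hzero \<A> (zero_obj \<A>) (tgt \<A> f) \<in> Hom \<A> (zero_obj \<A>) (tgt \<A> f)" using assms by simp_all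
  then show ?thesis using zero_obj_unique(2)[of "tgt \<A> f"] assms(1) tgt_obj by blast
qed

text \<open>The lifting property of the kernel comes for free in an abelian category, so
  \<open>i\<close> is only tested for being monic, against zero; the cokernel property of
  \<open>p\<close> is split into existence and uniqueness.\<close>

lemma short_exactI:
  assumes "i \<in> arr \<A>" "p \<in> arr \<A>" "src \<A> p = tgt \<A> i" "p \<cdot> i = hzero \<A> (src \<A> i) (tgt \<A> p)"
    and monic: "\<And>g. \<lbrakk>g \<in> arr \<A>; tgt \<A> g = src \<A> i; i \<cdot> g = hzero \<A> (src \<A> g) (tgt \<A> i)\<rbrakk>
      \<Longrightarrow> g = hzero \<A> (src \<A> g) (src \<A> i)"
    and desc: "\<And>g. \<lbrakk>g \<in> arr \<A>; src \<A> g = tgt \<A> i; g \<cdot> i = hzero \<A> (src \<A> i) (tgt \<A> g)\<rbrakk>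
      \<Longrightarrow> \<exists>u\<in>arr \<A>. src \<A> u = tgt \<A> p \<and> tgt \<A> u = tgt \<A> g \<and> u \<cdot> p = g"
    and epic: "\<And>u v. \<lbrakk>u \<in> arr \<A>; v \<in> arr \<A>; src \<A> u = tgt \<A> p; src \<A> v = tgt \<A> p;
      tgt \<A> u = tgt \<A> v; u \<cdot> p = v \<cdot> p\<rbrakk> \<Longrightarrow> u = v"
  shows "short_exact \<A> i p"
proof (rule short_exactI_monic)
  show "monic \<A> i" by (rule monicI[OF assms(1) monic])
  show "is_cokernel \<A> p i"
    unfolding is_cokernel_def
  proof (intro conjI ballI impI assms(1-4); (elim conjE)?)
    fix g assume g: "g \<in> arr \<A>" "src \<A> g = tgt \<A> i" "g \<cdot> i = hzero \<A> (src \<A> i) (tgt \<A> g)"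
    then obtain u where "u\<in>arr \<A>" "src \<A> u = tgt \<A> p" "tgt \<A> u = tgt \<A> g" "u \<cdot> p = g"
      using desc by blast
    then show "\<exists>!u. u \<in> Hom \<A> (tgt \<A> p) (tgt \<A> g) \<and> u \<cdot> p = g"
      by (intro ex1I[of _ u]) (auto intro: epic)
  qed
qed

lemma short_exactI':
  assumes "i \<in> arr \<A>" "p \<in> arr \<A>" "src \<A> p = tgt \<A> i" "p \<cdot> i = hzero \<A> (src \<A> i) (tgt \<A> p)"
    and epic: "\<And>g. \<lbrakk>g \<in> arr \<A>; src \<A> g = tgt \<A> p; g \<cdot> p = hzero \<A> (tgt \<A> i) (tgt \<A> g)\<rbrakk>
      \<Longrightarrow> g = hzero \<A> (tgt \<A> p) (tgt \<A> g)"
    and lift: "\<And>g. \<lbrakk>g \<in> arr \<A>; tgt \<A> g = tgt \<A> i; p \<cdot> g = hzero \<A> (src \<A> g) (tgt \<A> p)\<rbrakk>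
      \<Longrightarrow> \<exists>u\<in>arr \<A>. tgt \<A> u = src \<A> i \<and> src \<A> u = src \<A> g \<and> i \<cdot> u = g"
    and monic: "\<And>u v. \<lbrakk>u \<in> arr \<A>; v \<in> arr \<A>; tgt \<A> u = src \<A> i; tgt \<A> v = src \<A> i;
      src \<A> u = src \<A> v; i \<cdot> u = i \<cdot> v\<rbrakk> \<Longrightarrow> u = v"
  shows "short_exact \<A> i p"
proof (rule short_exactI_epic)
  show "epic \<A> p" by (rule epicI[OF assms(2)]) (use assms(3) epic in auto)
  show "is_kernel \<A> i p"
    unfolding is_kernel_def
  proof (intro conjI ballI impI assms(1-4) assms(3)[symmetric]; (elim conjE)?)
    fix g assume g: "g \<in> arr \<A>" "tgt \<A> g = src \<A> p" "p \<cdot> g = hzero \<A> (src \<A> g) (tgt \<A> p)"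
    then obtain u where "u\<in>arr \<A>" "tgt \<A> u = src \<A> i" "src \<A> u = src \<A> g" "i \<cdot> u = g"
      using lift assms(3) by metis
    then show "\<exists>!u. u \<in> Hom \<A> (src \<A> g) (src \<A> i) \<and> i \<cdot> u = g"
      by (intro ex1I[of _ u]) (auto intro: monic)
  qed
qed

end

section \<open>Push-outs, pull-backs and conflations\<close>

context abelian_category begin

lemma pushout_squareD:
  assumes "pushout_square \<A> f g u v"
  shows "f \<in> arr \<A>" "g \<in> arr \<A>" "u \<in> arr \<A>" "v \<in> arr \<A>" "src \<A> g = src \<A> f" "src \<A> u = tgt \<A> f"
    "src \<A> v = tgt \<A> g" "tgt \<A> v = tgt \<A> u" "u \<cdot> f = v \<cdot> g"
  using assms by (simp_all add: pushout_square_def)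

lemma pushout_square_ex1:
  assumes "pushout_square \<A> f g u v" "a \<in> arr \<A>" "b \<in> arr \<A>" "src \<A> a = tgt \<A> f"
    "src \<A> b = tgt \<A> g" "tgt \<A> a = tgt \<A> b" "a \<cdot> f = b \<cdot> g"
  shows "\<exists>!w. w \<in> Hom \<A> (tgt \<A> u) (tgt \<A> a) \<and> w \<cdot> u = a \<and> w \<cdot> v = b"
  using assms(1)[unfolded pushout_square_def] assms(2-7) by metis

lemma pushout_desc:
  assumes "pushout_square \<A> f g u v" "a \<in> arr \<A>" "b \<in> arr \<A>" "src \<A> a = tgt \<A> f"
    "src \<A> b = tgt \<A> g" "tgt \<A> a = tgt \<A> b" "a \<cdot> f = b \<cdot> g"
  obtains w where "w \<in> arr \<A>" "src \<A> w = tgt \<A> u" "tgt \<A> w = tgt \<A> a" "w \<cdot> u = a" "w \<cdot> v = b"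
  using pushout_square_ex1[OF assms] by auto

lemma pushout_cancel:
  assumes "pushout_square \<A> f g u v" "x \<in> arr \<A>" "y \<in> arr \<A>" "src \<A> x = tgt \<A> u"
    "src \<A> y = tgt \<A> u" "tgt \<A> x = tgt \<A> y" "x \<cdot> u = y \<cdot> u" "x \<cdot> v = y \<cdot> v"
  shows "x = y"
proof -
  note po = pushout_squareD[OF assms(1)]
  have "y \<cdot> (u \<cdot> f) = y \<cdot> (v \<cdot> g)" by (simp only: po(9))
  then have "\<exists>!w. w \<in> Hom \<A> (tgt \<A> u) (tgt \<A> (y \<cdot> u)) \<and> w \<cdot> u = y \<cdot> u \<and> w \<cdot> v = y \<cdot> v"
    by (intro pushout_square_ex1[OF assms(1)]) (use po(1-8) assms(3,5) in simp_all)
  moreover have "x \<in> Hom \<A> (tgt \<A> u) (tgt \<A> (y \<cdot> u)) \<and> x \<cdot> u = y \<cdot> u \<and> x \<cdot> v = y \<cdot> v"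
    "y \<in> Hom \<A> (tgt \<A> u) (tgt \<A> (y \<cdot> u)) \<and> y \<cdot> u = y \<cdot> u \<and> y \<cdot> v = y \<cdot> v"
    using po(1-8) assms(2-8) by simp_all
  ultimately show ?thesis by blast
qed

lemma pullback_squareD:
  assumes "pullback_square \<A> f g u v"
  shows "f \<in> arr \<A>" "g \<in> arr \<A>" "u \<in> arr \<A>" "v \<in> arr \<A>" "tgt \<A> g = tgt \<A> f" "tgt \<A> u = src \<A> f"
    "tgt \<A> v = src \<A> g" "src \<A> v = src \<A> u" "f \<cdot> u = g \<cdot> v"
  using assms by (simp_all add: pullback_square_def)

lemma pullback_square_ex1:
  assumes "pullback_square \<A> f g u v" "a \<in> arr \<A>" "b \<in> arr \<A>" "tgt \<A> a = src \<A> f"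
    "tgt \<A> b = src \<A> g" "src \<A> a = src \<A> b" "f \<cdot> a = g \<cdot> b"
  shows "\<exists>!w. w \<in> Hom \<A> (src \<A> a) (src \<A> u) \<and> u \<cdot> w = a \<and> v \<cdot> w = b"
  using assms(1)[unfolded pullback_square_def] assms(2-7) by metis

lemma pullback_lift:
  assumes "pullback_square \<A> f g u v" "a \<in> arr \<A>" "b \<in> arr \<A>" "tgt \<A> a = src \<A> f"
    "tgt \<A> b = src \<A> g" "src \<A> a = src \<A> b" "f \<cdot> a = g \<cdot> b"
  obtains w where "w \<in> arr \<A>" "tgt \<A> w = src \<A> u" "src \<A> w = src \<A> a" "u \<cdot> w = a" "v \<cdot> w = b"
  using pullback_square_ex1[OF assms] by auto

lemma pullback_cancel:
  assumes "pullback_square \<A> f g u v" "x \<in> arr \<A>" "y \<in> arr \<A>" "tgt \<A> x = src \<A> u"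
    "tgt \<A> y = src \<A> u" "src \<A> x = src \<A> y" "u \<cdot> x = u \<cdot> y" "v \<cdot> x = v \<cdot> y"
  shows "x = y"
proof -
  note pb = pullback_squareD[OF assms(1)]
  have "f \<cdot> u \<cdot> y = g \<cdot> v \<cdot> y" by (simp only: pb(9))
  then have "\<exists>!w. w \<in> Hom \<A> (src \<A> (u \<cdot> y)) (src \<A> u) \<and> u \<cdot> w = u \<cdot> y \<and> v \<cdot> w = v \<cdot> y"
    by (intro pullback_square_ex1[OF assms(1)]) (use pb(1-8) assms(3,5) in simp_all)
  moreover have "x \<in> Hom \<A> (src \<A> (u \<cdot> y)) (src \<A> u) \<and> u \<cdot> x = u \<cdot> y \<and> v \<cdot> x = v \<cdot> y"
    "y \<in> Hom \<A> (src \<A> (u \<cdot> y)) (src \<A> u) \<and> u \<cdot> y = u \<cdot> y \<and> v \<cdot> y = v \<cdot> y"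
    using pb(1-8) assms(2-8) by simp_all
  ultimately show ?thesis by blast
qed

lemma short_exact_cancel:
  assumes "short_exact \<A> i p"
  shows "\<lbrakk>x \<in> arr \<A>; y \<in> arr \<A>; src \<A> x = src \<A> y; tgt \<A> x = src \<A> i; tgt \<A> y = src \<A> i;
      i \<cdot> x = i \<cdot> y\<rbrakk> \<Longrightarrow> x = y"
    "\<lbrakk>x \<in> arr \<A>; y \<in> arr \<A>; tgt \<A> x = tgt \<A> y; src \<A> x = tgt \<A> p; src \<A> y = tgt \<A> p;
      x \<cdot> p = y \<cdot> p\<rbrakk> \<Longrightarrow> x = y"
  using assms kernel_cancel[of i p x y] cokernel_cancel[of p i x y] by (simp_all add: short_exact_def)

lemma short_exact_lift:
  assumes "short_exact \<A> i p" "g \<in> arr \<A>" "tgt \<A> g = tgt \<A> i"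
    "p \<cdot> g = hzero \<A> (src \<A> g) (tgt \<A> p)"
  obtains u where "u \<in> arr \<A>" "src \<A> u = src \<A> g" "tgt \<A> u = src \<A> i" "i \<cdot> u = g"
  using kernel_lift[of i p g] assms by (auto simp: short_exact_def)

lemma short_exact_desc:
  assumes "short_exact \<A> i p" "g \<in> arr \<A>" "src \<A> g = tgt \<A> i"
    "g \<cdot> i = hzero \<A> (src \<A> i) (tgt \<A> g)"
  obtains u where "u \<in> arr \<A>" "src \<A> u = tgt \<A> p" "tgt \<A> u = tgt \<A> g" "u \<cdot> p = g"
  using cokernel_desc[of p i g] assms by (auto simp: short_exact_def)

lemma short_exact_biprod:
  assumes [simp]: "X \<in> obj \<A>" "Y \<in> obj \<A>"
  shows "short_exact \<A> (inj1 \<A> X Y) (proj2 \<A> X Y)"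
proof (rule short_exactI)
  fix g assume g: "g \<in> arr \<A>" "tgt \<A> g = src \<A> (inj1 \<A> X Y)"
    "inj1 \<A> X Y \<cdot> g = hzero \<A> (src \<A> g) (tgt \<A> (inj1 \<A> X Y))"
  have "g = proj1 \<A> X Y \<cdot> (inj1 \<A> X Y \<cdot> g)" using g(1,2) by simp
  also have "\<dots> = hzero \<A> (src \<A> g) X" using g by simp
  finally show "g = hzero \<A> (src \<A> g) (src \<A> (inj1 \<A> X Y))" by simp
next
  fix g assume g: "g \<in> arr \<A>" "src \<A> g = tgt \<A> (inj1 \<A> X Y)"
    "g \<cdot> inj1 \<A> X Y = hzero \<A> (src \<A> (inj1 \<A> X Y)) (tgt \<A> g)"
  have "g \<cdot> inj2 \<A> X Y \<cdot> proj2 \<A> X Y = g"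
    by (rule biprod_eqI_out[of _ _ X Y]) (use g in simp_all)
  then show "\<exists>u\<in>arr \<A>. src \<A> u = tgt \<A> (proj2 \<A> X Y) \<and> tgt \<A> u = tgt \<A> g \<and> u \<cdot> proj2 \<A> X Y = g"
    using g by (intro bexI[of _ "g \<cdot> inj2 \<A> X Y"]) simp_all
next
  fix u v assume *: "u \<in> arr \<A>" "v \<in> arr \<A>" "src \<A> u = tgt \<A> (proj2 \<A> X Y)"
    "src \<A> v = tgt \<A> (proj2 \<A> X Y)" "tgt \<A> u = tgt \<A> v" "u \<cdot> proj2 \<A> X Y = v \<cdot> proj2 \<A> X Y"
  have "u = u \<cdot> proj2 \<A> X Y \<cdot> inj2 \<A> X Y" using *(1-5) by simp
  also have "\<dots> = v \<cdot> proj2 \<A> X Y \<cdot> inj2 \<A> X Y" by (simp only: *(6))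
  also have "\<dots> = v" using *(1-5) by simp
  finally show "u = v" .
qed simp_all

end

section \<open>Conflations in an extension-closed subcategory\<close>

locale exact_subcategory = abelian_category +
  fixes \<C> :: "'a set"
  assumes subcat: "additive_extension_closed \<A> \<C>"
begin

lemma in_obj [simp]: "X \<in> \<C> \<Longrightarrow> X \<in> obj \<A>"
  using subcat by (auto simp: additive_extension_closed_def)

lemma extension_closed:
  "\<lbrakk>short_exact \<A> i p; src \<A> i \<in> \<C>; tgt \<A> p \<in> \<C>\<rbrakk> \<Longrightarrow> tgt \<A> i \<in> \<C>"
  using subcat unfolding additive_extension_closed_def by blast

lemma conflationI:
  "\<lbrakk>short_exact \<A> i p; src \<A> i \<in> \<C>; tgt \<A> p \<in> \<C>\<rbrakk> \<Longrightarrow> conflation \<A> \<C> i p"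
  by (simp add: conflation_def extension_closed)

lemma conflationD:
  assumes "conflation \<A> \<C> i p"
  shows "short_exact \<A> i p" "i \<in> arr \<A>" "p \<in> arr \<A>" "src \<A> p = tgt \<A> i"
    "src \<A> i \<in> \<C>" "tgt \<A> i \<in> \<C>" "tgt \<A> p \<in> \<C>" "p \<cdot> i = hzero \<A> (src \<A> i) (tgt \<A> p)"
  using assms short_exact_arr[of i p] by (simp_all add: conflation_def)

lemma bsum_closed [simp]: "X \<in> \<C> \<Longrightarrow> Y \<in> \<C> \<Longrightarrow> bsum X Y \<in> \<C>"
  using extension_closed[OF short_exact_biprod[of X Y]] by simp

lemma conflation_biprod: "X \<in> \<C> \<Longrightarrow> Y \<in> \<C> \<Longrightarrow> conflation \<A> \<C> (inj1 \<A> X Y) (proj2 \<A> X Y)"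
  using short_exact_biprod[of X Y] by (simp add: conflation_def)

text \<open>The subcategory is only known to contain some zero object \<open>Z\<close>, while
  \<open>zero_obj\<close> is chosen in the ambient category. The zero maps from \<open>Z\<close> to
  \<open>zero_obj\<close> and back to \<open>Z\<close> form a short exact sequence, and extension
  closure does the rest.\<close>

lemma zero_obj_closed [simp]: "zero_obj \<A> \<in> \<C>"
proof -
  obtain Z where Z: "Z \<in> \<C>" "is_zero_object \<A> Z"
    using subcat by (auto simp: additive_extension_closed_def)
  let ?i = "hzero \<A> Z (zero_obj \<A>)" and ?p = "hzero \<A> (zero_obj \<A>) Z"
  have u: "f = hzero \<A> (src \<A> f) Z" if "f \<in> arr \<A>" "tgt \<A> f = Z" for f
  proof -
    have "\<exists>!h. h \<in> Hom \<A> (src \<A> f) Z"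
      using Z(2) that(1) unfolding is_zero_object_def by (blast intro: src_obj)
    moreover have "f \<in> Hom \<A> (src \<A> f) Z" "hzero \<A> (src \<A> f) Z \<in> Hom \<A> (src \<A> f) Z"
      using that Z(1) by simp_all
    ultimately show ?thesis by blast
  qed
  have "short_exact \<A> ?i ?p"
  proof (rule short_exactI)
    fix g assume "g \<in> arr \<A>" "tgt \<A> g = src \<A> ?i"
    then show "g = hzero \<A> (src \<A> g) (src \<A> ?i)" using u[of g] Z(1) by simp
  next
    fix g assume g: "g \<in> arr \<A>" "src \<A> g = tgt \<A> ?i"
    then have "g = hzero \<A> (zero_obj \<A>) (tgt \<A> g)" using from_zero_obj[of g] Z(1) by simp
    then show "\<exists>u\<in>arr \<A>. src \<A> u = tgt \<A> ?p \<and> tgt \<A> u = tgt \<A> g \<and> u \<cdot> ?p = g"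
      using g Z(1) by (intro bexI[of _ "hzero \<A> Z (tgt \<A> g)"]) simp_all
  next
    fix v w assume *: "v \<in> arr \<A>" "w \<in> arr \<A>" "src \<A> v = tgt \<A> ?p" "src \<A> w = tgt \<A> ?p" "tgt \<A> v = tgt \<A> w"
    have z: "ide \<A> Z = hzero \<A> Z Z" using u[of "ide \<A> Z"] Z(1) by simp
    have "v = v \<cdot> ide \<A> Z" "w = w \<cdot> ide \<A> Z" using * Z(1) by simp_all
    then show "v = w" using * Z(1) by (simp add: z)
  qed (use Z(1) in simp_all)
  then show ?thesis using extension_closed[of ?i ?p] Z(1) by simp
qed

lemma conflation_cancel:
  assumes "conflation \<A> \<C> i p"
  shows "\<lbrakk>x \<in> arr \<A>; y \<in> arr \<A>; src \<A> x = src \<A> y; tgt \<A> x = src \<A> i; tgt \<A> y = src \<A> i;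
      i \<cdot> x = i \<cdot> y\<rbrakk> \<Longrightarrow> x = y"
    "\<lbrakk>x \<in> arr \<A>; y \<in> arr \<A>; tgt \<A> x = tgt \<A> y; src \<A> x = tgt \<A> p; src \<A> y = tgt \<A> p;
      x \<cdot> p = y \<cdot> p\<rbrakk> \<Longrightarrow> x = y"
  using short_exact_cancel[of i p x y] assms by (simp_all add: conflation_def)

lemma conflation_lift:
  assumes "conflation \<A> \<C> i p" "g \<in> arr \<A>" "tgt \<A> g = tgt \<A> i"
    "p \<cdot> g = hzero \<A> (src \<A> g) (tgt \<A> p)"
  obtains u where "u \<in> arr \<A>" "src \<A> u = src \<A> g" "tgt \<A> u = src \<A> i" "i \<cdot> u = g"
  using short_exact_lift[of i p g] assms by (auto simp: conflation_def)

lemma conflation_desc: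
  assumes "conflation \<A> \<C> i p" "g \<in> arr \<A>" "src \<A> g = tgt \<A> i"
    "g \<cdot> i = hzero \<A> (src \<A> i) (tgt \<A> g)"
  obtains u where "u \<in> arr \<A>" "src \<A> u = tgt \<A> p" "tgt \<A> u = tgt \<A> g" "u \<cdot> p = g"
  using short_exact_desc[of i p g] assms by (auto simp: conflation_def)

text \<open>The push-out is built as the cokernel \<open>q\<close> of \<open>(i, -g)\<close> into
  the biproduct. The conflation formed by this map and \<open>q\<close> is recorded in the
  conclusion because it combines the inflation \<open>i\<close> with an arbitrary \<open>g\<close>
  into a single inflation, which is how a morphism is later replaced by an inflation.\<close>

lemma pushout_conflation:
  assumes ip: "conflation \<A> \<C> i p" and g: "g \<in> arr \<A>" "src \<A> g = src \<A> i" "tgt \<A> g \<in> \<C>"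
  obtains i' p' u q where "conflation \<A> \<C> i' p'" "pushout_square \<A> i g u i'" "p' \<cdot> u = p"
    "tgt \<A> p' = tgt \<A> p" "conflation \<A> \<C> (inj1 \<A> (tgt \<A> i) (tgt \<A> g) \<cdot> i \<oplus> hneg (inj2 \<A> (tgt \<A> i) (tgt \<A> g) \<cdot> g)) q"
    "q \<cdot> inj1 \<A> (tgt \<A> i) (tgt \<A> g) = u" "q \<cdot> inj2 \<A> (tgt \<A> i) (tgt \<A> g) = i'" "tgt \<A> q = tgt \<A> u"
proof -
  note c = conflationD[OF ip]
  define E F where "E = tgt \<A> i" "F = tgt \<A> g"
  note EF = this[symmetric]
  have o [simp]: "E \<in> \<C>" "F \<in> \<C>" using c g EF by simp_all
  let ?j1 = "inj1 \<A> E F" and ?j2 = "inj2 \<A> E F"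
  define m where "m = ?j1 \<cdot> i \<oplus> hneg (?j2 \<cdot> g)"
  have m [simp]: "m \<in> arr \<A>" "src \<A> m = src \<A> i" "tgt \<A> m = bsum E F"
    using c g EF by (simp_all add: m_def)
  have pm: "proj1 \<A> E F \<cdot> m = i" "proj2 \<A> E F \<cdot> m = hneg g"
    using c g EF by (simp_all add: m_def)
  obtain q where q: "is_cokernel \<A> q m" using cokernel_exists[OF m(1)] by blast
  have mm: "monic \<A> m"
  proof (rule monicI[OF m(1)])
    fix x assume x: "x \<in> arr \<A>" "tgt \<A> x = src \<A> m" "m \<cdot> x = hzero \<A> (src \<A> x) (tgt \<A> m)"
    then have "proj1 \<A> E F \<cdot> (m \<cdot> x) = hzero \<A> (src \<A> x) E" by simp
    moreover have "proj1 \<A> E F \<cdot> (m \<cdot> x) = i \<cdot> x" by (rule cmp_reassoc) (use pm x in simp_all)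
    ultimately have "i \<cdot> x = i \<cdot> hzero \<A> (src \<A> x) (src \<A> i)" using c x EF by simp
    then show "x = hzero \<A> (src \<A> x) (src \<A> m)"
      by - (rule conflation_cancel(1)[OF ip], use x c in simp_all)
  qed
  have mq: "short_exact \<A> m q" by (rule short_exactI_monic[OF mm q])
  note mq' = short_exact_arr[OF mq, simplified]
  define D where "D = tgt \<A> q"
  define u where "u = q \<cdot> ?j1"
  define i' where "i' = q \<cdot> ?j2"
  have [simp]: "D \<in> obj \<A>" using mq' by (simp add: D_def)
  have ar [simp]: "u \<in> arr \<A>" "src \<A> u = E" "tgt \<A> u = D" "i' \<in> arr \<A>" "src \<A> i' = F" "tgt \<A> i' = D"
    using mq' by (simp_all add: u_def i'_def D_def)
  have "u \<cdot> i \<oplus> hneg (i' \<cdot> g) = q \<cdot> m" unfolding m_def u_def i'_def using c g EF mq' by simp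
  then have sq: "u \<cdot> i = i' \<cdot> g"
    by - (rule diff_eq_zero, use mq' c g EF in \<open>simp_all add: D_def\<close>)
  have eqI: "x = y" if "x \<in> arr \<A>" "y \<in> arr \<A>" "src \<A> x = D" "src \<A> y = D" "tgt \<A> x = tgt \<A> y"
    "x \<cdot> u = y \<cdot> u" "x \<cdot> i' = y \<cdot> i'" for x y
  proof (rule short_exact_cancel(2)[OF mq])
    show "x \<cdot> q = y \<cdot> q"
      by (rule biprod_eqI_out[of _ _ E F])
        (use that mq' in \<open>simp_all add: D_def u_def i'_def\<close>)
  qed (use that mq' in \<open>simp_all add: D_def\<close>)
  have ex: "\<exists>w\<in>arr \<A>. src \<A> w = D \<and> tgt \<A> w = tgt \<A> a \<and> w \<cdot> u = a \<and> w \<cdot> i' = b"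
    if ab: "a \<in> arr \<A>" "b \<in> arr \<A>" "src \<A> a = E" "src \<A> b = F" "tgt \<A> a = tgt \<A> b" "a \<cdot> i = b \<cdot> g" for a b
  proof -
    let ?h = "a \<cdot> proj1 \<A> E F \<oplus> b \<cdot> proj2 \<A> E F"
    have "?h \<cdot> m = hzero \<A> (src \<A> m) (tgt \<A> ?h)" using ab c g EF by (simp add: pm hneg_arr)
    then obtain w where w: "w \<in> arr \<A>" "src \<A> w = tgt \<A> q" "tgt \<A> w = tgt \<A> ?h" "w \<cdot> q = ?h"
      using ab by (elim short_exact_desc[OF mq, rotated 2]) simp_all
    have "w \<cdot> u = ?h \<cdot> ?j1" "w \<cdot> i' = ?h \<cdot> ?j2"
      unfolding u_def i'_def by (rule cmp_reassoc, use w mq' in simp_all)+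
    then show ?thesis using ab w(1-3) by (intro bexI[of _ w]) (simp_all add: D_def)
  qed
  have po: "pushout_square \<A> i g u i'"
    unfolding pushout_square_def
  proof (intro conjI ballI impI; (elim conjE)?)
    fix a b assume ab: "a \<in> arr \<A>" "b \<in> arr \<A>" "src \<A> a = tgt \<A> i" "src \<A> b = tgt \<A> g" "tgt \<A> a = tgt \<A> b" "a \<cdot> i = b \<cdot> g"
    then obtain w where w: "w \<in> arr \<A>" "src \<A> w = D" "tgt \<A> w = tgt \<A> a" "w \<cdot> u = a" "w \<cdot> i' = b"
      using ex[of a b] EF by metis
    show "\<exists>!w. w \<in> Hom \<A> (tgt \<A> u) (tgt \<A> a) \<and> w \<cdot> u = a \<and> w \<cdot> i' = b"
    proof (rule ex1I[of _ w])
      fix x assume "x \<in> Hom \<A> (tgt \<A> u) (tgt \<A> a) \<and> x \<cdot> u = a \<and> x \<cdot> i' = b"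
      then show "x = w" using w by - (rule eqI, simp_all)
    qed (use w in simp_all)
  qed (use c g sq EF in simp_all)
  obtain p' where p': "p' \<in> arr \<A>" "src \<A> p' = D" "tgt \<A> p' = tgt \<A> p" "p' \<cdot> u = p"
    "p' \<cdot> i' = hzero \<A> F (tgt \<A> p)"
    using ex[of p "hzero \<A> F (tgt \<A> p)"] c g EF by (auto simp del: Hom_iff)
  have se: "short_exact \<A> i' p'"
  proof (rule short_exactI)
    fix x assume x: "x \<in> arr \<A>" "tgt \<A> x = src \<A> i'" "i' \<cdot> x = hzero \<A> (src \<A> x) (tgt \<A> i')"
    then have "q \<cdot> (?j2 \<cdot> x) = hzero \<A> (src \<A> (?j2 \<cdot> x)) (tgt \<A> q)" using mq' by (simp add: i'_def D_def)
    \<comment> \<open>An \<open>x\<close> killed by \<open>i'\<close> gives \<open>(0, x)\<close>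
      killed by \<open>q\<close>, hence of the form \<open>m \<cdot> y\<close>. Its first component
      \<open>i \<cdot> y\<close> vanishes, and with it \<open>y\<close> and
      \<open>x\<close>.\<close>
    then obtain y where y: "y \<in> arr \<A>" "src \<A> y = src \<A> x" "tgt \<A> y = src \<A> i" "m \<cdot> y = ?j2 \<cdot> x"
      using short_exact_lift[OF mq, of "?j2 \<cdot> x"] x by auto
    have "i \<cdot> y = proj1 \<A> E F \<cdot> (m \<cdot> y)" by (rule cmp_reassoc[symmetric]) (use pm y in simp_all)
    also have "\<dots> = i \<cdot> hzero \<A> (src \<A> x) (src \<A> i)" using y x c EF by simp
    finally have "y = hzero \<A> (src \<A> x) (src \<A> i)"
      by - (rule conflation_cancel(1)[OF ip], use x y c in simp_all)
    then have z: "?j2 \<cdot> x = hzero \<A> (src \<A> x) (bsum E F)" using y(4) x c by simp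
    have "x = proj2 \<A> E F \<cdot> (?j2 \<cdot> x)" using x(1,2) by simp
    also have "\<dots> = hzero \<A> (src \<A> x) F" using x by (simp add: z)
    finally show "x = hzero \<A> (src \<A> x) (src \<A> i')" by simp
  next
    fix t assume t: "t \<in> arr \<A>" "src \<A> t = tgt \<A> i'" "t \<cdot> i' = hzero \<A> (src \<A> i') (tgt \<A> t)"
    have "t \<cdot> u \<cdot> i = t \<cdot> i' \<cdot> g" using t(1,2) c g EF by (simp add: sq)
    then have "t \<cdot> u \<cdot> i = hzero \<A> (src \<A> i) (tgt \<A> (t \<cdot> u))" using t c g EF by (simp del: cmp_assoc')
    then obtain v where v: "v \<in> arr \<A>" "src \<A> v = tgt \<A> p" "tgt \<A> v = tgt \<A> t" "v \<cdot> p = t \<cdot> u"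
      using conflation_desc[OF ip, of "t \<cdot> u"] t c EF by auto
    have "v \<cdot> p' = t"
      by (rule eqI) (use v t p' in simp_all)
    then show "\<exists>u\<in>arr \<A>. src \<A> u = tgt \<A> p' \<and> tgt \<A> u = tgt \<A> t \<and> u \<cdot> p' = t"
      using v p' by auto
  next
    fix x y assume *: "x \<in> arr \<A>" "y \<in> arr \<A>" "src \<A> x = tgt \<A> p'" "src \<A> y = tgt \<A> p'"
      "tgt \<A> x = tgt \<A> y" "x \<cdot> p' = y \<cdot> p'"
    have "x \<cdot> (p' \<cdot> u) = y \<cdot> (p' \<cdot> u)" by (rule cmp_reassoc2) (use * p' in simp_all)
    then have "x \<cdot> p = y \<cdot> p" by (simp only: p'(4))
    then show "x = y" by - (rule conflation_cancel(2)[OF ip], use * p' in simp_all)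
  qed (use p' in simp_all)
  have "conflation \<A> \<C> i' p'" by (rule conflationI[OF se]) (use c p' in simp_all)
  \<comment> \<open>Extension closure has just placed the push-out object in the subcategory; only
    now is \<open>(m, q)\<close> a conflation.\<close>
  moreover from this have "D \<in> \<C>" using conflationD(6) by fastforce
  then have "conflation \<A> \<C> m q" by (intro conflationI[OF mq]) (use c in \<open>simp_all add: D_def\<close>)
  ultimately show thesis
    using po p' mq' by (intro that[of i' p' u q]) (simp_all add: m_def EF u_def i'_def D_def)
qed

text \<open>Dual construction: the pull-back is the kernel of \<open>(p, -h)\<close> on the
  biproduct, and \<open>i'\<close> is induced by \<open>i\<close> and a zero morphism.\<close>

lemma pullback_conflation:
  assumes ip: "conflation \<A> \<C> i p" and h: "h \<in> arr \<A>" "tgt \<A> h = tgt \<A> p" "src \<A> h \<in> \<C>"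
  obtains i' p' u where "conflation \<A> \<C> i' p'" "pullback_square \<A> p h u p'" "u \<cdot> i' = i"
    "src \<A> i' = src \<A> i"
proof -
  note c = conflationD[OF ip]
  define E F where "E = tgt \<A> i" "F = src \<A> h"
  note EF = this[symmetric]
  have o [simp]: "E \<in> \<C>" "F \<in> \<C>" using c h EF by simp_all
  let ?j1 = "inj1 \<A> E F" and ?j2 = "inj2 \<A> E F" and ?p1 = "proj1 \<A> E F" and ?p2 = "proj2 \<A> E F"
  define n where "n = p \<cdot> ?p1 \<oplus> hneg (h \<cdot> ?p2)"
  have n [simp]: "n \<in> arr \<A>" "tgt \<A> n = tgt \<A> p" "src \<A> n = bsum E F"
    using c h EF by (simp_all add: n_def)
  have nj: "n \<cdot> ?j1 = p" "n \<cdot> ?j2 = hneg h"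
    using c h EF by (simp_all add: n_def)
  obtain k where k: "is_kernel \<A> k n" using kernel_exists[OF n(1)] by blast
  have nn: "epic \<A> n"
  proof (rule epicI[OF n(1)])
    fix x assume x: "x \<in> arr \<A>" "src \<A> x = tgt \<A> n" "x \<cdot> n = hzero \<A> (src \<A> n) (tgt \<A> x)"
    have "x \<cdot> p = x \<cdot> (n \<cdot> ?j1)" by (simp only: nj)
    also have "\<dots> = hzero \<A> (src \<A> n) (tgt \<A> x) \<cdot> ?j1" by (rule cmp_reassoc) (use x in simp_all)
    also have "\<dots> = hzero \<A> (tgt \<A> n) (tgt \<A> x) \<cdot> p" using x c EF by simp
    finally show "x = hzero \<A> (tgt \<A> n) (tgt \<A> x)"
      by - (rule conflation_cancel(2)[OF ip], use x c in simp_all)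
  qed
  have kn: "short_exact \<A> k n" by (rule short_exactI_epic[OF nn k])
  note kn' = short_exact_arr(1,2,4)[OF kn, simplified]
  define D where "D = src \<A> k"
  define u where "u = ?p1 \<cdot> k"
  define p' where "p' = ?p2 \<cdot> k"
  have [simp]: "tgt \<A> k = bsum E F" "D \<in> obj \<A>"
    using kn' short_exact_arr(3)[OF kn] by (simp_all add: D_def)
  have ar [simp]: "u \<in> arr \<A>" "src \<A> u = D" "tgt \<A> u = E" "p' \<in> arr \<A>" "src \<A> p' = D" "tgt \<A> p' = F"
    using kn' by (simp_all add: u_def p'_def D_def)
  have "p \<cdot> u \<oplus> hneg (h \<cdot> p') = n \<cdot> k" unfolding n_def u_def p'_def using c h EF kn' by simp
  then have sq: "p \<cdot> u = h \<cdot> p'"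
    by - (rule diff_eq_zero, use kn' c h EF in \<open>simp_all add: D_def\<close>)
  have eqI: "x = y" if "x \<in> arr \<A>" "y \<in> arr \<A>" "tgt \<A> x = D" "tgt \<A> y = D" "src \<A> x = src \<A> y"
    "u \<cdot> x = u \<cdot> y" "p' \<cdot> x = p' \<cdot> y" for x y
  proof (rule short_exact_cancel(1)[OF kn])
    show "k \<cdot> x = k \<cdot> y"
      by (rule biprod_eqI_in[of _ _ E F])
        (use that kn' in \<open>simp_all add: D_def u_def p'_def\<close>)
  qed (use that kn' in \<open>simp_all add: D_def\<close>)
  have ex: "\<exists>w\<in>arr \<A>. tgt \<A> w = D \<and> src \<A> w = src \<A> a \<and> u \<cdot> w = a \<and> p' \<cdot> w = b"
    if ab: "a \<in> arr \<A>" "b \<in> arr \<A>" "tgt \<A> a = E" "tgt \<A> b = F" "src \<A> a = src \<A> b" "p \<cdot> a = h \<cdot> b" for a b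
  proof -
    let ?h = "?j1 \<cdot> a \<oplus> ?j2 \<cdot> b"
    have "n \<cdot> ?h = hzero \<A> (src \<A> ?h) (tgt \<A> n)"
      using ab c h EF by (simp add: cmp_reassoc[OF nj(1)] cmp_reassoc[OF nj(2)])
    then obtain w where w: "w \<in> arr \<A>" "tgt \<A> w = src \<A> k" "src \<A> w = src \<A> ?h" "k \<cdot> w = ?h"
      using ab by (elim short_exact_lift[OF kn, rotated 2]) simp_all
    have "u \<cdot> w = ?p1 \<cdot> ?h" "p' \<cdot> w = ?p2 \<cdot> ?h"
      unfolding w(4)[symmetric] u_def p'_def using w(1-3) kn' by simp_all
    then show ?thesis using ab w(1-3) by (intro bexI[of _ w]) (simp_all add: D_def)
  qed
  have pb: "pullback_square \<A> p h u p'"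
    unfolding pullback_square_def
  proof (intro conjI ballI impI; (elim conjE)?)
    fix a b assume ab: "a \<in> arr \<A>" "b \<in> arr \<A>" "tgt \<A> a = src \<A> p" "tgt \<A> b = src \<A> h" "src \<A> a = src \<A> b" "p \<cdot> a = h \<cdot> b"
    then obtain w where w: "w \<in> arr \<A>" "tgt \<A> w = D" "src \<A> w = src \<A> a" "u \<cdot> w = a" "p' \<cdot> w = b"
      using ex[of a b] EF c(4) by metis
    show "\<exists>!w. w \<in> Hom \<A> (src \<A> a) (src \<A> u) \<and> u \<cdot> w = a \<and> p' \<cdot> w = b"
    proof (rule ex1I[of _ w])
      fix x assume "x \<in> Hom \<A> (src \<A> a) (src \<A> u) \<and> u \<cdot> x = a \<and> p' \<cdot> x = b"
      then show "x = w" using w by - (rule eqI, simp_all)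
    qed (use w in simp_all)
  qed (use c h sq EF in simp_all)
  obtain i' where i': "i' \<in> arr \<A>" "tgt \<A> i' = D" "src \<A> i' = src \<A> i" "u \<cdot> i' = i"
    "p' \<cdot> i' = hzero \<A> (src \<A> i) F"
    using ex[of i "hzero \<A> (src \<A> i) F"] c h EF by (auto simp del: Hom_iff)
  have se: "short_exact \<A> i' p'"
  proof (rule short_exactI')
    fix x assume x: "x \<in> arr \<A>" "src \<A> x = tgt \<A> p'" "x \<cdot> p' = hzero \<A> (tgt \<A> i') (tgt \<A> x)"
    then have "x \<cdot> ?p2 \<cdot> k = hzero \<A> (src \<A> k) (tgt \<A> (x \<cdot> ?p2))" using kn' i' by (simp add: p'_def D_def)
    then obtain y where y: "y \<in> arr \<A>" "tgt \<A> y = tgt \<A> x" "src \<A> y = tgt \<A> n" "y \<cdot> n = x \<cdot> ?p2"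
      using short_exact_desc[OF kn, of "x \<cdot> ?p2"] x kn' by auto
    have "y \<cdot> p = y \<cdot> (n \<cdot> ?j1)" by (simp only: nj)
    also have "\<dots> = x \<cdot> ?p2 \<cdot> ?j1" by (rule cmp_reassoc) (use x y in simp_all)
    also have "\<dots> = hzero \<A> (tgt \<A> p) (tgt \<A> x) \<cdot> p" using y x c EF by simp
    finally have "y = hzero \<A> (tgt \<A> p) (tgt \<A> x)"
      by - (rule conflation_cancel(2)[OF ip], use x y c in simp_all)
    then have z: "x \<cdot> ?p2 = hzero \<A> (bsum E F) (tgt \<A> x)" using y(4) x c by simp
    have "x = x \<cdot> ?p2 \<cdot> ?j2" using x(1,2) by simp
    also have "\<dots> = hzero \<A> F (tgt \<A> x)" using x by (simp add: z del: cmp_assoc')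
    finally show "x = hzero \<A> (tgt \<A> p') (tgt \<A> x)" by simp
  next
    fix t assume t: "t \<in> arr \<A>" "tgt \<A> t = tgt \<A> i'" "p' \<cdot> t = hzero \<A> (src \<A> t) (tgt \<A> p')"
    have "p \<cdot> (u \<cdot> t) = h \<cdot> (p' \<cdot> t)" by (rule cmp_reassoc2[OF sq]) (use t c h i' EF in simp_all)
    then have "p \<cdot> (u \<cdot> t) = hzero \<A> (src \<A> (u \<cdot> t)) (tgt \<A> p)" using t c h EF i' by simp
    then obtain v where v: "v \<in> arr \<A>" "tgt \<A> v = src \<A> i" "src \<A> v = src \<A> t" "i \<cdot> v = u \<cdot> t"
      using conflation_lift[OF ip, of "u \<cdot> t"] t c EF i' by auto
    have "i' \<cdot> v = t"
      by (rule eqI) (use v t i' c(5) in \<open>simp_all add: cmp_reassoc[OF i'(4)] cmp_reassoc[OF i'(5)]\<close>)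
    then show "\<exists>u\<in>arr \<A>. tgt \<A> u = src \<A> i' \<and> src \<A> u = src \<A> t \<and> i' \<cdot> u = t"
      using v i' by auto
  next
    fix x y assume *: "x \<in> arr \<A>" "y \<in> arr \<A>" "tgt \<A> x = src \<A> i'" "tgt \<A> y = src \<A> i'"
      "src \<A> x = src \<A> y" "i' \<cdot> x = i' \<cdot> y"
    have "u \<cdot> (i' \<cdot> x) = u \<cdot> (i' \<cdot> y)" by (simp only: *)
    then have "i \<cdot> x = i \<cdot> y" using *(1-5) i' by (simp add: cmp_reassoc[OF i'(4)])
    then show "x = y" by - (rule conflation_cancel(1)[OF ip], use * i' in simp_all)
  qed (use i' in simp_all)
  have "conflation \<A> \<C> i' p'" by (rule conflationI[OF se]) (use c i' in simp_all)
  then show thesis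
    using pb i' by (intro that[of i' p' u]) simp_all
qed

lemma dsum_conflation:
  assumes ip: "conflation \<A> \<C> i p" and jq: "conflation \<A> \<C> j q"
  shows "conflation \<A> \<C> (dsum \<A> i j) (dsum \<A> p q)"
proof -
  note c = conflationD[OF ip] and d = conflationD[OF jq]
  have "short_exact \<A> (dsum \<A> i j) (dsum \<A> p q)"
  proof (rule short_exactI)
    show "dsum \<A> p q \<cdot> dsum \<A> i j = hzero \<A> (src \<A> (dsum \<A> i j)) (tgt \<A> (dsum \<A> p q))"
      by (rule biprod_eqI_in[of _ _ "tgt \<A> p" "tgt \<A> q"]) (use c d in simp_all)
  next
    fix g assume g: "g \<in> arr \<A>" "tgt \<A> g = src \<A> (dsum \<A> i j)"
      "dsum \<A> i j \<cdot> g = hzero \<A> (src \<A> g) (tgt \<A> (dsum \<A> i j))"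
    let ?X = "src \<A> i" and ?Y = "src \<A> j"
    have "i \<cdot> (proj1 \<A> ?X ?Y \<cdot> g) = proj1 \<A> (tgt \<A> i) (tgt \<A> j) \<cdot> (dsum \<A> i j \<cdot> g)"
      "j \<cdot> (proj2 \<A> ?X ?Y \<cdot> g) = proj2 \<A> (tgt \<A> i) (tgt \<A> j) \<cdot> (dsum \<A> i j \<cdot> g)"
      using g(1,2) c d by simp_all
    then have *: "i \<cdot> (proj1 \<A> ?X ?Y \<cdot> g) = i \<cdot> hzero \<A> (src \<A> g) ?X"
      "j \<cdot> (proj2 \<A> ?X ?Y \<cdot> g) = j \<cdot> hzero \<A> (src \<A> g) ?Y" using g c d by simp_all
    have "proj1 \<A> ?X ?Y \<cdot> g = hzero \<A> (src \<A> g) ?X" "proj2 \<A> ?X ?Y \<cdot> g = hzero \<A> (src \<A> g) ?Y"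
      by (rule conflation_cancel(1)[OF ip _ _ _ _ _ *(1)], use g c d in simp_all)
        (rule conflation_cancel(1)[OF jq _ _ _ _ _ *(2)], use g c d in simp_all)
    then show "g = hzero \<A> (src \<A> g) (src \<A> (dsum \<A> i j))"
      by - (rule biprod_eqI_in[of _ _ ?X ?Y], use g c d in simp_all)
  next
    fix g assume g: "g \<in> arr \<A>" "src \<A> g = tgt \<A> (dsum \<A> i j)"
      "g \<cdot> dsum \<A> i j = hzero \<A> (src \<A> (dsum \<A> i j)) (tgt \<A> g)"
    let ?j1 = "inj1 \<A> (tgt \<A> i) (tgt \<A> j)" and ?j2 = "inj2 \<A> (tgt \<A> i) (tgt \<A> j)"
    have "g \<cdot> (?j1 \<cdot> i) = g \<cdot> dsum \<A> i j \<cdot> inj1 \<A> (src \<A> i) (src \<A> j)"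
      "g \<cdot> (?j2 \<cdot> j) = g \<cdot> dsum \<A> i j \<cdot> inj2 \<A> (src \<A> i) (src \<A> j)"
      using g(1,2) c d by simp_all
    then have *: "g \<cdot> ?j1 \<cdot> i = hzero \<A> (src \<A> i) (tgt \<A> (g \<cdot> ?j1))"
      "g \<cdot> ?j2 \<cdot> j = hzero \<A> (src \<A> j) (tgt \<A> (g \<cdot> ?j2))"
      unfolding g(3) using g(1,2) c d by simp_all
    obtain a where a: "a \<in> arr \<A>" "src \<A> a = tgt \<A> p" "tgt \<A> a = tgt \<A> g" "a \<cdot> p = g \<cdot> ?j1"
      using conflation_desc[OF ip _ _ *(1)] g c d by auto
    obtain b where b: "b \<in> arr \<A>" "src \<A> b = tgt \<A> q" "tgt \<A> b = tgt \<A> g" "b \<cdot> q = g \<cdot> ?j2"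
      using conflation_desc[OF jq _ _ *(2)] g c d by auto
    let ?u = "a \<cdot> proj1 \<A> (tgt \<A> p) (tgt \<A> q) \<oplus> b \<cdot> proj2 \<A> (tgt \<A> p) (tgt \<A> q)"
    have "?u \<cdot> dsum \<A> p q = g"
      by (rule biprod_eqI_out[of _ _ "tgt \<A> i" "tgt \<A> j"]) (use a b c d g(1,2) in simp_all)
    then show "\<exists>u\<in>arr \<A>. src \<A> u = tgt \<A> (dsum \<A> p q) \<and> tgt \<A> u = tgt \<A> g \<and> u \<cdot> dsum \<A> p q = g"
      using a b c d by (intro bexI[of _ ?u]) simp_all
  next
    fix u v assume *: "u \<in> arr \<A>" "v \<in> arr \<A>" "src \<A> u = tgt \<A> (dsum \<A> p q)"
      "src \<A> v = tgt \<A> (dsum \<A> p q)" "tgt \<A> u = tgt \<A> v" "u \<cdot> dsum \<A> p q = v \<cdot> dsum \<A> p q"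
    let ?j1 = "inj1 \<A> (tgt \<A> i) (tgt \<A> j)" and ?j2 = "inj2 \<A> (tgt \<A> i) (tgt \<A> j)"
    have "u \<cdot> (dsum \<A> p q \<cdot> ?j1) = v \<cdot> (dsum \<A> p q \<cdot> ?j1)" "u \<cdot> (dsum \<A> p q \<cdot> ?j2) = v \<cdot> (dsum \<A> p q \<cdot> ?j2)"
      by (rule cmp_reassoc2[OF *(6)]; use *(1-5) c d in simp)+
    then have **: "u \<cdot> inj1 \<A> (tgt \<A> p) (tgt \<A> q) \<cdot> p = v \<cdot> inj1 \<A> (tgt \<A> p) (tgt \<A> q) \<cdot> p"
      "u \<cdot> inj2 \<A> (tgt \<A> p) (tgt \<A> q) \<cdot> q = v \<cdot> inj2 \<A> (tgt \<A> p) (tgt \<A> q) \<cdot> q"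
      using *(1-5) c d by simp_all
    have "u \<cdot> inj1 \<A> (tgt \<A> p) (tgt \<A> q) = v \<cdot> inj1 \<A> (tgt \<A> p) (tgt \<A> q)"
      by (rule conflation_cancel(2)[OF ip _ _ _ _ _ **(1)]) (use *(1-5) c d in simp_all)
    moreover have "u \<cdot> inj2 \<A> (tgt \<A> p) (tgt \<A> q) = v \<cdot> inj2 \<A> (tgt \<A> p) (tgt \<A> q)"
      by (rule conflation_cancel(2)[OF jq _ _ _ _ _ **(2)]) (use *(1-5) c d in simp_all)
    ultimately show "u = v"
      by - (rule biprod_eqI_out[of _ _ "tgt \<A> p" "tgt \<A> q"], use *(1-5) c d in simp_all)
  qed (use c d in simp_all)
  then show ?thesis using c d by (simp add: conflation_def)
qed

text \<open>The cokernel of \<open>j \<cdot> i\<close> is obtained as the push-out of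
  \<open>j\<close> along \<open>p\<close>. The conflation that comes with this push-out is the
  Noether sequence from the cokernel of \<open>i\<close> through that of \<open>j \<cdot> i\<close>
  to that of \<open>j\<close>.\<close>

lemma conflation_cmp:
  assumes ip: "conflation \<A> \<C> i p" and jq: "conflation \<A> \<C> j q" and ji: "src \<A> j = tgt \<A> i"
  obtains u c w where "conflation \<A> \<C> (j \<cdot> i) u" "conflation \<A> \<C> c w" "src \<A> c = tgt \<A> p"
    "tgt \<A> c = tgt \<A> u" "src \<A> u = tgt \<A> j" "u \<cdot> j = c \<cdot> p" "w \<cdot> u = q" "tgt \<A> w = tgt \<A> q"
proof -
  note ci = conflationD[OF ip] and cj = conflationD[OF jq]
  obtain c w u where cw: "conflation \<A> \<C> c w" and po: "pushout_square \<A> j p u c" and wu: "w \<cdot> u = q" "tgt \<A> w = tgt \<A> q"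
    using pushout_conflation[OF jq, of p] ci cj ji by metis
  note pd = pushout_squareD[OF po]
  have "short_exact \<A> (j \<cdot> i) u"
  proof (rule short_exactI)
    have "u \<cdot> (j \<cdot> i) = c \<cdot> (p \<cdot> i)" by (rule cmp_reassoc2[OF pd(9)]) (use pd ci ji in simp_all)
    then show "u \<cdot> (j \<cdot> i) = hzero \<A> (src \<A> (j \<cdot> i)) (tgt \<A> u)" using ci cj ji pd by simp
  next
    fix g assume g: "g \<in> arr \<A>" "tgt \<A> g = src \<A> (j \<cdot> i)" "j \<cdot> i \<cdot> g = hzero \<A> (src \<A> g) (tgt \<A> (j \<cdot> i))"
    then have "j \<cdot> (i \<cdot> g) = j \<cdot> hzero \<A> (src \<A> g) (tgt \<A> i)" using ci cj ji by simp
    then have "i \<cdot> g = i \<cdot> hzero \<A> (src \<A> g) (src \<A> i)"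
      by - (rule conflation_cancel(1)[OF jq], use g ci cj ji in simp_all)
    then have "g = hzero \<A> (src \<A> g) (src \<A> i)"
      by - (rule conflation_cancel(1)[OF ip], use g ci cj ji in simp_all)
    then show "g = hzero \<A> (src \<A> g) (src \<A> (j \<cdot> i))" using ci cj ji by simp
  next
    fix x assume x: "x \<in> arr \<A>" "src \<A> x = tgt \<A> (j \<cdot> i)" "x \<cdot> (j \<cdot> i) = hzero \<A> (src \<A> (j \<cdot> i)) (tgt \<A> x)"
    then have "x \<cdot> j \<cdot> i = hzero \<A> (src \<A> i) (tgt \<A> (x \<cdot> j))" using ci cj ji by simp
    then obtain y where y: "y \<in> arr \<A>" "src \<A> y = tgt \<A> p" "tgt \<A> y = tgt \<A> x" "y \<cdot> p = x \<cdot> j"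
      using conflation_desc[OF ip, of "x \<cdot> j"] x ci cj ji by auto
    obtain v where "v \<in> arr \<A>" "src \<A> v = tgt \<A> u" "tgt \<A> v = tgt \<A> x" "v \<cdot> u = x"
      using pushout_desc[OF po x(1) y(1)] x y ci cj ji by auto
    then show "\<exists>v\<in>arr \<A>. src \<A> v = tgt \<A> u \<and> tgt \<A> v = tgt \<A> x \<and> v \<cdot> u = x" by auto
  next
    fix x y assume *: "x \<in> arr \<A>" "y \<in> arr \<A>" "src \<A> x = tgt \<A> u" "src \<A> y = tgt \<A> u"
      "tgt \<A> x = tgt \<A> y" "x \<cdot> u = y \<cdot> u"
    have "x \<cdot> (u \<cdot> j) = y \<cdot> (u \<cdot> j)" by (rule cmp_reassoc2) (use * pd in simp_all)
    then have "x \<cdot> c \<cdot> p = y \<cdot> c \<cdot> p" using * pd by simp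
    then have "x \<cdot> c = y \<cdot> c"
      by - (rule conflation_cancel(2)[OF ip], use * pd in simp_all)
    then show "x = y" by - (rule pushout_cancel[OF po], use * in simp_all)
  qed (use pd ci ji in simp_all)
  moreover have "tgt \<A> u \<in> \<C>" using conflationD[OF cw] pd by simp
  ultimately have "conflation \<A> \<C> (j \<cdot> i) u" using ci cj ji by (intro conflationI) simp_all
  then show thesis using cw wu pd by (intro that[of u c w]) simp_all
qed

text \<open>A morphism of conflations that is the identity on the left has a right-hand square that
  is both a push-out and a pull-back, and this conflation expresses it. Once exactness in the middle
  is known, it lifts a pair of Ext classes over \<open>E\<close> and \<open>W\<close> with equal
  images to a class over \<open>tgt \<A> i\<close>.\<close>

lemma conflation_cone:
  assumes ip: "conflation \<A> \<C> i p" and jq: "conflation \<A> \<C> j q"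
    and b: "b \<in> arr \<A>" "src \<A> b = tgt \<A> i" "tgt \<A> b = tgt \<A> j" "b \<cdot> i = j"
    and c: "c \<in> arr \<A>" "src \<A> c = tgt \<A> p" "tgt \<A> c = tgt \<A> q" "q \<cdot> b = c \<cdot> p"
  defines "E \<equiv> tgt \<A> j" and "W \<equiv> tgt \<A> p"
  shows "conflation \<A> \<C> (inj1 \<A> E W \<cdot> b \<oplus> inj2 \<A> E W \<cdot> p) (q \<cdot> proj1 \<A> E W \<oplus> hneg (c \<cdot> proj2 \<A> E W))"
proof -
  note ci = conflationD[OF ip] and cj = conflationD[OF jq]
  have s: "src \<A> j = src \<A> i" using b ci by auto
  note EW = E_def[symmetric] W_def[symmetric]
  have [simp]: "E \<in> \<C>" "W \<in> \<C>" using ci cj EW by simp_all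
  let ?k = "inj1 \<A> E W \<cdot> b \<oplus> inj2 \<A> E W \<cdot> p" and ?n = "q \<cdot> proj1 \<A> E W \<oplus> hneg (c \<cdot> proj2 \<A> E W)"
  have k: "?k \<in> arr \<A>" "src \<A> ?k = tgt \<A> i" "tgt \<A> ?k = bsum E W" "proj1 \<A> E W \<cdot> ?k = b" "proj2 \<A> E W \<cdot> ?k = p"
    using ci cj b c EW by simp_all
  have n: "?n \<in> arr \<A>" "src \<A> ?n = bsum E W" "tgt \<A> ?n = tgt \<A> q" "?n \<cdot> inj1 \<A> E W = q" "?n \<cdot> inj2 \<A> E W = hneg c"
    using ci cj b c EW by simp_all
  have "short_exact \<A> ?k ?n"
  proof (rule short_exactI)
    show "?n \<cdot> ?k = hzero \<A> (src \<A> ?k) (tgt \<A> ?n)" using ci cj b c EW by (simp add: hneg_arr)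
  next
    fix g assume g: "g \<in> arr \<A>" "tgt \<A> g = src \<A> ?k" "?k \<cdot> g = hzero \<A> (src \<A> g) (tgt \<A> ?k)"
    have "b \<cdot> g = proj1 \<A> E W \<cdot> (?k \<cdot> g)" "p \<cdot> g = proj2 \<A> E W \<cdot> (?k \<cdot> g)"
      by (rule cmp_reassoc[symmetric], use g(1,2) k in simp_all)+
    then have *: "b \<cdot> g = hzero \<A> (src \<A> g) E" "p \<cdot> g = hzero \<A> (src \<A> g) (tgt \<A> p)"
      unfolding g(3) using g(1) ci cj k EW by simp_all
    obtain z where z: "z \<in> arr \<A>" "src \<A> z = src \<A> g" "tgt \<A> z = src \<A> i" "i \<cdot> z = g"
      using conflation_lift[OF ip _ _ *(2)] g k by auto
    have "j \<cdot> z = b \<cdot> (i \<cdot> z)" by (rule cmp_reassoc[symmetric]) (use b z ci in simp_all)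
    then have "j \<cdot> z = j \<cdot> hzero \<A> (src \<A> g) (src \<A> i)" unfolding z(4) * using cj s z EW g(1) ci by simp
    then have "z = hzero \<A> (src \<A> g) (src \<A> i)"
      by - (rule conflation_cancel(1)[OF jq], use s z g(1) ci in simp_all)
    then have "g = i \<cdot> hzero \<A> (src \<A> g) (src \<A> i)" using z(4) by simp
    also have "\<dots> = hzero \<A> (src \<A> g) (tgt \<A> i)" using g(1) ci by simp
    finally show "g = hzero \<A> (src \<A> g) (src \<A> ?k)" unfolding k(2) .
  next
    fix g assume g: "g \<in> arr \<A>" "src \<A> g = tgt \<A> ?k" "g \<cdot> ?k = hzero \<A> (src \<A> ?k) (tgt \<A> g)"
    define m where "m = g \<cdot> inj1 \<A> E W"
    define l where "l = g \<cdot> inj2 \<A> E W"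
    have ml: "m \<in> arr \<A>" "src \<A> m = E" "tgt \<A> m = tgt \<A> g" "l \<in> arr \<A>" "src \<A> l = W" "tgt \<A> l = tgt \<A> g"
      using g(1,2) unfolding k(3) by (simp_all add: m_def l_def)
    have "m \<cdot> b \<oplus> l \<cdot> p = g \<cdot> ?k" using g(1,2) unfolding k(3) m_def l_def using ci cj b c EW by simp
    then have e: "m \<cdot> b \<oplus> l \<cdot> p = hzero \<A> (tgt \<A> i) (tgt \<A> g)" unfolding g(3) k(2) .
    \<comment> \<open>Since \<open>p\<close> kills \<open>i\<close>, the first component
      \<open>m\<close> of \<open>g\<close> already vanishes on \<open>j\<close> and descends along
      \<open>q\<close> to \<open>m'\<close>; cancelling \<open>p\<close> then forces the second
      component to be \<open>hneg (m' \<cdot> c)\<close>.\<close>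
    have "(m \<cdot> b \<oplus> l \<cdot> p) \<cdot> i = m \<cdot> j" using ml b ci cj EW s by simp
    then have "m \<cdot> j = hzero \<A> (src \<A> j) (tgt \<A> m)" unfolding e using ml s ci g(1) by simp
    then obtain m' where m': "m' \<in> arr \<A>" "src \<A> m' = tgt \<A> q" "tgt \<A> m' = tgt \<A> g" "m' \<cdot> q = m"
      using conflation_desc[OF jq, of m] ml EW by auto
    have "m \<cdot> b = m' \<cdot> (q \<cdot> b)" by (rule cmp_reassoc[symmetric]) (use m' b cj in simp_all)
    then have "(m' \<cdot> c \<oplus> l) \<cdot> p = m \<cdot> b \<oplus> l \<cdot> p" using m' ml b c ci cj EW by simp
    then have "(m' \<cdot> c \<oplus> l) \<cdot> p = hzero \<A> W (tgt \<A> g) \<cdot> p" unfolding e using g(1) ci EW by simp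
    then have "m' \<cdot> c \<oplus> l = hzero \<A> W (tgt \<A> g)"
      by - (rule conflation_cancel(2)[OF ip], use m' ml b c ci cj EW g(1) in simp_all)
    then have "l = hneg (m' \<cdot> c)"
      by - (rule hneg_unique, use m' ml c EW in \<open>simp_all add: hadd_commute\<close>)
    then have "m' \<cdot> ?n = g"
      by - (rule biprod_eqI_out[of _ _ E W], use m' ml c cj EW g(1,2) k(3) in \<open>simp_all add: m_def l_def\<close>)
    then show "\<exists>u\<in>arr \<A>. src \<A> u = tgt \<A> ?n \<and> tgt \<A> u = tgt \<A> g \<and> u \<cdot> ?n = g"
      using m' n(3) by metis
  next
    fix u v assume *: "u \<in> arr \<A>" "v \<in> arr \<A>" "src \<A> u = tgt \<A> ?n" "src \<A> v = tgt \<A> ?n" "tgt \<A> u = tgt \<A> v"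
      "u \<cdot> ?n = v \<cdot> ?n"
    have "u \<cdot> (?n \<cdot> inj1 \<A> E W) = v \<cdot> (?n \<cdot> inj1 \<A> E W)"
      by (rule cmp_reassoc2[OF *(6)]) (use * n in simp_all)
    then have "u \<cdot> q = v \<cdot> q" unfolding n(4) .
    then show "u = v" by - (rule conflation_cancel(2)[OF jq], use * n in simp_all)
  qed (use k n in simp_all)
  then show ?thesis
    by (intro conflationI) (use k n ci cj in simp_all)
qed

end

section \<open>Morphisms of Yoneda sequences\<close>

text \<open>A recursive form of \<open>seq_morphism\<close> that hides all components but the first and the last.\<close>

fun chain_map :: "('o, 'a) addcat \<Rightarrow> 'a list \<Rightarrow> 'a list \<Rightarrow> 'a \<Rightarrow> 'a \<Rightarrow> bool" where
  "chain_map \<A> [] [] a b \<longleftrightarrow> a = b"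
| "chain_map \<A> (x # s) (y # t) a b \<longleftrightarrow> a \<in> Hom \<A> (src \<A> x) (src \<A> y) \<and>
     (\<exists>c. c \<in> Hom \<A> (tgt \<A> x) (tgt \<A> y) \<and> c \<cdot>\<^bsub>\<A>\<^esub> x = y \<cdot>\<^bsub>\<A>\<^esub> a \<and> chain_map \<A> s t c b)"
| "chain_map \<A> _ _ _ _ \<longleftrightarrow> False"

lemma seq_morphism_Nil: "seq_morphism \<A> [] s' \<phi> \<longleftrightarrow> s' = [] \<and> (\<exists>a. \<phi> = [a])"
  by (auto simp: seq_morphism_def length_Suc_conv)

lemma seq_morphism_Cons:
  "seq_morphism \<A> (x # s) (y # t) (a # \<psi>) \<longleftrightarrow> a \<in> Hom \<A> (src \<A> x) (src \<A> y) \<and>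
     hd \<psi> \<in> Hom \<A> (tgt \<A> x) (tgt \<A> y) \<and> hd \<psi> \<cdot>\<^bsub>\<A>\<^esub> x = y \<cdot>\<^bsub>\<A>\<^esub> a \<and> seq_morphism \<A> s t \<psi>"
proof (cases \<psi>)
  case Nil
  then show ?thesis by (auto simp: seq_morphism_def)
next
  case (Cons b \<psi>')
  have "(\<forall>k<Suc n. P k) \<longleftrightarrow> P 0 \<and> (\<forall>k<n. P (Suc k))" for n and P :: "nat \<Rightarrow> bool"
    by (auto simp: less_Suc_eq_0_disj)
  then show ?thesis using Cons by (auto simp: seq_morphism_def)
qed

lemma chain_map_iff: "chain_map \<A> s s' a b \<longleftrightarrow> (\<exists>\<phi>. seq_morphism \<A> s s' \<phi> \<and> hd \<phi> = a \<and> last \<phi> = b)"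
proof (induction \<A> s s' a b rule: chain_map.induct)
  case (1 \<A> a b)
  show ?case by (auto simp: seq_morphism_Nil)
next
  case (2 \<A> x s y t a b)
  show ?case
  proof
    assume "chain_map \<A> (x # s) (y # t) a b"
    then obtain \<psi> where "a \<in> Hom \<A> (src \<A> x) (src \<A> y)" "hd \<psi> \<in> Hom \<A> (tgt \<A> x) (tgt \<A> y)"
      "hd \<psi> \<cdot>\<^bsub>\<A>\<^esub> x = y \<cdot>\<^bsub>\<A>\<^esub> a" "seq_morphism \<A> s t \<psi>" "last \<psi> = b" using 2 by auto
    moreover from this have "\<psi> \<noteq> []" by (auto simp: seq_morphism_def)
    ultimately show "\<exists>\<phi>. seq_morphism \<A> (x # s) (y # t) \<phi> \<and> hd \<phi> = a \<and> last \<phi> = b"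
      by (intro exI[of _ "a # \<psi>"]) (simp add: seq_morphism_Cons)
  next
    assume "\<exists>\<phi>. seq_morphism \<A> (x # s) (y # t) \<phi> \<and> hd \<phi> = a \<and> last \<phi> = b"
    then obtain \<phi> where \<phi>: "seq_morphism \<A> (x # s) (y # t) \<phi>" "hd \<phi> = a" "last \<phi> = b" by blast
    obtain \<psi> where \<psi>: "\<phi> = a # \<psi>" using \<phi> by (cases \<phi>) (auto simp: seq_morphism_def)
    then have "\<psi> \<noteq> []" using \<phi> by (auto simp: seq_morphism_def)
    then show "chain_map \<A> (x # s) (y # t) a b"
      using \<phi> \<psi> 2 by (auto simp: seq_morphism_Cons)
  qed
qed (auto simp: seq_morphism_def)

lemma chain_map_length: "chain_map \<A> s s' a b \<Longrightarrow> length s = length s'"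
  by (auto simp: chain_map_iff seq_morphism_def)

text \<open>\<open>chain_map\<close> recurses from the left, whereas pull-backs alter the last
  square of a sequence; this gives access from the right.\<close>

lemma chain_map_snoc:
  "chain_map \<A> (s @ [x]) (t @ [y]) a b \<longleftrightarrow> (\<exists>c. chain_map \<A> s t a c \<and> c \<in> Hom \<A> (src \<A> x) (src \<A> y) \<and>
     b \<in> Hom \<A> (tgt \<A> x) (tgt \<A> y) \<and> b \<cdot>\<^bsub>\<A>\<^esub> x = y \<cdot>\<^bsub>\<A>\<^esub> c)"
proof (induction s arbitrary: t a)
  case Nil
  then show ?case by (cases t) (auto dest: chain_map_length)
next
  case (Cons z s)
  then show ?case by (cases t) (auto dest: chain_map_length)
qed

definition ycls :: "('o, 'a) addcat \<Rightarrow> 'o set \<Rightarrow> 'a list \<Rightarrow> 'a ext" where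
  "ycls \<A> \<C> s = Cls (yequiv \<A> \<C> `` {s})"

lemma yequiv_refl: "(s, s) \<in> yequiv \<A> \<C>"
  by (simp add: yequiv_def)

lemma yequiv_sym: "(s, s') \<in> yequiv \<A> \<C> \<Longrightarrow> (s', s) \<in> yequiv \<A> \<C>"
proof -
  have "sym (yrel \<A> \<C> \<union> (yrel \<A> \<C>)\<inverse>)" by (auto simp: sym_def)
  then have "sym (yequiv \<A> \<C>)" unfolding yequiv_def by (rule sym_rtrancl)
  then show "(s, s') \<in> yequiv \<A> \<C> \<Longrightarrow> (s', s) \<in> yequiv \<A> \<C>" by (rule symD)
qed

lemma yequiv_trans: "\<lbrakk>(s, s') \<in> yequiv \<A> \<C>; (s', s'') \<in> yequiv \<A> \<C>\<rbrakk> \<Longrightarrow> (s, s'') \<in> yequiv \<A> \<C>"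
  unfolding yequiv_def by (rule rtrancl_trans)

lemma ycls_eq_iff: "ycls \<A> \<C> s = ycls \<A> \<C> s' \<longleftrightarrow> (s, s') \<in> yequiv \<A> \<C>"
proof
  assume "ycls \<A> \<C> s = ycls \<A> \<C> s'"
  then have "s' \<in> yequiv \<A> \<C> `` {s}" using yequiv_refl[of s' \<A> \<C>] by (auto simp: ycls_def)
  then show "(s, s') \<in> yequiv \<A> \<C>" by simp
next
  assume e: "(s, s') \<in> yequiv \<A> \<C>"
  show "ycls \<A> \<C> s = ycls \<A> \<C> s'"
    unfolding ycls_def using yequiv_trans[OF e] yequiv_trans[OF yequiv_sym[OF e]] by blast
qed

lemma yequivI:
  assumes "yext \<A> \<C> t X Y s" "yext \<A> \<C> t X Y s'" "chain_map \<A> s s' (ide \<A> Y) (ide \<A> X)"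
  shows "(s, s') \<in> yequiv \<A> \<C>"
  using assms unfolding yequiv_def yrel_def chain_map_iff by blast

lemma Ext_pos: "t > 0 \<Longrightarrow> Ext \<A> \<C> t X Y = {ycls \<A> \<C> s | s. yext \<A> \<C> t X Y s}"
  by (auto simp: Ext_def ycls_def quotient_def)

section \<open>The shape of Yoneda sequences\<close>

context exact_subcategory begin

text \<open>Composability is separated from \<open>yext\<close> because it is also used for the
  tails of a sequence, which are not extensions themselves.\<close>

fun path :: "'b list \<Rightarrow> bool" where
  "path [] \<longleftrightarrow> True"
| "path [x] \<longleftrightarrow> x \<in> arr \<A>"
| "path (x # y # s) \<longleftrightarrow> x \<in> arr \<A> \<and> tgt \<A> x = src \<A> y \<and> path (y # s)"

lemma chain_map_refl: "path s \<Longrightarrow> s \<noteq> [] \<Longrightarrow> chain_map \<A> s s (ide \<A> (src \<A> (hd s))) (ide \<A> (tgt \<A> (last s)))"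
proof (induction s rule: path.induct)
  case (3 x y s)
  then have "chain_map \<A> (y # s) (y # s) (ide \<A> (src \<A> y)) (ide \<A> (tgt \<A> (last (y # s))))" by simp
  moreover have "x \<in> arr \<A>" "src \<A> y = tgt \<A> x" using 3(2) by simp_all
  ultimately have "chain_map \<A> (x # y # s) (x # y # s) (ide \<A> (src \<A> x)) (ide \<A> (tgt \<A> (last (y # s))))"
    by (subst chain_map.simps(2)) (intro conjI exI[of _ "ide \<A> (src \<A> y)"]; simp del: chain_map.simps)
  then show ?case by simp
qed auto

lemma chain_map_cmp:
  assumes "chain_map \<A> s s' a b" "chain_map \<A> s' s'' a' b'" "set s \<subseteq> arr \<A>" "set s' \<subseteq> arr \<A>" "set s'' \<subseteq> arr \<A>"
  shows "chain_map \<A> s s'' (a' \<cdot> a) (b' \<cdot> b)"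
  using assms
proof (induction s arbitrary: s' s'' a a')
  case Nil
  then show ?case by (cases s'; cases s'') auto
next
  case (Cons x s)
  obtain y t z r where yz: "s' = y # t" "s'' = z # r"
    using Cons.prems chain_map_length by (cases s'; cases s'') fastforce+
  obtain c where c: "c \<in> Hom \<A> (tgt \<A> x) (tgt \<A> y)" "c \<cdot> x = y \<cdot> a" "chain_map \<A> s t c b" "a \<in> Hom \<A> (src \<A> x) (src \<A> y)"
    using Cons.prems(1) yz by auto
  obtain c' where c': "c' \<in> Hom \<A> (tgt \<A> y) (tgt \<A> z)" "c' \<cdot> y = z \<cdot> a'" "chain_map \<A> t r c' b'" "a' \<in> Hom \<A> (src \<A> y) (src \<A> z)"
    using Cons.prems(2) yz by auto
  have ar: "x \<in> arr \<A>" "y \<in> arr \<A>" "z \<in> arr \<A>" "set s \<subseteq> arr \<A>" "set t \<subseteq> arr \<A>" "set r \<subseteq> arr \<A>"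
    using Cons.prems yz by auto
  have "c' \<cdot> c \<cdot> x = c' \<cdot> (y \<cdot> a)" using c c' ar by simp
  also have "\<dots> = z \<cdot> (a' \<cdot> a)" by (rule cmp_reassoc2) (use c c' ar in simp_all)
  finally have "c' \<cdot> c \<cdot> x = z \<cdot> (a' \<cdot> a)" .
  moreover have "chain_map \<A> s r (c' \<cdot> c) (b' \<cdot> b)" using Cons.IH c(3) c'(3) ar by blast
  ultimately show ?case using c c' ar yz by (auto intro!: exI[of _ "c' \<cdot> c"] simp del: cmp_assoc')
qed

lemma yext_ends: "yext \<A> \<C> t X Y s \<Longrightarrow> X \<in> \<C> \<and> Y \<in> \<C>"
  by (induction rule: yext.induct) (auto dest: conflationD)

lemma yext_length: "yext \<A> \<C> t X Y s \<Longrightarrow> length s = Suc t \<and> t > 0"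
  by (induction rule: yext.induct) auto

lemma yext_front:
  "yext \<A> \<C> t X Y s \<Longrightarrow> \<exists>i d r. s = i # d # r \<and> i \<in> arr \<A> \<and> d \<in> arr \<A> \<and> src \<A> d = tgt \<A> i \<and>
     d \<cdot> i = hzero \<A> Y (tgt \<A> d) \<and> src \<A> i = Y"
proof (induction rule: yext.induct)
  case (conflation i p)
  then show ?case using conflationD[of i p] by simp
next
  case (splice i p t X j s)
  then show ?case using conflationD[of i p] by auto
qed

lemma yext_back:
  "yext \<A> \<C> t X Y s \<Longrightarrow> \<exists>r d p. s = r @ [d, p] \<and> d \<in> arr \<A> \<and> p \<in> arr \<A> \<and> src \<A> p = tgt \<A> d \<and>
     p \<cdot> d = hzero \<A> (src \<A> d) X \<and> tgt \<A> p = X"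
proof (induction rule: yext.induct)
  case (conflation i p)
  then show ?case using conflationD[of i p] by simp
next
  case (splice i p t X j s)
  note c = conflationD[OF splice(1)]
  obtain r d q where r: "j # s = r @ [d, q]" "d \<in> arr \<A>" "q \<in> arr \<A>" "src \<A> q = tgt \<A> d"
     "q \<cdot> d = hzero \<A> (src \<A> d) X" "tgt \<A> q = X" using splice.IH by blast
  have X: "X \<in> obj \<A>" using yext_ends[OF splice(2)] by simp
  have j: "src \<A> j = tgt \<A> p" using yext_front[OF splice(2)] by auto
  show ?case
  proof (cases r)
    case Nil
    then have "i # j \<cdot> p # s = [i] @ [d \<cdot> p, q]" "q \<cdot> (d \<cdot> p) = hzero \<A> (src \<A> (d \<cdot> p)) X"
      using r c j X by (simp_all add: cmp_reassoc[OF r(5)])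
    then show ?thesis using r c j Nil by (intro exI[of _ "[i]"] exI[of _ "d \<cdot> p"] exI[of _ q]) simp
  next
    case (Cons a r')
    then show ?thesis using r by (intro exI[of _ "i # j \<cdot> p # r'"] exI[of _ d] exI[of _ q]) simp
  qed
qed

lemma yext_path: "yext \<A> \<C> t X Y s \<Longrightarrow> path s"
proof (induction rule: yext.induct)
  case (conflation i p)
  then show ?case using conflationD[of i p] by simp
next
  case (splice i p t X j s)
  note c = conflationD[OF splice(1)]
  obtain d r where "s = d # r" "j \<in> arr \<A>" "src \<A> d = tgt \<A> j" "src \<A> j = tgt \<A> p"
    using yext_front[OF splice(2)] by auto
  then show ?case using splice(3) c by simp
qed

lemma path_arr: "path s \<Longrightarrow> set s \<subseteq> arr \<A>"
  by (induction s rule: path.induct) auto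

lemma yext_arr: "yext \<A> \<C> t X Y s \<Longrightarrow> set s \<subseteq> arr \<A>"
  by (rule path_arr[OF yext_path])

lemma yext_src_tgt: "yext \<A> \<C> t X Y s \<Longrightarrow> src \<A> (hd s) = Y \<and> tgt \<A> (last s) = X \<and> s \<noteq> []"
proof (intro conjI)
  assume y: "yext \<A> \<C> t X Y s"
  show "src \<A> (hd s) = Y" "s \<noteq> []" using yext_front[OF y] by auto
  show "tgt \<A> (last s) = X" using yext_back[OF y] by auto
qed

lemma yext_chain_map_refl: "yext \<A> \<C> t X Y s \<Longrightarrow> chain_map \<A> s s (ide \<A> Y) (ide \<A> X)"
  using chain_map_refl[OF yext_path] yext_src_tgt by metis

text \<open>The degree is the length less one, and the ends are the outer source and target. So the
  parameters hidden by the existential quantifiers of \<open>yrel\<close> are determined by the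
  sequence.\<close>

lemma yext_unique:
  assumes "yext \<A> \<C> t X Y s" "yext \<A> \<C> t' X' Y' s"
  shows "t' = t" "X' = X" "Y' = Y"
  using yext_length[OF assms(1)] yext_length[OF assms(2)] yext_src_tgt[OF assms(1)] yext_src_tgt[OF assms(2)]
  by auto

lemma yext_chain_map_cmp:
  assumes "yext \<A> \<C> t X Y s" "yext \<A> \<C> t X' Y' s'" "yext \<A> \<C> t X'' Y'' s''"
    "chain_map \<A> s s' a b" "chain_map \<A> s' s'' a' b'"
  shows "chain_map \<A> s s'' (a' \<cdot> a) (b' \<cdot> b)"
  by (rule chain_map_cmp[OF assms(4,5)]) (use assms(1-3) yext_arr in blast)+

lemma chain_map_ends:
  assumes "yext \<A> \<C> t X Y s" "yext \<A> \<C> t X' Y' s'" "chain_map \<A> s s' a b"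
  shows "a \<in> Hom \<A> Y Y'" "b \<in> Hom \<A> X X'"
proof -
  show "a \<in> Hom \<A> Y Y'" using yext_front[OF assms(1)] yext_front[OF assms(2)] assms(3) by auto
  obtain r d p r' d' p' where "s = (r @ [d]) @ [p]" "s' = (r' @ [d']) @ [p']" "tgt \<A> p = X" "tgt \<A> p' = X'"
    using yext_back[OF assms(1)] yext_back[OF assms(2)] by auto
  then show "b \<in> Hom \<A> X X'" using assms(3) chain_map_snoc[of \<A> "r @ [d]" p "r' @ [d']" p' a b] by auto
qed

text \<open>By \<open>yext_unique\<close> a zigzag never leaves the sequences of a fixed degree with
  fixed ends. A property is therefore constant on a class as soon as it is invariant, in both
  directions, under a single chain map with identity ends.\<close>

lemma yequiv_induct:
  assumes eq: "(s, s') \<in> yequiv \<A> \<C>" and s: "yext \<A> \<C> t X Y s" and P: "P s"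
    and step: "\<And>u v. \<lbrakk>yext \<A> \<C> t X Y u; yext \<A> \<C> t X Y v; chain_map \<A> u v (ide \<A> Y) (ide \<A> X)\<rbrakk> \<Longrightarrow> P u \<longleftrightarrow> P v"
  shows "yext \<A> \<C> t X Y s' \<and> P s'"
  using eq[unfolded yequiv_def]
proof (induction rule: rtrancl_induct)
  case base
  then show ?case using s P by simp
next
  case (step u v)
  have *: "yext \<A> \<C> t X Y u \<and> yext \<A> \<C> t X Y v \<and> chain_map \<A> u v (ide \<A> Y) (ide \<A> X)"
    if uv: "(u, v) \<in> yrel \<A> \<C>" and y: "yext \<A> \<C> t X Y u \<or> yext \<A> \<C> t X Y v" for u v
  proof -
    obtain t' X' Y' where "yext \<A> \<C> t' X' Y' u" "yext \<A> \<C> t' X' Y' v" "chain_map \<A> u v (ide \<A> Y') (ide \<A> X')"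
      using uv unfolding yrel_def chain_map_iff by blast
    then show ?thesis using y yext_unique by metis
  qed
  show ?case using step.hyps(2) step.IH assms(4)[of u v] assms(4)[of v u] *[of u v] *[of v u] by blast
qed

section \<open>Push-out of sequences\<close>

lemma pushout_seq_yext:
  assumes "pushout_seq \<A> \<C> g s s'" "yext \<A> \<C> t X Y s"
  shows "yext \<A> \<C> t X (tgt \<A> g) s'"
proof -
  obtain i d r i' d' u where s: "s = i # d # r" "s' = i' # d' # r" "pushout_square \<A> i g u i'"
    "d' \<in> Hom \<A> (tgt \<A> u) (tgt \<A> d)"
    using assms(1) unfolding pushout_seq_def by blast
  obtain t' X' Y' where y': "yext \<A> \<C> t' X' Y' s'" using assms(1) unfolding pushout_seq_def by blast
  have "t' = t" using yext_length[OF y'] yext_length[OF assms(2)] s by simp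
  moreover have "Y' = tgt \<A> g" using yext_src_tgt[OF y'] s pushout_squareD[OF s(3)] by simp
  moreover have "X' = X" using yext_src_tgt[OF y'] yext_src_tgt[OF assms(2)] s by (cases r) auto
  ultimately show ?thesis using y' by simp
qed

text \<open>Only the leftmost conflation is pushed out. Its new deflation has the same target as the
  old one, so the rest of the sequence is spliced back unchanged.\<close>

lemma pushout_seq_exists:
  assumes "yext \<A> \<C> t X Y s" "g \<in> Hom \<A> Y Y'" "Y' \<in> \<C>"
  shows "\<exists>s'. pushout_seq \<A> \<C> g s s' \<and> yext \<A> \<C> t X Y' s'"
  using assms
proof (cases rule: yext.cases)
  case (conflation i p)
  then have g: "g \<in> arr \<A>" "src \<A> g = src \<A> i" "tgt \<A> g = Y'" "tgt \<A> g \<in> \<C>" using assms by simp_all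
  note c = conflationD[OF conflation(5)]
  obtain i' p' u where c': "conflation \<A> \<C> i' p'" "pushout_square \<A> i g u i'" "p' \<cdot> u = p" "tgt \<A> p' = tgt \<A> p"
    using pushout_conflation[OF conflation(5) g(1,2,4)] by metis
  note d = conflationD[OF c'(1)] pushout_squareD[OF c'(2)]
  have y: "yext \<A> \<C> t X Y' [i', p']" using yext.conflation[OF c'(1)] conflation c'(4) d g by simp
  have "pushout_seq \<A> \<C> g s [i', p']"
    unfolding pushout_seq_def
  proof (intro conjI exI)
    show "s = [i, p]" "[i', p'] = [i', p']" "pushout_square \<A> i g u i'" "p' \<cdot> u = p"
      using conflation c' by simp_all
    show "p' \<in> Hom \<A> (tgt \<A> u) (tgt \<A> p)" "p' \<cdot> i' = hzero \<A> (src \<A> i') (tgt \<A> p)" using c'(4) d by simp_all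
  qed (rule y)
  then show ?thesis using y by blast
next
  case (splice i p t0 j r)
  then have g: "g \<in> arr \<A>" "src \<A> g = src \<A> i" "tgt \<A> g = Y'" "tgt \<A> g \<in> \<C>" using assms by simp_all
  note c = conflationD[OF splice(4)]
  obtain i' p' u where c': "conflation \<A> \<C> i' p'" "pushout_square \<A> i g u i'" "p' \<cdot> u = p" "tgt \<A> p' = tgt \<A> p"
    using pushout_conflation[OF splice(4) g(1,2,4)] by metis
  note d = conflationD[OF c'(1)] pushout_squareD[OF c'(2)]
  have j: "j \<in> arr \<A>" "src \<A> j = tgt \<A> p" using yext_front[OF splice(5)] by auto
  have "yext \<A> \<C> t0 X (tgt \<A> p') (j # r)" using splice c'(4) by simp
  from yext.splice[OF c'(1) this] have y: "yext \<A> \<C> t X Y' (i' # j \<cdot> p' # r)" using splice(1) d g by simp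
  have "pushout_seq \<A> \<C> g s (i' # j \<cdot> p' # r)"
    unfolding pushout_seq_def
  proof (intro conjI exI)
    show "s = i # j \<cdot> p # r" "i' # j \<cdot> p' # r = i' # j \<cdot> p' # r" "pushout_square \<A> i g u i'"
      using splice c' by simp_all
    show "j \<cdot> p' \<in> Hom \<A> (tgt \<A> u) (tgt \<A> (j \<cdot> p))" "j \<cdot> p' \<cdot> i' = hzero \<A> (src \<A> i') (tgt \<A> (j \<cdot> p))"
      "j \<cdot> p' \<cdot> u = j \<cdot> p"
      using c'(3,4) d j c by simp_all
  qed (rule y)
  then show ?thesis using y by blast
qed

lemma pushout_seq_chain_map:
  assumes "pushout_seq \<A> \<C> g s s'" "yext \<A> \<C> t X Y s"
  shows "chain_map \<A> s s' g (ide \<A> X)"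
proof -
  obtain i d r i' d' u where s: "s = i # d # r" "s' = i' # d' # r" "pushout_square \<A> i g u i'"
    "d' \<in> Hom \<A> (tgt \<A> u) (tgt \<A> d)" "d' \<cdot> u = d"
    using assms(1) unfolding pushout_seq_def by blast
  note po = pushout_squareD[OF s(3)]
  have d: "d \<in> arr \<A>" "src \<A> d = tgt \<A> i" using yext_front[OF assms(2)] s by auto
  have r: "chain_map \<A> r r (ide \<A> (tgt \<A> d)) (ide \<A> X)"
  proof (cases r)
    case Nil
    then show ?thesis using yext_src_tgt[OF assms(2)] s by simp
  next
    case (Cons x r')
    then have "path r" "src \<A> x = tgt \<A> d" using yext_path[OF assms(2)] s by auto
    then show ?thesis using chain_map_refl[of r] Cons yext_src_tgt[OF assms(2)] s by simp
  qed
  show ?thesis unfolding s(1,2) chain_map.simps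
    by (intro conjI exI[of _ u] exI[of _ "ide \<A> (tgt \<A> d)"] r) (use s po d in simp_all)
qed

text \<open>The universal property of the push-out, carried over to sequences: only the component at
  the push-out object is new, and joint cancellation shows that it commutes with the following
  arrow.\<close>

lemma pushout_seq_factor:
  assumes "pushout_seq \<A> \<C> g s s'" "yext \<A> \<C> t X Y s" "yext \<A> \<C> t1 X1 Y1 s1" "chain_map \<A> s s1 g b"
  shows "chain_map \<A> s' s1 (ide \<A> (tgt \<A> g)) b"
proof -
  obtain i d r i' d' u where s: "s = i # d # r" "s' = i' # d' # r" "pushout_square \<A> i g u i'"
    "d' \<in> arr \<A>" "src \<A> d' = tgt \<A> u" "tgt \<A> d' = tgt \<A> d" "d' \<cdot> u = d" "d' \<cdot> i' = hzero \<A> (src \<A> i') (tgt \<A> d)"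
    using assms(1) unfolding pushout_seq_def by (auto simp del: cmp_assoc')
  note po = pushout_squareD[OF s(3)]
  have d: "d \<in> arr \<A>" "src \<A> d = tgt \<A> i" using yext_front[OF assms(2)] s by auto
  obtain i1 d1 r1 where s1: "s1 = i1 # d1 # r1" "i1 \<in> arr \<A>" "d1 \<in> arr \<A>" "src \<A> d1 = tgt \<A> i1"
    "d1 \<cdot> i1 = hzero \<A> (src \<A> i1) (tgt \<A> d1)" using yext_front[OF assms(3)] by auto
  obtain c e where c: "c \<in> arr \<A>" "src \<A> c = tgt \<A> i" "tgt \<A> c = tgt \<A> i1" "c \<cdot> i = i1 \<cdot> g" "tgt \<A> g = src \<A> i1"
    and e: "e \<in> arr \<A>" "src \<A> e = tgt \<A> d" "tgt \<A> e = tgt \<A> d1" "e \<cdot> d = d1 \<cdot> c" "chain_map \<A> r r1 e b"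
    using assms(4) unfolding s(1) s1(1) by auto
  obtain w where w: "w \<in> arr \<A>" "src \<A> w = tgt \<A> u" "tgt \<A> w = tgt \<A> i1" "w \<cdot> u = c" "w \<cdot> i' = i1"
    using pushout_desc[OF s(3), of c i1] c s1 by auto
  have "e \<cdot> d' = d1 \<cdot> w"
  proof (rule pushout_cancel[OF s(3)])
    show "e \<cdot> d' \<cdot> u = d1 \<cdot> w \<cdot> u" "e \<cdot> d' \<cdot> i' = d1 \<cdot> w \<cdot> i'"
      using s(4-8) e(1-4) w s1 po c(5) by simp_all
  qed (use s(4-8) e(1-4) w s1 po in simp_all)
  then show ?thesis unfolding s(2) s1(1) chain_map.simps
    by (intro conjI exI[of _ w] exI[of _ e] e(5)) (use s(4-8) e(1-4) w s1 po c(5) in simp_all)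
qed

text \<open>A chain map with left component \<open>g\<close> and identity on the right factors
  through every push-out sequence by an equivalence, so it computes the class on its own. Later
  arguments about push-outs of classes only have to exhibit such a chain map.\<close>

lemma push_ycls:
  assumes s: "yext \<A> \<C> t X Y s" and s1: "yext \<A> \<C> t X Y' s1" and m: "chain_map \<A> s s1 g (ide \<A> X)"
  shows "push \<A> \<C> g (ycls \<A> \<C> s) = ycls \<A> \<C> s1"
proof -
  have g: "g \<in> Hom \<A> Y Y'" using chain_map_ends[OF s s1 m] by simp
  have Y': "Y' \<in> \<C>" "X \<in> \<C>" using yext_ends[OF s1] by simp_all
  have po: "(v, w) \<in> yequiv \<A> \<C>" if u: "yext \<A> \<C> t X Y u" and w: "yext \<A> \<C> t X Y' w"
    and uv: "pushout_seq \<A> \<C> g u v" and uw: "chain_map \<A> u w g (ide \<A> X)" for u v w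
    using yequivI[OF pushout_seq_yext[OF uv u]] w pushout_seq_factor[OF uv u w uw] g by simp
  \<comment> \<open>All push-out sequences of \<open>u\<close> are treated at once: they are unique
    only up to equivalence, and \<open>push\<close> collects all of them.\<close>
  let ?P = "\<lambda>u. \<forall>v. pushout_seq \<A> \<C> g u v \<longrightarrow> (v, s1) \<in> yequiv \<A> \<C>"
  have "yext \<A> \<C> t X Y u \<and> ?P u" if "(s, u) \<in> yequiv \<A> \<C>" for u
  proof (rule yequiv_induct[OF that s])
    show "?P s" using po[OF s s1 _ m] by blast
    fix u v assume u: "yext \<A> \<C> t X Y u" and v: "yext \<A> \<C> t X Y v" and uv: "chain_map \<A> u v (ide \<A> Y) (ide \<A> X)"
    obtain u' where u': "pushout_seq \<A> \<C> g u u'" "yext \<A> \<C> t X Y' u'"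
      using pushout_seq_exists[OF u] g Y' by blast
    obtain v' where v': "pushout_seq \<A> \<C> g v v'" "yext \<A> \<C> t X Y' v'"
      using pushout_seq_exists[OF v] g Y' by blast
    have "(u'', v'') \<in> yequiv \<A> \<C>" if "pushout_seq \<A> \<C> g u u''" "pushout_seq \<A> \<C> g v v''" for u'' v''
    proof (rule po[OF u _ that(1)])
      show "yext \<A> \<C> t X Y' v''" using pushout_seq_yext[OF that(2) v] g by simp
      then have "chain_map \<A> u v'' (g \<cdot> ide \<A> Y) (ide \<A> X \<cdot> ide \<A> X)"
        using yext_chain_map_cmp[OF u v _ uv pushout_seq_chain_map[OF that(2) v]] by blast
      then show "chain_map \<A> u v'' g (ide \<A> X)" using g Y' by simp
    qed
    then show "?P u \<longleftrightarrow> ?P v"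
      using u'(1) v'(1) yequiv_trans[OF yequiv_sym[of u' _ \<A> \<C>]] yequiv_trans[of _ v' \<A> \<C> s1] by blast
  qed
  moreover have "\<exists>s'. pushout_seq \<A> \<C> g s s'" using pushout_seq_exists[OF s g Y'(1)] by blast
  ultimately have "{w. \<exists>u\<in>yequiv \<A> \<C> `` {s}. \<exists>v. pushout_seq \<A> \<C> g u v \<and> (v, w) \<in> yequiv \<A> \<C>} = yequiv \<A> \<C> `` {s1}"
    using yequiv_refl[of s \<A> \<C>] yequiv_trans[OF yequiv_sym[of _ s1 \<A> \<C>]] yequiv_trans[of _ s1 \<A> \<C>] by blast
  then show ?thesis by (simp add: ycls_def)
qed

section \<open>Pull-back of sequences\<close>

lemma pullback_seq_yext:
  assumes "pullback_seq \<A> \<C> s h s'" "yext \<A> \<C> t X Y s"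
  shows "yext \<A> \<C> t (src \<A> h) Y s'"
proof -
  obtain r d p d' p' u where s: "s = r @ [d, p]" "s' = r @ [d', p']" "pullback_square \<A> p h u p'"
    "d' \<in> Hom \<A> (src \<A> d) (src \<A> u)"
    using assms(1) unfolding pullback_seq_def by blast
  obtain t' X' Y' where y': "yext \<A> \<C> t' X' Y' s'" using assms(1) unfolding pullback_seq_def by blast
  have "t' = t" using yext_length[OF y'] yext_length[OF assms(2)] s by simp
  moreover have "X' = src \<A> h" using yext_src_tgt[OF y'] s pullback_squareD[OF s(3)] by simp
  moreover have "Y' = Y" using yext_src_tgt[OF y'] yext_src_tgt[OF assms(2)] s by (cases r) auto
  ultimately show ?thesis using y' by simp
qed

text \<open>The conflation to be pulled back sits at the inner end of the inductive structure of
  \<open>yext\<close>, hence an induction where the push-out got by with a case distinction.\<close>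

lemma pullback_seq_exists:
  assumes "yext \<A> \<C> t X Y s" "h \<in> Hom \<A> X' X" "X' \<in> \<C>"
  shows "\<exists>s'. pullback_seq \<A> \<C> s h s' \<and> yext \<A> \<C> t X' Y s'"
  using assms
proof (induction rule: yext.induct)
  case (conflation i p)
  then have h: "h \<in> arr \<A>" "tgt \<A> h = tgt \<A> p" "src \<A> h = X'" "src \<A> h \<in> \<C>" by simp_all
  note c = conflationD[OF conflation(1)]
  obtain i' p' u where c': "conflation \<A> \<C> i' p'" "pullback_square \<A> p h u p'" "u \<cdot> i' = i" "src \<A> i' = src \<A> i"
    using pullback_conflation[OF conflation(1) h(1,2,4)] by metis
  note d = conflationD[OF c'(1)] pullback_squareD[OF c'(2)]
  have y: "yext \<A> \<C> (Suc 0) X' (src \<A> i) [i', p']" using yext.conflation[OF c'(1)] c'(4) d h by simp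
  have "pullback_seq \<A> \<C> [i, p] h [i', p']"
    unfolding pullback_seq_def
  proof (intro conjI exI)
    show "[i, p] = [] @ [i, p]" "[i', p'] = [] @ [i', p']" "pullback_square \<A> p h u p'" "u \<cdot> i' = i"
      using c' by simp_all
    show "i' \<in> Hom \<A> (src \<A> i) (src \<A> u)" "p' \<cdot> i' = hzero \<A> (src \<A> i) (tgt \<A> p')" using c'(4) d by simp_all
  qed (rule y)
  then show ?case using y by blast
next
  case (splice i p t X j s)
  note c = conflationD[OF splice(1)]
  obtain s' where s': "pullback_seq \<A> \<C> (j # s) h s'" "yext \<A> \<C> t X' (tgt \<A> p) s'" using splice by blast
  obtain r d q d' q' u where r: "j # s = r @ [d, q]" "s' = r @ [d', q']" "pullback_square \<A> q h u q'"
     "d' \<in> arr \<A>" "src \<A> d' = src \<A> d" "tgt \<A> d' = src \<A> u" "u \<cdot> d' = d" "q' \<cdot> d' = hzero \<A> (src \<A> d) (tgt \<A> q')"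
    using s'(1) unfolding pullback_seq_def by (auto simp del: cmp_assoc')
  note pb = pullback_squareD[OF r(3)]
  have j: "j \<in> arr \<A>" "src \<A> j = tgt \<A> p" using yext_front[OF splice(2)] by auto
  show ?case
  \<comment> \<open>If the tail is a single conflation, its inflation is a factor of the composite
    \<open>j \<cdot> p\<close>, which therefore changes as well; otherwise the change is confined to
    the end of the tail.\<close>
  proof (cases r)
    case Nil
    then have js: "j = d" "s = [q]" using r by simp_all
    have y: "yext \<A> \<C> (Suc t) X' (src \<A> i) (i # d' \<cdot> p # [q'])"
      by (rule yext.splice[OF splice(1)]) (use s' r Nil in simp)
    have "pullback_seq \<A> \<C> (i # j \<cdot> p # s) h (i # d' \<cdot> p # [q'])"
      unfolding pullback_seq_def
    proof (intro conjI exI)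
      show "i # j \<cdot> p # s = [i] @ [j \<cdot> p, q]" "i # d' \<cdot> p # [q'] = [i] @ [d' \<cdot> p, q']"
        "pullback_square \<A> q h u q'" using js r by simp_all
      show "d' \<cdot> p \<in> Hom \<A> (src \<A> (j \<cdot> p)) (src \<A> u)" "u \<cdot> (d' \<cdot> p) = j \<cdot> p"
        "q' \<cdot> (d' \<cdot> p) = hzero \<A> (src \<A> (j \<cdot> p)) (tgt \<A> q')"
        using r(4-8) pb c j js by (simp_all add: cmp_reassoc[OF r(7)] cmp_reassoc[OF r(8)])
    qed (rule y)
    then show ?thesis using y by blast
  next
    case (Cons x r')
    then have js: "x = j" "s = r' @ [d, q]" "s' = j # r' @ [d', q']" using r by simp_all
    have y: "yext \<A> \<C> (Suc t) X' (src \<A> i) (i # j \<cdot> p # r' @ [d', q'])"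
      by (rule yext.splice[OF splice(1)]) (use s' js in simp)
    have "pullback_seq \<A> \<C> (i # j \<cdot> p # s) h (i # j \<cdot> p # r' @ [d', q'])"
      unfolding pullback_seq_def
    proof (intro conjI exI)
      show "i # j \<cdot> p # s = (i # j \<cdot> p # r') @ [d, q]" "i # j \<cdot> p # r' @ [d', q'] = (i # j \<cdot> p # r') @ [d', q']"
        "pullback_square \<A> q h u q'" using js r by simp_all
      show "d' \<in> Hom \<A> (src \<A> d) (src \<A> u)" "u \<cdot> d' = d" "q' \<cdot> d' = hzero \<A> (src \<A> d) (tgt \<A> q')"
        using r by simp_all
    qed (rule y)
    then show ?thesis using y by blast
  qed
qed

lemma pullback_seq_chain_map:
  assumes "pullback_seq \<A> \<C> s h s'" "yext \<A> \<C> t X Y s"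
  shows "chain_map \<A> s' s (ide \<A> Y) h"
proof -
  obtain r d p d' p' u where s: "s = r @ [d, p]" "s' = r @ [d', p']" "pullback_square \<A> p h u p'"
     "d' \<in> arr \<A>" "src \<A> d' = src \<A> d" "tgt \<A> d' = src \<A> u" "u \<cdot> d' = d" "p' \<cdot> d' = hzero \<A> (src \<A> d) (tgt \<A> p')"
    using assms(1) unfolding pullback_seq_def by (auto simp del: cmp_assoc')
  note pb = pullback_squareD[OF s(3)]
  have "chain_map \<A> (r @ [d]) (r @ [d]) (ide \<A> Y) (ide \<A> (tgt \<A> d))"
  proof -
    have "path (r @ [d])"
      using yext_path[OF assms(2)] unfolding s(1)
    proof (induction r)
      case (Cons a r)
      then show ?case by (cases r) auto
    qed simp
    then have "chain_map \<A> (r @ [d]) (r @ [d]) (ide \<A> (src \<A> (hd (r @ [d])))) (ide \<A> (tgt \<A> (last (r @ [d]))))"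
      by (rule chain_map_refl) simp
    moreover have "src \<A> (hd (r @ [d])) = Y" using yext_src_tgt[OF assms(2)] s by (cases r) auto
    ultimately show ?thesis by simp
  qed
  then obtain c where c: "chain_map \<A> r r (ide \<A> Y) c" "c \<in> Hom \<A> (src \<A> d) (src \<A> d)" "ide \<A> (tgt \<A> d) \<cdot> d = d \<cdot> c"
    unfolding chain_map_snoc by blast
  have d: "d \<in> arr \<A>" "p \<in> arr \<A>" "src \<A> p = tgt \<A> d" "p \<cdot> d = hzero \<A> (src \<A> d) (tgt \<A> p)"
    using yext_back[OF assms(2)] s by auto
  have "chain_map \<A> (r @ [d']) (r @ [d]) (ide \<A> Y) u"
    unfolding chain_map_snoc by (intro exI[of _ c] conjI c(1)) (use c s(4-8) pb d in simp_all)
  then have "chain_map \<A> ((r @ [d']) @ [p']) ((r @ [d]) @ [p]) (ide \<A> Y) h"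
    unfolding chain_map_snoc[of _ "r @ [d']"] by (intro exI[of _ u] conjI) (use pb in simp_all)
  then show ?thesis by (simp add: s)
qed

lemma pullback_seq_factor:
  assumes "pullback_seq \<A> \<C> s h s'" "yext \<A> \<C> t X Y s" "yext \<A> \<C> t1 X1 Y1 s1" "chain_map \<A> s1 s a h"
  shows "chain_map \<A> s1 s' a (ide \<A> (src \<A> h))"
proof -
  obtain r d p d' p' u where s: "s = r @ [d, p]" "s' = r @ [d', p']" "pullback_square \<A> p h u p'"
     "d' \<in> arr \<A>" "src \<A> d' = src \<A> d" "tgt \<A> d' = src \<A> u" "u \<cdot> d' = d" "p' \<cdot> d' = hzero \<A> (src \<A> d) (tgt \<A> p')"
    using assms(1) unfolding pullback_seq_def by (auto simp del: cmp_assoc')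
  note pb = pullback_squareD[OF s(3)]
  have d: "d \<in> arr \<A>" "src \<A> p = tgt \<A> d" using yext_back[OF assms(2)] s by auto
  obtain r1 d1 p1 where s1: "s1 = r1 @ [d1, p1]" "d1 \<in> arr \<A>" "p1 \<in> arr \<A>" "src \<A> p1 = tgt \<A> d1"
    "p1 \<cdot> d1 = hzero \<A> (src \<A> d1) (tgt \<A> p1)" using yext_back[OF assms(3)] by auto
  have "chain_map \<A> ((r1 @ [d1]) @ [p1]) ((r @ [d]) @ [p]) a h" using assms(4) s s1 by simp
  then obtain x y where x: "x \<in> arr \<A>" "src \<A> x = tgt \<A> d1" "tgt \<A> x = tgt \<A> d" "h \<cdot> p1 = p \<cdot> x" "tgt \<A> p1 = src \<A> h"
    and y: "y \<in> arr \<A>" "src \<A> y = src \<A> d1" "tgt \<A> y = src \<A> d" "x \<cdot> d1 = d \<cdot> y" "chain_map \<A> r1 r a y"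
    unfolding chain_map_snoc using s1 d by auto
  obtain w where w: "w \<in> arr \<A>" "tgt \<A> w = src \<A> u" "src \<A> w = tgt \<A> d1" "u \<cdot> w = x" "p' \<cdot> w = p1"
    using pullback_lift[OF s(3), of x p1] x s1 d by auto
  have "d' \<cdot> y = w \<cdot> d1"
  proof (rule pullback_cancel[OF s(3)])
    show "u \<cdot> (d' \<cdot> y) = u \<cdot> (w \<cdot> d1)" "p' \<cdot> (d' \<cdot> y) = p' \<cdot> (w \<cdot> d1)"
      using s(4-8) y(1-4) w s1 pb x(5) d
      by (simp_all add: cmp_reassoc[OF w(4)] cmp_reassoc[OF w(5)] cmp_reassoc[OF s(7)] cmp_reassoc[OF s(8)])
  qed (use s(4-8) y(1-4) w s1 pb in simp_all)
  then have "chain_map \<A> (r1 @ [d1]) (r @ [d']) a w"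
    unfolding chain_map_snoc by (intro exI[of _ y] conjI y(5)) (use s(4-8) y(1-4) w s1 pb in simp_all)
  then have "chain_map \<A> ((r1 @ [d1]) @ [p1]) ((r @ [d']) @ [p']) a (ide \<A> (src \<A> h))"
    unfolding chain_map_snoc[of _ "r1 @ [d1]"] by (intro exI[of _ w] conjI) (use w s1 pb x in simp_all)
  then show ?thesis by (simp add: s s1)
qed

text \<open>Dual to \<open>push_ycls\<close>: the chain map factors through every pull-back sequence
  by an equivalence.\<close>

lemma pull_ycls:
  assumes s: "yext \<A> \<C> t X Y s" and s1: "yext \<A> \<C> t X' Y s1" and m: "chain_map \<A> s1 s (ide \<A> Y) h"
  shows "pull \<A> \<C> (ycls \<A> \<C> s) h = ycls \<A> \<C> s1"
proof -
  have h: "h \<in> Hom \<A> X' X" using chain_map_ends[OF s1 s m] by simp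
  have X': "X' \<in> \<C>" "Y \<in> \<C>" using yext_ends[OF s1] by simp_all
  have pb: "(w, v) \<in> yequiv \<A> \<C>" if u: "yext \<A> \<C> t X Y u" and w: "yext \<A> \<C> t X' Y w"
    and uv: "pullback_seq \<A> \<C> u h v" and uw: "chain_map \<A> w u (ide \<A> Y) h" for u v w
    using yequivI[OF w] pullback_seq_yext[OF uv u] pullback_seq_factor[OF uv u w uw] h by simp
  let ?P = "\<lambda>u. \<forall>v. pullback_seq \<A> \<C> u h v \<longrightarrow> (s1, v) \<in> yequiv \<A> \<C>"
  have "yext \<A> \<C> t X Y u \<and> ?P u" if "(s, u) \<in> yequiv \<A> \<C>" for u
  proof (rule yequiv_induct[OF that s])
    show "?P s" using pb[OF s s1 _ m] by blast
    fix u v assume u: "yext \<A> \<C> t X Y u" and v: "yext \<A> \<C> t X Y v" and uv: "chain_map \<A> u v (ide \<A> Y) (ide \<A> X)"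
    obtain u' where u': "pullback_seq \<A> \<C> u h u'" "yext \<A> \<C> t X' Y u'"
      using pullback_seq_exists[OF u] h X' by blast
    obtain v' where v': "pullback_seq \<A> \<C> v h v'" "yext \<A> \<C> t X' Y v'"
      using pullback_seq_exists[OF v] h X' by blast
    have "(u'', v'') \<in> yequiv \<A> \<C>" if "pullback_seq \<A> \<C> u h u''" "pullback_seq \<A> \<C> v h v''" for u'' v''
    proof (rule pb[OF v _ that(2)])
      show y: "yext \<A> \<C> t X' Y u''" using pullback_seq_yext[OF that(1) u] h by simp
      have X: "X \<in> \<C>" using yext_ends[OF u] by simp
      have "chain_map \<A> u'' v (ide \<A> Y \<cdot> ide \<A> Y) (ide \<A> X \<cdot> h)"
        using yext_chain_map_cmp[OF y u v pullback_seq_chain_map[OF that(1) u] uv] .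
      then show "chain_map \<A> u'' v (ide \<A> Y) h" using h X' X by simp
    qed
    then show "?P u \<longleftrightarrow> ?P v"
      using u'(1) v'(1) yequiv_trans[of s1 u' \<A> \<C>] yequiv_trans[OF _ yequiv_sym[of _ v' \<A> \<C>], of s1] by blast
  qed
  moreover have "\<exists>s'. pullback_seq \<A> \<C> s h s'" using pullback_seq_exists[OF s h X'(1)] by blast
  ultimately have "{w. \<exists>u\<in>yequiv \<A> \<C> `` {s}. \<exists>v. pullback_seq \<A> \<C> u h v \<and> (v, w) \<in> yequiv \<A> \<C>} = yequiv \<A> \<C> `` {s1}"
    using yequiv_refl[of s \<A> \<C>] yequiv_trans[of s1 _ \<A> \<C>] yequiv_trans[OF yequiv_sym[of s1 _ \<A> \<C>]] by blast
  then show ?thesis by (simp add: ycls_def)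
qed

end

section \<open>Operations on extensions\<close>

context exact_subcategory begin

abbreviation EXT :: "nat \<Rightarrow> 'a \<Rightarrow> 'a \<Rightarrow> 'b ext set" where "EXT \<equiv> Ext \<A> \<C>"
abbreviation psh :: "'b \<Rightarrow> 'b ext \<Rightarrow> 'b ext" where "psh \<equiv> push \<A> \<C>"
abbreviation pll :: "'b ext \<Rightarrow> 'b \<Rightarrow> 'b ext" where "pll \<equiv> pull \<A> \<C>"

lemma Ext_0: "EXT 0 X Y = Mor ` Hom \<A> X Y"
  by (simp add: Ext_def)

lemma Ext_cases [consumes 1, case_names Mor Cls]:
  assumes "\<gamma> \<in> EXT t X Y"
  obtains f where "t = 0" "\<gamma> = Mor f" "f \<in> arr \<A>" "src \<A> f = X" "tgt \<A> f = Y"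
  | s where "t > 0" "\<gamma> = ycls \<A> \<C> s" "yext \<A> \<C> t X Y s"
  using assms by (cases "t = 0") (auto simp: Ext_0 Ext_pos)

text \<open>The chain map factors through the pull-back of \<open>s'\<close> along \<open>b\<close>,
  leaving a chain map with ends \<open>a\<close> and the identity. This pull-back sequence thus
  represents both sides.\<close>

lemma push_eq_pull:
  assumes "yext \<A> \<C> t X Y s" "yext \<A> \<C> t X' Y' s'" "chain_map \<A> s s' a b"
  shows "psh a (ycls \<A> \<C> s) = pll (ycls \<A> \<C> s') b"
proof -
  have ab: "a \<in> Hom \<A> Y Y'" "b \<in> Hom \<A> X X'" using chain_map_ends[OF assms] by simp_all
  have "X \<in> \<C>" using yext_ends[OF assms(1)] by simp
  then obtain v where v: "pullback_seq \<A> \<C> s' b v" "yext \<A> \<C> t X Y' v"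
    using pullback_seq_exists[OF assms(2) ab(2)] by blast
  have "chain_map \<A> s v a (ide \<A> X)" using pullback_seq_factor[OF v(1) assms(2,1,3)] ab by simp
  then show ?thesis
    using push_ycls[OF assms(1) v(2)] pull_ycls[OF assms(2) v(2) pullback_seq_chain_map[OF v(1) assms(2)]] by simp
qed

lemma push_seqE:
  assumes "yext \<A> \<C> t X Y s" "g \<in> Hom \<A> Y Y'" "Y' \<in> \<C>"
  obtains s' where "yext \<A> \<C> t X Y' s'" "chain_map \<A> s s' g (ide \<A> X)" "psh g (ycls \<A> \<C> s) = ycls \<A> \<C> s'"
  using pushout_seq_exists[OF assms] pushout_seq_chain_map[OF _ assms(1)] push_ycls[OF assms(1)] by blast

lemma pull_seqE:
  assumes "yext \<A> \<C> t X Y s" "h \<in> Hom \<A> X' X" "X' \<in> \<C>"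
  obtains s' where "yext \<A> \<C> t X' Y s'" "chain_map \<A> s' s (ide \<A> Y) h" "pll (ycls \<A> \<C> s) h = ycls \<A> \<C> s'"
  using pullback_seq_exists[OF assms] pullback_seq_chain_map[OF _ assms(1)] pull_ycls[OF assms(1)] by blast

lemma push_closed:
  assumes "\<gamma> \<in> EXT t X Y" "g \<in> arr \<A>" "src \<A> g = Y" "tgt \<A> g \<in> \<C>"
  shows "psh g \<gamma> \<in> EXT t X (tgt \<A> g)"
  using assms(1)
proof (cases rule: Ext_cases)
  case (Mor f)
  then show ?thesis using assms by (simp add: Ext_0)
next
  case (Cls s)
  then obtain s' where "yext \<A> \<C> t X (tgt \<A> g) s'" "psh g \<gamma> = ycls \<A> \<C> s'"
    using push_seqE[of t X Y s g "tgt \<A> g"] assms by auto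
  then show ?thesis using Cls by (auto simp: Ext_pos)
qed

lemma pull_closed:
  assumes "\<gamma> \<in> EXT t X Y" "h \<in> arr \<A>" "tgt \<A> h = X" "src \<A> h \<in> \<C>"
  shows "pll \<gamma> h \<in> EXT t (src \<A> h) Y"
  using assms(1)
proof (cases rule: Ext_cases)
  case (Mor f)
  then show ?thesis using assms by (simp add: Ext_0)
next
  case (Cls s)
  then obtain s' where "yext \<A> \<C> t (src \<A> h) Y s'" "pll \<gamma> h = ycls \<A> \<C> s'"
    using pull_seqE[of t X Y s h "src \<A> h"] assms by auto
  then show ?thesis using Cls by (auto simp: Ext_pos)
qed

lemma push_ide:
  assumes "\<gamma> \<in> EXT t X Y" shows "psh (ide \<A> Y) \<gamma> = \<gamma>"
  using assms
proof (cases rule: Ext_cases)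
  case (Cls s)
  then show ?thesis using push_ycls[OF Cls(3,3) yext_chain_map_refl[OF Cls(3)]] by simp
qed auto

lemma pull_ide:
  assumes "\<gamma> \<in> EXT t X Y" shows "pll \<gamma> (ide \<A> X) = \<gamma>"
  using assms
proof (cases rule: Ext_cases)
  case (Cls s)
  then show ?thesis using pull_ycls[OF Cls(3,3) yext_chain_map_refl[OF Cls(3)]] by simp
qed auto

lemma push_push:
  assumes "\<gamma> \<in> EXT t X Y" "g \<in> arr \<A>" "src \<A> g = Y" "g' \<in> arr \<A>" "src \<A> g' = tgt \<A> g" "tgt \<A> g \<in> \<C>" "tgt \<A> g' \<in> \<C>"
  shows "psh g' (psh g \<gamma>) = psh (g' \<cdot> g) \<gamma>"
  using assms(1)
proof (cases rule: Ext_cases)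
  case (Cls s)
  have X: "X \<in> \<C>" using yext_ends[OF Cls(3)] by simp
  obtain s' where s': "yext \<A> \<C> t X (tgt \<A> g) s'" "chain_map \<A> s s' g (ide \<A> X)" "psh g (ycls \<A> \<C> s) = ycls \<A> \<C> s'"
    by (rule push_seqE[OF Cls(3), of g "tgt \<A> g"]) (use assms in simp_all)
  obtain s'' where s'': "yext \<A> \<C> t X (tgt \<A> g') s''" "chain_map \<A> s' s'' g' (ide \<A> X)" "psh g' (ycls \<A> \<C> s') = ycls \<A> \<C> s''"
    by (rule push_seqE[OF s'(1), of g' "tgt \<A> g'"]) (use assms in simp_all)
  have "chain_map \<A> s s'' (g' \<cdot> g) (ide \<A> X)"
    using yext_chain_map_cmp[OF Cls(3) s'(1) s''(1) s'(2) s''(2)] X by simp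
  then show ?thesis using push_ycls[OF Cls(3) s''(1)] s' s'' Cls by simp
qed (use assms in simp)

lemma pull_pull:
  assumes "\<gamma> \<in> EXT t X Y" "h \<in> arr \<A>" "tgt \<A> h = X" "h' \<in> arr \<A>" "tgt \<A> h' = src \<A> h" "src \<A> h \<in> \<C>" "src \<A> h' \<in> \<C>"
  shows "pll (pll \<gamma> h) h' = pll \<gamma> (h \<cdot> h')"
  using assms(1)
proof (cases rule: Ext_cases)
  case (Cls s)
  have Y: "Y \<in> \<C>" using yext_ends[OF Cls(3)] by simp
  obtain s' where s': "yext \<A> \<C> t (src \<A> h) Y s'" "chain_map \<A> s' s (ide \<A> Y) h" "pll (ycls \<A> \<C> s) h = ycls \<A> \<C> s'"
    by (rule pull_seqE[OF Cls(3), of h "src \<A> h"]) (use assms in simp_all)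
  obtain s'' where s'': "yext \<A> \<C> t (src \<A> h') Y s''" "chain_map \<A> s'' s' (ide \<A> Y) h'" "pll (ycls \<A> \<C> s') h' = ycls \<A> \<C> s''"
    by (rule pull_seqE[OF s'(1), of h' "src \<A> h'"]) (use assms in simp_all)
  have "chain_map \<A> s'' s (ide \<A> Y) (h \<cdot> h')"
    using yext_chain_map_cmp[OF s''(1) s'(1) Cls(3) s''(2) s'(2)] Y by simp
  then show ?thesis using pull_ycls[OF Cls(3) s''(1)] s' s'' Cls by simp
qed (use assms in simp)

text \<open>The chain maps that define the two operations compose to one with ends \<open>g\<close>
  and \<open>h\<close>, to which \<open>push_eq_pull\<close> applies.\<close>

lemma push_pull:
  assumes "\<gamma> \<in> EXT t X Y" "g \<in> arr \<A>" "src \<A> g = Y" "tgt \<A> g \<in> \<C>" "h \<in> arr \<A>" "tgt \<A> h = X" "src \<A> h \<in> \<C>"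
  shows "psh g (pll \<gamma> h) = pll (psh g \<gamma>) h"
  using assms(1)
proof (cases rule: Ext_cases)
  case (Cls s)
  have Y: "Y \<in> \<C>" "X \<in> \<C>" using yext_ends[OF Cls(3)] by simp_all
  obtain s' where s': "yext \<A> \<C> t (src \<A> h) Y s'" "chain_map \<A> s' s (ide \<A> Y) h" "pll (ycls \<A> \<C> s) h = ycls \<A> \<C> s'"
    by (rule pull_seqE[OF Cls(3), of h "src \<A> h"]) (use assms in simp_all)
  obtain s'' where s'': "yext \<A> \<C> t X (tgt \<A> g) s''" "chain_map \<A> s s'' g (ide \<A> X)" "psh g (ycls \<A> \<C> s) = ycls \<A> \<C> s''"
    by (rule push_seqE[OF Cls(3), of g "tgt \<A> g"]) (use assms in simp_all)
  have "chain_map \<A> s' s'' g h"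
    using yext_chain_map_cmp[OF s'(1) Cls(3) s''(1) s'(2) s''(2)] Y assms by simp
  then show ?thesis using push_eq_pull[OF s'(1) s''(1)] s' s'' Cls by simp
qed (use assms in simp)

text \<open>\<open>con i p \<gamma>\<close> is the Yoneda product of the conflation \<open>(i, p)\<close> with \<open>\<gamma>\<close>, that is, the connecting
  morphism of \<open>(i, p)\<close>.\<close>

fun con :: "'b \<Rightarrow> 'b \<Rightarrow> 'b ext \<Rightarrow> 'b ext" where
  "con i p (Mor g) = pll (ycls \<A> \<C> [i, p]) g"
| "con i p (Cls S) = Cls {w. \<exists>s\<in>S. (i # hd s \<cdot> p # tl s, w) \<in> yequiv \<A> \<C>}"

definition conf_map :: "'b \<Rightarrow> 'b \<Rightarrow> 'b \<Rightarrow> 'b \<Rightarrow> 'b \<Rightarrow> 'b \<Rightarrow> 'b \<Rightarrow> bool" where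
  "conf_map i p j q a b c \<longleftrightarrow> conflation \<A> \<C> i p \<and> conflation \<A> \<C> j q \<and> a \<in> Hom \<A> (src \<A> i) (src \<A> j) \<and>
     b \<in> Hom \<A> (tgt \<A> i) (tgt \<A> j) \<and> c \<in> Hom \<A> (tgt \<A> p) (tgt \<A> q) \<and> b \<cdot> i = j \<cdot> a \<and> c \<cdot> p = q \<cdot> b"

lemma conf_mapD:
  assumes "conf_map i p j q a b c"
  shows "conflation \<A> \<C> i p" "conflation \<A> \<C> j q" "a \<in> arr \<A>" "src \<A> a = src \<A> i" "tgt \<A> a = src \<A> j"
    "b \<in> arr \<A>" "src \<A> b = tgt \<A> i" "tgt \<A> b = tgt \<A> j" "c \<in> arr \<A>" "src \<A> c = tgt \<A> p" "tgt \<A> c = tgt \<A> q"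
    "b \<cdot> i = j \<cdot> a" "c \<cdot> p = q \<cdot> b"
  using assms by (simp_all add: conf_map_def)

lemma conf_map_chain_map:
  assumes "conf_map i p j q a b c"
  shows "chain_map \<A> [i, p] [j, q] a c"
proof -
  note d = conf_mapD[OF assms]
  note e = conflationD[OF d(1)] conflationD[OF d(2)]
  show ?thesis using d(3-) e by auto
qed

lemma yext_splice:
  assumes "conflation \<A> \<C> i p" "yext \<A> \<C> t X (tgt \<A> p) s"
  shows "yext \<A> \<C> (Suc t) X (src \<A> i) (i # hd s \<cdot> p # tl s)"
proof -
  obtain j r where "s = j # r" using yext_front[OF assms(2)] by auto
  then show ?thesis using yext.splice[OF assms(1)] assms(2) by simp
qed

lemma chain_map_splice:
  assumes m: "conf_map i p j q a b c" and s: "yext \<A> \<C> t X (tgt \<A> p) s" and s': "yext \<A> \<C> t X' (tgt \<A> q) s'"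
    and "chain_map \<A> s s' c d"
  shows "chain_map \<A> (i # hd s \<cdot> p # tl s) (j # hd s' \<cdot> q # tl s') a d"
proof -
  note d = conf_mapD[OF m]
  note e = conflationD[OF d(1)] conflationD[OF d(2)]
  obtain k r where k: "s = k # r" "k \<in> arr \<A>" "src \<A> k = tgt \<A> p" using yext_front[OF s] by auto
  obtain k' r' where k': "s' = k' # r'" "k' \<in> arr \<A>" "src \<A> k' = tgt \<A> q" using yext_front[OF s'] by auto
  obtain x where x: "x \<in> arr \<A>" "src \<A> x = tgt \<A> k" "tgt \<A> x = tgt \<A> k'" "x \<cdot> k = k' \<cdot> c" "chain_map \<A> r r' x d"
    using assms(4) k k' by auto
  have "x \<cdot> (k \<cdot> p) = k' \<cdot> (c \<cdot> p)" by (rule cmp_reassoc2[OF x(4)]) (use x k k' d e in simp_all)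
  then have "x \<cdot> (k \<cdot> p) = k' \<cdot> q \<cdot> b" using d e k k' by simp
  then show ?thesis
    unfolding k(1) k'(1) list.sel chain_map.simps
    by (intro conjI exI[of _ b] exI[of _ x] x(5)) (use x(1-3) k k' d e in simp_all)
qed

lemma conf_map_ide: "conflation \<A> \<C> i p \<Longrightarrow> conf_map i p i p (ide \<A> (src \<A> i)) (ide \<A> (tgt \<A> i)) (ide \<A> (tgt \<A> p))"
  unfolding conf_map_def using conflationD[of i p] by simp

text \<open>A chain map with identity ends is prolonged by the identity of \<open>(i, p)\<close>, so
  splicing respects zigzags.\<close>

lemma con_ycls:
  assumes ip: "conflation \<A> \<C> i p" and s: "yext \<A> \<C> t X (tgt \<A> p) s"
  shows "con i p (ycls \<A> \<C> s) = ycls \<A> \<C> (i # hd s \<cdot> p # tl s)"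
proof -
  let ?f = "\<lambda>s. i # hd s \<cdot> p # tl s"
  have "yext \<A> \<C> t X (tgt \<A> p) u \<and> (?f s, ?f u) \<in> yequiv \<A> \<C>" if "(s, u) \<in> yequiv \<A> \<C>" for u
  proof (rule yequiv_induct[OF that s])
    fix u v assume u: "yext \<A> \<C> t X (tgt \<A> p) u" and v: "yext \<A> \<C> t X (tgt \<A> p) v"
      and uv: "chain_map \<A> u v (ide \<A> (tgt \<A> p)) (ide \<A> X)"
    have "(?f u, ?f v) \<in> yequiv \<A> \<C>"
      by (rule yequivI[OF yext_splice[OF ip u] yext_splice[OF ip v] chain_map_splice[OF conf_map_ide[OF ip] u v uv]])
    then show "(?f s, ?f u) \<in> yequiv \<A> \<C> \<longleftrightarrow> (?f s, ?f v) \<in> yequiv \<A> \<C>"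
      using yequiv_trans yequiv_sym by blast
  qed (rule yequiv_refl)
  then have "{w. \<exists>u\<in>yequiv \<A> \<C> `` {s}. (?f u, w) \<in> yequiv \<A> \<C>} = yequiv \<A> \<C> `` {?f s}"
    using yequiv_refl[of s \<A> \<C>] yequiv_trans[of "?f s" _ \<A> \<C>] by blast
  then show ?thesis by (simp add: ycls_def)
qed

lemma yext_conflation: "conflation \<A> \<C> i p \<Longrightarrow> yext \<A> \<C> (Suc 0) (tgt \<A> p) (src \<A> i) [i, p]"
  by (rule yext.conflation)

lemma con_closed:
  assumes ip: "conflation \<A> \<C> i p" and g: "\<gamma> \<in> EXT t X (tgt \<A> p)" and X: "X \<in> \<C>"
  shows "con i p \<gamma> \<in> EXT (Suc t) X (src \<A> i)"
  using g
proof (cases rule: Ext_cases)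
  case (Mor f)
  have "ycls \<A> \<C> [i, p] \<in> EXT (Suc 0) (tgt \<A> p) (src \<A> i)"
    using yext_conflation[OF ip] by (auto simp: Ext_pos)
  then have "pll (ycls \<A> \<C> [i, p]) f \<in> EXT (Suc 0) (src \<A> f) (src \<A> i)"
    by (rule pull_closed) (use Mor X in simp_all)
  then show ?thesis using Mor by simp
next
  case (Cls s)
  then show ?thesis using con_ycls[OF ip Cls(3)] yext_splice[OF ip Cls(3)] by (auto simp: Ext_pos)
qed

lemma con_pull:
  assumes ip: "conflation \<A> \<C> i p" and g: "\<gamma> \<in> EXT t X (tgt \<A> p)" and X: "X \<in> \<C>"
    and h: "h \<in> arr \<A>" "tgt \<A> h = X" "src \<A> h \<in> \<C>"
  shows "pll (con i p \<gamma>) h = con i p (pll \<gamma> h)"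
  using g
proof (cases rule: Ext_cases)
  case (Mor f)
  have "ycls \<A> \<C> [i, p] \<in> EXT (Suc 0) (tgt \<A> p) (src \<A> i)"
    using yext_conflation[OF ip] by (auto simp: Ext_pos)
  then show ?thesis using Mor h X by (simp add: pull_pull)
next
  case (Cls s)
  obtain s' where s': "yext \<A> \<C> t (src \<A> h) (tgt \<A> p) s'" "chain_map \<A> s' s (ide \<A> (tgt \<A> p)) h" "pll (ycls \<A> \<C> s) h = ycls \<A> \<C> s'"
    by (rule pull_seqE[OF Cls(3), of h "src \<A> h"]) (use h in simp_all)
  show ?thesis
    using pull_ycls[OF yext_splice[OF ip Cls(3)] yext_splice[OF ip s'(1)] chain_map_splice[OF conf_map_ide[OF ip] s'(1) Cls(3) s'(2)]]
      Cls s' con_ycls[OF ip] by simp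
qed

text \<open>In degree 0 the two conflations are compared by \<open>push_eq_pull\<close>; in positive
  degree the morphism of conflations is prolonged by the chain map that represents the push-out
  along \<open>c\<close>.\<close>

lemma con_natural:
  assumes m: "conf_map i p j q a b c" and g: "\<gamma> \<in> EXT t X (tgt \<A> p)" and X: "X \<in> \<C>"
  shows "psh a (con i p \<gamma>) = con j q (psh c \<gamma>)"
proof -
  note d = conf_mapD[OF m]
  note e = conflationD[OF d(1)] conflationD[OF d(2)]
  have y: "ycls \<A> \<C> [i, p] \<in> EXT (Suc 0) (tgt \<A> p) (src \<A> i)" "ycls \<A> \<C> [j, q] \<in> EXT (Suc 0) (tgt \<A> q) (src \<A> j)"
    using yext_conflation d(1,2) by (auto simp: Ext_pos)
  show ?thesis using g
  proof (cases rule: Ext_cases)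
    case (Mor f)
    have "psh a (pll (ycls \<A> \<C> [i, p]) f) = pll (psh a (ycls \<A> \<C> [i, p])) f"
      by (rule push_pull[OF y(1)]) (use d e Mor X in simp_all)
    also have "\<dots> = pll (pll (ycls \<A> \<C> [j, q]) c) f"
      using push_eq_pull[OF yext_conflation[OF d(1)] yext_conflation[OF d(2)] conf_map_chain_map[OF m]] by simp
    also have "\<dots> = pll (ycls \<A> \<C> [j, q]) (c \<cdot> f)"
      by (rule pull_pull[OF y(2)]) (use d e Mor X in simp_all)
    finally show ?thesis using Mor by simp
  next
    case (Cls s)
    obtain s' where s': "yext \<A> \<C> t X (tgt \<A> q) s'" "chain_map \<A> s s' c (ide \<A> X)" "psh c (ycls \<A> \<C> s) = ycls \<A> \<C> s'"
      by (rule push_seqE[OF Cls(3), of c "tgt \<A> q"]) (use d e in simp_all)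
    show ?thesis
      using push_ycls[OF yext_splice[OF d(1) Cls(3)] yext_splice[OF d(2) s'(1)] chain_map_splice[OF m Cls(3) s'(1,2)]]
        Cls s' con_ycls[OF d(1)] con_ycls[OF d(2)] by simp
  qed
qed

text \<open>\<open>decomp s i p \<gamma>\<close>: the sequence \<open>s\<close> is spliced from its first conflation \<open>(i, p)\<close> and \<open>\<gamma>\<close>.\<close>

definition decomp :: "'b list \<Rightarrow> 'b \<Rightarrow> 'b \<Rightarrow> 'b ext \<Rightarrow> bool" where
  "decomp s i p \<gamma> \<longleftrightarrow> conflation \<A> \<C> i p \<and> (s = [i, p] \<and> \<gamma> = Mor (ide \<A> (tgt \<A> p)) \<or>
     (\<exists>j r t X. s = i # j \<cdot> p # r \<and> yext \<A> \<C> t X (tgt \<A> p) (j # r) \<and> \<gamma> = ycls \<A> \<C> (j # r)))"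

lemma decomp_exists:
  assumes "yext \<A> \<C> (Suc t) X Y s"
  shows "\<exists>i p \<gamma>. decomp s i p \<gamma>"
  using assms by (cases rule: yext.cases) (auto simp: decomp_def, blast)

lemma decompD:
  assumes "yext \<A> \<C> (Suc t) X Y s" "decomp s i p \<gamma>"
  shows "conflation \<A> \<C> i p" "src \<A> i = Y" "\<gamma> \<in> EXT t X (tgt \<A> p)" "ycls \<A> \<C> s = con i p \<gamma>"
proof -
  show ip: "conflation \<A> \<C> i p" using assms(2) by (simp add: decomp_def)
  note c = conflationD[OF ip]
  have "src \<A> i = Y \<and> \<gamma> \<in> EXT t X (tgt \<A> p) \<and> ycls \<A> \<C> s = con i p \<gamma>"
    using assms(2) unfolding decomp_def
  proof (elim conjE disjE exE)
    assume s: "s = [i, p]" and g: "\<gamma> = Mor (ide \<A> (tgt \<A> p))"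
    have y: "yext \<A> \<C> (Suc 0) (tgt \<A> p) (src \<A> i) s" using yext_conflation[OF ip] s by simp
    have "ycls \<A> \<C> s \<in> EXT (Suc 0) (tgt \<A> p) (src \<A> i)" using y by (auto simp: Ext_pos)
    then show ?thesis using yext_unique[OF assms(1) y] g s c by (auto simp: Ext_0 pull_ide)
  next
    fix j r t' X' assume s: "s = i # j \<cdot> p # r" and y: "yext \<A> \<C> t' X' (tgt \<A> p) (j # r)" and g: "\<gamma> = ycls \<A> \<C> (j # r)"
    have y': "yext \<A> \<C> (Suc t') X' (src \<A> i) s" using yext_splice[OF ip y] s by simp
    then show ?thesis using yext_unique[OF assms(1) y'] g s con_ycls[OF ip y] y yext_length[OF y]
      by (auto simp: Ext_pos)
  qed
  then show "src \<A> i = Y" "\<gamma> \<in> EXT t X (tgt \<A> p)" "ycls \<A> \<C> s = con i p \<gamma>" by simp_all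
qed

lemma con_surj:
  assumes "\<gamma> \<in> EXT (Suc t) X Y"
  obtains i p \<delta> where "conflation \<A> \<C> i p" "src \<A> i = Y" "\<delta> \<in> EXT t X (tgt \<A> p)" "\<gamma> = con i p \<delta>"
  using assms
proof (cases rule: Ext_cases)
  case (Cls s)
  then show thesis using decomp_exists[OF Cls(3)] decompD[OF Cls(3)] that by metis
qed simp

lemma decomp_0:
  assumes "yext \<A> \<C> (Suc 0) X Y s" "decomp s i p \<gamma>"
  shows "s = [i, p] \<and> \<gamma> = Mor (ide \<A> X) \<and> tgt \<A> p = X"
  using assms(2) unfolding decomp_def
proof (elim conjE disjE exE)
  assume s: "s = [i, p]" and g: "\<gamma> = Mor (ide \<A> (tgt \<A> p))"
  then show ?thesis using yext_src_tgt[OF assms(1)] by simp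
next
  fix j r t' X' assume "s = i # j \<cdot> p # r" "yext \<A> \<C> t' X' (tgt \<A> p) (j # r)"
  then show ?thesis using yext_length[OF assms(1)] by (auto dest!: yext_length)
qed

lemma decomp_Suc:
  assumes "yext \<A> \<C> (Suc t) X Y s" "t > 0" "decomp s i p \<gamma>"
  obtains j r where "s = i # j \<cdot> p # r" "yext \<A> \<C> t X (tgt \<A> p) (j # r)" "\<gamma> = ycls \<A> \<C> (j # r)"
  using assms(3) unfolding decomp_def
proof (elim conjE disjE exE)
  assume "s = [i, p]"
  then show thesis using yext_length[OF assms(1)] assms(2) by simp
next
  fix j r t' X' assume ip: "conflation \<A> \<C> i p" and s: "s = i # j \<cdot> p # r"
    and y: "yext \<A> \<C> t' X' (tgt \<A> p) (j # r)" and g: "\<gamma> = ycls \<A> \<C> (j # r)"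
  have y': "yext \<A> \<C> (Suc t') X' (src \<A> i) s" using yext_splice[OF ip y] s by simp
  have "t' = t" "X' = X" using yext_unique[OF assms(1) y'] by simp_all
  then show thesis using that s y g by blast
qed

text \<open>A chain map between spliced sequences knows only the composites of deflations with the
  next inflations. The component between the cokernels is induced from the first square, and
  cancelling the deflation \<open>p\<close> shows that it fits the remaining ones. In degree one the
  cokernel is \<open>X\<close> itself and the component is the identity.\<close>

lemma decomp_step:
  assumes s: "yext \<A> \<C> (Suc t) X Y s" and s': "yext \<A> \<C> (Suc t) X Y s'" and m: "chain_map \<A> s s' (ide \<A> Y) (ide \<A> X)"
    and d: "decomp s i p \<gamma>" and d': "decomp s' j q \<delta>"
  shows "\<exists>b c. conf_map i p j q (ide \<A> Y) b c \<and> psh c \<gamma> = \<delta>"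
proof -
  note D = decompD[OF s d] and D' = decompD[OF s' d']
  note c = conflationD[OF D(1)] conflationD[OF D'(1)]
  have YX: "Y \<in> \<C>" "X \<in> \<C>" using yext_ends[OF s] by simp_all
  have l: "length s = length s'" using m by (rule chain_map_length)
  show ?thesis
  proof (cases "t = 0")
    case True
    have *: "s = [i, p]" "\<gamma> = Mor (ide \<A> X)" "s' = [j, q]" "\<delta> = Mor (ide \<A> X)" "tgt \<A> p = X" "tgt \<A> q = X"
      using decomp_0[of X Y s i p \<gamma>] decomp_0[of X Y s' j q \<delta>] s s' d d' True by simp_all
    obtain b where "b \<in> arr \<A>" "src \<A> b = tgt \<A> i" "tgt \<A> b = tgt \<A> j" "b \<cdot> i = j" "p = q \<cdot> b"
      using m unfolding *(1,3) using c *(5,6) D(2) D'(2) YX by auto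
    then have "conf_map i p j q (ide \<A> Y) b (ide \<A> X)"
      unfolding conf_map_def using c *(5,6) D(1,2) D'(1,2) YX by simp
    then show ?thesis using * YX by (intro exI[of _ b] exI[of _ "ide \<A> X"]) simp
  next
    case False
    then obtain k r k' r' where k: "s = i # k \<cdot> p # r" "yext \<A> \<C> t X (tgt \<A> p) (k # r)" "\<gamma> = ycls \<A> \<C> (k # r)"
      and k': "s' = j # k' \<cdot> q # r'" "yext \<A> \<C> t X (tgt \<A> q) (k' # r')" "\<delta> = ycls \<A> \<C> (k' # r')"
      using decomp_Suc[OF s _ d] decomp_Suc[OF s' _ d'] by (metis gr0I)
    have kk: "k \<in> arr \<A>" "src \<A> k = tgt \<A> p" "k' \<in> arr \<A>" "src \<A> k' = tgt \<A> q"
      using yext_front[OF k(2)] yext_front[OF k'(2)] by auto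
    obtain b x where m': "b \<in> Hom \<A> (tgt \<A> i) (tgt \<A> j)" "b \<cdot> i = j \<cdot> ide \<A> Y"
      "x \<in> Hom \<A> (tgt \<A> (k \<cdot> p)) (tgt \<A> (k' \<cdot> q))" "x \<cdot> (k \<cdot> p) = k' \<cdot> q \<cdot> b"
      and x5: "chain_map \<A> r r' x (ide \<A> X)"
      using m[unfolded k(1) k'(1) chain_map.simps] by (elim conjE exE)
    have b: "b \<in> arr \<A>" "src \<A> b = tgt \<A> i" "tgt \<A> b = tgt \<A> j" "b \<cdot> i = j"
      using m'(1,2) c D'(2) YX by simp_all
    have x: "x \<in> arr \<A>" "src \<A> x = tgt \<A> k" "tgt \<A> x = tgt \<A> k'" "x \<cdot> (k \<cdot> p) = k' \<cdot> (q \<cdot> b)"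
      using m'(3,4) c kk b by simp_all
    have "q \<cdot> b \<cdot> i = hzero \<A> (src \<A> i) (tgt \<A> (q \<cdot> b))" using b c D D' by simp
    then obtain e where e: "e \<in> arr \<A>" "src \<A> e = tgt \<A> p" "tgt \<A> e = tgt \<A> q" "e \<cdot> p = q \<cdot> b"
      using conflation_desc[OF D(1), of "q \<cdot> b"] b c by auto
    have "x \<cdot> k = k' \<cdot> e"
      by (rule conflation_cancel(2)[OF D(1)]) (use x(1-4) kk e c in simp_all)
    then have "chain_map \<A> (k # r) (k' # r') e (ide \<A> X)"
      unfolding chain_map.simps by (intro conjI exI[of _ x] x5) (use x(1-3) kk e in simp_all)
    then have "psh e \<gamma> = \<delta>" using push_ycls[OF k(2) k'(2)] k k' by simp
    moreover have "conf_map i p j q (ide \<A> Y) b e"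
      using b e c D(1,2) D'(1,2) YX by (simp add: conf_map_def)
    ultimately show ?thesis by blast
  qed
qed

text \<open>The direct sum inside the definition of the Baer sum, isolated and extended to morphisms
  so that all degrees share one formula.\<close>

fun osum :: "'b ext \<Rightarrow> 'b ext \<Rightarrow> 'b ext" where
  "osum (Mor f) (Mor g) = Mor (dsum \<A> f g)"
| "osum (Cls S) (Cls T) = Cls {w. \<exists>s\<in>S. \<exists>s'\<in>T. (map2 (dsum \<A>) s s', w) \<in> yequiv \<A> \<C>}"
| "osum _ _ = undefined"

lemma chain_map_dsum:
  assumes "chain_map \<A> s u a b" "chain_map \<A> s' u' a' b'" "length s = length s'"
    "set s \<subseteq> arr \<A>" "set s' \<subseteq> arr \<A>" "set u \<subseteq> arr \<A>" "set u' \<subseteq> arr \<A>"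
  shows "chain_map \<A> (map2 (dsum \<A>) s s') (map2 (dsum \<A>) u u') (dsum \<A> a a') (dsum \<A> b b')"
  using assms
proof (induction s arbitrary: u s' u' a a')
  case Nil
  then show ?case by (cases u; cases s'; cases u') auto
next
  case (Cons x s)
  then obtain y t x' r y' t' where e: "u = y # t" "s' = x' # r" "u' = y' # t'"
    using chain_map_length[OF Cons.prems(1)] chain_map_length[OF Cons.prems(2)] by (cases u; cases s'; cases u') auto
  obtain c where c: "c \<in> Hom \<A> (tgt \<A> x) (tgt \<A> y)" "c \<cdot> x = y \<cdot> a" "chain_map \<A> s t c b" "a \<in> Hom \<A> (src \<A> x) (src \<A> y)"
    using Cons.prems(1) e by auto
  obtain c' where c': "c' \<in> Hom \<A> (tgt \<A> x') (tgt \<A> y')" "c' \<cdot> x' = y' \<cdot> a'" "chain_map \<A> r t' c' b'" "a' \<in> Hom \<A> (src \<A> x') (src \<A> y')"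
    using Cons.prems(2) e by auto
  have ar: "x \<in> arr \<A>" "y \<in> arr \<A>" "x' \<in> arr \<A>" "y' \<in> arr \<A>" using Cons.prems e by auto
  have "chain_map \<A> (map2 (dsum \<A>) s r) (map2 (dsum \<A>) t t') (dsum \<A> c c') (dsum \<A> b b')"
    by (rule Cons.IH[OF c(3) c'(3)]) (use Cons.prems e in auto)
  then show ?case using c(1,2,4) c'(1,2,4) ar by (auto simp: e intro!: exI[of _ "dsum \<A> c c'"])
qed

lemma yext_dsum:
  "\<lbrakk>yext \<A> \<C> t X Y s; yext \<A> \<C> t X' Y' s'\<rbrakk> \<Longrightarrow> yext \<A> \<C> t (bsum X X') (bsum Y Y') (map2 (dsum \<A>) s s')"
proof (induction arbitrary: X' Y' s' rule: yext.induct)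
  case (conflation i p)
  from conflation(2) show ?case
  proof (cases rule: yext.cases)
    case ip: (conflation i' p')
    note d = dsum_conflation[OF conflation(1) ip(4)]
    show ?thesis
      using yext_conflation[OF d] conflationD[OF conflation(1)] conflationD[OF ip(4)] ip by simp
  next
    case (splice i' p' j s)
    then show ?thesis by (auto dest: yext_length)
  qed
next
  case (splice i p t X j s)
  from splice(4) show ?case
  proof (cases rule: yext.cases)
    case (conflation i' p')
    then show ?thesis using splice(2) by (auto dest: yext_length)
  next
    case sp: (splice i' p' j' r')
    note d = dsum_conflation[OF splice(1) sp(3)]
    note c = conflationD[OF splice(1)] conflationD[OF sp(3)]
    have j: "j \<in> arr \<A>" "j' \<in> arr \<A>" "src \<A> j = tgt \<A> p" "src \<A> j' = tgt \<A> p'"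
      using yext_front[OF splice(2)] yext_front[OF sp(4)] by auto
    have "yext \<A> \<C> t (bsum X X') (tgt \<A> (dsum \<A> p p')) (dsum \<A> j j' # map2 (dsum \<A>) s r')"
      using splice(3)[of X' "tgt \<A> p'" "j' # r'"] sp c by simp
    from yext.splice[OF d this] show ?thesis using c j sp by simp
  qed
qed

text \<open>The zigzags in the two arguments are followed one at a time, with the identity chain map
  on the other argument.\<close>

lemma osum_ycls:
  assumes s: "yext \<A> \<C> t X Y s" and s': "yext \<A> \<C> t X' Y' s'"
  shows "osum (ycls \<A> \<C> s) (ycls \<A> \<C> s') = ycls \<A> \<C> (map2 (dsum \<A>) s s')"
proof -
  have XY: "X \<in> \<C>" "Y \<in> \<C>" "X' \<in> \<C>" "Y' \<in> \<C>" using yext_ends[OF s] yext_ends[OF s'] by simp_all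
  have e: "(map2 (dsum \<A>) u u', map2 (dsum \<A>) v v') \<in> yequiv \<A> \<C>"
    if "yext \<A> \<C> t X Y u" "yext \<A> \<C> t X' Y' u'" "yext \<A> \<C> t X Y v" "yext \<A> \<C> t X' Y' v'"
      "chain_map \<A> u v (ide \<A> Y) (ide \<A> X)" "chain_map \<A> u' v' (ide \<A> Y') (ide \<A> X')" for u u' v v'
  proof (rule yequivI[OF yext_dsum[OF that(1,2)] yext_dsum[OF that(3,4)]])
    have "chain_map \<A> (map2 (dsum \<A>) u u') (map2 (dsum \<A>) v v') (dsum \<A> (ide \<A> Y) (ide \<A> Y')) (dsum \<A> (ide \<A> X) (ide \<A> X'))"
      by (rule chain_map_dsum[OF that(5,6)]) (use yext_arr[OF that(1)] yext_arr[OF that(2)] yext_arr[OF that(3)] yext_arr[OF that(4)] yext_length[OF that(1)] yext_length[OF that(2)] in simp_all)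
    then show "chain_map \<A> (map2 (dsum \<A>) u u') (map2 (dsum \<A>) v v') (ide \<A> (bsum Y Y')) (ide \<A> (bsum X X'))"
      using XY by simp
  qed
  have 1: "yext \<A> \<C> t X Y u \<and> (map2 (dsum \<A>) s s', map2 (dsum \<A>) u s') \<in> yequiv \<A> \<C>" if "(s, u) \<in> yequiv \<A> \<C>" for u
  proof (rule yequiv_induct[OF that s])
    fix u v assume "yext \<A> \<C> t X Y u" "yext \<A> \<C> t X Y v" "chain_map \<A> u v (ide \<A> Y) (ide \<A> X)"
    then have "(map2 (dsum \<A>) u s', map2 (dsum \<A>) v s') \<in> yequiv \<A> \<C>"
      using e s' yext_chain_map_refl[OF s'] by blast
    then show "(map2 (dsum \<A>) s s', map2 (dsum \<A>) u s') \<in> yequiv \<A> \<C> \<longleftrightarrow> (map2 (dsum \<A>) s s', map2 (dsum \<A>) v s') \<in> yequiv \<A> \<C>"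
      using yequiv_trans yequiv_sym by blast
  qed (rule yequiv_refl)
  have 2: "(map2 (dsum \<A>) u s', map2 (dsum \<A>) u u') \<in> yequiv \<A> \<C>" if u: "yext \<A> \<C> t X Y u" and eq: "(s', u') \<in> yequiv \<A> \<C>" for u u'
  proof (rule yequiv_induct[OF eq s', THEN conjunct2])
    fix v w assume "yext \<A> \<C> t X' Y' v" "yext \<A> \<C> t X' Y' w" "chain_map \<A> v w (ide \<A> Y') (ide \<A> X')"
    then have "(map2 (dsum \<A>) u v, map2 (dsum \<A>) u w) \<in> yequiv \<A> \<C>"
      using e u yext_chain_map_refl[OF u] by blast
    then show "(map2 (dsum \<A>) u s', map2 (dsum \<A>) u v) \<in> yequiv \<A> \<C> \<longleftrightarrow> (map2 (dsum \<A>) u s', map2 (dsum \<A>) u w) \<in> yequiv \<A> \<C>"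
      using yequiv_trans yequiv_sym by blast
  qed (rule yequiv_refl)
  have "(map2 (dsum \<A>) s s', map2 (dsum \<A>) u u') \<in> yequiv \<A> \<C>" if "(s, u) \<in> yequiv \<A> \<C>" "(s', u') \<in> yequiv \<A> \<C>" for u u'
    using 1[OF that(1)] 2[OF _ that(2)] yequiv_trans by blast
  then have "{w. \<exists>u\<in>yequiv \<A> \<C> `` {s}. \<exists>u'\<in>yequiv \<A> \<C> `` {s'}. (map2 (dsum \<A>) u u', w) \<in> yequiv \<A> \<C>}
      = yequiv \<A> \<C> `` {map2 (dsum \<A>) s s'}"
    using yequiv_refl[of s \<A> \<C>] yequiv_refl[of s' \<A> \<C>] yequiv_trans[of "map2 (dsum \<A>) s s'" _ \<A> \<C>] by blast
  then show ?thesis by (simp add: ycls_def)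
qed

lemma osum_closed:
  assumes "\<gamma> \<in> EXT t X Y" "\<delta> \<in> EXT t X' Y'"
  shows "osum \<gamma> \<delta> \<in> EXT t (bsum X X') (bsum Y Y')"
  using assms(1)
proof (cases rule: Ext_cases)
  case (Mor f)
  then show ?thesis using assms(2) by (auto simp: Ext_0)
next
  case (Cls s)
  then obtain s' where "\<delta> = ycls \<A> \<C> s'" "yext \<A> \<C> t X' Y' s'" using assms(2) by (auto simp: Ext_pos)
  then show ?thesis using Cls osum_ycls[OF Cls(3)] yext_dsum[OF Cls(3)] by (auto simp: Ext_pos)
qed

lemma con_osum:
  assumes ip: "conflation \<A> \<C> i p" and jq: "conflation \<A> \<C> j q"
    and g: "\<gamma> \<in> EXT t X (tgt \<A> p)" and d: "\<delta> \<in> EXT t X' (tgt \<A> q)" and X: "X \<in> \<C>" "X' \<in> \<C>"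
  shows "con (dsum \<A> i j) (dsum \<A> p q) (osum \<gamma> \<delta>) = osum (con i p \<gamma>) (con j q \<delta>)"
proof -
  note c = conflationD[OF ip] conflationD[OF jq]
  note ds = dsum_conflation[OF ip jq]
  show ?thesis using g
  proof (cases rule: Ext_cases)
    case (Mor f)
    then obtain f' where f': "\<delta> = Mor f'" "f' \<in> arr \<A>" "src \<A> f' = X'" "tgt \<A> f' = tgt \<A> q"
      using d by (auto simp: Ext_0)
    obtain s where s: "yext \<A> \<C> (Suc 0) X (src \<A> i) s" "chain_map \<A> s [i, p] (ide \<A> (src \<A> i)) f" "pll (ycls \<A> \<C> [i, p]) f = ycls \<A> \<C> s"
      by (rule pull_seqE[OF yext_conflation[OF ip], of f X]) (use Mor X in simp_all)
    obtain s' where s': "yext \<A> \<C> (Suc 0) X' (src \<A> j) s'" "chain_map \<A> s' [j, q] (ide \<A> (src \<A> j)) f'" "pll (ycls \<A> \<C> [j, q]) f' = ycls \<A> \<C> s'"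
      by (rule pull_seqE[OF yext_conflation[OF jq], of f' X']) (use f' X in simp_all)
    have "chain_map \<A> (map2 (dsum \<A>) s s') (map2 (dsum \<A>) [i, p] [j, q]) (dsum \<A> (ide \<A> (src \<A> i)) (ide \<A> (src \<A> j))) (dsum \<A> f f')"
      by (rule chain_map_dsum[OF s(2) s'(2)])
        (use yext_arr[OF s(1)] yext_arr[OF s'(1)] yext_length[OF s(1)] yext_length[OF s'(1)] c in simp_all)
    then have m: "chain_map \<A> (map2 (dsum \<A>) s s') [dsum \<A> i j, dsum \<A> p q] (ide \<A> (bsum (src \<A> i) (src \<A> j))) (dsum \<A> f f')"
      using c by (simp del: chain_map.simps)
    have "pll (ycls \<A> \<C> [dsum \<A> i j, dsum \<A> p q]) (dsum \<A> f f') = ycls \<A> \<C> (map2 (dsum \<A>) s s')"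
      by (rule pull_ycls[of "Suc 0" "tgt \<A> (dsum \<A> p q)" "src \<A> (dsum \<A> i j)"])
        (use yext_conflation[OF ds] yext_dsum[OF s(1) s'(1)] m c in simp_all)
    then show ?thesis using Mor f' s s' osum_ycls[OF s(1) s'(1)] by simp
  next
    case (Cls s)
    then obtain s' where s': "\<delta> = ycls \<A> \<C> s'" "yext \<A> \<C> t X' (tgt \<A> q) s'" using d by (auto simp: Ext_pos)
    obtain k r where k: "s = k # r" "k \<in> arr \<A>" "src \<A> k = tgt \<A> p" using yext_front[OF Cls(3)] by auto
    obtain k' r' where k': "s' = k' # r'" "k' \<in> arr \<A>" "src \<A> k' = tgt \<A> q" using yext_front[OF s'(2)] by auto
    have y: "yext \<A> \<C> t (bsum X X') (tgt \<A> (dsum \<A> p q)) (map2 (dsum \<A>) s s')"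
      using yext_dsum[OF Cls(3) s'(2)] c by simp
    show ?thesis
      using osum_ycls[OF Cls(3) s'(2)] con_ycls[OF ds y] con_ycls[OF ip Cls(3)] con_ycls[OF jq s'(2)]
        osum_ycls[OF yext_splice[OF ip Cls(3)] yext_splice[OF jq s'(2)]] k k' c Cls s' by simp
  qed
qed

text \<open>In degree 0 the Baer formula collapses to the addition of morphisms, so the sum has one
  description in every degree.\<close>

lemma ext_add_osum:
  assumes "\<gamma> \<in> EXT t X Y" "\<delta> \<in> EXT t X Y" "X \<in> \<C>" "Y \<in> \<C>"
  shows "ext_add \<A> \<C> X Y \<gamma> \<delta> = psh (codiag \<A> Y) (pll (osum \<gamma> \<delta>) (diag \<A> X))"
  using assms(1)
proof (cases rule: Ext_cases)
  case (Mor f)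
  then obtain f' where f': "\<delta> = Mor f'" "f' \<in> arr \<A>" "src \<A> f' = X" "tgt \<A> f' = Y"
    using assms(2) by (auto simp: Ext_0)
  then show ?thesis using Mor codiag_dsum_diag[of f f'] by simp
next
  case (Cls s)
  then show ?thesis using assms(2) by (auto simp: Ext_pos ycls_def)
qed

lemma ext_add_closed:
  assumes "\<gamma> \<in> EXT t X Y" "\<delta> \<in> EXT t X Y" "X \<in> \<C>" "Y \<in> \<C>"
  shows "ext_add \<A> \<C> X Y \<gamma> \<delta> \<in> EXT t X Y"
proof -
  have "pll (osum \<gamma> \<delta>) (diag \<A> X) \<in> EXT t (src \<A> (diag \<A> X)) (bsum Y Y)"
    by (rule pull_closed[OF osum_closed[OF assms(1,2)]]) (use assms in simp_all)
  then have "psh (codiag \<A> Y) (pll (osum \<gamma> \<delta>) (diag \<A> X)) \<in> EXT t (src \<A> (diag \<A> X)) (tgt \<A> (codiag \<A> Y))"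
    by (rule push_closed) (use assms in simp_all)
  then show ?thesis using assms by (simp add: ext_add_osum)
qed

text \<open>The codiagonals form a morphism from the direct sum of \<open>(i, p)\<close> with itself
  to \<open>(i, p)\<close>, so every ingredient of the Baer sum passes through the connecting
  morphism. This additivity carries the group axioms from one degree to the next.\<close>

lemma ext_add_con:
  assumes ip: "conflation \<A> \<C> i p" and g: "\<gamma> \<in> EXT t X (tgt \<A> p)" and d: "\<delta> \<in> EXT t X (tgt \<A> p)" and X: "X \<in> \<C>"
  shows "ext_add \<A> \<C> X (src \<A> i) (con i p \<gamma>) (con i p \<delta>) = con i p (ext_add \<A> \<C> X (tgt \<A> p) \<gamma> \<delta>)"
proof -
  note c = conflationD[OF ip]
  note ds = dsum_conflation[OF ip ip]
  have m: "conf_map (dsum \<A> i i) (dsum \<A> p p) i p (codiag \<A> (src \<A> i)) (codiag \<A> (tgt \<A> i)) (codiag \<A> (tgt \<A> p))"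
    unfolding conf_map_def using ds ip c codiag_natural[of i] codiag_natural[of p] by simp
  have o: "osum \<gamma> \<delta> \<in> EXT t (bsum X X) (tgt \<A> (dsum \<A> p p))" using osum_closed[OF g d] c by simp
  have pl: "pll (osum \<gamma> \<delta>) (diag \<A> X) \<in> EXT t X (tgt \<A> (dsum \<A> p p))"
    using pull_closed[OF o, of "diag \<A> X"] X by simp
  have "ext_add \<A> \<C> X (src \<A> i) (con i p \<gamma>) (con i p \<delta>) = psh (codiag \<A> (src \<A> i)) (pll (osum (con i p \<gamma>) (con i p \<delta>)) (diag \<A> X))"
    by (rule ext_add_osum) (use con_closed[OF ip g X] con_closed[OF ip d X] X c in simp_all)
  also have "osum (con i p \<gamma>) (con i p \<delta>) = con (dsum \<A> i i) (dsum \<A> p p) (osum \<gamma> \<delta>)"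
    using con_osum[OF ip ip g d X X] by simp
  also have "pll \<dots> (diag \<A> X) = con (dsum \<A> i i) (dsum \<A> p p) (pll (osum \<gamma> \<delta>) (diag \<A> X))"
    by (rule con_pull[OF ds o]) (use X in simp_all)
  also have "psh (codiag \<A> (src \<A> i)) \<dots> = con i p (psh (codiag \<A> (tgt \<A> p)) (pll (osum \<gamma> \<delta>) (diag \<A> X)))"
    by (rule con_natural[OF m pl X])
  also have "psh (codiag \<A> (tgt \<A> p)) (pll (osum \<gamma> \<delta>) (diag \<A> X)) = ext_add \<A> \<C> X (tgt \<A> p) \<gamma> \<delta>"
    using ext_add_osum[OF g d X] c by simp
  finally show ?thesis .
qed

end

section \<open>The Baer sum\<close>

context exact_subcategory begin

abbreviation xadd :: "'a \<Rightarrow> 'a \<Rightarrow> 'b ext \<Rightarrow> 'b ext \<Rightarrow> 'b ext" where "xadd \<equiv> ext_add \<A> \<C>"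
abbreviation xzero :: "nat \<Rightarrow> 'a \<Rightarrow> 'a \<Rightarrow> 'b ext" where "xzero \<equiv> ext_zero \<A> \<C>"
abbreviation xgrp :: "nat \<Rightarrow> 'a \<Rightarrow> 'a \<Rightarrow> 'b ext monoid" where "xgrp \<equiv> Ext_group \<A> \<C>"

lemma conf_map_cmp:
  assumes "conf_map i p j q a b c" "conf_map j q k r a' b' c'"
  shows "conf_map i p k r (a' \<cdot> a) (b' \<cdot> b) (c' \<cdot> c)"
proof -
  note d = conf_mapD[OF assms(1)] and e = conf_mapD[OF assms(2)]
  note f = conflationD[OF d(1)] conflationD[OF d(2)] conflationD[OF e(2)]
  have "b' \<cdot> (j \<cdot> a) = k \<cdot> (a' \<cdot> a)" by (rule cmp_reassoc2[OF e(12)]) (use d(3-11) e(3-11) f in simp_all)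
  moreover have "c' \<cdot> (q \<cdot> b) = r \<cdot> (b' \<cdot> b)" by (rule cmp_reassoc2[OF e(13)]) (use d(3-11) e(3-11) f in simp_all)
  ultimately show ?thesis using d e f by (simp add: conf_map_def)
qed

lemma conf_map_hadd:
  assumes "conf_map i p j q a b c" "conf_map i p j q a' b' c'"
  shows "conf_map i p j q (a \<oplus> a') (b \<oplus> b') (c \<oplus> c')"
proof -
  note d = conf_mapD[OF assms(1)] and e = conf_mapD[OF assms(2)]
  note f = conflationD[OF d(1)] conflationD[OF d(2)]
  show ?thesis using d e f by (simp add: conf_map_def)
qed

lemma conf_map_pushout:
  assumes ip: "conflation \<A> \<C> i p" and g: "g \<in> arr \<A>" "src \<A> g = src \<A> i" "tgt \<A> g \<in> \<C>"
  obtains j u q where "conf_map i p j q g u (ide \<A> (tgt \<A> p))" "src \<A> j = tgt \<A> g" "tgt \<A> q = tgt \<A> p"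
proof -
  obtain i' p' u where c': "conflation \<A> \<C> i' p'" "pushout_square \<A> i g u i'" "p' \<cdot> u = p" "tgt \<A> p' = tgt \<A> p"
    using pushout_conflation[OF assms] by metis
  have "conf_map i p i' p' g u (ide \<A> (tgt \<A> p))"
    using ip c' pushout_squareD[OF c'(2)] conflationD[OF ip] conflationD[OF c'(1)] by (simp add: conf_map_def)
  then show thesis using that c' pushout_squareD[OF c'(2)] by metis
qed

text \<open>The push-out of \<open>(i, p) \<oplus> (j, q)\<close> along the codiagonal.\<close>

lemma conf_amalgam:
  assumes ip: "conflation \<A> \<C> i p" and jq: "conflation \<A> \<C> j q" and s: "src \<A> j = src \<A> i"
  obtains k r b b' c c' where "conf_map i p k r (ide \<A> (src \<A> i)) b c" "conf_map j q k r (ide \<A> (src \<A> i)) b' c'"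
    "c = inj1 \<A> (tgt \<A> p) (tgt \<A> q)" "c' = inj2 \<A> (tgt \<A> p) (tgt \<A> q)" "tgt \<A> r = bsum (tgt \<A> p) (tgt \<A> q)" "src \<A> k = src \<A> i"
proof -
  note c = conflationD[OF ip] conflationD[OF jq]
  have m1: "conf_map i p (dsum \<A> i j) (dsum \<A> p q) (inj1 \<A> (src \<A> i) (src \<A> j)) (inj1 \<A> (tgt \<A> i) (tgt \<A> j)) (inj1 \<A> (tgt \<A> p) (tgt \<A> q))"
    and m2: "conf_map j q (dsum \<A> i j) (dsum \<A> p q) (inj2 \<A> (src \<A> i) (src \<A> j)) (inj2 \<A> (tgt \<A> i) (tgt \<A> j)) (inj2 \<A> (tgt \<A> p) (tgt \<A> q))"
    using dsum_conflation[OF ip jq] ip jq c by (simp_all add: conf_map_def)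
  obtain k u r where m: "conf_map (dsum \<A> i j) (dsum \<A> p q) k r (codiag \<A> (src \<A> i)) u (ide \<A> (tgt \<A> (dsum \<A> p q)))"
    "src \<A> k = tgt \<A> (codiag \<A> (src \<A> i))" "tgt \<A> r = tgt \<A> (dsum \<A> p q)"
    by (rule conf_map_pushout[OF dsum_conflation[OF ip jq], of "codiag \<A> (src \<A> i)"]) (use c s in simp_all)
  show thesis
    by (rule that[of k r "u \<cdot> inj1 \<A> (tgt \<A> i) (tgt \<A> j)" _ "u \<cdot> inj2 \<A> (tgt \<A> i) (tgt \<A> j)"])
      (use conf_map_cmp[OF m1 m(1)] conf_map_cmp[OF m2 m(1)] c s m(2,3) in simp_all)
qed

text \<open>Naturality with the identity on the left: a Yoneda product may be moved to any larger
  conflation with the same left end, so that products over different conflations become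
  comparable.\<close>

lemma con_amalgam:
  assumes m: "conf_map i p k r (ide \<A> (src \<A> i)) b c" and g: "\<gamma> \<in> EXT t X (tgt \<A> p)" and X: "X \<in> \<C>"
  shows "con i p \<gamma> = con k r (psh c \<gamma>)" "psh c \<gamma> \<in> EXT t X (tgt \<A> r)"
proof -
  note d = conf_mapD[OF m]
  note e = conflationD[OF d(1)] conflationD[OF d(2)]
  show "psh c \<gamma> \<in> EXT t X (tgt \<A> r)" using push_closed[OF g, of c] d e by simp
  show "con i p \<gamma> = con k r (psh c \<gamma>)"
    using con_natural[OF m g X] push_ide[OF con_closed[OF d(1) g X]] by simp
qed

text \<open>Both classes are moved to the amalgam of their first conflations, where their Baer sum
  can be computed one degree lower.\<close>

lemma con_surj2:
  assumes "\<gamma> \<in> EXT (Suc t) X Y" "\<delta> \<in> EXT (Suc t) X Y" "X \<in> \<C>"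
  obtains i p \<gamma>' \<delta>' where "conflation \<A> \<C> i p" "src \<A> i = Y" "\<gamma>' \<in> EXT t X (tgt \<A> p)" "\<delta>' \<in> EXT t X (tgt \<A> p)"
    "\<gamma> = con i p \<gamma>'" "\<delta> = con i p \<delta>'"
proof -
  obtain i p \<gamma>' where 1: "conflation \<A> \<C> i p" "src \<A> i = Y" "\<gamma>' \<in> EXT t X (tgt \<A> p)" "\<gamma> = con i p \<gamma>'"
    by (rule con_surj[OF assms(1)])
  obtain j q \<delta>' where 2: "conflation \<A> \<C> j q" "src \<A> j = Y" "\<delta>' \<in> EXT t X (tgt \<A> q)" "\<delta> = con j q \<delta>'"
    by (rule con_surj[OF assms(2)])
  obtain k r b b' c c' where m: "conf_map i p k r (ide \<A> (src \<A> i)) b c" "conf_map j q k r (ide \<A> (src \<A> i)) b' c'"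
    "src \<A> k = src \<A> i" using conf_amalgam[OF 1(1) 2(1)] 1 2 by metis
  have m2: "conf_map j q k r (ide \<A> (src \<A> j)) b' c'" using m(2) 1 2 by simp
  show thesis
    by (rule that[OF conf_mapD(2)[OF m(1)] _ con_amalgam(2)[OF m(1) 1(3) assms(3)] con_amalgam(2)[OF m2 2(3) assms(3)]])
      (use 1 2 m con_amalgam(1)[OF m(1) 1(3) assms(3)] con_amalgam(1)[OF m2 2(3) assms(3)] in simp_all)
qed

lemma con_surj3:
  assumes "\<gamma> \<in> EXT (Suc t) X Y" "\<delta> \<in> EXT (Suc t) X Y" "\<epsilon> \<in> EXT (Suc t) X Y" "X \<in> \<C>"
  obtains i p \<gamma>' \<delta>' \<epsilon>' where "conflation \<A> \<C> i p" "src \<A> i = Y" "\<gamma>' \<in> EXT t X (tgt \<A> p)" "\<delta>' \<in> EXT t X (tgt \<A> p)"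
    "\<epsilon>' \<in> EXT t X (tgt \<A> p)" "\<gamma> = con i p \<gamma>'" "\<delta> = con i p \<delta>'" "\<epsilon> = con i p \<epsilon>'"
proof -
  obtain i p \<gamma>' \<delta>' where 1: "conflation \<A> \<C> i p" "src \<A> i = Y" "\<gamma>' \<in> EXT t X (tgt \<A> p)" "\<delta>' \<in> EXT t X (tgt \<A> p)"
    "\<gamma> = con i p \<gamma>'" "\<delta> = con i p \<delta>'" by (rule con_surj2[OF assms(1,2,4)])
  obtain j q \<epsilon>' where 2: "conflation \<A> \<C> j q" "src \<A> j = Y" "\<epsilon>' \<in> EXT t X (tgt \<A> q)" "\<epsilon> = con j q \<epsilon>'"
    by (rule con_surj[OF assms(3)])
  obtain k r b b' c c' where m: "conf_map i p k r (ide \<A> (src \<A> i)) b c" "conf_map j q k r (ide \<A> (src \<A> i)) b' c'"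
    "src \<A> k = src \<A> i" using conf_amalgam[OF 1(1) 2(1)] 1 2 by metis
  have m2: "conf_map j q k r (ide \<A> (src \<A> j)) b' c'" using m(2) 1 2 by simp
  note c1 = con_amalgam[OF m(1) 1(3) assms(4)] and c2 = con_amalgam[OF m(1) 1(4) assms(4)] and c3 = con_amalgam[OF m2 2(3) assms(4)]
  show thesis
    by (rule that[OF conf_mapD(2)[OF m(1)] _ c1(2) c2(2) c3(2)]) (use 1 2 m c1(1) c2(1) c3(1) in simp_all)
qed

text \<open>The group structure and the additivity of push-out and pull-back go through one
  induction, since they depend on each other: the zero class in degree \<open>t + 1\<close>, for
  instance, is recognised by the additivity of push-outs in degree \<open>t\<close>.\<close>

definition Ext_additive :: "nat \<Rightarrow> bool" where
  "Ext_additive t \<longleftrightarrow>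
     (\<forall>X\<in>\<C>. \<forall>Y\<in>\<C>. comm_group (xgrp t X Y)) \<and>
     (\<forall>X\<in>\<C>. \<forall>Y\<in>\<C>. \<forall>\<gamma>\<in>EXT t X Y. \<forall>\<delta>\<in>EXT t X Y. \<forall>g\<in>arr \<A>. src \<A> g = Y \<longrightarrow> tgt \<A> g \<in> \<C> \<longrightarrow>
        psh g (xadd X Y \<gamma> \<delta>) = xadd X (tgt \<A> g) (psh g \<gamma>) (psh g \<delta>)) \<and>
     (\<forall>X\<in>\<C>. \<forall>Y\<in>\<C>. \<forall>\<gamma>\<in>EXT t X Y. \<forall>\<delta>\<in>EXT t X Y. \<forall>h\<in>arr \<A>. tgt \<A> h = X \<longrightarrow> src \<A> h \<in> \<C> \<longrightarrow>
        pll (xadd X Y \<gamma> \<delta>) h = xadd (src \<A> h) Y (pll \<gamma> h) (pll \<delta> h)) \<and>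
     (\<forall>X\<in>\<C>. \<forall>Y\<in>\<C>. \<forall>\<gamma>\<in>EXT t X Y. \<forall>g\<in>arr \<A>. \<forall>g'\<in>arr \<A>. src \<A> g = Y \<longrightarrow> src \<A> g' = Y \<longrightarrow> tgt \<A> g = tgt \<A> g' \<longrightarrow>
        tgt \<A> g' \<in> \<C> \<longrightarrow> psh (g \<oplus> g') \<gamma> = xadd X (tgt \<A> g') (psh g \<gamma>) (psh g' \<gamma>))"

lemma Ext_additive_0: "Ext_additive 0"
proof -
  have "comm_group (xgrp 0 X Y)" if "X \<in> \<C>" "Y \<in> \<C>" for X Y
  proof (rule comm_groupI)
    fix x assume "x \<in> carrier (xgrp 0 X Y)"
    then obtain f where "x = Mor f" "f \<in> arr \<A>" "src \<A> f = X" "tgt \<A> f = Y" by (auto simp: Ext_group_def Ext_0)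
    then show "\<exists>y\<in>carrier (xgrp 0 X Y). y \<otimes>\<^bsub>xgrp 0 X Y\<^esub> x = \<one>\<^bsub>xgrp 0 X Y\<^esub>"
      by (intro bexI[of _ "Mor (hneg f)"]) (simp_all add: Ext_group_def ext_zero_def Ext_0)
  qed (use that in \<open>auto simp: Ext_group_def Ext_0 ext_zero_def hadd_ac\<close>)
  then show ?thesis unfolding Ext_additive_def by (auto simp: Ext_0)
qed

section \<open>The trivial extensions as Yoneda products\<close>

lemma conflation_ide_zero:
  assumes Y: "Y \<in> \<C>"
  shows "conflation \<A> \<C> (ide \<A> Y) (hzero \<A> Y (zero_obj \<A>))"
proof (rule conflationI)
  show "short_exact \<A> (ide \<A> Y) (hzero \<A> Y (zero_obj \<A>))"
  proof (rule short_exactI)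
    fix g assume g: "g \<in> arr \<A>" "src \<A> g = tgt \<A> (ide \<A> Y)" "g \<cdot> ide \<A> Y = hzero \<A> (src \<A> (ide \<A> Y)) (tgt \<A> g)"
    then show "\<exists>u\<in>arr \<A>. src \<A> u = tgt \<A> (hzero \<A> Y (zero_obj \<A>)) \<and> tgt \<A> u = tgt \<A> g \<and> u \<cdot> hzero \<A> Y (zero_obj \<A>) = g"
      using Y by (intro bexI[of _ "hzero \<A> (zero_obj \<A>) (tgt \<A> g)"]) simp_all
  next
    fix u v assume *: "u \<in> arr \<A>" "v \<in> arr \<A>" "src \<A> u = tgt \<A> (hzero \<A> Y (zero_obj \<A>))"
      "src \<A> v = tgt \<A> (hzero \<A> Y (zero_obj \<A>))" "tgt \<A> u = tgt \<A> v"
    show "u = v" using from_zero_obj[of u] from_zero_obj[of v] * Y by simp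
  qed (use Y in simp_all)
qed (use Y in simp_all)

lemma conflation_zero_ide:
  assumes X: "X \<in> \<C>"
  shows "conflation \<A> \<C> (hzero \<A> (zero_obj \<A>) X) (ide \<A> X)"
proof (rule conflationI)
  show "short_exact \<A> (hzero \<A> (zero_obj \<A>) X) (ide \<A> X)"
  proof (rule short_exactI)
    fix g assume "g \<in> arr \<A>" "tgt \<A> g = src \<A> (hzero \<A> (zero_obj \<A>) X)"
    then show "g = hzero \<A> (src \<A> g) (src \<A> (hzero \<A> (zero_obj \<A>) X))" using to_zero_obj[of g] X by simp
  next
    fix g assume "g \<in> arr \<A>" "src \<A> g = tgt \<A> (hzero \<A> (zero_obj \<A>) X)"
    then show "\<exists>u\<in>arr \<A>. src \<A> u = tgt \<A> (ide \<A> X) \<and> tgt \<A> u = tgt \<A> g \<and> u \<cdot> ide \<A> X = g"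
      using X by (intro bexI[of _ g]) simp_all
  qed (use X in simp_all)
qed (use X in simp_all)

lemma ide_zero_obj: "ide \<A> (zero_obj \<A>) = hzero \<A> (zero_obj \<A>) (zero_obj \<A>)"
  using to_zero_obj[of "ide \<A> (zero_obj \<A>)"] by simp

text \<open>The prescribed trivial sequence appears as a product with the conflation from
  \<open>Y\<close> by its identity to the zero object; in this form it can be compared with other
  products.\<close>

lemma trivial_seq_splice:
  assumes "X \<in> \<C>" "Y \<in> \<C>"
  shows "\<exists>s. yext \<A> \<C> (Suc t) X (zero_obj \<A>) s \<and>
    trivial_seq \<A> (Suc (Suc t)) X Y = ide \<A> Y # hd s \<cdot> hzero \<A> Y (zero_obj \<A>) # tl s"
  using assms(2)
proof (induction t arbitrary: Y)
  case 0
  then show ?case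
    using yext_conflation[OF conflation_zero_ide[OF assms(1)]] assms(1)
    by (intro exI[of _ "[hzero \<A> (zero_obj \<A>) X, ide \<A> X]"]) simp
next
  case (Suc t)
  let ?Z = "zero_obj \<A>"
  obtain s where s: "yext \<A> \<C> (Suc t) X ?Z s"
    "trivial_seq \<A> (Suc (Suc t)) X ?Z = ide \<A> ?Z # hd s \<cdot> hzero \<A> ?Z ?Z # tl s" using Suc.IH[of ?Z] by auto
  have "yext \<A> \<C> (Suc (Suc t)) X ?Z (trivial_seq \<A> (Suc (Suc t)) X ?Z)"
    using yext_splice[OF conflation_ide_zero[of ?Z], of "Suc t" X s] s by simp
  moreover have "trivial_seq \<A> (Suc (Suc (Suc t))) X Y = ide \<A> Y # hzero \<A> Y ?Z # tl (trivial_seq \<A> (Suc (Suc t)) X ?Z)"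
    by (cases t) simp_all
  moreover have "hd (trivial_seq \<A> (Suc (Suc t)) X ?Z) = ide \<A> ?Z" using s by simp
  ultimately show ?case using Suc.prems by (intro exI[of _ "trivial_seq \<A> (Suc (Suc t)) X ?Z"]) simp
qed

section \<open>Inductive step for the group structure\<close>

context
  fixes t assumes add: "Ext_additive t"
begin

lemma grp: "X \<in> \<C> \<Longrightarrow> Y \<in> \<C> \<Longrightarrow> comm_group (xgrp t X Y)"
  using add by (simp add: Ext_additive_def)

lemma push_add':
  "\<lbrakk>\<gamma> \<in> EXT t X Y; \<delta> \<in> EXT t X Y; X \<in> \<C>; g \<in> arr \<A>; src \<A> g = Y; Y \<in> \<C>; tgt \<A> g \<in> \<C>\<rbrakk> \<Longrightarrow>
    psh g (xadd X Y \<gamma> \<delta>) = xadd X (tgt \<A> g) (psh g \<gamma>) (psh g \<delta>)"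
  using add by (simp add: Ext_additive_def)

lemma pull_add':
  "\<lbrakk>\<gamma> \<in> EXT t X Y; \<delta> \<in> EXT t X Y; X \<in> \<C>; Y \<in> \<C>; h \<in> arr \<A>; tgt \<A> h = X; src \<A> h \<in> \<C>\<rbrakk> \<Longrightarrow>
    pll (xadd X Y \<gamma> \<delta>) h = xadd (src \<A> h) Y (pll \<gamma> h) (pll \<delta> h)"
  using add by (simp add: Ext_additive_def)

lemma push_hadd':
  "\<lbrakk>\<gamma> \<in> EXT t X Y; X \<in> \<C>; Y \<in> \<C>; g \<in> arr \<A>; g' \<in> arr \<A>; src \<A> g = Y; src \<A> g' = Y; tgt \<A> g = tgt \<A> g'; tgt \<A> g' \<in> \<C>\<rbrakk> \<Longrightarrow>
    psh (g \<oplus> g') \<gamma> = xadd X (tgt \<A> g') (psh g \<gamma>) (psh g' \<gamma>)"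
  using add by (simp add: Ext_additive_def)

text \<open>An idempotent of a group is its unit; in this way additivity yields the preservation of
  zero below.\<close>

lemma idem_zero':
  assumes "\<gamma> \<in> EXT t X Y" "xadd X Y \<gamma> \<gamma> = \<gamma>" "X \<in> \<C>" "Y \<in> \<C>"
  shows "\<gamma> = xzero t X Y"
proof -
  interpret comm_group "xgrp t X Y" using grp assms by simp
  show ?thesis using assms(1,2) r_cancel_one[of \<gamma> \<gamma>] by (simp add: Ext_group_def)
qed

lemma zero_closed': "X \<in> \<C> \<Longrightarrow> Y \<in> \<C> \<Longrightarrow> xzero t X Y \<in> EXT t X Y"
proof -
  assume "X \<in> \<C>" "Y \<in> \<C>"
  then interpret comm_group "xgrp t X Y" using grp by simp
  show ?thesis using one_closed by (simp add: Ext_group_def)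
qed

lemma xadd_zero':
  assumes "\<gamma> \<in> EXT t X Y" "X \<in> \<C>" "Y \<in> \<C>"
  shows "xadd X Y (xzero t X Y) \<gamma> = \<gamma>" "xadd X Y \<gamma> (xzero t X Y) = \<gamma>"
proof -
  interpret comm_group "xgrp t X Y" using grp assms by simp
  show "xadd X Y (xzero t X Y) \<gamma> = \<gamma>" "xadd X Y \<gamma> (xzero t X Y) = \<gamma>"
    using assms(1) l_one[of \<gamma>] r_one[of \<gamma>] by (simp_all add: Ext_group_def)
qed

lemma push_zero':
  assumes "X \<in> \<C>" "g \<in> arr \<A>" "src \<A> g = Y" "Y \<in> \<C>" "tgt \<A> g \<in> \<C>"
  shows "psh g (xzero t X Y) = xzero t X (tgt \<A> g)"
proof (rule idem_zero')
  note z = zero_closed'[OF assms(1,4)]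
  show "psh g (xzero t X Y) \<in> EXT t X (tgt \<A> g)" using push_closed[OF z assms(2,3,5)] .
  show "xadd X (tgt \<A> g) (psh g (xzero t X Y)) (psh g (xzero t X Y)) = psh g (xzero t X Y)"
    using push_add'[OF z z assms(1-5)] xadd_zero'[OF z assms(1,4)] by simp
qed (use assms in simp_all)

lemma push_hzero':
  assumes "\<gamma> \<in> EXT t X Y" "X \<in> \<C>" "Y \<in> \<C>" "Y' \<in> \<C>"
  shows "psh (hzero \<A> Y Y') \<gamma> = xzero t X Y'"
proof (rule idem_zero')
  show "psh (hzero \<A> Y Y') \<gamma> \<in> EXT t X Y'" using push_closed[OF assms(1), of "hzero \<A> Y Y'"] assms by simp
  show "xadd X Y' (psh (hzero \<A> Y Y') \<gamma>) (psh (hzero \<A> Y Y') \<gamma>) = psh (hzero \<A> Y Y') \<gamma>"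
    using push_hadd'[OF assms(1-3), of "hzero \<A> Y Y'" "hzero \<A> Y Y'"] assms by simp
qed (use assms in simp_all)

text \<open>Over the amalgam of the two conflations both sides become the product with the same zero
  class. This independence is required because \<open>ext_zero\<close> is given by one particular
  sequence.\<close>

lemma con_zero_unique':
  assumes ip: "conflation \<A> \<C> i p" and jq: "conflation \<A> \<C> j q" and s: "src \<A> j = src \<A> i" and X: "X \<in> \<C>"
  shows "con i p (xzero t X (tgt \<A> p)) = con j q (xzero t X (tgt \<A> q))"
proof -
  note c = conflationD[OF ip] conflationD[OF jq]
  obtain k r b b' d d' where m: "conf_map i p k r (ide \<A> (src \<A> i)) b d" "conf_map j q k r (ide \<A> (src \<A> i)) b' d'"
    "src \<A> k = src \<A> i" using conf_amalgam[OF ip jq s] by metis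
  have m2: "conf_map j q k r (ide \<A> (src \<A> j)) b' d'" using m(2) s by simp
  note D = conf_mapD[OF m(1)] and D2 = conf_mapD[OF m2]
  note k = conflationD[OF D(2)]
  have "con i p (xzero t X (tgt \<A> p)) = con k r (psh d (xzero t X (tgt \<A> p)))"
    by (rule con_amalgam(1)[OF m(1) zero_closed' X]) (use c X in simp_all)
  moreover have "con j q (xzero t X (tgt \<A> q)) = con k r (psh d' (xzero t X (tgt \<A> q)))"
    by (rule con_amalgam(1)[OF m2 zero_closed' X]) (use c X in simp_all)
  moreover have "psh d (xzero t X (tgt \<A> p)) = xzero t X (tgt \<A> r)" "psh d' (xzero t X (tgt \<A> q)) = xzero t X (tgt \<A> r)"
    using push_zero'[of X d "tgt \<A> p"] push_zero'[of X d' "tgt \<A> q"] D D2 k c X by simp_all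
  ultimately show ?thesis by simp
qed

text \<open>In degree one the split conflation maps to \<open>(i, p)\<close> with identity on the
  left and zero on the right. In higher degrees the trivial sequence is a product with a class whose
  second argument is the zero object; that class is zero because the identity of the zero object is
  a zero morphism.\<close>

lemma con_zero':
  assumes ip: "conflation \<A> \<C> i p" and X: "X \<in> \<C>"
  shows "con i p (xzero t X (tgt \<A> p)) = xzero (Suc t) X (src \<A> i)"
proof (cases t)
  case 0
  note c = conflationD[OF ip]
  let ?Y = "src \<A> i"
  have m: "conf_map (inj1 \<A> ?Y X) (proj2 \<A> ?Y X) i p (ide \<A> (src \<A> (inj1 \<A> ?Y X))) (i \<cdot> proj1 \<A> ?Y X) (hzero \<A> X (tgt \<A> p))"
    using ip conflation_biprod[of ?Y X] c X by (simp add: conf_map_def cmp_reassoc[OF c(8)])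
  have e: "Mor (ide \<A> X) \<in> EXT 0 X (tgt \<A> (proj2 \<A> ?Y X))" using X c by (simp add: Ext_0)
  have "xzero (Suc 0) X ?Y = ycls \<A> \<C> [inj1 \<A> ?Y X, proj2 \<A> ?Y X]"
    by (simp add: ext_zero_def ycls_def)
  also have "\<dots> = con (inj1 \<A> ?Y X) (proj2 \<A> ?Y X) (Mor (ide \<A> X))"
  proof -
    have "ycls \<A> \<C> [inj1 \<A> ?Y X, proj2 \<A> ?Y X] \<in> EXT (Suc 0) X ?Y"
      using yext_conflation[OF conflation_biprod[of ?Y X]] X c by (auto simp: Ext_pos)
    then show ?thesis by (simp add: pull_ide)
  qed
  also have "\<dots> = con i p (psh (hzero \<A> X (tgt \<A> p)) (Mor (ide \<A> X)))" by (rule con_amalgam(1)[OF m e X])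
  finally show ?thesis using 0 X c by (simp add: ext_zero_def)
next
  case (Suc t')
  note c = conflationD[OF ip]
  let ?Y = "src \<A> i" and ?Z = "zero_obj \<A>"
  obtain s where s: "yext \<A> \<C> t X ?Z s" "trivial_seq \<A> (Suc t) X ?Y = ide \<A> ?Y # hd s \<cdot> hzero \<A> ?Y ?Z # tl s"
    using trivial_seq_splice[OF X c(5), of t'] Suc by auto
  have e: "ycls \<A> \<C> s \<in> EXT t X ?Z" using s Suc by (auto simp: Ext_pos)
  have cz: "conflation \<A> \<C> (ide \<A> ?Y) (hzero \<A> ?Y ?Z)" using conflation_ide_zero c by simp
  have "xzero (Suc t) X ?Y = con (ide \<A> ?Y) (hzero \<A> ?Y ?Z) (ycls \<A> \<C> s)"
    using con_ycls[OF cz, of t X s] s c by (simp add: ext_zero_def ycls_def)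
  also have "ycls \<A> \<C> s = psh (hzero \<A> ?Z ?Z) (ycls \<A> \<C> s)" using push_ide[OF e] by (simp add: ide_zero_obj)
  also have "\<dots> = xzero t X ?Z" by (rule push_hzero'[OF e X]) simp_all
  finally show ?thesis using con_zero_unique'[OF ip cz _ X] c by simp
qed

lemma Ext_additive_Suc: "Ext_additive (Suc t)"
proof -
  have 1: "comm_group (xgrp (Suc t) X Y)" if X: "X \<in> \<C>" and Y: "Y \<in> \<C>" for X Y
  proof -
    \<comment> \<open>Classes over one conflation are added one degree lower, so each axiom below is
      the axiom in degree \<open>t\<close> for representatives over a common conflation.\<close>
    have *: "xadd X Y (con i p \<gamma>) (con i p \<delta>) = con i p (xadd X (tgt \<A> p) \<gamma> \<delta>)"
      "xadd X (tgt \<A> p) \<gamma> \<delta> \<in> EXT t X (tgt \<A> p)"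
      if "conflation \<A> \<C> i p" "src \<A> i = Y" "\<gamma> \<in> EXT t X (tgt \<A> p)" "\<delta> \<in> EXT t X (tgt \<A> p)" for i p \<gamma> \<delta>
      using ext_add_con[OF that(1,3,4) X] that ext_add_closed[OF that(3,4) X] conflationD[OF that(1)] by simp_all
    show ?thesis
    proof (rule comm_groupI)
      fix x y assume xy: "x \<in> carrier (xgrp (Suc t) X Y)" "y \<in> carrier (xgrp (Suc t) X Y)"
      then have xy': "x \<in> EXT (Suc t) X Y" "y \<in> EXT (Suc t) X Y" by (simp_all add: Ext_group_def)
      show "x \<otimes>\<^bsub>xgrp (Suc t) X Y\<^esub> y \<in> carrier (xgrp (Suc t) X Y)"
        using ext_add_closed[OF xy' X Y] by (simp add: Ext_group_def)
      obtain i p \<gamma> \<delta> where g: "conflation \<A> \<C> i p" "src \<A> i = Y" "\<gamma> \<in> EXT t X (tgt \<A> p)" "\<delta> \<in> EXT t X (tgt \<A> p)"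
        "x = con i p \<gamma>" "y = con i p \<delta>" by (rule con_surj2[OF xy' X])
      interpret G: comm_group "xgrp t X (tgt \<A> p)" using grp X conflationD[OF g(1)] by simp
      have "xadd X (tgt \<A> p) \<gamma> \<delta> = xadd X (tgt \<A> p) \<delta> \<gamma>" using G.m_comm[of \<gamma> \<delta>] g by (simp add: Ext_group_def)
      then show "x \<otimes>\<^bsub>xgrp (Suc t) X Y\<^esub> y = y \<otimes>\<^bsub>xgrp (Suc t) X Y\<^esub> x"
        using *(1)[OF g(1-4)] *(1)[OF g(1,2,4,3)] g by (simp add: Ext_group_def)
    next
      fix x y z assume "x \<in> carrier (xgrp (Suc t) X Y)" "y \<in> carrier (xgrp (Suc t) X Y)" "z \<in> carrier (xgrp (Suc t) X Y)"
      then have xyz: "x \<in> EXT (Suc t) X Y" "y \<in> EXT (Suc t) X Y" "z \<in> EXT (Suc t) X Y" by (simp_all add: Ext_group_def)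
      obtain i p \<gamma> \<delta> \<epsilon> where g: "conflation \<A> \<C> i p" "src \<A> i = Y" "\<gamma> \<in> EXT t X (tgt \<A> p)" "\<delta> \<in> EXT t X (tgt \<A> p)"
        "\<epsilon> \<in> EXT t X (tgt \<A> p)" "x = con i p \<gamma>" "y = con i p \<delta>" "z = con i p \<epsilon>" by (rule con_surj3[OF xyz X])
      interpret G: comm_group "xgrp t X (tgt \<A> p)" using grp X conflationD[OF g(1)] by simp
      have "xadd X (tgt \<A> p) (xadd X (tgt \<A> p) \<gamma> \<delta>) \<epsilon> = xadd X (tgt \<A> p) \<gamma> (xadd X (tgt \<A> p) \<delta> \<epsilon>)"
        using G.m_assoc[of \<gamma> \<delta> \<epsilon>] g by (simp add: Ext_group_def)
      then show "x \<otimes>\<^bsub>xgrp (Suc t) X Y\<^esub> y \<otimes>\<^bsub>xgrp (Suc t) X Y\<^esub> z = x \<otimes>\<^bsub>xgrp (Suc t) X Y\<^esub> (y \<otimes>\<^bsub>xgrp (Suc t) X Y\<^esub> z)"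
        using * g by (simp add: Ext_group_def)
    next
      have "con (ide \<A> Y) (hzero \<A> Y (zero_obj \<A>)) (xzero t X (zero_obj \<A>)) \<in> EXT (Suc t) X (src \<A> (ide \<A> Y))"
        by (rule con_closed[OF conflation_ide_zero[OF Y]]) (use zero_closed' X Y in simp_all)
      then show "\<one>\<^bsub>xgrp (Suc t) X Y\<^esub> \<in> carrier (xgrp (Suc t) X Y)"
        using con_zero'[OF conflation_ide_zero[OF Y] X] Y by (simp add: Ext_group_def)
    next
      fix x assume "x \<in> carrier (xgrp (Suc t) X Y)"
      then have x: "x \<in> EXT (Suc t) X Y" by (simp add: Ext_group_def)
      obtain i p \<gamma> where g: "conflation \<A> \<C> i p" "src \<A> i = Y" "\<gamma> \<in> EXT t X (tgt \<A> p)" "x = con i p \<gamma>"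
        by (rule con_surj[OF x])
      interpret G: comm_group "xgrp t X (tgt \<A> p)" using grp X conflationD[OF g(1)] by simp
      have z: "xzero t X (tgt \<A> p) \<in> EXT t X (tgt \<A> p)" using zero_closed' X conflationD[OF g(1)] by simp
      show "\<one>\<^bsub>xgrp (Suc t) X Y\<^esub> \<otimes>\<^bsub>xgrp (Suc t) X Y\<^esub> x = x"
        using *(1)[OF g(1,2) z g(3)] con_zero'[OF g(1) X] xadd_zero'(1)[OF g(3) X] g conflationD[OF g(1)]
        by (simp add: Ext_group_def)
      obtain \<delta> where d: "\<delta> \<in> EXT t X (tgt \<A> p)" "xadd X (tgt \<A> p) \<delta> \<gamma> = xzero t X (tgt \<A> p)"
        using G.l_inv_ex[of \<gamma>] g by (auto simp: Ext_group_def)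
      have "con i p \<delta> \<in> EXT (Suc t) X Y" using con_closed[OF g(1) d(1) X] g by simp
      moreover have "xadd X Y (con i p \<delta>) x = xzero (Suc t) X Y"
        using *(1)[OF g(1,2) d(1) g(3)] d con_zero'[OF g(1) X] g by simp
      ultimately show "\<exists>y\<in>carrier (xgrp (Suc t) X Y). y \<otimes>\<^bsub>xgrp (Suc t) X Y\<^esub> x = \<one>\<^bsub>xgrp (Suc t) X Y\<^esub>"
        by (auto simp: Ext_group_def)
    qed
  qed
  have 2: "psh g (xadd X Y \<gamma> \<delta>) = xadd X (tgt \<A> g) (psh g \<gamma>) (psh g \<delta>)"
    if X: "X \<in> \<C>" and gd: "\<gamma> \<in> EXT (Suc t) X Y" "\<delta> \<in> EXT (Suc t) X Y" and g: "g \<in> arr \<A>" "src \<A> g = Y" "tgt \<A> g \<in> \<C>"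
    for X Y g \<gamma> \<delta>
  proof -
    obtain i p \<gamma>' \<delta>' where c: "conflation \<A> \<C> i p" "src \<A> i = Y" "\<gamma>' \<in> EXT t X (tgt \<A> p)" "\<delta>' \<in> EXT t X (tgt \<A> p)"
      "\<gamma> = con i p \<gamma>'" "\<delta> = con i p \<delta>'" by (rule con_surj2[OF gd X])
    obtain j u q where m: "conf_map i p j q g u (ide \<A> (tgt \<A> p))" "src \<A> j = tgt \<A> g" "tgt \<A> q = tgt \<A> p"
      by (rule conf_map_pushout[OF c(1), of g]) (use g c in simp_all)
    \<comment> \<open>The push-out of the conflation along \<open>g\<close> keeps its right-hand
      end, so the second factor of the product is unchanged and the sum may be formed before or
      after pushing.\<close>
    have *: "psh g (con i p \<epsilon>) = con j q \<epsilon>" if "\<epsilon> \<in> EXT t X (tgt \<A> p)" for \<epsilon>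
      using con_natural[OF m(1) that X] push_ide[OF that] by simp
    have s: "xadd X (tgt \<A> p) \<gamma>' \<delta>' \<in> EXT t X (tgt \<A> p)"
      using ext_add_closed[OF c(3,4) X] conflationD[OF c(1)] by simp
    show ?thesis
      using ext_add_con[OF c(1,3,4) X] ext_add_con[OF conf_mapD(2)[OF m(1)], of \<gamma>' t X \<delta>'] c m *[OF c(3)] *[OF c(4)] *[OF s] X by simp
  qed
  have 3: "pll (xadd X Y \<gamma> \<delta>) h = xadd (src \<A> h) Y (pll \<gamma> h) (pll \<delta> h)"
    if X: "X \<in> \<C>" and gd: "\<gamma> \<in> EXT (Suc t) X Y" "\<delta> \<in> EXT (Suc t) X Y" and h: "h \<in> arr \<A>" "tgt \<A> h = X" "src \<A> h \<in> \<C>"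
    for X Y h \<gamma> \<delta>
  proof -
    obtain i p \<gamma>' \<delta>' where c: "conflation \<A> \<C> i p" "src \<A> i = Y" "\<gamma>' \<in> EXT t X (tgt \<A> p)" "\<delta>' \<in> EXT t X (tgt \<A> p)"
      "\<gamma> = con i p \<gamma>'" "\<delta> = con i p \<delta>'" by (rule con_surj2[OF gd X])
    have s: "xadd X (tgt \<A> p) \<gamma>' \<delta>' \<in> EXT t X (tgt \<A> p)"
      using ext_add_closed[OF c(3,4) X] conflationD[OF c(1)] by simp
    have p: "pll \<gamma>' h \<in> EXT t (src \<A> h) (tgt \<A> p)" "pll \<delta>' h \<in> EXT t (src \<A> h) (tgt \<A> p)"
      using pull_closed c h by simp_all
    show ?thesis
      using ext_add_con[OF c(1,3,4) X] ext_add_con[OF c(1) p h(3)] con_pull[OF c(1,3) X h] con_pull[OF c(1,4) X h]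
        con_pull[OF c(1) s X h] pull_add'[OF c(3,4) X _ h] conflationD[OF c(1)] c by simp
  qed
  have 4: "psh (g \<oplus> g') \<gamma> = xadd X (tgt \<A> g') (psh g \<gamma>) (psh g' \<gamma>)"
    if X: "X \<in> \<C>" and ga: "\<gamma> \<in> EXT (Suc t) X Y" and g: "g \<in> arr \<A>" "g' \<in> arr \<A>" "src \<A> g = Y" "src \<A> g' = Y" "tgt \<A> g = tgt \<A> g'" "tgt \<A> g' \<in> \<C>"
    for X Y g g' \<gamma>
  proof -
    obtain i p \<delta> where c: "conflation \<A> \<C> i p" "src \<A> i = Y" "\<delta> \<in> EXT t X (tgt \<A> p)" "\<gamma> = con i p \<delta>" by (rule con_surj[OF ga])
    obtain j u q where m: "conf_map i p j q g u (ide \<A> (tgt \<A> p))" "src \<A> j = tgt \<A> g" "tgt \<A> q = tgt \<A> p"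
      by (rule conf_map_pushout[OF c(1), of g]) (use g c in simp_all)
    obtain j' u' q' where m': "conf_map i p j' q' g' u' (ide \<A> (tgt \<A> p))" "src \<A> j' = tgt \<A> g'" "tgt \<A> q' = tgt \<A> p"
      by (rule conf_map_pushout[OF c(1), of g']) (use g c in simp_all)
    \<comment> \<open>The push-outs of \<open>(i, p)\<close> along \<open>g\<close> and
      \<open>g'\<close> have the same left end. Over their amalgam both \<open>g\<close> and
      \<open>g'\<close> extend to morphisms from \<open>(i, p)\<close> to one conflation, and such
      morphisms can be added.\<close>
    obtain k r b b' d d' where n: "conf_map j q k r (ide \<A> (src \<A> j)) b d" "conf_map j' q' k r (ide \<A> (src \<A> j)) b' d'"
      "src \<A> k = src \<A> j"
      using conf_amalgam[OF conf_mapD(2)[OF m(1)] conf_mapD(2)[OF m'(1)]] m m' g by metis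
    have n1: "conf_map i p k r g (b \<cdot> u) d" and n2: "conf_map i p k r g' (b' \<cdot> u') d'"
      using conf_map_cmp[OF m(1) n(1)] conf_map_cmp[OF m'(1) n(2)] conf_mapD[OF n(1)] conf_mapD[OF n(2)] m m' g by simp_all
    note D = conf_mapD[OF n1] conf_mapD[OF n2] and k = conflationD[OF conf_mapD(2)[OF n1]] conflationD[OF c(1)]
    have kk: "psh d \<delta> \<in> EXT t X (tgt \<A> r)" "psh d' \<delta> \<in> EXT t X (tgt \<A> r)"
      using push_closed[OF c(3), of d] push_closed[OF c(3), of d'] D k by simp_all
    have "psh (g \<oplus> g') \<gamma> = con k r (psh (d \<oplus> d') \<delta>)"
      using con_natural[OF conf_map_hadd[OF n1 n2] c(3) X] c by simp
    also have "psh (d \<oplus> d') \<delta> = xadd X (tgt \<A> r) (psh d \<delta>) (psh d' \<delta>)"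
      using push_hadd'[OF c(3) X, of d d'] D k by simp
    also have "con k r \<dots> = xadd X (src \<A> k) (con k r (psh d \<delta>)) (con k r (psh d' \<delta>))"
      using ext_add_con[OF D(2) kk X] by simp
    finally show ?thesis using con_natural[OF n1 c(3) X] con_natural[OF n2 c(3) X] c n m g by simp
  qed
  show ?thesis unfolding Ext_additive_def
    using 1 2 3 4 by (intro conjI ballI impI) simp_all
qed

end

lemma Ext_additive: "Ext_additive t"
  by (induction t) (simp_all add: Ext_additive_0 Ext_additive_Suc)

lemmas Ext_comm_group = grp[OF Ext_additive]
  and push_add = push_add'[OF Ext_additive]
  and pull_add = pull_add'[OF Ext_additive]
  and push_hadd = push_hadd'[OF Ext_additive]
  and xzero_closed [simp] = zero_closed'[OF Ext_additive]
  and xadd_zero = xadd_zero'[OF Ext_additive]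
  and push_zero = push_zero'[OF Ext_additive]
  and push_hzero = push_hzero'[OF Ext_additive]
  and con_zero = con_zero'[OF Ext_additive]

end

section \<open>Exactness in the second variable\<close>

context exact_subcategory begin

lemma xadd_assoc:
  assumes "\<gamma> \<in> EXT t X Y" "\<delta> \<in> EXT t X Y" "\<epsilon> \<in> EXT t X Y" "X \<in> \<C>" "Y \<in> \<C>"
  shows "xadd X Y (xadd X Y \<gamma> \<delta>) \<epsilon> = xadd X Y \<gamma> (xadd X Y \<delta> \<epsilon>)"
proof -
  interpret comm_group "xgrp t X Y" using Ext_comm_group assms by simp
  show ?thesis using m_assoc[of \<gamma> \<delta> \<epsilon>] assms by (simp add: Ext_group_def)
qed

lemma xadd_commute:
  assumes "\<gamma> \<in> EXT t X Y" "\<delta> \<in> EXT t X Y" "X \<in> \<C>" "Y \<in> \<C>"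
  shows "xadd X Y \<gamma> \<delta> = xadd X Y \<delta> \<gamma>"
proof -
  interpret comm_group "xgrp t X Y" using Ext_comm_group assms by simp
  show ?thesis using m_comm[of \<gamma> \<delta>] assms by (simp add: Ext_group_def)
qed

lemma xneg_exists:
  assumes "\<gamma> \<in> EXT t X Y" "X \<in> \<C>" "Y \<in> \<C>"
  obtains \<delta> where "\<delta> \<in> EXT t X Y" "xadd X Y \<delta> \<gamma> = xzero t X Y" "xadd X Y \<gamma> \<delta> = xzero t X Y"
proof -
  interpret comm_group "xgrp t X Y" using Ext_comm_group assms by simp
  obtain \<delta> where "\<delta> \<in> EXT t X Y" "xadd X Y \<delta> \<gamma> = xzero t X Y"
    using l_inv_ex[of \<gamma>] assms by (auto simp: Ext_group_def)
  then show thesis using that xadd_commute assms by metis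
qed

lemma push_hneg:
  assumes "\<gamma> \<in> EXT t X Y" "X \<in> \<C>" "Y \<in> \<C>" "g \<in> arr \<A>" "src \<A> g = Y" "tgt \<A> g \<in> \<C>"
  shows "xadd X (tgt \<A> g) (psh g \<gamma>) (psh (hneg g) \<gamma>) = xzero t X (tgt \<A> g)"
  using push_hadd[OF assms(1-3), of g "hneg g"] push_hzero[OF assms(1-3), of "tgt \<A> g"] assms by simp

lemma pull_zero:
  assumes "Y \<in> \<C>" "h \<in> arr \<A>" "tgt \<A> h = X" "X \<in> \<C>" "src \<A> h \<in> \<C>"
  shows "pll (xzero t X Y) h = xzero t (src \<A> h) Y"
proof -
  note z = xzero_closed[OF assms(4,1)]
  have p: "pll (xzero t X Y) h \<in> EXT t (src \<A> h) Y" using pull_closed[OF z assms(2,3,5)] .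
  have "xadd (src \<A> h) Y (pll (xzero t X Y) h) (pll (xzero t X Y) h) = pll (xzero t X Y) h"
    using pull_add[OF z z assms(4,1,2,3,5)] xadd_zero[OF z assms(4,1)] by simp
  then show ?thesis using idem_zero'[OF Ext_additive p] assms by simp
qed

text \<open>The split conflation has an endomorphism that is the identity on the left and zero on
  the right; it replaces \<open>\<gamma>\<close> by its push-out along a zero morphism.\<close>

lemma con_split_zero:
  assumes g: "\<gamma> \<in> EXT t X W" and "X \<in> \<C>" "Y \<in> \<C>" "W \<in> \<C>"
  shows "con (inj1 \<A> Y W) (proj2 \<A> Y W) \<gamma> = xzero (Suc t) X Y"
proof -
  have m: "conf_map (inj1 \<A> Y W) (proj2 \<A> Y W) (inj1 \<A> Y W) (proj2 \<A> Y W) (ide \<A> (src \<A> (inj1 \<A> Y W)))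
      (inj1 \<A> Y W \<cdot> proj1 \<A> Y W) (hzero \<A> W W)"
    using conflation_biprod[of Y W] assms by (simp add: conf_map_def)
  have "con (inj1 \<A> Y W) (proj2 \<A> Y W) \<gamma> = con (inj1 \<A> Y W) (proj2 \<A> Y W) (psh (hzero \<A> W W) \<gamma>)"
    by (rule con_amalgam(1)[OF m]) (use assms in simp_all)
  then show ?thesis using con_zero[OF conflation_biprod[of Y W], of X t] push_hzero[OF g] assms by simp
qed

text \<open>\<open>p\<close> is the right-hand component of a morphism from a split conflation to
  \<open>(i, p)\<close> that fixes the left end.\<close>

lemma con_push_self:
  assumes ip: "conflation \<A> \<C> i p" and g: "\<gamma> \<in> EXT t X (tgt \<A> i)" and X: "X \<in> \<C>"
  shows "con i p (psh p \<gamma>) = xzero (Suc t) X (src \<A> i)"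
proof -
  note c = conflationD[OF ip]
  let ?Y = "src \<A> i" and ?E = "tgt \<A> i"
  have m: "conf_map (inj1 \<A> ?Y ?E) (proj2 \<A> ?Y ?E) i p (ide \<A> (src \<A> (inj1 \<A> ?Y ?E))) (i \<cdot> proj1 \<A> ?Y ?E \<oplus> proj2 \<A> ?Y ?E) p"
    using ip conflation_biprod[of ?Y ?E] c by (simp add: conf_map_def cmp_reassoc[OF c(8)])
  show ?thesis using con_amalgam(1)[OF m _ X, of \<gamma> t] con_split_zero[OF g X, of ?Y] g c by simp
qed

text \<open>\<open>i\<close> is the left-hand component of a morphism from \<open>(i, p)\<close> to
  a split conflation that is the identity on the right.\<close>

lemma push_con_self:
  assumes ip: "conflation \<A> \<C> i p" and g: "\<gamma> \<in> EXT t X (tgt \<A> p)" and X: "X \<in> \<C>"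
  shows "psh i (con i p \<gamma>) = xzero (Suc t) X (tgt \<A> i)"
proof -
  note c = conflationD[OF ip]
  let ?E = "tgt \<A> i" and ?W = "tgt \<A> p"
  have m: "conf_map i p (inj1 \<A> ?E ?W) (proj2 \<A> ?E ?W) i (inj1 \<A> ?E ?W \<oplus> inj2 \<A> ?E ?W \<cdot> p) (ide \<A> ?W)"
    using ip conflation_biprod[of ?E ?W] c by (simp add: conf_map_def)
  show ?thesis using con_natural[OF m g X] con_split_zero[OF g X, of ?E] push_ide[OF g] c by simp
qed

text \<open>The middle components differ by a morphism vanishing on \<open>i\<close>, hence by one
  of the form \<open>u \<cdot> p\<close>. The resulting ambiguity on the right is what the
  correction term of \<open>splice_rel\<close> has to absorb.\<close>

lemma conf_map_homotopy:
  assumes "conf_map i p k r a b c" "conf_map i p k r a b' c'"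
  obtains u where "u \<in> arr \<A>" "src \<A> u = tgt \<A> p" "tgt \<A> u = tgt \<A> k" "c = c' \<oplus> r \<cdot> u"
proof -
  note d = conf_mapD[OF assms(1)] and e = conf_mapD[OF assms(2)]
  note f = conflationD[OF d(1)] conflationD[OF d(2)]
  have "(b \<oplus> hneg b') \<cdot> i = hzero \<A> (src \<A> i) (tgt \<A> (b \<oplus> hneg b'))" using d e f by simp
  then obtain u where u: "u \<in> arr \<A>" "src \<A> u = tgt \<A> p" "tgt \<A> u = tgt \<A> k" "u \<cdot> p = b \<oplus> hneg b'"
    using conflation_desc[OF d(1), of "b \<oplus> hneg b'"] d e f by auto
  have "r \<cdot> (u \<cdot> p) = c \<cdot> p \<oplus> hneg (c' \<cdot> p)" unfolding u(4) using d e f by simp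
  then have "(c' \<oplus> r \<cdot> u) \<cdot> p = c' \<cdot> p \<oplus> (c \<cdot> p \<oplus> hneg (c' \<cdot> p))" using d e f u(1-3) by simp
  also have "\<dots> = c \<cdot> p"
    using d(1-11) e(1-11) f hadd_left_commute[of "c' \<cdot> p" "c \<cdot> p" "hneg (c' \<cdot> p)"] by simp
  finally have "c' \<oplus> r \<cdot> u = c"
    by - (rule conflation_cancel(2)[OF d(1)], use d(1-11) e(1-11) f u(1-3) in simp_all)
  then show thesis using that u by metis
qed

text \<open>Two Yoneda products with a conflation agree iff they agree, up to an element of the middle term,
  over a common enlargement of the two conflations; this replaces zigzags of sequences.\<close>

definition splice_rel :: "nat \<Rightarrow> 'a \<Rightarrow> 'b \<Rightarrow> 'b \<Rightarrow> 'b ext \<Rightarrow> 'b \<Rightarrow> 'b \<Rightarrow> 'b ext \<Rightarrow> bool" where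
  "splice_rel t X i p \<gamma> j q \<delta> \<longleftrightarrow> (\<exists>k r b c b' c' \<tau>. conf_map i p k r (ide \<A> (src \<A> i)) b c \<and>
     conf_map j q k r (ide \<A> (src \<A> i)) b' c' \<and> \<tau> \<in> EXT t X (tgt \<A> k) \<and>
     psh c \<gamma> = xadd X (tgt \<A> r) (psh c' \<delta>) (psh r \<tau>))"

lemma splice_rel_conf_map:
  assumes m: "conf_map i p j q (ide \<A> (src \<A> i)) b c" and g: "\<gamma> \<in> EXT t X (tgt \<A> p)" and X: "X \<in> \<C>"
  shows "splice_rel t X i p \<gamma> j q (psh c \<gamma>)"
proof -
  note d = conf_mapD[OF m]
  note f = conflationD[OF d(1)] conflationD[OF d(2)]
  have s: "src \<A> j = src \<A> i" using d f by simp
  have p: "psh c \<gamma> \<in> EXT t X (tgt \<A> q)" using push_closed[OF g, of c] d f by simp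
  show ?thesis
    unfolding splice_rel_def
  proof (intro exI conjI)
    show "conf_map j q j q (ide \<A> (src \<A> i)) (ide \<A> (tgt \<A> j)) (ide \<A> (tgt \<A> q))"
      using conf_map_ide[OF d(2)] s by simp
    show "xzero t X (tgt \<A> j) \<in> EXT t X (tgt \<A> j)" using X f by simp
    show "psh c \<gamma> = xadd X (tgt \<A> q) (psh (ide \<A> (tgt \<A> q)) (psh c \<gamma>)) (psh q (xzero t X (tgt \<A> j)))"
      using push_ide[OF p] push_zero[of X q "tgt \<A> j" t] xadd_zero(2)[OF p X] X f by simp
  qed (rule m)
qed

lemma splice_rel_sym:
  assumes r: "splice_rel t X i p \<gamma> j q \<delta>" and g: "\<gamma> \<in> EXT t X (tgt \<A> p)" "\<delta> \<in> EXT t X (tgt \<A> q)" and X: "X \<in> \<C>"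
  shows "splice_rel t X j q \<delta> i p \<gamma>"
proof -
  obtain k r b c b' c' \<tau> where m: "conf_map i p k r (ide \<A> (src \<A> i)) b c" and m': "conf_map j q k r (ide \<A> (src \<A> i)) b' c'"
    and t: "\<tau> \<in> EXT t X (tgt \<A> k)" and e: "psh c \<gamma> = xadd X (tgt \<A> r) (psh c' \<delta>) (psh r \<tau>)"
    using r unfolding splice_rel_def by blast
  note d = conf_mapD[OF m] conf_mapD[OF m']
  note f = conflationD[OF d(1)] conflationD[OF d(2)] conflationD[OF d(14)]
  have s: "src \<A> j = src \<A> i" using d f by simp
  obtain \<sigma> where \<sigma>: "\<sigma> \<in> EXT t X (tgt \<A> k)" "xadd X (tgt \<A> k) \<tau> \<sigma> = xzero t X (tgt \<A> k)"
    using xneg_exists[OF t X] f by metis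
  have cl: "psh c' \<delta> \<in> EXT t X (tgt \<A> r)" "psh r \<tau> \<in> EXT t X (tgt \<A> r)" "psh r \<sigma> \<in> EXT t X (tgt \<A> r)"
    using push_closed[OF g(2), of c'] push_closed[OF t, of r] push_closed[OF \<sigma>(1), of r] d f by simp_all
  have "xadd X (tgt \<A> r) (psh c \<gamma>) (psh r \<sigma>) = psh c' \<delta>"
    using xadd_assoc[OF cl X] push_add[OF t \<sigma>(1) X, of r] \<sigma>(2) push_zero[of X r "tgt \<A> k" t] xadd_zero(2)[OF cl(1) X] X d f e by simp
  then show ?thesis
    unfolding splice_rel_def s using m m' \<sigma>(1) by metis
qed

text \<open>The two enlargements are amalgamated. The conflation \<open>(j, q)\<close> then has two
  maps into the amalgam that agree only on the left; their right components differ by a homotopy,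
  whose contribution is absorbed into the new correction.\<close>

lemma splice_rel_trans:
  assumes r1: "splice_rel t X i p \<gamma> j q \<delta>" and r2: "splice_rel t X j q \<delta> l m \<epsilon>"
    and g: "\<gamma> \<in> EXT t X (tgt \<A> p)" "\<delta> \<in> EXT t X (tgt \<A> q)" "\<epsilon> \<in> EXT t X (tgt \<A> m)" and X: "X \<in> \<C>"
  shows "splice_rel t X i p \<gamma> l m \<epsilon>"
proof -
  obtain k r b c b' c' \<tau> where m: "conf_map i p k r (ide \<A> (src \<A> i)) b c" and m': "conf_map j q k r (ide \<A> (src \<A> i)) b' c'"
    and t: "\<tau> \<in> EXT t X (tgt \<A> k)" and e: "psh c \<gamma> = xadd X (tgt \<A> r) (psh c' \<delta>) (psh r \<tau>)"
    using r1 unfolding splice_rel_def by blast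
  obtain k2 r2 a d a' d' \<tau>2 where n: "conf_map j q k2 r2 (ide \<A> (src \<A> j)) a d" and n': "conf_map l m k2 r2 (ide \<A> (src \<A> j)) a' d'"
    and t2: "\<tau>2 \<in> EXT t X (tgt \<A> k2)" and e2: "psh d \<delta> = xadd X (tgt \<A> r2) (psh d' \<epsilon>) (psh r2 \<tau>2)"
    using r2 unfolding splice_rel_def by blast
  note M = conf_mapD[OF m] and M' = conf_mapD[OF m'] and N = conf_mapD[OF n] and N' = conf_mapD[OF n']
  note f = conflationD[OF M(1)] conflationD[OF M'(1)] conflationD[OF M(2)] conflationD[OF N'(1)] conflationD[OF N(2)]
  let ?Y = "src \<A> i"
  have s: "src \<A> j = ?Y" "src \<A> k = ?Y" "src \<A> k2 = ?Y" "src \<A> l = ?Y"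
    using M(5) M'(4,5) N(4,5) N'(4,5) f by simp_all
  obtain k3 r3 x x2 y y2 where o: "conf_map k r k3 r3 (ide \<A> ?Y) x y" and o2: "conf_map k2 r2 k3 r3 (ide \<A> ?Y) x2 y2"
    using conf_amalgam[OF M(2) N(2)] s by metis
  note O = conf_mapD[OF o] and O2 = conf_mapD[OF o2]
  note f3 = conflationD[OF O(2)]
  have Y: "?Y \<in> obj \<A>" using f by simp
  have c1: "conf_map i p k3 r3 (ide \<A> ?Y) (x \<cdot> b) (y \<cdot> c)" and c2: "conf_map l m k3 r3 (ide \<A> ?Y) (x2 \<cdot> a') (y2 \<cdot> d')"
    and c3: "conf_map j q k3 r3 (ide \<A> ?Y) (x \<cdot> b') (y \<cdot> c')" and c4: "conf_map j q k3 r3 (ide \<A> ?Y) (x2 \<cdot> a) (y2 \<cdot> d)"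
    using conf_map_cmp[OF m o] conf_map_cmp[OF n' o2[folded s(1)]] conf_map_cmp[OF m' o] conf_map_cmp[OF n o2[folded s(1)]] Y s
    by simp_all
  obtain u where u: "u \<in> arr \<A>" "src \<A> u = tgt \<A> q" "tgt \<A> u = tgt \<A> k3" "y \<cdot> c' = y2 \<cdot> d \<oplus> r3 \<cdot> u"
    by (rule conf_map_homotopy[OF c3 c4])
  let ?W = "tgt \<A> r3"
  have t0: "psh x \<tau> \<in> EXT t X (tgt \<A> k3)" and t1: "psh u \<delta> \<in> EXT t X (tgt \<A> k3)" and t2': "psh x2 \<tau>2 \<in> EXT t X (tgt \<A> k3)"
    using push_closed[OF t, of x] push_closed[OF g(2), of u] push_closed[OF t2, of x2] O O2 u f3 by simp_all
  have cl: "psh c' \<delta> \<in> EXT t X (tgt \<A> r)" "psh r \<tau> \<in> EXT t X (tgt \<A> r)" "psh d' \<epsilon> \<in> EXT t X (tgt \<A> r2)" "psh r2 \<tau>2 \<in> EXT t X (tgt \<A> r2)"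
    using push_closed[OF g(2), of c'] push_closed[OF t, of r] push_closed[OF g(3), of d'] push_closed[OF t2, of r2] M M' N N' f by simp_all
  have A: "psh (y2 \<cdot> d') \<epsilon> \<in> EXT t X ?W" "psh r3 (psh x \<tau>) \<in> EXT t X ?W" "psh r3 (psh u \<delta>) \<in> EXT t X ?W" "psh r3 (psh x2 \<tau>2) \<in> EXT t X ?W"
    using push_closed[OF g(3), of "y2 \<cdot> d'"] push_closed[OF t0, of r3] push_closed[OF t1, of r3] push_closed[OF t2', of r3]
      conf_mapD(9-11)[OF c2] f3 by simp_all
  have s1: "psh y (psh r \<tau>) = psh r3 (psh x \<tau>)"
    using push_push[OF t, of r y] push_push[OF t, of x r3] O f f3 by simp
  have s2: "psh y2 (psh r2 \<tau>2) = psh r3 (psh x2 \<tau>2)"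
    using push_push[OF t2, of r2 y2] push_push[OF t2, of x2 r3] O2 f f3 by simp
  have s3: "psh (y2 \<cdot> d) \<delta> = xadd X ?W (psh (y2 \<cdot> d') \<epsilon>) (psh r3 (psh x2 \<tau>2))"
    using push_push[OF g(2), of d y2] push_push[OF g(3), of d' y2] push_add[OF cl(3,4) X, of y2] e2 s2 O2 N N' f f3 by simp
  have s4: "psh (y \<cdot> c') \<delta> = xadd X ?W (psh (y2 \<cdot> d) \<delta>) (psh r3 (psh u \<delta>))"
    unfolding u(4) using push_hadd[OF g(2) X, of "y2 \<cdot> d" "r3 \<cdot> u"] push_push[OF g(2), of u r3] conf_mapD(9-11)[OF c4] u(1-3) f f3 by simp
  have "psh (y \<cdot> c) \<gamma> = psh y (psh c \<gamma>)" using push_push[OF g(1), of c y] M O f f3 by simp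
  also have "\<dots> = xadd X ?W (psh (y \<cdot> c') \<delta>) (psh r3 (psh x \<tau>))"
    unfolding e using push_add[OF cl(1,2) X, of y] push_push[OF g(2), of c' y] s1 M' O f f3 by simp
  \<comment> \<open>Three corrections accumulate: those of the two given relations and the class
    \<open>psh u \<delta>\<close> produced by the homotopy.\<close>
  also have "\<dots> = xadd X ?W (psh (y2 \<cdot> d') \<epsilon>) (xadd X ?W (xadd X ?W (psh r3 (psh x2 \<tau>2)) (psh r3 (psh u \<delta>))) (psh r3 (psh x \<tau>)))"
    unfolding s4 s3 using xadd_assoc[OF A(1,4,3) X] xadd_assoc[OF A(1) ext_add_closed[OF A(4,3) X] A(2) X] f3 by simp
  also have "xadd X ?W (xadd X ?W (psh r3 (psh x2 \<tau>2)) (psh r3 (psh u \<delta>))) (psh r3 (psh x \<tau>)) =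
      psh r3 (xadd X (tgt \<A> k3) (xadd X (tgt \<A> k3) (psh x2 \<tau>2) (psh u \<delta>)) (psh x \<tau>))"
    using push_add[OF t2' t1 X, of r3] push_add[OF ext_add_closed[OF t2' t1 X] t0 X, of r3] f3 by simp
  finally have "psh (y \<cdot> c) \<gamma> = xadd X ?W (psh (y2 \<cdot> d') \<epsilon>)
    (psh r3 (xadd X (tgt \<A> k3) (xadd X (tgt \<A> k3) (psh x2 \<tau>2) (psh u \<delta>)) (psh x \<tau>)))" .
  moreover have "xadd X (tgt \<A> k3) (xadd X (tgt \<A> k3) (psh x2 \<tau>2) (psh u \<delta>)) (psh x \<tau>) \<in> EXT t X (tgt \<A> k3)"
    using ext_add_closed[OF ext_add_closed[OF t2' t1 X] t0 X] f3 by simp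
  ultimately show ?thesis unfolding splice_rel_def using c1 c2 by blast
qed

text \<open>The product with a morphism is a pull-back and need not be literally a splice with
  \<open>(i, p)\<close>, so the first conflation of a representing sequence is only related to
  \<open>(i, p)\<close>. In positive degree the splice itself serves.\<close>

lemma splice_rel_decomp:
  assumes ip: "conflation \<A> \<C> i p" and g: "\<gamma> \<in> EXT t X (tgt \<A> p)" and X: "X \<in> \<C>"
  obtains s j q \<delta> where "yext \<A> \<C> (Suc t) X (src \<A> i) s" "ycls \<A> \<C> s = con i p \<gamma>" "decomp s j q \<delta>" "splice_rel t X j q \<delta> i p \<gamma>"
  using g
proof (cases rule: Ext_cases)
  case (Mor f)
  note c = conflationD[OF ip]
  obtain s where s: "yext \<A> \<C> (Suc 0) X (src \<A> i) s" "chain_map \<A> s [i, p] (ide \<A> (src \<A> i)) f" "pll (ycls \<A> \<C> [i, p]) f = ycls \<A> \<C> s"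
    by (rule pull_seqE[OF yext_conflation[OF ip], of f X]) (use Mor X in simp_all)
  obtain j q \<delta> where d: "decomp s j q \<delta>" using decomp_exists[OF s(1)] by blast
  note D = decompD[OF s(1) d] decomp_0[OF s(1) d]
  note k = conflationD[OF D(1)]
  have sj: "s = [j, q]" "\<delta> = Mor (ide \<A> X)" "tgt \<A> q = X" using D(5) by simp_all
  obtain b where "b \<in> arr \<A>" "src \<A> b = tgt \<A> j" "tgt \<A> b = tgt \<A> i" "b \<cdot> j = i" "f \<cdot> q = p \<cdot> b"
    using s(2) unfolding sj(1) using c k sj(3) D(2) by auto
  then have "conf_map j q i p (ide \<A> (src \<A> j)) b f"
    using ip D(1,2) c k Mor sj by (simp add: conf_map_def)
  then have "splice_rel t X j q \<delta> i p (psh f \<delta>)"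
    by (rule splice_rel_conf_map) (use D(3) X Mor in simp_all)
  then show thesis using that[of s j q \<delta>] s d Mor sj by simp
next
  case (Cls s)
  obtain k r where k: "s = k # r" using yext_front[OF Cls(3)] by auto
  have "decomp (i # hd s \<cdot> p # tl s) i p \<gamma>" unfolding decomp_def using ip Cls k by auto
  moreover have "splice_rel t X i p \<gamma> i p \<gamma>"
    using splice_rel_conf_map[OF conf_map_ide[OF ip] g X] push_ide[OF g] by simp
  ultimately show thesis
    using that yext_splice[OF ip Cls(3)] con_ycls[OF ip Cls(3)] Cls(2) by metis
qed

text \<open>Each step of a zigzag between representing sequences induces a morphism of their first
  conflations by \<open>decomp_step\<close>, hence stays within the relation. Here an equality of
  classes becomes an equation one degree lower.\<close>

lemma splice_rel_if_con_eq:
  assumes ip: "conflation \<A> \<C> i p" and jq: "conflation \<A> \<C> j q" and s: "src \<A> j = src \<A> i"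
    and g: "\<gamma> \<in> EXT t X (tgt \<A> p)" and d: "\<delta> \<in> EXT t X (tgt \<A> q)" and X: "X \<in> \<C>"
    and eq: "con i p \<gamma> = con j q \<delta>"
  shows "splice_rel t X i p \<gamma> j q \<delta>"
proof -
  let ?Y = "src \<A> i"
  obtain u i' p' \<gamma>' where u: "yext \<A> \<C> (Suc t) X ?Y u" "ycls \<A> \<C> u = con i p \<gamma>" "decomp u i' p' \<gamma>'" "splice_rel t X i' p' \<gamma>' i p \<gamma>"
    by (rule splice_rel_decomp[OF ip g X])
  obtain v j' q' \<delta>' where v: "yext \<A> \<C> (Suc t) X ?Y v" "ycls \<A> \<C> v = con j q \<delta>" "decomp v j' q' \<delta>'" "splice_rel t X j' q' \<delta>' j q \<delta>"
    by (rule splice_rel_decomp[OF jq d X]) (simp add: s)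
  have "(u, v) \<in> yequiv \<A> \<C>" using u v eq by (simp flip: ycls_eq_iff)
  \<comment> \<open>Quantifying over every decomposition of \<open>w\<close> makes the induction
    independent of the choice of a first conflation.\<close>
  let ?P = "\<lambda>w. \<forall>k r \<epsilon>. decomp w k r \<epsilon> \<longrightarrow> splice_rel t X i' p' \<gamma>' k r \<epsilon>"
  have step: "splice_rel t X k r \<epsilon> k' r' \<epsilon>'"
    if w: "yext \<A> \<C> (Suc t) X ?Y w" "yext \<A> \<C> (Suc t) X ?Y w'" "chain_map \<A> w w' (ide \<A> ?Y) (ide \<A> X)"
      "decomp w k r \<epsilon>" "decomp w' k' r' \<epsilon>'" for w w' k r \<epsilon> k' r' \<epsilon>'
  proof -
    obtain b c where "conf_map k r k' r' (ide \<A> ?Y) b c" "psh c \<epsilon> = \<epsilon>'" using decomp_step[OF w] by blast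
    then show ?thesis using splice_rel_conf_map[of k r k' r' b c \<epsilon> t X] decompD[OF w(1,4)] X by simp
  qed
  have "yext \<A> \<C> (Suc t) X ?Y v \<and> ?P v"
  proof (rule yequiv_induct[OF \<open>(u, v) \<in> yequiv \<A> \<C>\<close> u(1)])
    show "?P u" using step[OF u(1) u(1) yext_chain_map_refl[OF u(1)] u(3)] by blast
    fix w w' assume w: "yext \<A> \<C> (Suc t) X ?Y w" "yext \<A> \<C> (Suc t) X ?Y w'" "chain_map \<A> w w' (ide \<A> ?Y) (ide \<A> X)"
    show "?P w \<longleftrightarrow> ?P w'"
    proof (intro iffI allI impI)
      fix k r \<epsilon> assume P: "?P w" and d: "decomp w' k r \<epsilon>"
      obtain k' r' \<epsilon>' where d': "decomp w k' r' \<epsilon>'" using decomp_exists[OF w(1)] by blast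
      then show "splice_rel t X i' p' \<gamma>' k r \<epsilon>"
        using splice_rel_trans[OF _ step[OF w d' d] decompD(3)[OF u(1,3)] decompD(3)[OF w(1) d'] decompD(3)[OF w(2) d] X] P by blast
    next
      fix k r \<epsilon> assume P: "?P w'" and d: "decomp w k r \<epsilon>"
      obtain k' r' \<epsilon>' where d': "decomp w' k' r' \<epsilon>'" using decomp_exists[OF w(2)] by blast
      have "splice_rel t X k' r' \<epsilon>' k r \<epsilon>"
        by (rule splice_rel_sym[OF step[OF w d d'] decompD(3)[OF w(1) d] decompD(3)[OF w(2) d'] X])
      then show "splice_rel t X i' p' \<gamma>' k r \<epsilon>"
        using splice_rel_trans[OF _ _ decompD(3)[OF u(1,3)] decompD(3)[OF w(2) d'] decompD(3)[OF w(1) d] X] P d' by blast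
    qed
  qed
  then have "splice_rel t X i' p' \<gamma>' j' q' \<delta>'" using v(3) by blast
  moreover have "splice_rel t X i p \<gamma> i' p' \<gamma>'" by (rule splice_rel_sym[OF u(4) decompD(3)[OF u(1,3)] g X])
  ultimately have "splice_rel t X i p \<gamma> j' q' \<delta>'"
    using splice_rel_trans[OF _ _ g decompD(3)[OF u(1,3)] decompD(3)[OF v(1,3)] X] by blast
  then show ?thesis by (rule splice_rel_trans[OF _ v(4) g decompD(3)[OF v(1,3)] d X])
qed

text \<open>Comparing the product of \<open>\<gamma>\<close> with that of zero gives an enlargement
  over which the images of \<open>\<gamma>\<close> along \<open>c\<close> and of some
  \<open>\<tau>\<close> along \<open>r\<close> agree. The pair of \<open>\<tau>\<close> and
  \<open>\<gamma>\<close> is then killed by the deflation of \<open>conflation_cone\<close>, and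
  exactness in the middle, assumed for all conflations in degree \<open>t\<close>, lifts it. The
  second component of the lift is the claim.\<close>

lemma con_exact_step:
  assumes mid: "\<And>i p \<beta>. \<lbrakk>conflation \<A> \<C> i p; \<beta> \<in> EXT t X (tgt \<A> i); psh p \<beta> = xzero t X (tgt \<A> p)\<rbrakk> \<Longrightarrow>
      \<exists>\<alpha>\<in>EXT t X (src \<A> i). \<beta> = psh i \<alpha>"
    and ip: "conflation \<A> \<C> i p" and g: "\<gamma> \<in> EXT t X (tgt \<A> p)" and X: "X \<in> \<C>"
    and z: "con i p \<gamma> = xzero (Suc t) X (src \<A> i)"
  shows "\<exists>\<tau>\<in>EXT t X (tgt \<A> i). \<gamma> = psh p \<tau>"
proof -
  have "con i p \<gamma> = con i p (xzero t X (tgt \<A> p))" using z con_zero[OF ip X] by simp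
  then have "splice_rel t X i p \<gamma> i p (xzero t X (tgt \<A> p))"
    by (intro splice_rel_if_con_eq[OF ip ip]) (use g X conflationD[OF ip] in simp_all)
  then obtain k r b c b' c' \<tau> where m: "conf_map i p k r (ide \<A> (src \<A> i)) b c" and m': "conf_map i p k r (ide \<A> (src \<A> i)) b' c'"
    and t: "\<tau> \<in> EXT t X (tgt \<A> k)" and e: "psh c \<gamma> = xadd X (tgt \<A> r) (psh c' (xzero t X (tgt \<A> p))) (psh r \<tau>)"
    unfolding splice_rel_def by blast
  note d = conf_mapD[OF m] conf_mapD[OF m']
  note f = conflationD[OF d(1)] conflationD[OF d(2)]
  have pr: "psh r \<tau> \<in> EXT t X (tgt \<A> r)" using push_closed[OF t, of r] f by simp
  have e': "psh c \<gamma> = psh r \<tau>"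
    using e push_zero[of X c' "tgt \<A> p" t] xadd_zero(1)[OF pr X] X d f by simp
  let ?E = "tgt \<A> k" and ?W = "tgt \<A> p"
  let ?S = "bsum ?E ?W"
  let ?k = "inj1 \<A> ?E ?W \<cdot> b \<oplus> inj2 \<A> ?E ?W \<cdot> p" and ?n = "r \<cdot> proj1 \<A> ?E ?W \<oplus> hneg (c \<cdot> proj2 \<A> ?E ?W)"
  have k: "b \<cdot> i = k" using d f by simp
  have cone: "conflation \<A> \<C> ?k ?n" by (rule conflation_cone[OF d(1,2)]) (use d f k in simp_all)
  define \<theta> where "\<theta> = xadd X ?S (psh (inj1 \<A> ?E ?W) \<tau>) (psh (inj2 \<A> ?E ?W) \<gamma>)"
  have j: "psh (inj1 \<A> ?E ?W) \<tau> \<in> EXT t X ?S" "psh (inj2 \<A> ?E ?W) \<gamma> \<in> EXT t X ?S"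
    using push_closed[OF t, of "inj1 \<A> ?E ?W"] push_closed[OF g, of "inj2 \<A> ?E ?W"] f by simp_all
  have \<theta>: "\<theta> \<in> EXT t X ?S" unfolding \<theta>_def using ext_add_closed[OF j X] f by simp
  have p2: "psh (proj2 \<A> ?E ?W) \<theta> = \<gamma>"
    unfolding \<theta>_def using push_add[OF j X, of "proj2 \<A> ?E ?W"] push_push[OF t, of "inj1 \<A> ?E ?W" "proj2 \<A> ?E ?W"]
      push_push[OF g, of "inj2 \<A> ?E ?W" "proj2 \<A> ?E ?W"] push_ide[OF g] push_hzero[OF t X, of ?W] xadd_zero(1)[OF g X] f by simp
  have p1: "psh (proj1 \<A> ?E ?W) \<theta> = \<tau>"
    unfolding \<theta>_def using push_add[OF j X, of "proj1 \<A> ?E ?W"] push_push[OF t, of "inj1 \<A> ?E ?W" "proj1 \<A> ?E ?W"]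
      push_push[OF g, of "inj2 \<A> ?E ?W" "proj1 \<A> ?E ?W"] push_ide[OF t] push_hzero[OF g X, of ?E] xadd_zero(2)[OF t X] f by simp
  have "psh ?n \<theta> = xadd X (tgt \<A> r) (psh (r \<cdot> proj1 \<A> ?E ?W) \<theta>) (psh (hneg c \<cdot> proj2 \<A> ?E ?W) \<theta>)"
    using push_hadd[OF \<theta> X, of "r \<cdot> proj1 \<A> ?E ?W" "hneg (c \<cdot> proj2 \<A> ?E ?W)"] d f by simp
  also have "\<dots> = xadd X (tgt \<A> r) (psh r \<tau>) (psh (hneg c) \<gamma>)"
    using push_push[OF \<theta>, of "proj1 \<A> ?E ?W" r] push_push[OF \<theta>, of "proj2 \<A> ?E ?W" "hneg c"] p1 p2 d f by simp
  also have "\<dots> = xzero t X (tgt \<A> r)" using push_hneg[OF g X, of c] e' d f by simp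
  finally have "psh ?n \<theta> = xzero t X (tgt \<A> ?n)" using d f by simp
  then obtain \<rho> where \<rho>: "\<rho> \<in> EXT t X (src \<A> ?k)" "\<theta> = psh ?k \<rho>"
    using mid[OF cone, of \<theta>] \<theta> d f by auto
  have \<rho>': "\<rho> \<in> EXT t X (tgt \<A> i)" using \<rho> d f by simp
  have "\<gamma> = psh (proj2 \<A> ?E ?W) (psh ?k \<rho>)" using p2 \<rho> by simp
  also have "\<dots> = psh (proj2 \<A> ?E ?W \<cdot> ?k) \<rho>" by (rule push_push[OF \<rho>']) (use d f in simp_all)
  also have "proj2 \<A> ?E ?W \<cdot> ?k = p" using d f by simp
  finally show ?thesis using \<rho>' by blast
qed

text \<open>Exactness in the middle in degree \<open>t\<close> gives exactness at the next term by
  \<open>con_exact_step\<close>, and this gives the middle in degree \<open>t + 1\<close>. For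
  \<open>\<beta>\<close> a product of \<open>(j, q)\<close> with \<open>\<sigma>\<close>, its image
  along \<open>p\<close> is the product of \<open>\<sigma>\<close> with the Noether conflation; the
  vanishing of this lifts \<open>\<sigma>\<close> to the cokernel of \<open>j \<cdot> i\<close>,
  where it defines a class over the source of \<open>i\<close>.\<close>

lemma push_exact:
  assumes "conflation \<A> \<C> i p" "\<beta> \<in> EXT t X (tgt \<A> i)" "psh p \<beta> = xzero t X (tgt \<A> p)" "X \<in> \<C>"
  shows "\<exists>\<alpha>\<in>EXT t X (src \<A> i). \<beta> = psh i \<alpha>"
  using assms(1-3)
proof (induction t arbitrary: i p \<beta>)
  case 0
  note c = conflationD[OF 0(1)]
  obtain f where f: "\<beta> = Mor f" "f \<in> arr \<A>" "src \<A> f = X" "tgt \<A> f = tgt \<A> i" using 0(2) by (auto simp: Ext_0)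
  have "p \<cdot> f = hzero \<A> (src \<A> f) (tgt \<A> p)" using 0(3) f by (simp add: ext_zero_def)
  then obtain u where "u \<in> arr \<A>" "src \<A> u = X" "tgt \<A> u = src \<A> i" "i \<cdot> u = f"
    using conflation_lift[OF 0(1) f(2,4)] f(3) by metis
  then show ?case using f by (intro bexI[of _ "Mor u"]) (simp_all add: Ext_0)
next
  case (Suc t)
  obtain j q \<sigma> where j: "conflation \<A> \<C> j q" "src \<A> j = tgt \<A> i" "\<sigma> \<in> EXT t X (tgt \<A> q)" "\<beta> = con j q \<sigma>"
    by (rule con_surj[OF Suc.prems(2)])
  obtain u c w where u: "conflation \<A> \<C> (j \<cdot> i) u" "conflation \<A> \<C> c w" "src \<A> c = tgt \<A> p"
    "tgt \<A> c = tgt \<A> u" "src \<A> u = tgt \<A> j" "u \<cdot> j = c \<cdot> p" "w \<cdot> u = q" "tgt \<A> w = tgt \<A> q"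
    by (rule conflation_cmp[OF Suc.prems(1) j(1,2)])
  note f = conflationD[OF Suc.prems(1)] conflationD[OF j(1)] conflationD[OF u(1)] conflationD[OF u(2)]
  have m: "conf_map j q c w p u (ide \<A> (tgt \<A> q))" using j u f by (simp add: conf_map_def)
  have "con c w \<sigma> = xzero (Suc t) X (src \<A> c)"
    using con_natural[OF m j(3) assms(4)] push_ide[OF j(3)] Suc.prems(3) j u by simp
  then have "\<exists>\<tau>\<in>EXT t X (tgt \<A> c). \<sigma> = psh w \<tau>"
    by - (rule con_exact_step[OF _ u(2) _ assms(4)], erule (2) Suc.IH, use j(3) u(8) in simp_all)
  then obtain \<tau> where \<tau>: "\<tau> \<in> EXT t X (tgt \<A> c)" "\<sigma> = psh w \<tau>" by blast
  have m2: "conf_map (j \<cdot> i) u j q i (ide \<A> (tgt \<A> j)) w" using j u f by (simp add: conf_map_def)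
  have \<tau>': "\<tau> \<in> EXT t X (tgt \<A> u)" using \<tau> u by simp
  have "psh i (con (j \<cdot> i) u \<tau>) = \<beta>" using con_natural[OF m2 \<tau>' assms(4)] \<tau> j by simp
  moreover have "con (j \<cdot> i) u \<tau> \<in> EXT (Suc t) X (src \<A> i)" using con_closed[OF u(1) \<tau>' assms(4)] f j by simp
  ultimately show ?case by blast
qed

lemma con_exact:
  assumes "conflation \<A> \<C> i p" "\<gamma> \<in> EXT t X (tgt \<A> p)" "X \<in> \<C>" "con i p \<gamma> = xzero (Suc t) X (src \<A> i)"
  shows "\<exists>\<tau>\<in>EXT t X (tgt \<A> i). \<gamma> = psh p \<tau>"
  using con_exact_step[OF push_exact[OF _ _ _ assms(3)] assms] .

end

section \<open>Exactness in the first variable\<close>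

context exact_subcategory begin

lemma xadd_cancel:
  assumes "xadd X Y \<gamma> \<epsilon> = xadd X Y \<delta> \<epsilon>" "\<gamma> \<in> EXT t X Y" "\<delta> \<in> EXT t X Y" "\<epsilon> \<in> EXT t X Y" "X \<in> \<C>" "Y \<in> \<C>"
  shows "\<gamma> = \<delta>"
proof -
  interpret comm_group "xgrp t X Y" using Ext_comm_group assms by simp
  show ?thesis using right_cancel[of \<epsilon> \<gamma> \<delta>] assms by (simp add: Ext_group_def)
qed

text \<open>Write \<open>\<gamma>\<close> as the product of \<open>(j, q)\<close> with
  \<open>\<sigma>\<close>. Pushing \<open>(j, q)\<close> out along \<open>i\<close> makes the
  product vanish and lifts \<open>\<sigma>\<close> to a class over the push-out object; the image of
  this class over \<open>tgt \<A> p\<close> is, up to sign, the preimage sought.\<close>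

lemma push_inflation_exact:
  assumes ip: "conflation \<A> \<C> i p" and g: "\<gamma> \<in> EXT (Suc t) X (src \<A> i)" and X: "X \<in> \<C>"
    and z: "psh i \<gamma> = xzero (Suc t) X (tgt \<A> i)"
  shows "\<exists>\<beta>\<in>EXT t X (tgt \<A> p). \<gamma> = con i p \<beta>"
proof -
  obtain j q \<sigma> where j: "conflation \<A> \<C> j q" "src \<A> j = src \<A> i" "\<sigma> \<in> EXT t X (tgt \<A> q)" "\<gamma> = con j q \<sigma>"
    by (rule con_surj[OF g])
  note f = conflationD[OF ip] conflationD[OF j(1)]
  obtain k r u where k: "conflation \<A> \<C> k r" "pushout_square \<A> j i u k" "r \<cdot> u = q" "tgt \<A> r = tgt \<A> q"
    using pushout_conflation[OF j(1), of i] f j by metis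
  note po = pushout_squareD[OF k(2)] and fk = conflationD[OF k(1)]
  have "conf_map j q k r i u (ide \<A> (tgt \<A> q))" using j k po f fk by (simp add: conf_map_def)
  then have "con k r \<sigma> = psh i \<gamma>" using con_natural[OF _ j(3) X] push_ide[OF j(3)] j by simp
  then have "con k r \<sigma> = xzero (Suc t) X (src \<A> k)" using z po by simp
  then obtain \<tau> where \<tau>: "\<tau> \<in> EXT t X (tgt \<A> k)" "\<sigma> = psh r \<tau>"
    using con_exact[OF k(1), of \<sigma> t X] j k X by auto
  \<comment> \<open>The push-out object of the two inflations has two projections, \<open>r\<close>
    onto the cokernel of \<open>j\<close> and \<open>v\<close> onto the cokernel of
    \<open>i\<close>.\<close>
  obtain v where v: "v \<in> arr \<A>" "src \<A> v = tgt \<A> u" "tgt \<A> v = tgt \<A> p" "v \<cdot> u = hzero \<A> (tgt \<A> j) (tgt \<A> p)" "v \<cdot> k = p"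
    using pushout_desc[OF k(2), of "hzero \<A> (tgt \<A> j) (tgt \<A> p)" p] f j by auto
  obtain l m e e' c c' where a: "conf_map j q l m (ide \<A> (src \<A> j)) e c" "conf_map i p l m (ide \<A> (src \<A> j)) e' c'"
    using conf_amalgam[OF j(1) ip] j(2) by metis
  have a2: "conf_map i p l m (ide \<A> (src \<A> i)) e' c'" using a(2) j(2) by simp
  note d = conf_mapD[OF a(1)] conf_mapD[OF a2]
  note fl = conflationD[OF d(2)]
  obtain w where w: "w \<in> arr \<A>" "src \<A> w = tgt \<A> u" "tgt \<A> w = tgt \<A> l" "w \<cdot> u = e" "w \<cdot> k = e'"
    using pushout_desc[OF k(2), of e e'] d f j fl by auto
  \<comment> \<open>Over the amalgam of \<open>(j, q)\<close> and \<open>(i, p)\<close> the sum of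
    the two projections factors through \<open>m\<close>, so the sum of the two images of
    \<open>\<tau>\<close> has product zero with \<open>(l, m)\<close>.\<close>
  have mw: "m \<cdot> w = c \<cdot> r \<oplus> c' \<cdot> v"
  proof (rule pushout_cancel[OF k(2)])
    show "m \<cdot> w \<cdot> u = (c \<cdot> r \<oplus> c' \<cdot> v) \<cdot> u" "m \<cdot> w \<cdot> k = (c \<cdot> r \<oplus> c' \<cdot> v) \<cdot> k"
      using d w v k(3,4) po fk fl f by simp_all
  qed (use d w v k(3,4) po fk fl f in simp_all)
  have vt: "psh v \<tau> \<in> EXT t X (tgt \<A> p)" using push_closed[OF \<tau>(1), of v] v po f by simp
  have wt: "psh w \<tau> \<in> EXT t X (tgt \<A> l)" using push_closed[OF \<tau>(1), of w] w po fl by simp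
  have cl: "psh c \<sigma> \<in> EXT t X (tgt \<A> m)" "psh c' (psh v \<tau>) \<in> EXT t X (tgt \<A> m)"
    using push_closed[OF j(3), of c] push_closed[OF vt, of c'] d fl by simp_all
  have "psh m (psh w \<tau>) = psh (m \<cdot> w) \<tau>" using push_push[OF \<tau>(1), of w m] w po fl by simp
  also have "\<dots> = xadd X (tgt \<A> m) (psh c \<sigma>) (psh c' (psh v \<tau>))"
    unfolding mw \<tau>(2) using push_hadd[OF \<tau>(1) X, of "c \<cdot> r" "c' \<cdot> v"] push_push[OF \<tau>(1), of r c] push_push[OF \<tau>(1), of v c']
      d v k(3,4) po fk fl f by simp
  finally have "xadd X (src \<A> l) (con l m (psh c \<sigma>)) (con l m (psh c' (psh v \<tau>))) = xzero (Suc t) X (src \<A> l)"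
    using ext_add_con[OF d(2) cl X] con_push_self[OF d(2) wt X] by simp
  then have *: "xadd X (src \<A> i) \<gamma> (con i p (psh v \<tau>)) = xzero (Suc t) X (src \<A> i)"
    using con_amalgam(1)[OF a(1) j(3) X] con_amalgam(1)[OF a2 vt X] j d f by simp
  obtain \<delta> where \<delta>: "\<delta> \<in> EXT t X (tgt \<A> p)" "xadd X (tgt \<A> p) \<delta> (psh v \<tau>) = xzero t X (tgt \<A> p)"
    using xneg_exists[OF vt X] f by metis
  have "xadd X (src \<A> i) (con i p \<delta>) (con i p (psh v \<tau>)) = xzero (Suc t) X (src \<A> i)"
    using ext_add_con[OF ip \<delta>(1) vt X] \<delta>(2) con_zero[OF ip X] by simp
  then have "\<gamma> = con i p \<delta>"
    using xadd_cancel[of X "src \<A> i" \<gamma> "con i p (psh v \<tau>)" "con i p \<delta>" "Suc t"] * g con_closed[OF ip \<delta>(1) X] con_closed[OF ip vt X] X f by simp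
  then show ?thesis using \<delta> by blast
qed

text \<open>A class of positive degree over the middle term is killed by the first inflation of a
  sequence representing it; composing that inflation with \<open>i\<close> enlarges the conflation
  accordingly.\<close>

lemma efface:
  assumes ip: "conflation \<A> \<C> i p" and m: "\<mu> \<in> EXT (Suc t) X (tgt \<A> i)" and X: "X \<in> \<C>"
  obtains k r b c where "conf_map i p k r (ide \<A> (src \<A> i)) b c" "psh b \<mu> = xzero (Suc t) X (tgt \<A> k)"
proof -
  obtain j q \<nu> where j: "conflation \<A> \<C> j q" "src \<A> j = tgt \<A> i" "\<nu> \<in> EXT t X (tgt \<A> q)" "\<mu> = con j q \<nu>"
    by (rule con_surj[OF m])
  obtain u c w where u: "conflation \<A> \<C> (j \<cdot> i) u" "conflation \<A> \<C> c w" "src \<A> c = tgt \<A> p"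
    "tgt \<A> c = tgt \<A> u" "src \<A> u = tgt \<A> j" "u \<cdot> j = c \<cdot> p"
    by (rule conflation_cmp[OF ip j(1,2)])
  note f = conflationD[OF ip] conflationD[OF j(1)] conflationD[OF u(1)] conflationD[OF u(2)]
  have "conf_map i p (j \<cdot> i) u (ide \<A> (src \<A> i)) j c" using ip j u f by (simp add: conf_map_def)
  moreover have "psh j \<mu> = xzero (Suc t) X (tgt \<A> (j \<cdot> i))" using push_con_self[OF j(1,3) X] j f by simp
  ultimately show thesis by (rule that)
qed

text \<open>The connecting morphism of a conflation \<open>(k, p)\<close> in the first variable: the Yoneda product of
  an element of \<open>Ext\<^sup>t(src k, Y)\<close> with \<open>(k, p)\<close>. By \<open>rcon_con'\<close> below, the choice made by
  \<open>SOME\<close> does not matter.\<close>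

fun rcon :: "'b \<Rightarrow> 'b \<Rightarrow> nat \<Rightarrow> 'a \<Rightarrow> 'b ext \<Rightarrow> 'b ext" where
  "rcon k p 0 Y \<gamma> = psh (case \<gamma> of Mor g \<Rightarrow> g) (ycls \<A> \<C> [k, p])"
| "rcon k p (Suc t) Y \<gamma> =
     (case SOME (i, q, \<rho>). conflation \<A> \<C> i q \<and> src \<A> i = Y \<and> \<rho> \<in> EXT t (src \<A> k) (tgt \<A> q) \<and> \<gamma> = con i q \<rho>
      of (i, q, \<rho>) \<Rightarrow> con i q (rcon k p t (tgt \<A> q) \<rho>))"

lemma ycls_conflation:
  assumes ip: "conflation \<A> \<C> i p"
  shows "ycls \<A> \<C> [i, p] \<in> EXT (Suc 0) (tgt \<A> p) (src \<A> i)" "ycls \<A> \<C> [i, p] = con i p (Mor (ide \<A> (tgt \<A> p)))"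
proof -
  show *: "ycls \<A> \<C> [i, p] \<in> EXT (Suc 0) (tgt \<A> p) (src \<A> i)"
    using yext_conflation[OF ip] by (auto simp: Ext_pos)
  show "ycls \<A> \<C> [i, p] = con i p (Mor (ide \<A> (tgt \<A> p)))" using pull_ide[OF *] by simp
qed

section \<open>The long exact sequence of a fixed conflation in the first variable\<close>

context
  fixes k p assumes kp: "conflation \<A> \<C> k p"
begin


text \<open>These are the properties in degree \<open>t\<close> from which independence of the
  chosen presentation in degree \<open>t + 1\<close> follows; they pass through the induction
  together.\<close>

definition rcon_additive :: "nat \<Rightarrow> bool" where
  "rcon_additive t \<longleftrightarrow>
     (\<forall>Y\<in>\<C>. \<forall>\<gamma>\<in>EXT t (src \<A> k) Y. rcon k p t Y \<gamma> \<in> EXT (Suc t) (tgt \<A> p) Y) \<and>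
     (\<forall>Y\<in>\<C>. \<forall>\<gamma>\<in>EXT t (src \<A> k) Y. \<forall>\<delta>\<in>EXT t (src \<A> k) Y. rcon k p t Y (xadd (src \<A> k) Y \<gamma> \<delta>) = xadd (tgt \<A> p) Y (rcon k p t Y \<gamma>) (rcon k p t Y \<delta>)) \<and>
     (\<forall>Y\<in>\<C>. \<forall>\<gamma>\<in>EXT t (src \<A> k) Y. \<forall>g\<in>arr \<A>. src \<A> g = Y \<longrightarrow> tgt \<A> g \<in> \<C> \<longrightarrow>
        rcon k p t (tgt \<A> g) (psh g \<gamma>) = psh g (rcon k p t Y \<gamma>))"

lemma K_closed [simp]: "src \<A> k \<in> \<C>" "tgt \<A> p \<in> \<C>" "tgt \<A> k \<in> \<C>"
  using conflationD[OF kp] by simp_all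

lemma rcon_additive_0: "rcon_additive 0"
proof -
  note y = ycls_conflation(1)[OF kp]
  have cl: "psh g (ycls \<A> \<C> [k, p]) \<in> EXT (Suc 0) (tgt \<A> p) (tgt \<A> g)"
    if "g \<in> arr \<A>" "src \<A> g = (src \<A> k)" "tgt \<A> g \<in> \<C>" for g
    by (rule push_closed[OF y that])
  have p: "psh (g' \<cdot> g) (ycls \<A> \<C> [k, p]) = psh g' (psh g (ycls \<A> \<C> [k, p]))"
    if "g \<in> arr \<A>" "src \<A> g = (src \<A> k)" "g' \<in> arr \<A>" "src \<A> g' = tgt \<A> g" "tgt \<A> g \<in> \<C>" "tgt \<A> g' \<in> \<C>" for g g'
    using push_push[OF y that] by simp
  show ?thesis
    unfolding rcon_additive_def
    using cl p push_hadd[OF y] by (auto simp: Ext_0)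
qed

context
  fixes t assumes ra: "rcon_additive t"
begin

lemma rcon_closed': "\<gamma> \<in> EXT t (src \<A> k) Y \<Longrightarrow> Y \<in> \<C> \<Longrightarrow> rcon k p t Y \<gamma> \<in> EXT (Suc t) (tgt \<A> p) Y"
  using ra by (simp add: rcon_additive_def)

lemma rcon_add': "\<lbrakk>\<gamma> \<in> EXT t (src \<A> k) Y; \<delta> \<in> EXT t (src \<A> k) Y; Y \<in> \<C>\<rbrakk> \<Longrightarrow>
    rcon k p t Y (xadd (src \<A> k) Y \<gamma> \<delta>) = xadd (tgt \<A> p) Y (rcon k p t Y \<gamma>) (rcon k p t Y \<delta>)"
  using ra by (simp add: rcon_additive_def)

lemma rcon_push': "\<lbrakk>\<gamma> \<in> EXT t (src \<A> k) Y; Y \<in> \<C>; g \<in> arr \<A>; src \<A> g = Y; tgt \<A> g \<in> \<C>\<rbrakk> \<Longrightarrow>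
    rcon k p t (tgt \<A> g) (psh g \<gamma>) = psh g (rcon k p t Y \<gamma>)"
  using ra by (simp add: rcon_additive_def)

text \<open>Two presentations of one class are related by \<open>splice_rel\<close>. The map of
  degree \<open>t\<close> is applied to this relation, and the product with the enlarged conflation
  then removes the correction, since it becomes a composite of consecutive maps.\<close>

lemma rcon_con':
  assumes ip: "conflation \<A> \<C> i q" and g: "\<rho> \<in> EXT t (src \<A> k) (tgt \<A> q)"
  shows "rcon k p (Suc t) (src \<A> i) (con i q \<rho>) = con i q (rcon k p t (tgt \<A> q) \<rho>)"
proof -
  let ?P = "\<lambda>(i', q', \<rho>'). conflation \<A> \<C> i' q' \<and> src \<A> i' = src \<A> i \<and> \<rho>' \<in> EXT t (src \<A> k) (tgt \<A> q') \<and> con i q \<rho> = con i' q' \<rho>'"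
  have "?P (i, q, \<rho>)" using ip g by simp
  then have "?P (SOME x. ?P x)" by (rule someI)
  moreover obtain i' q' \<rho>' where s: "(SOME x. ?P x) = (i', q', \<rho>')" by (rule prod_cases3)
  ultimately have j: "conflation \<A> \<C> i' q'" "src \<A> i' = src \<A> i" "\<rho>' \<in> EXT t (src \<A> k) (tgt \<A> q')" "con i q \<rho> = con i' q' \<rho>'"
    by simp_all
  have "splice_rel t (src \<A> k) i q \<rho> i' q' \<rho>'" by (rule splice_rel_if_con_eq[OF ip j(1,2) g j(3) _ j(4)]) simp
  then obtain l m b c b' c' \<tau> where m: "conf_map i q l m (ide \<A> (src \<A> i)) b c" and m': "conf_map i' q' l m (ide \<A> (src \<A> i)) b' c'"
    and t: "\<tau> \<in> EXT t (src \<A> k) (tgt \<A> l)" and e: "psh c \<rho> = xadd (src \<A> k) (tgt \<A> m) (psh c' \<rho>') (psh m \<tau>)"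
    unfolding splice_rel_def by blast
  have m2: "conf_map i' q' l m (ide \<A> (src \<A> i')) b' c'" using m' j by simp
  note d = conf_mapD[OF m] conf_mapD[OF m2]
  note f = conflationD[OF d(1)] conflationD[OF d(2)] conflationD[OF d(14)]
  have cl: "psh c' \<rho>' \<in> EXT t (src \<A> k) (tgt \<A> m)" "psh m \<tau> \<in> EXT t (src \<A> k) (tgt \<A> m)"
    using push_closed[OF j(3), of c'] push_closed[OF t, of m] d f by simp_all
  have r: "rcon k p t (tgt \<A> q) \<rho> \<in> EXT (Suc t) (tgt \<A> p) (tgt \<A> q)" "rcon k p t (tgt \<A> q') \<rho>' \<in> EXT (Suc t) (tgt \<A> p) (tgt \<A> q')"
    "rcon k p t (tgt \<A> l) \<tau> \<in> EXT (Suc t) (tgt \<A> p) (tgt \<A> l)"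
    using rcon_closed' g j(3) t f by simp_all
  have cl': "psh c' (rcon k p t (tgt \<A> q') \<rho>') \<in> EXT (Suc t) (tgt \<A> p) (tgt \<A> m)" "psh m (rcon k p t (tgt \<A> l) \<tau>) \<in> EXT (Suc t) (tgt \<A> p) (tgt \<A> m)"
    using push_closed[OF r(2), of c'] push_closed[OF r(3), of m] d f by simp_all
  have "con i q (rcon k p t (tgt \<A> q) \<rho>) = con l m (psh c (rcon k p t (tgt \<A> q) \<rho>))"
    by (rule con_amalgam(1)[OF m r(1)]) simp
  also have "psh c (rcon k p t (tgt \<A> q) \<rho>) = rcon k p t (tgt \<A> m) (psh c \<rho>)"
    using rcon_push'[OF g, of c] d f by simp
  also have "\<dots> = xadd (tgt \<A> p) (tgt \<A> m) (psh c' (rcon k p t (tgt \<A> q') \<rho>')) (psh m (rcon k p t (tgt \<A> l) \<tau>))"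
    unfolding e using rcon_add'[OF cl] rcon_push'[OF j(3), of c'] rcon_push'[OF t, of m] d f by simp
  also have "con l m \<dots> = xadd (tgt \<A> p) (src \<A> l) (con l m (psh c' (rcon k p t (tgt \<A> q') \<rho>'))) (con l m (psh m (rcon k p t (tgt \<A> l) \<tau>)))"
    using ext_add_con[OF d(2) cl'] by simp
  also have "\<dots> = con i' q' (rcon k p t (tgt \<A> q') \<rho>')"
    using con_push_self[OF d(2) r(3)] con_amalgam(1)[OF m2 r(2)] xadd_zero(2)[OF con_closed[OF j(1) r(2)]] d f j by simp
  finally show ?thesis using s by simp
qed

lemma rcon_additive_Suc: "rcon_additive (Suc t)"
proof -
  have 1: "rcon k p (Suc t) Y \<gamma> \<in> EXT (Suc (Suc t)) (tgt \<A> p) Y" if Y: "Y \<in> \<C>" and g: "\<gamma> \<in> EXT (Suc t) (src \<A> k) Y" for Y \<gamma>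
  proof -
    obtain i q \<rho> where j: "conflation \<A> \<C> i q" "src \<A> i = Y" "\<rho> \<in> EXT t (src \<A> k) (tgt \<A> q)" "\<gamma> = con i q \<rho>"
      by (rule con_surj[OF g])
    show ?thesis
      using con_closed[OF j(1) rcon_closed'[OF j(3)]] rcon_con'[OF j(1,3)] conflationD[OF j(1)] j by simp
  qed
  have 2: "rcon k p (Suc t) Y (xadd (src \<A> k) Y \<gamma> \<delta>) = xadd (tgt \<A> p) Y (rcon k p (Suc t) Y \<gamma>) (rcon k p (Suc t) Y \<delta>)"
    if Y: "Y \<in> \<C>" and g: "\<gamma> \<in> EXT (Suc t) (src \<A> k) Y" "\<delta> \<in> EXT (Suc t) (src \<A> k) Y" for Y \<gamma> \<delta>
  proof -
    obtain i q \<rho> \<rho>' where j: "conflation \<A> \<C> i q" "src \<A> i = Y" "\<rho> \<in> EXT t (src \<A> k) (tgt \<A> q)" "\<rho>' \<in> EXT t (src \<A> k) (tgt \<A> q)"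
      "\<gamma> = con i q \<rho>" "\<delta> = con i q \<rho>'"
      by (rule con_surj2[OF g]) simp
    note f = conflationD[OF j(1)]
    have s: "xadd (src \<A> k) (tgt \<A> q) \<rho> \<rho>' \<in> EXT t (src \<A> k) (tgt \<A> q)" using ext_add_closed[OF j(3,4)] f by simp
    have "rcon k p (Suc t) Y (xadd (src \<A> k) Y \<gamma> \<delta>) = con i q (rcon k p t (tgt \<A> q) (xadd (src \<A> k) (tgt \<A> q) \<rho> \<rho>'))"
      using ext_add_con[OF j(1,3,4)] rcon_con'[OF j(1) s] j by simp
    also have "\<dots> = xadd (tgt \<A> p) (src \<A> i) (con i q (rcon k p t (tgt \<A> q) \<rho>)) (con i q (rcon k p t (tgt \<A> q) \<rho>'))"
      using rcon_add'[OF j(3,4)] ext_add_con[OF j(1) rcon_closed'[OF j(3)] rcon_closed'[OF j(4)]] f by simp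
    finally show ?thesis using rcon_con'[OF j(1,3)] rcon_con'[OF j(1,4)] j by simp
  qed
  have 3: "rcon k p (Suc t) (tgt \<A> g) (psh g \<gamma>) = psh g (rcon k p (Suc t) Y \<gamma>)"
    if Y: "Y \<in> \<C>" and ga: "\<gamma> \<in> EXT (Suc t) (src \<A> k) Y" and g: "g \<in> arr \<A>" "src \<A> g = Y" "tgt \<A> g \<in> \<C>" for Y \<gamma> g
  proof -
    obtain i q \<rho> where j: "conflation \<A> \<C> i q" "src \<A> i = Y" "\<rho> \<in> EXT t (src \<A> k) (tgt \<A> q)" "\<gamma> = con i q \<rho>"
      by (rule con_surj[OF ga])
    obtain l u m where m: "conf_map i q l m g u (ide \<A> (tgt \<A> q))" "src \<A> l = tgt \<A> g" "tgt \<A> m = tgt \<A> q"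
      by (rule conf_map_pushout[OF j(1), of g]) (use g j in simp_all)
    note f = conflationD[OF j(1)]
    have r: "rcon k p t (tgt \<A> q) \<rho> \<in> EXT (Suc t) (tgt \<A> p) (tgt \<A> q)" using rcon_closed'[OF j(3)] f by simp
    have "psh g \<gamma> = con l m \<rho>" using con_natural[OF m(1) j(3)] push_ide[OF j(3)] j by simp
    then have "rcon k p (Suc t) (tgt \<A> g) (psh g \<gamma>) = con l m (rcon k p t (tgt \<A> q) \<rho>)"
      using rcon_con'[OF conf_mapD(2)[OF m(1)], of \<rho>] j m by simp
    also have "\<dots> = psh g (con i q (rcon k p t (tgt \<A> q) \<rho>))"
      using con_natural[OF m(1) r] push_ide[OF r] by simp
    finally show ?thesis using rcon_con'[OF j(1,3)] j by simp
  qed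
  show ?thesis unfolding rcon_additive_def using 1 2 3 by (intro conjI ballI impI) simp_all
qed

end

lemma rcon_additive: "rcon_additive t"
  by (induction t) (simp_all add: rcon_additive_0 rcon_additive_Suc)

lemmas rcon_closed = rcon_closed'[OF rcon_additive]
  and rcon_add = rcon_add'[OF rcon_additive]
  and rcon_push = rcon_push'[OF rcon_additive]
  and rcon_con = rcon_con'[OF rcon_additive]

lemma rcon_zero: "Y \<in> \<C> \<Longrightarrow> rcon k p t Y (xzero t (src \<A> k) Y) = xzero (Suc t) (tgt \<A> p) Y"
proof -
  assume Y: "Y \<in> \<C>"
  note z = xzero_closed[OF K_closed(1) Y, of t]
  have "xadd (tgt \<A> p) Y (rcon k p t Y (xzero t (src \<A> k) Y)) (rcon k p t Y (xzero t (src \<A> k) Y)) = rcon k p t Y (xzero t (src \<A> k) Y)"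
    using rcon_add[OF z z Y] xadd_zero[OF z K_closed(1) Y] by simp
  then show ?thesis using idem_zero'[OF Ext_additive rcon_closed[OF z Y]] Y by simp
qed

text \<open>Shifting along \<open>con\<close> leads down to degree 0, where the claim is
  \<open>push_con_self\<close> for \<open>(k, p)\<close>.\<close>

lemma rcon_pull_self:
  "\<tau> \<in> EXT t (tgt \<A> k) Y \<Longrightarrow> Y \<in> \<C> \<Longrightarrow> rcon k p t Y (pll \<tau> k) = xzero (Suc t) (tgt \<A> p) Y"
proof (induction t arbitrary: Y \<tau>)
  case 0
  note c = conflationD[OF kp]
  note y = ycls_conflation[OF kp]
  obtain m where m: "\<tau> = Mor m" "m \<in> arr \<A>" "src \<A> m = tgt \<A> k" "tgt \<A> m = Y" using 0 by (auto simp: Ext_0)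
  have e: "Mor (ide \<A> (tgt \<A> p)) \<in> EXT 0 (tgt \<A> p) (tgt \<A> p)" using c by (simp add: Ext_0)
  have "psh (m \<cdot> k) (ycls \<A> \<C> [k, p]) = psh m (psh k (ycls \<A> \<C> [k, p]))"
    using push_push[OF y(1), of k m] m c 0 by simp
  also have "psh k (ycls \<A> \<C> [k, p]) = xzero (Suc 0) (tgt \<A> p) (tgt \<A> k)"
    unfolding y(2) by (rule push_con_self[OF kp e]) simp
  also have "psh m \<dots> = xzero (Suc 0) (tgt \<A> p) Y" using push_zero[of "tgt \<A> p" m "tgt \<A> k" "Suc 0"] m 0 by simp
  finally show ?case using m by simp
next
  case (Suc t)
  obtain i q \<rho> where j: "conflation \<A> \<C> i q" "src \<A> i = Y" "\<rho> \<in> EXT t (tgt \<A> k) (tgt \<A> q)" "\<tau> = con i q \<rho>"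
    by (rule con_surj[OF Suc.prems(1)])
  note c = conflationD[OF kp] conflationD[OF j(1)]
  have r: "pll \<rho> k \<in> EXT t (src \<A> k) (tgt \<A> q)" using pull_closed[OF j(3), of k] c by simp
  have "rcon k p (Suc t) Y (pll \<tau> k) = con i q (rcon k p t (tgt \<A> q) (pll \<rho> k))"
    using con_pull[OF j(1,3), of k] rcon_con[OF j(1) r] j c by simp
  then show ?case using Suc.IH[OF j(3)] con_zero[OF j(1), of "tgt \<A> p" "Suc t"] j c by simp
qed

text \<open>In degree 0 the push-out of \<open>(k, p)\<close> along the morphism splits, and its
  retraction extends the morphism over \<open>k\<close>. In the inductive step the
  \<open>rcon\<close> image of the second factor \<open>\<rho>\<close> comes from a class
  \<open>\<mu>\<close> over the middle term; enlarging the conflation until \<open>\<mu>\<close>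
  dies makes the induction hypothesis applicable to the push-out of \<open>\<rho>\<close>.\<close>

lemma rcon_exact:
  "\<lbrakk>\<gamma> \<in> EXT t (src \<A> k) Y; Y \<in> \<C>; rcon k p t Y \<gamma> = xzero (Suc t) (tgt \<A> p) Y\<rbrakk> \<Longrightarrow> \<exists>\<tau>\<in>EXT t (tgt \<A> k) Y. \<gamma> = pll \<tau> k"
proof (induction t arbitrary: Y \<gamma>)
  case 0
  note c = conflationD[OF kp]
  note y = ycls_conflation[OF kp]
  obtain g where g: "\<gamma> = Mor g" "g \<in> arr \<A>" "src \<A> g = (src \<A> k)" "tgt \<A> g = Y" using 0 by (auto simp: Ext_0)
  obtain j u q where m: "conf_map k p j q g u (ide \<A> (tgt \<A> p))" "src \<A> j = tgt \<A> g" "tgt \<A> q = (tgt \<A> p)"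
    by (rule conf_map_pushout[OF kp, of g]) (use g 0 in simp_all)
  note d = conf_mapD[OF m(1)]
  note f = conflationD[OF d(2)]
  have e: "Mor (ide \<A> (tgt \<A> p)) \<in> EXT 0 (tgt \<A> p) (tgt \<A> p)" using c by (simp add: Ext_0)
  have "con j q (Mor (ide \<A> (tgt \<A> p))) = psh g (ycls \<A> \<C> [k, p])"
    unfolding y(2) using con_natural[OF m(1) e] c by simp
  then have "con j q (Mor (ide \<A> (tgt \<A> p))) = xzero (Suc 0) (tgt \<A> p) (src \<A> j)" using 0(3) g m by simp
  then obtain \<tau> where "\<tau> \<in> EXT 0 (tgt \<A> p) (tgt \<A> j)" "Mor (ide \<A> (tgt \<A> p)) = psh q \<tau>"
    using con_exact[OF d(2), of "Mor (ide \<A> (tgt \<A> p))" 0 "tgt \<A> p"] e m by auto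
  then obtain s where s: "s \<in> arr \<A>" "src \<A> s = (tgt \<A> p)" "tgt \<A> s = tgt \<A> j" "q \<cdot> s = ide \<A> (tgt \<A> p)"
    by (auto simp: Ext_0)
  let ?E = "tgt \<A> j"
  \<comment> \<open>The idempotent complementary to the section \<open>s\<close>; it factors through
    \<open>j\<close>, and the factor \<open>r\<close> is the retraction.\<close>
  let ?e = "ide \<A> ?E \<oplus> hneg (s \<cdot> q)"
  have "q \<cdot> ?e = hzero \<A> (src \<A> ?e) (tgt \<A> q)" using s f m by (simp add: cmp_reassoc[OF s(4)] hneg_arr)
  then obtain r where r: "r \<in> arr \<A>" "src \<A> r = ?E" "tgt \<A> r = src \<A> j" "j \<cdot> r = ?e"
    using conflation_lift[OF d(2), of ?e] s f m by auto
  have "j \<cdot> (r \<cdot> j) = ?e \<cdot> j" by (rule cmp_reassoc[OF r(4)]) (use r f in simp_all)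
  also have "\<dots> = j \<cdot> ide \<A> (src \<A> j)" using s f m by simp
  finally have rj: "r \<cdot> j = ide \<A> (src \<A> j)"
    by - (rule conflation_cancel(1)[OF d(2)], use r f in simp_all)
  have "r \<cdot> (u \<cdot> k) = g" unfolding d(12) using r(1-3) g m(2) f by (simp add: cmp_reassoc[OF rj])
  then show ?case using g r(1-3) d(6-8) c m(2) by (intro bexI[of _ "Mor (r \<cdot> u)"]) (simp_all add: Ext_0)
next
  case (Suc t)
  obtain i q \<rho> where j: "conflation \<A> \<C> i q" "src \<A> i = Y" "\<rho> \<in> EXT t (src \<A> k) (tgt \<A> q)" "\<gamma> = con i q \<rho>"
    by (rule con_surj[OF Suc.prems(1)])
  note c = conflationD[OF kp] conflationD[OF j(1)]
  have r: "rcon k p t (tgt \<A> q) \<rho> \<in> EXT (Suc t) (tgt \<A> p) (tgt \<A> q)" using rcon_closed[OF j(3)] c by simp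
  have "con i q (rcon k p t (tgt \<A> q) \<rho>) = xzero (Suc (Suc t)) (tgt \<A> p) (src \<A> i)"
    using rcon_con[OF j(1,3)] Suc.prems(3) j by simp
  then obtain \<mu> where \<mu>: "\<mu> \<in> EXT (Suc t) (tgt \<A> p) (tgt \<A> i)" "rcon k p t (tgt \<A> q) \<rho> = psh q \<mu>"
    using con_exact[OF j(1) r] by auto
  obtain l m b d where m: "conf_map i q l m (ide \<A> (src \<A> i)) b d" "psh b \<mu> = xzero (Suc t) (tgt \<A> p) (tgt \<A> l)"
    by (rule efface[OF j(1) \<mu>(1)]) simp
  note D = conf_mapD[OF m(1)]
  note f = conflationD[OF D(2)]
  have ds: "psh d \<rho> \<in> EXT t (src \<A> k) (tgt \<A> m)" using push_closed[OF j(3), of d] D f by simp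
  have "rcon k p t (tgt \<A> m) (psh d \<rho>) = psh d (psh q \<mu>)" using rcon_push[OF j(3), of d] D f c \<mu>(2) by simp
  also have "\<dots> = psh m (psh b \<mu>)"
    using push_push[OF \<mu>(1), of q d] push_push[OF \<mu>(1), of b m] D f c by simp
  also have "\<dots> = xzero (Suc t) (tgt \<A> p) (tgt \<A> m)" using m(2) push_zero[of "tgt \<A> p" m "tgt \<A> l" "Suc t"] f by simp
  finally obtain \<tau> where \<tau>: "\<tau> \<in> EXT t (tgt \<A> k) (tgt \<A> m)" "psh d \<rho> = pll \<tau> k"
    using Suc.IH[OF ds] f by auto
  have "\<gamma> = con l m (pll \<tau> k)" using con_amalgam(1)[OF m(1) j(3)] j \<tau> by simp
  also have "\<dots> = pll (con l m \<tau>) k" using con_pull[OF D(2) \<tau>(1), of k] c by simp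
  finally show ?case using con_closed[OF D(2) \<tau>(1)] D j f c by auto
qed

text \<open>In degree 0 the composite \<open>h \<cdot> p\<close> lifts through the deflation
  \<open>q\<close>, and the lift restricts to the kernels: the left component of this morphism of
  conflations is the preimage. The inductive step effaces a class over the middle term as in
  \<open>rcon_exact\<close>.\<close>

lemma rcon_surj:
  "\<lbrakk>\<gamma> \<in> EXT (Suc t) (tgt \<A> p) Y; Y \<in> \<C>; pll \<gamma> p = xzero (Suc t) (tgt \<A> k) Y\<rbrakk> \<Longrightarrow> \<exists>\<sigma>\<in>EXT t (src \<A> k) Y. \<gamma> = rcon k p t Y \<sigma>"
proof (induction t arbitrary: Y \<gamma>)
  case 0
  note c = conflationD[OF kp]
  obtain i q \<rho> where j: "conflation \<A> \<C> i q" "src \<A> i = Y" "\<rho> \<in> EXT 0 (tgt \<A> p) (tgt \<A> q)" "\<gamma> = con i q \<rho>"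
    by (rule con_surj[OF 0(1)])
  note f = conflationD[OF j(1)]
  obtain h where h: "\<rho> = Mor h" "h \<in> arr \<A>" "src \<A> h = (tgt \<A> p)" "tgt \<A> h = tgt \<A> q" using j by (auto simp: Ext_0)
  have r: "pll \<rho> p \<in> EXT 0 (tgt \<A> k) (tgt \<A> q)" using pull_closed[OF j(3), of p] c by simp
  have "con i q (pll \<rho> p) = xzero (Suc 0) (tgt \<A> k) (src \<A> i)"
    using 0(3) con_pull[OF j(1,3), of p] j c by simp
  then obtain \<tau> where "\<tau> \<in> EXT 0 (tgt \<A> k) (tgt \<A> i)" "pll \<rho> p = psh q \<tau>" using con_exact[OF j(1) r] by auto
  then obtain m where m: "m \<in> arr \<A>" "src \<A> m = tgt \<A> k" "tgt \<A> m = tgt \<A> i" "h \<cdot> p = q \<cdot> m"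
    using h by (auto simp: Ext_0)
  have "q \<cdot> (m \<cdot> k) = h \<cdot> (p \<cdot> k)" by (rule cmp_reassoc2[OF m(4)[symmetric]]) (use m h c f in simp_all)
  then have "q \<cdot> (m \<cdot> k) = hzero \<A> (src \<A> (m \<cdot> k)) (tgt \<A> q)" using m h c f by simp
  then obtain g where g: "g \<in> arr \<A>" "src \<A> g = (src \<A> k)" "tgt \<A> g = src \<A> i" "i \<cdot> g = m \<cdot> k"
    using conflation_lift[OF j(1), of "m \<cdot> k"] m c f by auto
  have "conf_map k p i q g m h" using kp j g m h c f by (simp add: conf_map_def)
  moreover have "Mor (ide \<A> (tgt \<A> p)) \<in> EXT 0 (tgt \<A> p) (tgt \<A> p)" using c by (simp add: Ext_0)
  ultimately have "psh g (ycls \<A> \<C> [k, p]) = \<gamma>"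
    unfolding ycls_conflation(2)[OF kp] using con_natural[of k p i q g m h "Mor (ide \<A> (tgt \<A> p))" 0 "tgt \<A> p"] h j by simp
  then show ?case using g j by (intro bexI[of _ "Mor g"]) (simp_all add: Ext_0)
next
  case (Suc t)
  obtain i q \<rho> where j: "conflation \<A> \<C> i q" "src \<A> i = Y" "\<rho> \<in> EXT (Suc t) (tgt \<A> p) (tgt \<A> q)" "\<gamma> = con i q \<rho>"
    by (rule con_surj[OF Suc.prems(1)])
  note c = conflationD[OF kp] conflationD[OF j(1)]
  have r: "pll \<rho> p \<in> EXT (Suc t) (tgt \<A> k) (tgt \<A> q)" using pull_closed[OF j(3), of p] c by simp
  have "con i q (pll \<rho> p) = xzero (Suc (Suc t)) (tgt \<A> k) (src \<A> i)"
    using Suc.prems(3) con_pull[OF j(1,3), of p] j c by simp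
  then obtain \<mu> where \<mu>: "\<mu> \<in> EXT (Suc t) (tgt \<A> k) (tgt \<A> i)" "pll \<rho> p = psh q \<mu>"
    using con_exact[OF j(1) r] by auto
  obtain l m b d where m: "conf_map i q l m (ide \<A> (src \<A> i)) b d" "psh b \<mu> = xzero (Suc t) (tgt \<A> k) (tgt \<A> l)"
    by (rule efface[OF j(1) \<mu>(1)]) simp
  note D = conf_mapD[OF m(1)]
  note f = conflationD[OF D(2)]
  have ds: "psh d \<rho> \<in> EXT (Suc t) (tgt \<A> p) (tgt \<A> m)" using push_closed[OF j(3), of d] D f by simp
  have "pll (psh d \<rho>) p = psh d (psh q \<mu>)" using push_pull[OF j(3), of d p] D f c \<mu>(2) by simp
  also have "\<dots> = psh m (psh b \<mu>)"
    using push_push[OF \<mu>(1), of q d] push_push[OF \<mu>(1), of b m] D f c by simp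
  also have "\<dots> = xzero (Suc t) (tgt \<A> k) (tgt \<A> m)" using m(2) push_zero[of "tgt \<A> k" m "tgt \<A> l" "Suc t"] f by simp
  finally obtain \<sigma> where \<sigma>: "\<sigma> \<in> EXT t (src \<A> k) (tgt \<A> m)" "psh d \<rho> = rcon k p t (tgt \<A> m) \<sigma>"
    using Suc.IH[OF ds] f by auto
  have "\<gamma> = con l m (rcon k p t (tgt \<A> m) \<sigma>)" using con_amalgam(1)[OF m(1) j(3)] j \<sigma> by simp
  also have "\<dots> = rcon k p (Suc t) Y (con l m \<sigma>)" using rcon_con[OF D(2) \<sigma>(1)] D j f c by simp
  finally show ?case using con_closed[OF D(2) \<sigma>(1)] D j f c by auto
qed

lemma pull_exact:
  "\<lbrakk>\<gamma> \<in> EXT t (tgt \<A> k) Y; Y \<in> \<C>; pll \<gamma> k = xzero t (src \<A> k) Y\<rbrakk> \<Longrightarrow> \<exists>\<delta>\<in>EXT t (tgt \<A> p) Y. \<gamma> = pll \<delta> p"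
proof (induction t arbitrary: Y \<gamma>)
  case 0
  note c = conflationD[OF kp]
  obtain g where g: "\<gamma> = Mor g" "g \<in> arr \<A>" "src \<A> g = tgt \<A> k" "tgt \<A> g = Y" using 0 by (auto simp: Ext_0)
  have "g \<cdot> k = hzero \<A> (src \<A> k) (tgt \<A> g)" using 0(3) g by (simp add: ext_zero_def)
  then obtain u where "u \<in> arr \<A>" "src \<A> u = (tgt \<A> p)" "tgt \<A> u = Y" "u \<cdot> p = g"
    using conflation_desc[OF kp g(2,3)] g(4) by metis
  then show ?case using g by (intro bexI[of _ "Mor u"]) (simp_all add: Ext_0)
next
  case (Suc t)
  obtain i q \<rho> where j: "conflation \<A> \<C> i q" "src \<A> i = Y" "\<rho> \<in> EXT t (tgt \<A> k) (tgt \<A> q)" "\<gamma> = con i q \<rho>"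
    by (rule con_surj[OF Suc.prems(1)])
  note c = conflationD[OF kp] conflationD[OF j(1)]
  have r: "pll \<rho> k \<in> EXT t (src \<A> k) (tgt \<A> q)" using pull_closed[OF j(3), of k] c by simp
  have "con i q (pll \<rho> k) = xzero (Suc t) (src \<A> k) (src \<A> i)"
    using Suc.prems(3) con_pull[OF j(1,3), of k] j c by simp
  then obtain \<mu> where \<mu>: "\<mu> \<in> EXT t (src \<A> k) (tgt \<A> i)" "pll \<rho> k = psh q \<mu>"
    using con_exact[OF j(1) r] by auto
  have rm: "rcon k p t (tgt \<A> i) \<mu> \<in> EXT (Suc t) (tgt \<A> p) (tgt \<A> i)" using rcon_closed[OF \<mu>(1)] c by simp
  obtain l m b d where m: "conf_map i q l m (ide \<A> (src \<A> i)) b d"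
    "psh b (rcon k p t (tgt \<A> i) \<mu>) = xzero (Suc t) (tgt \<A> p) (tgt \<A> l)"
    by (rule efface[OF j(1) rm]) simp
  note D = conf_mapD[OF m(1)]
  note f = conflationD[OF D(2)]
  have bm: "psh b \<mu> \<in> EXT t (src \<A> k) (tgt \<A> l)" using push_closed[OF \<mu>(1), of b] D f by simp
  have "rcon k p t (tgt \<A> l) (psh b \<mu>) = xzero (Suc t) (tgt \<A> p) (tgt \<A> l)" using rcon_push[OF \<mu>(1), of b] m D f c by simp
  then obtain \<nu> where \<nu>: "\<nu> \<in> EXT t (tgt \<A> k) (tgt \<A> l)" "psh b \<mu> = pll \<nu> k" using rcon_exact[OF bm] f by auto
  obtain \<nu>' where \<nu>': "\<nu>' \<in> EXT t (tgt \<A> k) (tgt \<A> l)" "xadd (tgt \<A> k) (tgt \<A> l) \<nu> \<nu>' = xzero t (tgt \<A> k) (tgt \<A> l)"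
    by (rule xneg_exists[OF \<nu>(1)]) (use f in simp_all)
  have ds: "psh d \<rho> \<in> EXT t (tgt \<A> k) (tgt \<A> m)" using push_closed[OF j(3), of d] D f by simp
  have mn: "psh m \<nu>' \<in> EXT t (tgt \<A> k) (tgt \<A> m)" "psh m \<nu> \<in> EXT t (tgt \<A> k) (tgt \<A> m)"
    using push_closed[OF \<nu>'(1), of m] push_closed[OF \<nu>(1), of m] f by simp_all
  have "pll (psh d \<rho>) k = psh d (psh q \<mu>)" using push_pull[OF j(3), of d k] D f c \<mu>(2) by simp
  also have "\<dots> = psh m (pll \<nu> k)"
    using push_push[OF \<mu>(1), of q d] push_push[OF \<mu>(1), of b m] D f c \<nu>(2) by simp
  also have "\<dots> = pll (psh m \<nu>) k" using push_pull[OF \<nu>(1), of m k] f c by simp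
  finally have e: "pll (psh d \<rho>) k = pll (psh m \<nu>) k" .
  \<comment> \<open>The subtracted class is a push-out along \<open>m\<close>, so its product with
    \<open>(l, m)\<close> vanishes and the subtraction does not affect
    \<open>\<gamma>\<close>.\<close>
  let ?\<epsilon> = "xadd (tgt \<A> k) (tgt \<A> m) (psh d \<rho>) (psh m \<nu>')"
  have ep: "?\<epsilon> \<in> EXT t (tgt \<A> k) (tgt \<A> m)" using ext_add_closed[OF ds mn(1)] f by simp
  have "pll ?\<epsilon> k = pll (xadd (tgt \<A> k) (tgt \<A> m) (psh m \<nu>) (psh m \<nu>')) k"
    using pull_add[OF ds mn(1), of k] pull_add[OF mn(2,1), of k] e c f by simp
  also have "xadd (tgt \<A> k) (tgt \<A> m) (psh m \<nu>) (psh m \<nu>') = xzero t (tgt \<A> k) (tgt \<A> m)"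
    using push_add[OF \<nu>(1) \<nu>'(1), of m] \<nu>'(2) push_zero[of "tgt \<A> k" m "tgt \<A> l" t] f by simp
  finally have "pll ?\<epsilon> k = xzero t (src \<A> k) (tgt \<A> m)" using pull_zero[of "tgt \<A> m" k "tgt \<A> k" t] c f by simp
  then obtain \<delta> where \<delta>: "\<delta> \<in> EXT t (tgt \<A> p) (tgt \<A> m)" "?\<epsilon> = pll \<delta> p" using Suc.IH[OF ep] f by auto
  have "pll (con l m \<delta>) p = con l m ?\<epsilon>" using con_pull[OF D(2) \<delta>(1), of p] \<delta>(2) c by simp
  also have "\<dots> = xadd (tgt \<A> k) (src \<A> l) (con l m (psh d \<rho>)) (con l m (psh m \<nu>'))"
    using ext_add_con[OF D(2) ds mn(1)] by simp
  also have "\<dots> = con i q \<rho>"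
    using con_push_self[OF D(2) \<nu>'(1)] con_amalgam(1)[OF m(1) j(3)] xadd_zero(2)[OF con_closed[OF j(1,3)]] D j c by simp
  finally have "\<gamma> = pll (con l m \<delta>) p" using j(4) by simp
  moreover have "con l m \<delta> \<in> EXT (Suc t) (tgt \<A> p) Y" using con_closed[OF D(2) \<delta>(1)] D(5) j(2) c by simp
  ultimately show ?case by blast
qed

end

end

section \<open>\<open>n\<close>-Frobenius categories\<close>

lemma hom_bij_betw_iff:
  assumes "group G" "group H" "h \<in> hom G H"
  shows "bij_betw h (carrier G) (carrier H) \<longleftrightarrow>
    (\<forall>x\<in>carrier G. h x = \<one>\<^bsub>H\<^esub> \<longrightarrow> x = \<one>\<^bsub>G\<^esub>) \<and> (\<forall>y\<in>carrier H. \<exists>x\<in>carrier G. h x = y)"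
proof -
  interpret group_hom G H h using assms by (simp add: group_hom_def group_hom_axioms_def)
  have "inj_on h (carrier G) \<longleftrightarrow> (\<forall>x\<in>carrier G. h x = \<one>\<^bsub>H\<^esub> \<longrightarrow> x = \<one>\<^bsub>G\<^esub>)"
    using inj_on_one_iff by (simp add: Ball_def)
  moreover have "h ` carrier G = carrier H \<longleftrightarrow> (\<forall>y\<in>carrier H. \<exists>x\<in>carrier G. h x = y)"
  proof
    assume "h ` carrier G = carrier H"
    then show "\<forall>y\<in>carrier H. \<exists>x\<in>carrier G. h x = y" by (metis imageE)
  next
    assume "\<forall>y\<in>carrier H. \<exists>x\<in>carrier G. h x = y"
    then show "h ` carrier G = carrier H" using hom_closed by (intro equalityI subsetI) auto
  qed
  ultimately show ?thesis by (simp add: bij_betw_def)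
qed

lemma (in group_hom) kernel_coset_eq_iff:
  assumes x: "x \<in> carrier G" and y: "y \<in> carrier G"
  shows "kernel G H h #>\<^bsub>G\<^esub> x = kernel G H h #>\<^bsub>G\<^esub> y \<longleftrightarrow> h x = h y"
proof -
  interpret normal "kernel G H h" G by (rule normal_kernel)
  have "kernel G H h #>\<^bsub>G\<^esub> x = kernel G H h #>\<^bsub>G\<^esub> y \<longleftrightarrow> x \<in> kernel G H h #>\<^bsub>G\<^esub> y"
  proof
    assume "kernel G H h #>\<^bsub>G\<^esub> x = kernel G H h #>\<^bsub>G\<^esub> y"
    then show "x \<in> kernel G H h #>\<^bsub>G\<^esub> y" using G.rcos_self[OF x subgroup_axioms] by simp
  next
    assume "x \<in> kernel G H h #>\<^bsub>G\<^esub> y"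
    then show "kernel G H h #>\<^bsub>G\<^esub> x = kernel G H h #>\<^bsub>G\<^esub> y"
      by (rule G.repr_independence[OF _ y subgroup_axioms, symmetric])
  qed
  also have "\<dots> \<longleftrightarrow> x \<otimes>\<^bsub>G\<^esub> inv\<^bsub>G\<^esub> y \<in> kernel G H h"
    by (rule rcos_module[OF G.is_group y x])
  also have "\<dots> \<longleftrightarrow> h x = h y"
  proof -
    have "h (x \<otimes>\<^bsub>G\<^esub> inv\<^bsub>G\<^esub> y) = h x \<otimes>\<^bsub>H\<^esub> inv\<^bsub>H\<^esub> h y" using x y by (simp only: hom_mult hom_inv G.inv_closed)
    moreover have "h x \<otimes>\<^bsub>H\<^esub> inv\<^bsub>H\<^esub> h y = \<one>\<^bsub>H\<^esub> \<longleftrightarrow> h x = \<one>\<^bsub>H\<^esub> \<otimes>\<^bsub>H\<^esub> h y"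
      by (rule H.inv_solve_right') (simp_all only: H.one_closed hom_closed x y)
    moreover have "\<one>\<^bsub>H\<^esub> \<otimes>\<^bsub>H\<^esub> h y = h y" by (rule H.l_one[OF hom_closed[OF y]])
    moreover have "x \<otimes>\<^bsub>G\<^esub> inv\<^bsub>G\<^esub> y \<in> carrier G" by (rule G.m_closed[OF x G.inv_closed[OF y]])
    ultimately show ?thesis by (simp only: kernel_def mem_Collect_eq simp_thms)
  qed
  finally show ?thesis .
qed

text \<open>The two surjections identify the quotients with their target groups, and
  \<open>comm\<close> turns the induced map into \<open>\<psi>\<close>. Injectivity and surjectivity
  are compared on representatives.\<close>

lemma iso_Mod_kernel_iff:
  assumes G: "group G\<^sub>1" "group G\<^sub>2" and H: "group H\<^sub>1" "group H\<^sub>2"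
    and \<alpha>\<^sub>1: "\<alpha>\<^sub>1 \<in> hom G\<^sub>1 H\<^sub>1" "\<alpha>\<^sub>1 ` carrier G\<^sub>1 = carrier H\<^sub>1" and \<alpha>\<^sub>2: "\<alpha>\<^sub>2 \<in> hom G\<^sub>2 H\<^sub>2" "\<alpha>\<^sub>2 ` carrier G\<^sub>2 = carrier H\<^sub>2"
    and K: "K\<^sub>1 = kernel G\<^sub>1 H\<^sub>1 \<alpha>\<^sub>1" "K\<^sub>2 = kernel G\<^sub>2 H\<^sub>2 \<alpha>\<^sub>2"
    and \<phi>: "\<phi> \<in> hom G\<^sub>1 G\<^sub>2" and \<psi>: "\<psi> \<in> hom H\<^sub>1 H\<^sub>2"
    and comm: "\<And>x. x \<in> carrier G\<^sub>1 \<Longrightarrow> \<psi> (\<alpha>\<^sub>1 x) = \<alpha>\<^sub>2 (\<phi> x)"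
  shows "(\<lambda>S. \<Union>x\<in>S. K\<^sub>2 #>\<^bsub>G\<^sub>2\<^esub> \<phi> x) \<in> iso (G\<^sub>1 Mod K\<^sub>1) (G\<^sub>2 Mod K\<^sub>2) \<longleftrightarrow> \<psi> \<in> iso H\<^sub>1 H\<^sub>2"
    (is "?F \<in> _ \<longleftrightarrow> _")
proof -
  interpret a1: group_hom G\<^sub>1 H\<^sub>1 \<alpha>\<^sub>1 using G H \<alpha>\<^sub>1 by (simp add: group_hom_def group_hom_axioms_def)
  interpret a2: group_hom G\<^sub>2 H\<^sub>2 \<alpha>\<^sub>2 using G H \<alpha>\<^sub>2 by (simp add: group_hom_def group_hom_axioms_def)
  interpret n1: normal K\<^sub>1 G\<^sub>1 unfolding K by (rule a1.normal_kernel)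
  interpret n2: normal K\<^sub>2 G\<^sub>2 unfolding K by (rule a2.normal_kernel)
  have \<phi>c: "\<phi> x \<in> carrier G\<^sub>2" if "x \<in> carrier G\<^sub>1" for x using \<phi> that by (auto simp: hom_def)
  have \<phi>m: "\<phi> (x \<otimes>\<^bsub>G\<^sub>1\<^esub> y) = \<phi> x \<otimes>\<^bsub>G\<^sub>2\<^esub> \<phi> y" if "x \<in> carrier G\<^sub>1" "y \<in> carrier G\<^sub>1" for x y
    using \<phi> that by (auto simp: hom_def)
  note c1 = a1.kernel_coset_eq_iff[folded K] and c2 = a2.kernel_coset_eq_iff[folded K]
  \<comment> \<open>All representatives of a coset have images in one coset, so the union collapses
    to it.\<close>
  have F: "?F (K\<^sub>1 #>\<^bsub>G\<^sub>1\<^esub> x) = K\<^sub>2 #>\<^bsub>G\<^sub>2\<^esub> \<phi> x" if x: "x \<in> carrier G\<^sub>1" for x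
  proof -
    have "K\<^sub>2 #>\<^bsub>G\<^sub>2\<^esub> \<phi> y = K\<^sub>2 #>\<^bsub>G\<^sub>2\<^esub> \<phi> x" if y: "y \<in> K\<^sub>1 #>\<^bsub>G\<^sub>1\<^esub> x" for y
    proof -
      have yc: "y \<in> carrier G\<^sub>1" using a1.G.r_coset_subset_G[OF n1.subset x] y by blast
      have "\<alpha>\<^sub>1 y = \<alpha>\<^sub>1 x" using c1[OF yc x] a1.G.repr_independence[OF y x n1.subgroup_axioms] by simp
      then have "\<alpha>\<^sub>2 (\<phi> y) = \<alpha>\<^sub>2 (\<phi> x)" using comm[OF yc] comm[OF x] by simp
      then show ?thesis using c2[OF \<phi>c[OF yc] \<phi>c[OF x]] by simp
    qed
    then show ?thesis using a1.G.rcos_self[OF x n1.subgroup_axioms] by blast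
  qed
  have car1: "carrier (G\<^sub>1 Mod K\<^sub>1) = (\<lambda>x. K\<^sub>1 #>\<^bsub>G\<^sub>1\<^esub> x) ` carrier G\<^sub>1"
    and car2: "carrier (G\<^sub>2 Mod K\<^sub>2) = (\<lambda>x. K\<^sub>2 #>\<^bsub>G\<^sub>2\<^esub> x) ` carrier G\<^sub>2"
    by (auto simp: FactGroup_def RCOSETS_def)
  have hom: "?F \<in> hom (G\<^sub>1 Mod K\<^sub>1) (G\<^sub>2 Mod K\<^sub>2)"
  proof (rule homI)
    fix S assume "S \<in> carrier (G\<^sub>1 Mod K\<^sub>1)"
    then obtain x where "x \<in> carrier G\<^sub>1" "S = K\<^sub>1 #>\<^bsub>G\<^sub>1\<^esub> x" unfolding car1 by blast
    then show "?F S \<in> carrier (G\<^sub>2 Mod K\<^sub>2)" unfolding car2 using F \<phi>c by (metis image_eqI)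
  next
    fix S T assume "S \<in> carrier (G\<^sub>1 Mod K\<^sub>1)" "T \<in> carrier (G\<^sub>1 Mod K\<^sub>1)"
    then obtain x y where x: "x \<in> carrier G\<^sub>1" "S = K\<^sub>1 #>\<^bsub>G\<^sub>1\<^esub> x" and y: "y \<in> carrier G\<^sub>1" "T = K\<^sub>1 #>\<^bsub>G\<^sub>1\<^esub> y"
      unfolding car1 by blast
    have "S \<otimes>\<^bsub>G\<^sub>1 Mod K\<^sub>1\<^esub> T = K\<^sub>1 #>\<^bsub>G\<^sub>1\<^esub> (x \<otimes>\<^bsub>G\<^sub>1\<^esub> y)" using n1.rcos_sum x y by (simp add: FactGroup_def)
    moreover have "?F S \<otimes>\<^bsub>G\<^sub>2 Mod K\<^sub>2\<^esub> ?F T = K\<^sub>2 #>\<^bsub>G\<^sub>2\<^esub> (\<phi> x \<otimes>\<^bsub>G\<^sub>2\<^esub> \<phi> y)"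
      unfolding x(2) y(2) F[OF x(1)] F[OF y(1)] using n2.rcos_sum[OF \<phi>c[OF x(1)] \<phi>c[OF y(1)]] by (simp add: FactGroup_def)
    ultimately show "?F (S \<otimes>\<^bsub>G\<^sub>1 Mod K\<^sub>1\<^esub> T) = ?F S \<otimes>\<^bsub>G\<^sub>2 Mod K\<^sub>2\<^esub> ?F T"
      using F[of "x \<otimes>\<^bsub>G\<^sub>1\<^esub> y"] \<phi>m[OF x(1) y(1)] x y by simp
  qed
  have "inj_on ?F (carrier (G\<^sub>1 Mod K\<^sub>1)) \<longleftrightarrow>
      (\<forall>x\<in>carrier G\<^sub>1. \<forall>y\<in>carrier G\<^sub>1. \<psi> (\<alpha>\<^sub>1 x) = \<psi> (\<alpha>\<^sub>1 y) \<longrightarrow> \<alpha>\<^sub>1 x = \<alpha>\<^sub>1 y)"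
    unfolding car1 inj_on_def using F c1 c2 \<phi>c comm by simp
  also have "\<dots> \<longleftrightarrow> inj_on \<psi> (carrier H\<^sub>1)" unfolding inj_on_def \<alpha>\<^sub>1(2)[symmetric] by simp
  finally have inj: "inj_on ?F (carrier (G\<^sub>1 Mod K\<^sub>1)) \<longleftrightarrow> inj_on \<psi> (carrier H\<^sub>1)" .
  have "?F ` carrier (G\<^sub>1 Mod K\<^sub>1) = carrier (G\<^sub>2 Mod K\<^sub>2) \<longleftrightarrow> carrier (G\<^sub>2 Mod K\<^sub>2) \<subseteq> ?F ` carrier (G\<^sub>1 Mod K\<^sub>1)"
    using hom by (auto simp: hom_def)
  also have "\<dots> \<longleftrightarrow> (\<forall>y\<in>carrier G\<^sub>2. \<exists>x\<in>carrier G\<^sub>1. K\<^sub>2 #>\<^bsub>G\<^sub>2\<^esub> y = K\<^sub>2 #>\<^bsub>G\<^sub>2\<^esub> \<phi> x)"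
  proof -
    have "?F ` carrier (G\<^sub>1 Mod K\<^sub>1) = (\<lambda>x. K\<^sub>2 #>\<^bsub>G\<^sub>2\<^esub> \<phi> x) ` carrier G\<^sub>1"
      unfolding car1 image_image by (rule image_cong[OF refl F])
    then show ?thesis unfolding car2 by (auto simp: image_iff subset_iff)
  qed
  also have "\<dots> \<longleftrightarrow> (\<forall>y\<in>carrier G\<^sub>2. \<exists>x\<in>carrier G\<^sub>1. \<alpha>\<^sub>2 y = \<psi> (\<alpha>\<^sub>1 x))"
    using c2 \<phi>c comm by simp
  also have "\<dots> \<longleftrightarrow> carrier H\<^sub>2 \<subseteq> \<psi> ` carrier H\<^sub>1"
    unfolding \<alpha>\<^sub>1(2)[symmetric] \<alpha>\<^sub>2(2)[symmetric] by (auto simp: image_iff)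
  also have "\<dots> \<longleftrightarrow> \<psi> ` carrier H\<^sub>1 = carrier H\<^sub>2" using \<psi> by (auto simp: hom_def)
  finally show ?thesis using inj hom \<psi> by (simp add: iso_def bij_betw_def)
qed

section \<open>Homomorphisms between Ext groups, and bijectivity in degree n+1\<close>

context exact_subcategory begin

lemma pull_hzero:
  "\<lbrakk>\<gamma> \<in> EXT t X Y; X \<in> \<C>; Y \<in> \<C>; X' \<in> \<C>\<rbrakk> \<Longrightarrow> pll \<gamma> (hzero \<A> X' X) = xzero t X' Y"
proof (induction t arbitrary: Y \<gamma>)
  case 0
  then show ?case by (auto simp: Ext_0 ext_zero_def)
next
  case (Suc t)
  obtain i p \<rho> where j: "conflation \<A> \<C> i p" "src \<A> i = Y" "\<rho> \<in> EXT t X (tgt \<A> p)" "\<gamma> = con i p \<rho>"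
    by (rule con_surj[OF Suc.prems(1)])
  show ?case
    using con_pull[OF j(1,3), of "hzero \<A> X' X"] Suc.IH[OF j(3)] con_zero[OF j(1), of X' t] conflationD[OF j(1)] j Suc.prems
    by simp
qed

lemma Ext_group_simps [simp]:
  "carrier (xgrp t X Y) = EXT t X Y" "mult (xgrp t X Y) = xadd X Y" "one (xgrp t X Y) = xzero t X Y"
  by (simp_all add: Ext_group_def)

lemma Ext_grp: "X \<in> \<C> \<Longrightarrow> Y \<in> \<C> \<Longrightarrow> group (xgrp t X Y)"
  using Ext_comm_group comm_group_def by blast

lemma push_hom:
  assumes "X \<in> \<C>" "g \<in> arr \<A>" "src \<A> g = Y" "Y \<in> \<C>" "tgt \<A> g = Y'" "Y' \<in> \<C>"
  shows "psh g \<in> hom (xgrp t X Y) (xgrp t X Y')"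
  using assms push_closed[of _ t X Y g] push_add[of _ t X Y _ g] by (auto intro!: homI)

lemma pull_hom:
  assumes "Y \<in> \<C>" "h \<in> arr \<A>" "tgt \<A> h = X" "X \<in> \<C>" "src \<A> h = X'" "X' \<in> \<C>"
  shows "(\<lambda>\<gamma>. pll \<gamma> h) \<in> hom (xgrp t X Y) (xgrp t X' Y)"
  using assms pull_closed[of _ t X Y h] pull_add[of _ t X Y _ h] by (auto intro!: homI)

lemma con_hom:
  assumes "conflation \<A> \<C> k p" "X \<in> \<C>"
  shows "con k p \<in> hom (xgrp t X (tgt \<A> p)) (xgrp (Suc t) X (src \<A> k))"
  using con_closed[OF assms(1) _ assms(2)] ext_add_con[OF assms(1) _ _ assms(2)] by (auto intro!: homI)

lemma rcon_hom:
  assumes "conflation \<A> \<C> k p" "Y \<in> \<C>"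
  shows "rcon k p t Y \<in> hom (xgrp t (src \<A> k) Y) (xgrp (Suc t) (tgt \<A> p) Y)"
  using rcon_closed[OF assms(1) _ assms(2)] rcon_add[OF assms(1) _ _ assms(2)] by (auto intro!: homI)

lemma Ext_vanishes_iff: "X \<in> \<C> \<Longrightarrow> Y \<in> \<C> \<Longrightarrow> Ext_vanishes \<A> \<C> t X Y \<longleftrightarrow> (\<forall>\<gamma>\<in>EXT t X Y. \<gamma> = xzero t X Y)"
  using xzero_closed[of X Y t] by (auto simp: Ext_vanishes_def)

text \<open>Only bijectivity is kept, since the map is a homomorphism anyway. In this form the
  composition and cancellation of morphisms are statements about \<open>bij_betw\<close>.\<close>

definition push_bij :: "nat \<Rightarrow> 'b \<Rightarrow> bool" where
  "push_bij n f \<longleftrightarrow> (\<forall>X\<in>\<C>. bij_betw (psh f) (EXT (Suc n) X (src \<A> f)) (EXT (Suc n) X (tgt \<A> f)))"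

definition pull_bij :: "nat \<Rightarrow> 'b \<Rightarrow> bool" where
  "pull_bij n f \<longleftrightarrow> (\<forall>X\<in>\<C>. bij_betw (\<lambda>\<gamma>. pll \<gamma> f) (EXT (Suc n) (tgt \<A> f) X) (EXT (Suc n) (src \<A> f) X))"

lemma push_bij_iff:
  assumes "f \<in> arr \<A>" "src \<A> f \<in> \<C>" "tgt \<A> f \<in> \<C>"
  shows "push_bij n f \<longleftrightarrow> (\<forall>X\<in>\<C>.
    (\<forall>\<gamma>\<in>EXT (Suc n) X (src \<A> f). psh f \<gamma> = xzero (Suc n) X (tgt \<A> f) \<longrightarrow> \<gamma> = xzero (Suc n) X (src \<A> f)) \<and>
    (\<forall>\<delta>\<in>EXT (Suc n) X (tgt \<A> f). \<exists>\<gamma>\<in>EXT (Suc n) X (src \<A> f). psh f \<gamma> = \<delta>))"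
  unfolding push_bij_def
  using hom_bij_betw_iff[OF Ext_grp Ext_grp push_hom, of _ "src \<A> f" "tgt \<A> f" f "Suc n"] assms by simp

lemma pull_bij_iff:
  assumes "f \<in> arr \<A>" "src \<A> f \<in> \<C>" "tgt \<A> f \<in> \<C>"
  shows "pull_bij n f \<longleftrightarrow> (\<forall>X\<in>\<C>.
    (\<forall>\<gamma>\<in>EXT (Suc n) (tgt \<A> f) X. pll \<gamma> f = xzero (Suc n) (src \<A> f) X \<longrightarrow> \<gamma> = xzero (Suc n) (tgt \<A> f) X) \<and>
    (\<forall>\<delta>\<in>EXT (Suc n) (src \<A> f) X. \<exists>\<gamma>\<in>EXT (Suc n) (tgt \<A> f) X. pll \<gamma> f = \<delta>))"
  unfolding pull_bij_def
  using hom_bij_betw_iff[OF Ext_grp Ext_grp pull_hom, of "tgt \<A> f" _ "src \<A> f" f "Suc n"] assms by simp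

lemma push_iso_iff:
  assumes "f \<in> arr \<A>" "src \<A> f \<in> \<C>" "tgt \<A> f \<in> \<C>"
  shows "(\<forall>X\<in>\<C>. psh f \<in> iso (xgrp (Suc n) X (src \<A> f)) (xgrp (Suc n) X (tgt \<A> f))) \<longleftrightarrow> push_bij n f"
  using push_hom[OF _ assms(1) refl assms(2) refl assms(3), of _ "Suc n"] by (simp add: iso_def push_bij_def)

lemma pull_iso_iff:
  assumes "f \<in> arr \<A>" "src \<A> f \<in> \<C>" "tgt \<A> f \<in> \<C>"
  shows "(\<forall>X\<in>\<C>. (\<lambda>\<gamma>. pll \<gamma> f) \<in> iso (xgrp (Suc n) (tgt \<A> f) X) (xgrp (Suc n) (src \<A> f) X)) \<longleftrightarrow> pull_bij n f"
  using pull_hom[OF _ assms(1) refl assms(3) refl assms(2), of _ "Suc n"] by (simp add: iso_def pull_bij_def)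

section \<open>The quotient of Ext^n identified with Ext^(n+1)\<close>

context
  fixes n assumes frob: "n_Frobenius \<A> \<C> n"
begin

abbreviation "nproj \<equiv> n_projective \<A> \<C> n"

lemma nproj_iff_ninj: "nproj P \<longleftrightarrow> n_injective \<A> \<C> n P"
  using frob by (simp add: n_Frobenius_def)

lemma nproj_closed: "nproj P \<Longrightarrow> P \<in> \<C>"
  by (simp add: n_projective_def)

lemma proj_cover:
  assumes "X \<in> \<C>"
  obtains k p where "conflation \<A> \<C> k p" "tgt \<A> p = X" "nproj (tgt \<A> k)"
proof -
  obtain P p where "nproj P" "p \<in> Hom \<A> P X" "deflation \<A> \<C> p"
    using frob assms unfolding n_Frobenius_def by blast
  then show thesis using that conflationD(4) unfolding deflation_def by fastforce
qed

lemma inj_hull: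
  assumes "X \<in> \<C>"
  obtains k p where "conflation \<A> \<C> k p" "src \<A> k = X" "nproj (tgt \<A> k)"
proof -
  obtain P p where "n_injective \<A> \<C> n P" "p \<in> Hom \<A> X P" "inflation \<A> \<C> p"
    using frob assms unfolding n_Frobenius_def by blast
  then show thesis using that nproj_iff_ninj unfolding inflation_def by fastforce
qed

lemma Ext_from_nproj: "\<lbrakk>\<gamma> \<in> EXT t P X; nproj P; n < t; X \<in> \<C>\<rbrakk> \<Longrightarrow> \<gamma> = xzero t P X"
  using Ext_vanishes_iff[of P X t] by (simp add: n_projective_def)

lemma Ext_to_nproj: "\<lbrakk>\<gamma> \<in> EXT t X P; nproj P; n < t; X \<in> \<C>\<rbrakk> \<Longrightarrow> \<gamma> = xzero t X P"
  using Ext_vanishes_iff[of X P t] by (simp add: nproj_iff_ninj n_injective_def)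

text \<open>A class in Ext^n out of an n-projective \<open>Q\<close> lifts along an n-projective
  cover of \<open>Y\<close>, because the obstruction lies in degree n+1 out of \<open>Q\<close>. So
  every element of the subgroup comes from a class into an n-injective, whose \<open>rcon\<close>
  image vanishes. Conversely, an element killed by \<open>rcon\<close> extends along
  \<open>k\<close> to the n-projective \<open>tgt \<A> k\<close>.\<close>

lemma kernel_rcon:
  assumes kp: "conflation \<A> \<C> k p" and P: "nproj (tgt \<A> k)" and Y: "Y \<in> \<C>"
  shows "proj_factoring \<A> \<C> n (src \<A> k) Y = kernel (xgrp n (src \<A> k) Y) (xgrp (Suc n) (tgt \<A> p) Y) (rcon k p n Y)"
proof (intro equalityI subsetI)
  note c = conflationD[OF kp]
  fix \<gamma> assume "\<gamma> \<in> proj_factoring \<A> \<C> n (src \<A> k) Y"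
  then obtain Q \<eta> h where Q: "nproj Q" and h: "h \<in> arr \<A>" "src \<A> h = src \<A> k" "tgt \<A> h = Q" and \<eta>: "\<eta> \<in> EXT n Q Y" "\<gamma> = pll \<eta> h"
    unfolding proj_factoring_def by auto
  note Q' = nproj_closed[OF Q]
  obtain l q where l: "conflation \<A> \<C> l q" "tgt \<A> q = Y" "nproj (tgt \<A> l)" by (rule proj_cover[OF Y])
  note d = conflationD[OF l(1)]
  have "con l q \<eta> \<in> EXT (Suc n) Q (src \<A> l)" using con_closed[OF l(1), of \<eta> n Q] \<eta> l Q' by simp
  then have "con l q \<eta> = xzero (Suc n) Q (src \<A> l)" using Ext_from_nproj Q d by simp
  then obtain \<eta>' where \<eta>': "\<eta>' \<in> EXT n Q (tgt \<A> l)" "\<eta> = psh q \<eta>'"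
    using con_exact[OF l(1), of \<eta> n Q] \<eta> l Q' by auto
  have e: "pll \<eta>' h \<in> EXT n (src \<A> k) (tgt \<A> l)" using pull_closed[OF \<eta>'(1), of h] h c by simp
  have "rcon k p n (tgt \<A> l) (pll \<eta>' h) \<in> EXT (Suc n) (tgt \<A> p) (tgt \<A> l)" using rcon_closed[OF kp e] d by simp
  then have z: "rcon k p n (tgt \<A> l) (pll \<eta>' h) = xzero (Suc n) (tgt \<A> p) (tgt \<A> l)" using Ext_to_nproj l(3) c by simp
  have g: "\<gamma> = psh q (pll \<eta>' h)" using push_pull[OF \<eta>'(1), of q h] \<eta> \<eta>' h d l Y c by simp
  then have "rcon k p n Y \<gamma> = psh q (xzero (Suc n) (tgt \<A> p) (tgt \<A> l))" using rcon_push[OF kp e, of q] z d l Y by simp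
  also have "\<dots> = xzero (Suc n) (tgt \<A> p) Y" using push_zero[of "tgt \<A> p" q "tgt \<A> l" "Suc n"] c d l Y by simp
  finally show "\<gamma> \<in> kernel (xgrp n (src \<A> k) Y) (xgrp (Suc n) (tgt \<A> p) Y) (rcon k p n Y)"
    using pull_closed[OF \<eta>(1), of h] \<eta> h c by (simp add: kernel_def)
next
  fix \<gamma> assume "\<gamma> \<in> kernel (xgrp n (src \<A> k) Y) (xgrp (Suc n) (tgt \<A> p) Y) (rcon k p n Y)"
  then obtain \<tau> where "\<tau> \<in> EXT n (tgt \<A> k) Y" "\<gamma> = pll \<tau> k"
    using rcon_exact[OF kp _ Y, of \<gamma> n] by (auto simp: kernel_def)
  then show "\<gamma> \<in> proj_factoring \<A> \<C> n (src \<A> k) Y"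
    using P conflationD[OF kp] unfolding proj_factoring_def by auto
qed

text \<open>One inclusion holds because the product already vanishes over the n-projective. For the
  other, the element lifts to \<open>\<tau>\<close> over the n-injective \<open>tgt \<A> k\<close>,
  so \<open>\<tau>\<close> extends along an inflation of \<open>X\<close> into an n-injective; being
  n-projective too, that object provides the factorisation.\<close>

lemma kernel_con:
  assumes kp: "conflation \<A> \<C> k p" and P: "nproj (tgt \<A> k)" and X: "X \<in> \<C>"
  shows "proj_factoring \<A> \<C> n X (tgt \<A> p) = kernel (xgrp n X (tgt \<A> p)) (xgrp (Suc n) X (src \<A> k)) (con k p)"
proof (intro equalityI subsetI)
  note c = conflationD[OF kp]
  fix \<gamma> assume "\<gamma> \<in> proj_factoring \<A> \<C> n X (tgt \<A> p)"
  then obtain Q \<eta> h where Q: "nproj Q" and h: "h \<in> arr \<A>" "src \<A> h = X" "tgt \<A> h = Q" and \<eta>: "\<eta> \<in> EXT n Q (tgt \<A> p)" "\<gamma> = pll \<eta> h"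
    unfolding proj_factoring_def by auto
  note Q' = nproj_closed[OF Q]
  have "con k p \<eta> \<in> EXT (Suc n) Q (src \<A> k)" using con_closed[OF kp \<eta>(1) Q'] .
  then have "con k p \<eta> = xzero (Suc n) Q (src \<A> k)" using Ext_from_nproj Q c by simp
  then have "con k p \<gamma> = xzero (Suc n) X (src \<A> k)"
    using con_pull[OF kp \<eta>(1) Q', of h] pull_zero[of "src \<A> k" h Q "Suc n"] h \<eta> X Q' c by simp
  then show "\<gamma> \<in> kernel (xgrp n X (tgt \<A> p)) (xgrp (Suc n) X (src \<A> k)) (con k p)"
    using pull_closed[OF \<eta>(1), of h] \<eta> h X by (simp add: kernel_def)
next
  note c = conflationD[OF kp]
  fix \<gamma> assume "\<gamma> \<in> kernel (xgrp n X (tgt \<A> p)) (xgrp (Suc n) X (src \<A> k)) (con k p)"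
  then obtain \<tau> where \<tau>: "\<tau> \<in> EXT n X (tgt \<A> k)" "\<gamma> = psh p \<tau>"
    using con_exact[OF kp _ X, of \<gamma> n] by (auto simp: kernel_def)
  obtain l q where l: "conflation \<A> \<C> l q" "src \<A> l = X" "nproj (tgt \<A> l)" by (rule inj_hull[OF X])
  note d = conflationD[OF l(1)]
  have t: "\<tau> \<in> EXT n (src \<A> l) (tgt \<A> k)" using \<tau> l by simp
  have "rcon l q n (tgt \<A> k) \<tau> \<in> EXT (Suc n) (tgt \<A> q) (tgt \<A> k)" using rcon_closed[OF l(1) t] c by simp
  then have "rcon l q n (tgt \<A> k) \<tau> = xzero (Suc n) (tgt \<A> q) (tgt \<A> k)" using Ext_to_nproj P d by simp
  then obtain \<tau>' where \<tau>': "\<tau>' \<in> EXT n (tgt \<A> l) (tgt \<A> k)" "\<tau> = pll \<tau>' l"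
    using rcon_exact[OF l(1) t] c by auto
  have "\<gamma> = pll (psh p \<tau>') l" using push_pull[OF \<tau>'(1), of p l] \<tau> \<tau>' c d by simp
  moreover have "psh p \<tau>' \<in> EXT n (tgt \<A> l) (tgt \<A> p)" using push_closed[OF \<tau>'(1), of p] c by simp
  ultimately show "\<gamma> \<in> proj_factoring \<A> \<C> n X (tgt \<A> p)"
    using l d unfolding proj_factoring_def by auto
qed

lemma rcon_image:
  assumes kp: "conflation \<A> \<C> k p" and P: "nproj (tgt \<A> k)" and Y: "Y \<in> \<C>"
  shows "rcon k p n Y ` carrier (xgrp n (src \<A> k) Y) = carrier (xgrp (Suc n) (tgt \<A> p) Y)"
proof (intro equalityI subsetI)
  note c = conflationD[OF kp]
  fix \<gamma> assume "\<gamma> \<in> carrier (xgrp (Suc n) (tgt \<A> p) Y)"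
  then have g: "\<gamma> \<in> EXT (Suc n) (tgt \<A> p) Y" by simp
  have "pll \<gamma> p \<in> EXT (Suc n) (tgt \<A> k) Y" using pull_closed[OF g, of p] c by simp
  then have "pll \<gamma> p = xzero (Suc n) (tgt \<A> k) Y" using Ext_from_nproj P Y by simp
  then show "\<gamma> \<in> rcon k p n Y ` carrier (xgrp n (src \<A> k) Y)" using rcon_surj[OF kp g Y] by auto
qed (use rcon_closed[OF kp _ Y] in auto)

lemma con_image:
  assumes kp: "conflation \<A> \<C> k p" and P: "nproj (tgt \<A> k)" and X: "X \<in> \<C>"
  shows "con k p ` carrier (xgrp n X (tgt \<A> p)) = carrier (xgrp (Suc n) X (src \<A> k))"
proof (intro equalityI subsetI)
  note c = conflationD[OF kp]
  fix \<gamma> assume "\<gamma> \<in> carrier (xgrp (Suc n) X (src \<A> k))"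
  then have g: "\<gamma> \<in> EXT (Suc n) X (src \<A> k)" by simp
  have "psh k \<gamma> \<in> EXT (Suc n) X (tgt \<A> k)" using push_closed[OF g, of k] c by simp
  then have "psh k \<gamma> = xzero (Suc n) X (tgt \<A> k)" using Ext_to_nproj P X by simp
  then show "\<gamma> \<in> con k p ` carrier (xgrp n X (tgt \<A> p))" using push_inflation_exact[OF kp g X] by auto
qed (use con_closed[OF kp _ X] in auto)

lemma push_mod_iso_iff:
  assumes kp: "conflation \<A> \<C> k p" and P: "nproj (tgt \<A> k)" and f: "f \<in> arr \<A>" "src \<A> f \<in> \<C>" "tgt \<A> f \<in> \<C>"
  shows "push_mod \<A> \<C> n (src \<A> k) f \<in> iso (Ext_mod \<A> \<C> n (src \<A> k) (src \<A> f)) (Ext_mod \<A> \<C> n (src \<A> k) (tgt \<A> f)) \<longleftrightarrow>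
    psh f \<in> iso (xgrp (Suc n) (tgt \<A> p) (src \<A> f)) (xgrp (Suc n) (tgt \<A> p) (tgt \<A> f))"
proof -
  note c = conflationD[OF kp]
  have "push_mod \<A> \<C> n (src \<A> k) f = (\<lambda>S. \<Union>\<gamma>\<in>S. proj_factoring \<A> \<C> n (src \<A> k) (tgt \<A> f) #>\<^bsub>xgrp n (src \<A> k) (tgt \<A> f)\<^esub> psh f \<gamma>)"
    by (simp add: fun_eq_iff push_mod_def)
  moreover have "psh f (rcon k p n (src \<A> f) \<gamma>) = rcon k p n (tgt \<A> f) (psh f \<gamma>)" if "\<gamma> \<in> EXT n (src \<A> k) (src \<A> f)" for \<gamma>
    using rcon_push[OF kp that, of f] f by simp
  ultimately show ?thesis
    unfolding Ext_mod_def
    using iso_Mod_kernel_iff[OF Ext_grp Ext_grp Ext_grp Ext_grp rcon_hom[OF kp] rcon_image[OF kp P] rcon_hom[OF kp] rcon_image[OF kp P]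
        kernel_rcon[OF kp P] kernel_rcon[OF kp P] push_hom push_hom, of "src \<A> f" "tgt \<A> f" f f] f c by simp
qed

lemma pull_mod_iso_iff:
  assumes kp: "conflation \<A> \<C> k p" and P: "nproj (tgt \<A> k)" and f: "f \<in> arr \<A>" "src \<A> f \<in> \<C>" "tgt \<A> f \<in> \<C>"
  shows "pull_mod \<A> \<C> n (tgt \<A> p) f \<in> iso (Ext_mod \<A> \<C> n (tgt \<A> f) (tgt \<A> p)) (Ext_mod \<A> \<C> n (src \<A> f) (tgt \<A> p)) \<longleftrightarrow>
    (\<lambda>\<gamma>. pll \<gamma> f) \<in> iso (xgrp (Suc n) (tgt \<A> f) (src \<A> k)) (xgrp (Suc n) (src \<A> f) (src \<A> k))"
proof -
  note c = conflationD[OF kp]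
  have "pull_mod \<A> \<C> n (tgt \<A> p) f = (\<lambda>S. \<Union>\<gamma>\<in>S. proj_factoring \<A> \<C> n (src \<A> f) (tgt \<A> p) #>\<^bsub>xgrp n (src \<A> f) (tgt \<A> p)\<^esub> pll \<gamma> f)"
    by (simp add: fun_eq_iff pull_mod_def)
  moreover have "pll (con k p \<gamma>) f = con k p (pll \<gamma> f)" if "\<gamma> \<in> EXT n (tgt \<A> f) (tgt \<A> p)" for \<gamma>
    using con_pull[OF kp that, of f] f by simp
  ultimately show ?thesis
    unfolding Ext_mod_def
    using iso_Mod_kernel_iff[OF Ext_grp Ext_grp Ext_grp Ext_grp con_hom[OF kp] con_image[OF kp P] con_hom[OF kp] con_image[OF kp P]
        kernel_con[OF kp P] kernel_con[OF kp P] pull_hom pull_hom, of "tgt \<A> f" "src \<A> f" f f] f c by simp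
qed

text \<open>\<open>push_mod_iso_iff\<close> relates the two ends of a conflation, so
  \<open>X\<close> plays different roles on the two sides. Every object is the right end of one
  conflation with n-projective middle term and the left end of another, so both universal statements
  are exhausted.\<close>

lemma push_mod_iff:
  assumes f: "f \<in> arr \<A>" "src \<A> f \<in> \<C>" "tgt \<A> f \<in> \<C>"
  shows "(\<forall>X\<in>\<C>. push_mod \<A> \<C> n X f \<in> iso (Ext_mod \<A> \<C> n X (src \<A> f)) (Ext_mod \<A> \<C> n X (tgt \<A> f))) \<longleftrightarrow> push_bij n f"
  unfolding push_iso_iff[OF f, symmetric]
proof (intro iffI ballI)
  fix X assume a: "\<forall>X\<in>\<C>. push_mod \<A> \<C> n X f \<in> iso (Ext_mod \<A> \<C> n X (src \<A> f)) (Ext_mod \<A> \<C> n X (tgt \<A> f))" and X: "X \<in> \<C>"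
  obtain k p where k: "conflation \<A> \<C> k p" "tgt \<A> p = X" "nproj (tgt \<A> k)" by (rule proj_cover[OF X])
  show "psh f \<in> iso (xgrp (Suc n) X (src \<A> f)) (xgrp (Suc n) X (tgt \<A> f))"
    using push_mod_iso_iff[OF k(1,3) f] a k(2) conflationD[OF k(1)] by simp
next
  fix X assume a: "\<forall>X\<in>\<C>. psh f \<in> iso (xgrp (Suc n) X (src \<A> f)) (xgrp (Suc n) X (tgt \<A> f))" and X: "X \<in> \<C>"
  obtain k p where k: "conflation \<A> \<C> k p" "src \<A> k = X" "nproj (tgt \<A> k)" by (rule inj_hull[OF X])
  show "push_mod \<A> \<C> n X f \<in> iso (Ext_mod \<A> \<C> n X (src \<A> f)) (Ext_mod \<A> \<C> n X (tgt \<A> f))"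
    using push_mod_iso_iff[OF k(1,3) f] a k(2) conflationD[OF k(1)] by simp
qed

lemma pull_mod_iff:
  assumes f: "f \<in> arr \<A>" "src \<A> f \<in> \<C>" "tgt \<A> f \<in> \<C>"
  shows "(\<forall>X\<in>\<C>. pull_mod \<A> \<C> n X f \<in> iso (Ext_mod \<A> \<C> n (tgt \<A> f) X) (Ext_mod \<A> \<C> n (src \<A> f) X)) \<longleftrightarrow> pull_bij n f"
  unfolding pull_iso_iff[OF f, symmetric]
proof (intro iffI ballI)
  fix X assume a: "\<forall>X\<in>\<C>. pull_mod \<A> \<C> n X f \<in> iso (Ext_mod \<A> \<C> n (tgt \<A> f) X) (Ext_mod \<A> \<C> n (src \<A> f) X)" and X: "X \<in> \<C>"
  obtain k p where k: "conflation \<A> \<C> k p" "src \<A> k = X" "nproj (tgt \<A> k)" by (rule inj_hull[OF X])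
  show "(\<lambda>\<gamma>. pll \<gamma> f) \<in> iso (xgrp (Suc n) (tgt \<A> f) X) (xgrp (Suc n) (src \<A> f) X)"
    using pull_mod_iso_iff[OF k(1,3) f] a k(2) conflationD[OF k(1)] by simp
next
  fix X assume a: "\<forall>X\<in>\<C>. (\<lambda>\<gamma>. pll \<gamma> f) \<in> iso (xgrp (Suc n) (tgt \<A> f) X) (xgrp (Suc n) (src \<A> f) X)" and X: "X \<in> \<C>"
  obtain k p where k: "conflation \<A> \<C> k p" "tgt \<A> p = X" "nproj (tgt \<A> k)" by (rule proj_cover[OF X])
  show "pull_mod \<A> \<C> n X f \<in> iso (Ext_mod \<A> \<C> n (tgt \<A> f) X) (Ext_mod \<A> \<C> n (src \<A> f) X)"
    using pull_mod_iso_iff[OF k(1,3) f] a k(2) conflationD[OF k(1)] by simp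
qed

text \<open>Each class of higher degree out of \<open>C\<close> is a Yoneda product with a class out
  of \<open>C\<close> one degree lower, so vanishing in degree n+1 propagates upwards.\<close>

lemma nprojI_right:
  assumes C: "C \<in> \<C>" and z: "\<And>X \<gamma>. \<lbrakk>X \<in> \<C>; \<gamma> \<in> EXT (Suc n) C X\<rbrakk> \<Longrightarrow> \<gamma> = xzero (Suc n) C X"
  shows "nproj C"
proof -
  have "\<lbrakk>X \<in> \<C>; \<gamma> \<in> EXT (Suc n + m) C X\<rbrakk> \<Longrightarrow> \<gamma> = xzero (Suc n + m) C X" for m X \<gamma>
  proof (induction m arbitrary: X \<gamma>)
    case (Suc m)
    obtain j q \<sigma> where j: "conflation \<A> \<C> j q" "src \<A> j = X" "\<sigma> \<in> EXT (Suc n + m) C (tgt \<A> q)" "\<gamma> = con j q \<sigma>"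
      using con_surj[of \<gamma> "Suc n + m" C X] Suc.prems(2) by auto
    have "\<sigma> = xzero (Suc n + m) C (tgt \<A> q)" using Suc.IH j conflationD[OF j(1)] by simp
    then show ?case using con_zero[OF j(1) C, of "Suc n + m"] j by simp
  qed (use z in simp)
  then have "Ext_vanishes \<A> \<C> i C X" if "n < i" "X \<in> \<C>" for i X
    using that Ext_vanishes_iff[OF C that(2)] by (metis Suc_leI le_Suc_ex)
  then show ?thesis using C by (simp add: n_projective_def)
qed

text \<open>In this variable the shift uses covers: a class of degree above n+1 vanishes on the
  n-projective cover of \<open>X\<close>, hence comes from its kernel one degree lower. The
  n-injectivity obtained is n-projectivity by the Frobenius condition.\<close>

lemma nprojI_left:
  assumes C: "C \<in> \<C>" and z: "\<And>X \<gamma>. \<lbrakk>X \<in> \<C>; \<gamma> \<in> EXT (Suc n) X C\<rbrakk> \<Longrightarrow> \<gamma> = xzero (Suc n) X C"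
  shows "nproj C"
proof -
  have "\<lbrakk>X \<in> \<C>; \<gamma> \<in> EXT (Suc n + m) X C\<rbrakk> \<Longrightarrow> \<gamma> = xzero (Suc n + m) X C" for m X \<gamma>
  proof (induction m arbitrary: X \<gamma>)
    case (Suc m)
    have g: "\<gamma> \<in> EXT (Suc (Suc n + m)) X C" using Suc.prems by simp
    obtain k p where k: "conflation \<A> \<C> k p" "tgt \<A> p = X" "nproj (tgt \<A> k)" by (rule proj_cover[OF Suc.prems(1)])
    note c = conflationD[OF k(1)]
    have g': "\<gamma> \<in> EXT (Suc (Suc n + m)) (tgt \<A> p) C" using g k by simp
    have "pll \<gamma> p \<in> EXT (Suc (Suc n + m)) (tgt \<A> k) C" using pull_closed[OF g', of p] c by simp
    then have "pll \<gamma> p = xzero (Suc (Suc n + m)) (tgt \<A> k) C" using Ext_from_nproj k(3) C by simp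
    then obtain \<sigma> where s: "\<sigma> \<in> EXT (Suc n + m) (src \<A> k) C" "\<gamma> = rcon k p (Suc n + m) C \<sigma>"
      using rcon_surj[OF k(1) g' C] by blast
    have "\<sigma> = xzero (Suc n + m) (src \<A> k) C" using Suc.IH s c by simp
    then show ?case using rcon_zero[OF k(1) C, of "Suc n + m"] s k(2) by simp
  qed (use z in simp)
  then have "Ext_vanishes \<A> \<C> i X C" if "n < i" "X \<in> \<C>" for i X
    using that Ext_vanishes_iff[OF that(2) C] by (metis Suc_leI le_Suc_ex)
  then show ?thesis using C by (simp add: nproj_iff_ninj n_injective_def)
qed

section \<open>Inflations and their cokernels\<close>

context
  fixes i p assumes ip: "conflation \<A> \<C> i p"
begin

text \<open>The two halves of bijectivity are used at different objects. Over the kernel of an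
  n-projective cover of \<open>X\<close>, injectivity makes the shifted class
  \<open>\<sigma>\<close> lift along \<open>p\<close>. Back over \<open>X\<close>, surjectivity
  makes the shifted lift come through \<open>i\<close>, and \<open>p\<close> kills it.\<close>

lemma nproj_if_push_bij:
  assumes bij: "push_bij n i"
  shows "nproj (tgt \<A> p)"
proof (rule nprojI_left)
  note c = conflationD[OF ip]
  let ?C = "tgt \<A> p"
  show "?C \<in> \<C>" using c by simp
  fix X \<gamma> assume X: "X \<in> \<C>" and g: "\<gamma> \<in> EXT (Suc n) X ?C"
  obtain k q where k: "conflation \<A> \<C> k q" "tgt \<A> q = X" "nproj (tgt \<A> k)" by (rule proj_cover[OF X])
  note d = conflationD[OF k(1)]
  obtain \<sigma> where \<sigma>: "\<sigma> \<in> EXT n (src \<A> k) ?C" "\<gamma> = rcon k q n ?C \<sigma>"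
    using rcon_image[OF k(1,3) c(7)] g k(2) by auto
  have cs: "con i p \<sigma> \<in> EXT (Suc n) (src \<A> k) (src \<A> i)" using con_closed[OF ip \<sigma>(1)] d by simp
  moreover have "psh i (con i p \<sigma>) = xzero (Suc n) (src \<A> k) (tgt \<A> i)" using push_con_self[OF ip \<sigma>(1)] d by simp
  ultimately have "con i p \<sigma> = xzero (Suc n) (src \<A> k) (src \<A> i)" using bij push_bij_iff[of i n] c d by simp
  then obtain \<sigma>' where \<sigma>': "\<sigma>' \<in> EXT n (src \<A> k) (tgt \<A> i)" "\<sigma> = psh p \<sigma>'" using con_exact[OF ip \<sigma>(1)] d by auto
  have r: "rcon k q n (tgt \<A> i) \<sigma>' \<in> EXT (Suc n) X (tgt \<A> i)" using rcon_closed[OF k(1) \<sigma>'(1)] c k(2) by simp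
  then obtain \<tau> where \<tau>: "\<tau> \<in> EXT (Suc n) X (src \<A> i)" "psh i \<tau> = rcon k q n (tgt \<A> i) \<sigma>'"
    using bij[unfolded push_bij_iff[OF c(2,5,6)]] X by blast
  have "\<gamma> = psh p (psh i \<tau>)" using rcon_push[OF k(1) \<sigma>'(1), of p] \<sigma> \<sigma>' \<tau> c by simp
  also have "\<dots> = psh (hzero \<A> (src \<A> i) ?C) \<tau>" using push_push[OF \<tau>(1), of i p] c by simp
  finally show "\<gamma> = xzero (Suc n) X ?C" using push_hzero[OF \<tau>(1) X] c by simp
qed

text \<open>Injectivity presents \<open>\<gamma>\<close> as the \<open>rcon\<close> image of some
  \<open>\<sigma>\<close> in degree n. Surjectivity, applied to the product of
  \<open>\<sigma>\<close> with an n-projective cover of \<open>X\<close>, shows that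
  \<open>\<sigma>\<close> extends along \<open>i\<close> up to a class coming from the middle term
  of the cover. The extendable part dies under \<open>rcon\<close>, and the other part because this
  middle term is n-injective.\<close>

lemma nproj_if_pull_bij:
  assumes bij: "pull_bij n i"
  shows "nproj (tgt \<A> p)"
proof (rule nprojI_right)
  note c = conflationD[OF ip]
  let ?C = "tgt \<A> p" and ?M = "src \<A> i" and ?N = "tgt \<A> i"
  show "?C \<in> \<C>" using c by simp
  fix X \<gamma> assume X: "X \<in> \<C>" and g: "\<gamma> \<in> EXT (Suc n) ?C X"
  have gp: "pll \<gamma> p \<in> EXT (Suc n) ?N X" using pull_closed[OF g, of p] c by simp
  have "pll (pll \<gamma> p) i = pll \<gamma> (hzero \<A> ?M ?C)" using pull_pull[OF g, of p i] c by simp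
  then have "pll (pll \<gamma> p) i = xzero (Suc n) ?M X" using pull_hzero[OF g] X c by simp
  then have "pll \<gamma> p = xzero (Suc n) ?N X" using bij pull_bij_iff[of i n] gp X c by simp
  then obtain \<sigma> where \<sigma>: "\<sigma> \<in> EXT n ?M X" "\<gamma> = rcon i p n X \<sigma>" using rcon_surj[OF ip g X] by blast
  obtain k q where k: "conflation \<A> \<C> k q" "tgt \<A> q = X" "nproj (tgt \<A> k)" by (rule proj_cover[OF X])
  note d = conflationD[OF k(1)]
  have s: "\<sigma> \<in> EXT n ?M (tgt \<A> q)" using \<sigma> k by simp
  have "con k q \<sigma> \<in> EXT (Suc n) ?M (src \<A> k)" using con_closed[OF k(1) s] c by simp
  then obtain \<kappa> where \<kappa>: "\<kappa> \<in> EXT (Suc n) ?N (src \<A> k)" "pll \<kappa> i = con k q \<sigma>"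
    using bij pull_bij_iff[of i n] c d by blast
  then obtain \<sigma>' where \<sigma>': "\<sigma>' \<in> EXT n ?N (tgt \<A> q)" "\<kappa> = con k q \<sigma>'"
    using con_image[OF k(1,3), of ?N] c by auto
  \<comment> \<open>\<open>\<nu>\<close> is the negative of \<open>\<sigma>'\<close>, so that
    \<open>?e\<close> below is the difference between \<open>\<sigma>\<close> and a class that
    extends along \<open>i\<close>.\<close>
  obtain \<nu> where \<nu>: "\<nu> \<in> EXT n ?N (tgt \<A> q)" "xadd ?N (tgt \<A> q) \<sigma>' \<nu> = xzero n ?N (tgt \<A> q)"
    by (rule xneg_exists[OF \<sigma>'(1)]) (use c d in simp_all)
  have pn: "pll \<nu> i \<in> EXT n ?M (tgt \<A> q)" using pull_closed[OF \<nu>(1), of i] c by simp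
  let ?e = "xadd ?M (tgt \<A> q) \<sigma> (pll \<nu> i)"
  have e: "?e \<in> EXT n ?M (tgt \<A> q)" using ext_add_closed[OF s pn] c d by simp
  have cl: "con k q \<sigma>' \<in> EXT (Suc n) ?N (src \<A> k)" "con k q \<nu> \<in> EXT (Suc n) ?N (src \<A> k)"
    using con_closed[OF k(1) \<sigma>'(1)] con_closed[OF k(1) \<nu>(1)] c by simp_all
  have "con k q ?e = xadd ?M (src \<A> k) (pll (con k q \<sigma>') i) (pll (con k q \<nu>) i)"
    using ext_add_con[OF k(1) s pn] con_pull[OF k(1) \<nu>(1), of i] \<kappa> \<sigma>' c by simp
  also have "\<dots> = pll (xadd ?N (src \<A> k) (con k q \<sigma>') (con k q \<nu>)) i" using pull_add[OF cl, of i] c d by simp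
  also have "xadd ?N (src \<A> k) (con k q \<sigma>') (con k q \<nu>) = xzero (Suc n) ?N (src \<A> k)"
    using ext_add_con[OF k(1) \<sigma>'(1) \<nu>(1)] \<nu>(2) con_zero[OF k(1), of ?N n] c by simp
  finally have "con k q ?e = xzero (Suc n) ?M (src \<A> k)" using pull_zero[of "src \<A> k" i ?N "Suc n"] c d by simp
  then obtain \<tau> where \<tau>: "\<tau> \<in> EXT n ?M (tgt \<A> k)" "?e = psh q \<tau>" using con_exact[OF k(1) e] c by auto
  have "rcon i p n (tgt \<A> k) \<tau> \<in> EXT (Suc n) ?C (tgt \<A> k)" using rcon_closed[OF ip \<tau>(1)] d by simp
  then have "rcon i p n (tgt \<A> k) \<tau> = xzero (Suc n) ?C (tgt \<A> k)" using Ext_to_nproj k(3) c by simp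
  then have "rcon i p n (tgt \<A> q) ?e = xzero (Suc n) ?C (tgt \<A> q)"
    unfolding \<tau>(2) using rcon_push[OF ip \<tau>(1), of q] push_zero[of ?C q "tgt \<A> k" "Suc n"] c d by simp
  moreover have "rcon i p n (tgt \<A> q) ?e = rcon i p n (tgt \<A> q) \<sigma>"
    using rcon_add[OF ip s pn] rcon_pull_self[OF ip \<nu>(1)] xadd_zero(2)[OF rcon_closed[OF ip s]] c d by simp
  ultimately show "\<gamma> = xzero (Suc n) ?C X" using \<sigma> k(2) by simp
qed

text \<open>In the first variable the neighbouring terms of the long exact sequence have degrees n+1
  and n+2 out of the n-projective cokernel and vanish.\<close>

lemma pull_bij_if_nproj:
  assumes P: "nproj (tgt \<A> p)"
  shows "pull_bij n i"
proof -
  note c = conflationD[OF ip]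
  show ?thesis
    unfolding pull_bij_iff[OF c(2,5,6)]
  proof (intro conjI ballI impI)
    fix X \<gamma> assume X: "X \<in> \<C>" and g: "\<gamma> \<in> EXT (Suc n) (tgt \<A> i) X" "pll \<gamma> i = xzero (Suc n) (src \<A> i) X"
    obtain \<delta> where "\<delta> \<in> EXT (Suc n) (tgt \<A> p) X" "\<gamma> = pll \<delta> p" using pull_exact[OF ip g(1) X g(2)] by blast
    then show "\<gamma> = xzero (Suc n) (tgt \<A> i) X"
      using Ext_from_nproj[OF _ P, of \<delta> "Suc n" X] pull_zero[of X p "tgt \<A> p" "Suc n"] X c by simp
  next
    fix X \<delta> assume X: "X \<in> \<C>" and d: "\<delta> \<in> EXT (Suc n) (src \<A> i) X"
    have "rcon i p (Suc n) X \<delta> = xzero (Suc (Suc n)) (tgt \<A> p) X"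
      using Ext_from_nproj[OF rcon_closed[OF ip d X] P _ X] by simp
    then show "\<exists>\<gamma>\<in>EXT (Suc n) (tgt \<A> i) X. pll \<gamma> i = \<delta>" using rcon_exact[OF ip d X] by metis
  qed
qed

text \<open>Surjectivity is read off the long exact sequence. For injectivity the preceding term has
  degree n and need not vanish. Its elements do extend along an inflation of \<open>X\<close> into
  an n-injective, as the cokernel of \<open>i\<close> is n-injective, and over that object, which is
  also n-projective, the product with \<open>(i, p)\<close> is zero.\<close>

lemma push_bij_if_nproj:
  assumes P: "nproj (tgt \<A> p)"
  shows "push_bij n i"
proof -
  note c = conflationD[OF ip]
  show ?thesis
    unfolding push_bij_iff[OF c(2,5,6)]
  proof (intro conjI ballI impI)
    fix X \<gamma> assume X: "X \<in> \<C>" and g: "\<gamma> \<in> EXT (Suc n) X (src \<A> i)" "psh i \<gamma> = xzero (Suc n) X (tgt \<A> i)"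
    obtain \<beta> where b: "\<beta> \<in> EXT n X (tgt \<A> p)" "\<gamma> = con i p \<beta>" using push_inflation_exact[OF ip g(1) X g(2)] by blast
    obtain k q where k: "conflation \<A> \<C> k q" "src \<A> k = X" "nproj (tgt \<A> k)" by (rule inj_hull[OF X])
    note d = conflationD[OF k(1)]
    have b': "\<beta> \<in> EXT n (src \<A> k) (tgt \<A> p)" using b k by simp
    have "rcon k q n (tgt \<A> p) \<beta> = xzero (Suc n) (tgt \<A> q) (tgt \<A> p)"
      using Ext_to_nproj[OF rcon_closed[OF k(1) b'] P] c d by simp
    then obtain \<beta>' where b'': "\<beta>' \<in> EXT n (tgt \<A> k) (tgt \<A> p)" "\<beta> = pll \<beta>' k" using rcon_exact[OF k(1) b'] c by blast
    have "con i p \<beta>' = xzero (Suc n) (tgt \<A> k) (src \<A> i)"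
      using Ext_from_nproj[OF con_closed[OF ip b''(1)] k(3)] c d by simp
    then show "\<gamma> = xzero (Suc n) X (src \<A> i)"
      using con_pull[OF ip b''(1), of k] b b'' pull_zero[of "src \<A> i" k "tgt \<A> k" "Suc n"] c d k(2) by simp
  next
    fix X \<delta> assume X: "X \<in> \<C>" and d: "\<delta> \<in> EXT (Suc n) X (tgt \<A> i)"
    have "psh p \<delta> \<in> EXT (Suc n) X (tgt \<A> p)" using push_closed[OF d, of p] c by simp
    then have "psh p \<delta> = xzero (Suc n) X (tgt \<A> p)" using Ext_to_nproj[OF _ P] X by simp
    then show "\<exists>\<gamma>\<in>EXT (Suc n) X (src \<A> i). psh i \<gamma> = \<delta>" using push_exact[OF ip d _ X] by metis
  qed
qed

lemma inflation_push_bij_iff_pull_bij: "push_bij n i \<longleftrightarrow> pull_bij n i"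
  using nproj_if_push_bij nproj_if_pull_bij pull_bij_if_nproj push_bij_if_nproj by blast

end

section \<open>Reduction of an arbitrary morphism to an inflation\<close>

lemma proj2_bij:
  assumes P: "nproj P" and N: "N \<in> \<C>"
  shows "push_bij n (proj2 \<A> P N)" "pull_bij n (proj2 \<A> P N)"
proof -
  have P' [simp]: "P \<in> \<C>" using P by (rule nproj_closed)
  note c = conflation_biprod[OF P' N]
  let ?p = "proj2 \<A> P N" and ?j = "inj2 \<A> P N"
  have p: "?p \<in> arr \<A>" "src \<A> ?p \<in> \<C>" "tgt \<A> ?p \<in> \<C>" using N by simp_all
  show "push_bij n ?p"
    unfolding push_bij_iff[OF p]
  proof (intro conjI ballI impI)
    fix X \<gamma> assume X: "X \<in> \<C>" and g: "\<gamma> \<in> EXT (Suc n) X (src \<A> ?p)" "psh ?p \<gamma> = xzero (Suc n) X (tgt \<A> ?p)"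
    then obtain \<alpha> where "\<alpha> \<in> EXT (Suc n) X P" "\<gamma> = psh (inj1 \<A> P N) \<alpha>"
      using push_exact[OF c, of \<gamma> "Suc n" X] N by auto
    then show "\<gamma> = xzero (Suc n) X (src \<A> ?p)"
      using Ext_to_nproj[OF _ P, of \<alpha> "Suc n" X] push_zero[of X "inj1 \<A> P N" P "Suc n"] X N by simp
  next
    fix X \<delta> assume X: "X \<in> \<C>" and d: "\<delta> \<in> EXT (Suc n) X (tgt \<A> ?p)"
    then have d': "\<delta> \<in> EXT (Suc n) X N" using N by simp
    have "psh ?p (psh ?j \<delta>) = \<delta>" using push_push[OF d', of ?j ?p] push_ide[OF d'] N by simp
    moreover have "psh ?j \<delta> \<in> EXT (Suc n) X (src \<A> ?p)" using push_closed[OF d', of ?j] N by simp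
    ultimately show "\<exists>\<gamma>\<in>EXT (Suc n) X (src \<A> ?p). psh ?p \<gamma> = \<delta>" by blast
  qed
  show "pull_bij n ?p"
    unfolding pull_bij_iff[OF p]
  proof (intro conjI ballI impI)
    fix X \<gamma> assume X: "X \<in> \<C>" and g: "\<gamma> \<in> EXT (Suc n) (tgt \<A> ?p) X" "pll \<gamma> ?p = xzero (Suc n) (src \<A> ?p) X"
    then have g': "\<gamma> \<in> EXT (Suc n) N X" using N by simp
    have "\<gamma> = pll (pll \<gamma> ?p) ?j" using pull_pull[OF g', of ?p ?j] pull_ide[OF g'] N by simp
    then show "\<gamma> = xzero (Suc n) (tgt \<A> ?p) X" using g(2) pull_zero[of X ?j "bsum P N" "Suc n"] X N by simp
  next
    fix X \<delta> assume X: "X \<in> \<C>" and "\<delta> \<in> EXT (Suc n) (src \<A> ?p) X"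
    then have d: "\<delta> \<in> EXT (Suc n) (tgt \<A> (inj1 \<A> P N)) X" using N by simp
    have "pll \<delta> (inj1 \<A> P N) \<in> EXT (Suc n) P X" using pull_closed[OF d, of "inj1 \<A> P N"] N by simp
    then have "pll \<delta> (inj1 \<A> P N) = xzero (Suc n) P X" using Ext_from_nproj[OF _ P] X by simp
    then show "\<exists>\<gamma>\<in>EXT (Suc n) (tgt \<A> ?p) X. pll \<gamma> ?p = \<delta>"
      using pull_exact[OF c d X] N by auto
  qed
qed

lemma push_bij_cmp_iff:
  assumes f: "f \<in> arr \<A>" "src \<A> f \<in> \<C>" "tgt \<A> f \<in> \<C>" and g: "g \<in> arr \<A>" "src \<A> g = tgt \<A> f" "tgt \<A> g \<in> \<C>" and b: "push_bij n g"
  shows "push_bij n (g \<cdot> f) \<longleftrightarrow> push_bij n f"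
proof -
  have "bij_betw (psh (g \<cdot> f)) (EXT (Suc n) X (src \<A> f)) (EXT (Suc n) X (tgt \<A> g)) \<longleftrightarrow>
      bij_betw (psh f) (EXT (Suc n) X (src \<A> f)) (EXT (Suc n) X (tgt \<A> f))" if X: "X \<in> \<C>" for X
  proof -
    have "bij_betw (psh g) (EXT (Suc n) X (tgt \<A> f)) (EXT (Suc n) X (tgt \<A> g))"
      using b X g by (simp add: push_bij_def)
    moreover have "psh f ` EXT (Suc n) X (src \<A> f) \<subseteq> EXT (Suc n) X (tgt \<A> f)" using push_closed f by auto
    ultimately have "bij_betw (psh f) (EXT (Suc n) X (src \<A> f)) (EXT (Suc n) X (tgt \<A> f)) \<longleftrightarrow>
        bij_betw (psh g \<circ> psh f) (EXT (Suc n) X (src \<A> f)) (EXT (Suc n) X (tgt \<A> g))"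
      by (rule bij_betw_comp_iff2)
    also have "\<dots> \<longleftrightarrow> bij_betw (psh (g \<cdot> f)) (EXT (Suc n) X (src \<A> f)) (EXT (Suc n) X (tgt \<A> g))"
      by (rule bij_betw_cong) (use push_push f g in simp)
    finally show ?thesis by simp
  qed
  then show ?thesis using f g by (simp add: push_bij_def)
qed

lemma pull_bij_cmp_iff:
  assumes f: "f \<in> arr \<A>" "src \<A> f \<in> \<C>" "tgt \<A> f \<in> \<C>" and g: "g \<in> arr \<A>" "src \<A> g = tgt \<A> f" "tgt \<A> g \<in> \<C>" and b: "pull_bij n g"
  shows "pull_bij n (g \<cdot> f) \<longleftrightarrow> pull_bij n f"
proof -
  have "bij_betw (\<lambda>\<gamma>. pll \<gamma> (g \<cdot> f)) (EXT (Suc n) (tgt \<A> g) X) (EXT (Suc n) (src \<A> f) X) \<longleftrightarrow>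
      bij_betw (\<lambda>\<gamma>. pll \<gamma> f) (EXT (Suc n) (tgt \<A> f) X) (EXT (Suc n) (src \<A> f) X)" if X: "X \<in> \<C>" for X
  proof -
    have "bij_betw (\<lambda>\<gamma>. pll \<gamma> g) (EXT (Suc n) (tgt \<A> g) X) (EXT (Suc n) (tgt \<A> f) X)"
      using b X g by (simp add: pull_bij_def)
    then have "bij_betw (\<lambda>\<gamma>. pll \<gamma> f) (EXT (Suc n) (tgt \<A> f) X) (EXT (Suc n) (src \<A> f) X) \<longleftrightarrow>
        bij_betw ((\<lambda>\<gamma>. pll \<gamma> f) \<circ> (\<lambda>\<gamma>. pll \<gamma> g)) (EXT (Suc n) (tgt \<A> g) X) (EXT (Suc n) (src \<A> f) X)"
      by (rule bij_betw_comp_iff)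
    also have "\<dots> \<longleftrightarrow> bij_betw (\<lambda>\<gamma>. pll \<gamma> (g \<cdot> f)) (EXT (Suc n) (tgt \<A> g) X) (EXT (Suc n) (src \<A> f) X)"
      by (rule bij_betw_cong) (use pull_pull f g in simp)
    finally show ?thesis by simp
  qed
  then show ?thesis using f g by (simp add: pull_bij_def)
qed

text \<open>Embedding the source of \<open>f\<close> into an \<open>n\<close>-injective \<open>I\<close> replaces \<open>f\<close> by an inflation into \<open>I \<oplus> N\<close>.\<close>

lemma push_bij_iff_pull_bij:
  assumes f: "f \<in> arr \<A>" "src \<A> f \<in> \<C>" "tgt \<A> f \<in> \<C>"
  shows "push_bij n f \<longleftrightarrow> pull_bij n f"
proof -
  obtain j q where j: "conflation \<A> \<C> j q" "src \<A> j = src \<A> f" "nproj (tgt \<A> j)" by (rule inj_hull[OF f(2)])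
  note c = conflationD[OF j(1)]
  let ?I = "tgt \<A> j" and ?N = "tgt \<A> f"
  \<comment> \<open>\<open>pushout_conflation\<close> provides an inflation with components
    \<open>j\<close> and the negative of the second morphism; starting from \<open>hneg f\<close>
    makes the second component equal to \<open>f\<close>.\<close>
  let ?m = "inj1 \<A> ?I ?N \<cdot> j \<oplus> hneg (inj2 \<A> ?I ?N \<cdot> hneg f)"
  have hf: "hneg f \<in> arr \<A>" "src \<A> (hneg f) = src \<A> j" "tgt \<A> (hneg f) \<in> \<C>" using f j by simp_all
  obtain r where "conflation \<A> \<C> (inj1 \<A> ?I (tgt \<A> (hneg f)) \<cdot> j \<oplus> hneg (inj2 \<A> ?I (tgt \<A> (hneg f)) \<cdot> hneg f)) r"
    by (rule pushout_conflation[OF j(1) hf]) (rule that)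
  then have r: "conflation \<A> \<C> ?m r" unfolding hneg_arr(3)[OF f(1)] .
  have ff: "hneg (hneg f) = f" by (rule hneg_unique[symmetric]) (use f in simp_all)
  have m: "?m \<in> arr \<A>" "src \<A> ?m = src \<A> f" "tgt \<A> ?m = bsum ?I ?N" "proj2 \<A> ?I ?N \<cdot> ?m = f"
    using f c j ff by simp_all
  have m': "src \<A> ?m \<in> \<C>" "tgt \<A> ?m \<in> \<C>" unfolding m(2,3) using f c by simp_all
  have p: "proj2 \<A> ?I ?N \<in> arr \<A>" "src \<A> (proj2 \<A> ?I ?N) = tgt \<A> ?m" "tgt \<A> (proj2 \<A> ?I ?N) \<in> \<C>"
    unfolding m(3) using f c by simp_all
  \<comment> \<open>\<open>f\<close> is \<open>?m\<close> followed by the projection that discards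
    the n-projective \<open>?I\<close>; this projection is bijective in degree n+1 on either side
    and can be cancelled.\<close>
  have "push_bij n f \<longleftrightarrow> push_bij n ?m" "pull_bij n f \<longleftrightarrow> pull_bij n ?m"
    using push_bij_cmp_iff[OF m(1) m' p proj2_bij(1)[OF j(3) f(3)]]
      pull_bij_cmp_iff[OF m(1) m' p proj2_bij(2)[OF j(3) f(3)]] unfolding m(4) by blast+
  then show ?thesis using inflation_push_bij_iff_pull_bij[OF r] by blast
qed

end

end

theorem corollary4p8:
  fixes \<A> :: "('o, 'a) addcat" and \<C> :: "'o set" and n :: nat and f :: 'a and M N :: 'o
  assumes "abelian_category \<A>"
    and "additive_extension_closed \<A> \<C>"
    and "n_Frobenius \<A> \<C> n"
    and "M \<in> \<C>" and "N \<in> \<C>" and "f \<in> Hom \<A> M N"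
  shows "(quasi_invertible \<A> \<C> n f \<longleftrightarrow>
            (\<forall>X\<in>\<C>. push_mod \<A> \<C> n X f \<in> iso (Ext_mod \<A> \<C> n X M) (Ext_mod \<A> \<C> n X N)))
       \<and> (quasi_invertible \<A> \<C> n f \<longleftrightarrow>
            (\<forall>X\<in>\<C>. pull_mod \<A> \<C> n X f \<in> iso (Ext_mod \<A> \<C> n N X) (Ext_mod \<A> \<C> n M X)))"
proof -
  interpret exact_subcategory \<A> \<C>
    using assms(1,2) by (simp add: exact_subcategory_def exact_subcategory_axioms_def)
  have f: "f \<in> arr \<A>" "src \<A> f = M" "tgt \<A> f = N" using assms(6) by simp_all
  then have f': "f \<in> arr \<A>" "src \<A> f \<in> \<C>" "tgt \<A> f \<in> \<C>" using assms(4,5) by simp_all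
  have "quasi_invertible \<A> \<C> n f \<longleftrightarrow> push_bij n f"
    using push_iso_iff[OF f', of n] by (simp add: quasi_invertible_def)
  \<comment> \<open>Quasi-invertibility is defined on the covariant side, so only the second
    equivalence passes through the comparison of the two sides.\<close>
  then show ?thesis
    using push_mod_iff[OF assms(3) f'] pull_mod_iff[OF assms(3) f'] push_bij_iff_pull_bij[OF assms(3) f'] f by simp
qed

end
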